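(* Let $n>1$ and let $s=s_{12}-s_{02}+s_{01}$ be a $1$-shell from $\mathcal{A}(p_n)$ with $\operatorname{supp}(s_{ij})=\{i,j\}$. Then there are $a,b,c,c'$ in $M_n$ and integers $k_1,k_2,k_3$ with $0\le k_i<n$ such that (i) $\widehat{S}\mathrm{d}(a,c)=k_1$, $\widehat{S}\mathrm{d}(a,b)=k_2$, and $\widehat{S}\mathrm{d}(b,c')=k_3$; (ii) $s_{01}(\{0,1\})\equiv[a,c]$, $s_{02}(\{0,2\})\equiv[a,b]$, and $s_{12}(\{1,2\})\equiv[c',b]$. Let $k_4$ be the integer with $0\le k_4<n$ and $k_4\equiv k_2-(k_1-k_3)\pmod n$, and let $$n_s:=\min\{2(n-k_4)-1,\;2k_4+1\}.$$ Then $$B(s)=n_s.$$ Moreover, taking $k_1=0$, $k_2=0$ and $k_3=\lfloor n/2\rfloor$, one gets $n_s\ge n-1$, and $B(\mathcal{A}(p_n))\ge n-1$. Therefore $\lim_{n\to\infty}B(\mathcal{A}(p_n))=\infty$.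
   Context: The structure. $M_n=(|M_n|;S,g_n)$ is a (saturated model of the theory of the) following structure: the universe is a circle; $S$ is the ternary relation such that $S(a,b,c)$ holds iff $a,b,c$ are distinct and $b$ comes before $c$ going around the circle clockwise starting at $a$; $g=g_n$ is the clockwise rotation by $2\pi/n$ radians. $\operatorname{Th}(M_n)$ is rosy, has quantifier elimination, and has a unique complete $1$-type $p_n$ over $\emptyset$ (isolated by $x=x$); in the home sort $\operatorname{acl}(A)=\operatorname{dcl}(A)=\bigcup_{0\le i<n}g^i(A)$. Let $\widehat{S}(x,y,z)$ be the formula $(x\ne z\wedge S(x,y,z))\vee(x=z\wedge x\neq y)$. For $a,b\in M_n$ with $\operatorname{acl}(a)\ne\operatorname{acl}(b)$ and an integer $k$, $\widehat{S}\mathrm{d}(a,b)=k$ means $M_n\models\widehat{S}(g^k(a),b,g^{k+1}(a))$. Functors. Work in $\mathcal{M}=M_n^{\mathrm{eq}}$ with thorn-independence, over the base $B_0=\operatorname{acl}^{\mathrm{eq}}(\emptyset)$. For a finite $s\subset\omega$, a primitive category is a non-empty $X\subseteq\mathcal{P}(s)$ closed under subsets, viewed as a category with exactly one morphism $\iota_{u,v}:u\to v$ if $u\subseteq v$ and none otherwise; for a functor $f$ on $X$ put $f^u_v=f(\iota_{u,v})$. $\mathcal{C}$ is the category whose objects are small subsets of $\mathcal{M}$ containing $B_0$ and whose morphisms are elementary maps fixing $B_0$ pointwise; write $f^u_v(u)$ for the image $f^u_v(f(u))$. $\mathcal{A}(p_n)$ is the family of all closed independent functors in $p_n$, i.e.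 functors $f:X\to\mathcal{C}$ ($X$ a primitive category) such that: (1) whenever $\{i\}\in X$, there is $b\models p_n$ such that, with $C:=f^{\emptyset}_{\{i\}}(\emptyset)$, $f(\{i\})=\operatorname{acl}(Cb)$ and $b$ is independent from $C$ over $B_0$; (2) whenever $\emptyset\ne u\in X$, $f(u)=\operatorname{acl}\big(\bigcup_{i\in u}f^{\{i\}}_u(\{i\})\big)$ and $\{f^{\{i\}}_u(\{i\}):i\in u\}$ is independent over $f^{\emptyset}_u(\emptyset)$. Chains. A $k$-simplex is an $f\in\mathcal{A}(p_n)$ with domain $\mathcal{P}(s)$, $|s|=k+1$, $f(\emptyset)=B_0$; $\operatorname{supp}(f)=s$. $k$-chains are elements of the free abelian group on the $k$-simplices. For $s=\{s_0<\dots<s_k\}$, $\partial^if=f\restriction\mathcal{P}(s\setminus\{s_i\})$ (extended linearly) and $\partial=\sum_{i=0}^k(-1)^i\partial^i$. For $\tau=\sum_in_if_i$ with distinct simplices $f_i$ and nonzero integers $n_i$, the length is $|\tau|=\sum_i|n_i|$. A $1$-shell is a $1$-chain $\pm(f_0-f_1+f_2)$ with $f_i$ $1$-simplices and $\partial^if_j=\partial^{j-1}f_i$ for $0\le i<j\le2$. For a $1$-shell $s$: $B(s):=\min\{|\tau|:\tau\text{ is a }2\text{-chain with }\partial(\tau)=s\}$ (and $B(s):=-\infty$ if $s$ is not the boundary of any $2$-chain). $B(\mathcal{A}(p_n)):=\max\{B(s): s\text{ is a }1\text{-shell of }\mathcal{A}(p_n)\}$. Bracket notation. Given the $1$-shell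 $s$, the values of the $s_{ij}$ at a common vertex $\{i\}$ coincide; for each $i\in\{0,1,2\}$ fix an element $v_i\in M_n$ of this common value with value equal to $\operatorname{acl}(v_i)$. For $i<j$ and $x,y\in M_n$, $s_{ij}(\{i,j\})\equiv[x,y]$ means that the pair $\big((s_{ij})^{\{i\}}_{\{i,j\}}(v_i),(s_{ij})^{\{j\}}_{\{i,j\}}(v_j)\big)$ has the same type over $\emptyset$ as $(x,y)$. *)

theory Defs
  imports Complex_Main "HOL-Library.FuncSet" "HOL-Library.Poly_Mapping"
    "HOL-Library.Extended_Real"
begin

unbundle cardinal_syntax

section \<open>Many-sorted first-order logic\<close>

text \<open>
  Relational many-sorted languages: \<open>'s\<close> is the type of sorts, \<open>'r\<close> the type of relation
  symbols; a function symbol enters through its graph.  Variables are natural numbers and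
  a quantifier carries the sort over which it ranges.  Formulas need not be well-sorted: in
  all structures below elements of different sorts are different and relations only hold of
  tuples of the right sorts, so an ill-sorted atom is just false.
\<close>

datatype ('s, 'r) fm =
    Eq nat nat
  | Rel 'r "nat list"
  | Neg "('s, 'r) fm"
  | Conj "('s, 'r) fm" "('s, 'r) fm"
  | Ex 's nat "('s, 'r) fm"

primrec fv :: "('s, 'r) fm \<Rightarrow> nat set" where
  "fv (Eq i j) = {i, j}"
| "fv (Rel r is) = set is"
| "fv (Neg \<phi>) = fv \<phi>"
| "fv (Conj \<phi> \<psi>) = fv \<phi> \<union> fv \<psi>"
| "fv (Ex s i \<phi>) = fv \<phi> - {i}"

record ('s, 'r, 'e) fostruct =
  Univ :: "'s \<Rightarrow> 'e set"
  Interp :: "'r \<Rightarrow> 'e list set"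

primrec sat :: "('s, 'r, 'e) fostruct \<Rightarrow> ('s, 'r) fm \<Rightarrow> (nat \<Rightarrow> 'e) \<Rightarrow> bool" where
  "sat N (Eq i j) \<sigma> \<longleftrightarrow> \<sigma> i = \<sigma> j"
| "sat N (Rel r is) \<sigma> \<longleftrightarrow> map \<sigma> is \<in> Interp N r"
| "sat N (Neg \<phi>) \<sigma> \<longleftrightarrow> \<not> sat N \<phi> \<sigma>"
| "sat N (Conj \<phi> \<psi>) \<sigma> \<longleftrightarrow> sat N \<phi> \<sigma> \<and> sat N \<psi> \<sigma>"
| "sat N (Ex s i \<phi>) \<sigma> \<longleftrightarrow> (\<exists>x \<in> Univ N s. sat N \<phi> (\<sigma>(i := x)))"

definition total :: "('s, 'r, 'e) fostruct \<Rightarrow> 'e set" where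
  "total N = (\<Union>s. Univ N s)"

text \<open>
  \<open>N \<Turnstile> \<phi>(x\<^sub>0, \<dots>, x\<^sub>m\<^sub>-\<^sub>1)\<close>; only used for \<open>\<phi>\<close> with free variables among \<open>0, \<dots>, m - 1\<close>.  A formula
  \<open>\<phi>(x, c)\<close> with parameters is given by \<open>\<phi>\<close> and the list \<open>c\<close>, whose entries are substituted for
  the variables following those of \<open>x\<close>.
\<close>
definition holds :: "('s, 'r, 'e) fostruct \<Rightarrow> ('s, 'r) fm \<Rightarrow> 'e list \<Rightarrow> bool" where
  "holds N \<phi> xs \<longleftrightarrow> sat N \<phi> (\<lambda>i. xs ! i)"

definition tuples :: "'e set \<Rightarrow> nat \<Rightarrow> 'e list set" where
  "tuples A m = {xs. length xs = m \<and> set xs \<subseteq> A}"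

definition same_type :: "('s, 'r, 'e) fostruct \<Rightarrow> 'e set \<Rightarrow> 'e list \<Rightarrow> 'e list \<Rightarrow> bool" where
  "same_type N A xs ys \<longleftrightarrow> length xs = length ys \<and>
     (\<forall>\<phi> cs. set cs \<subseteq> A \<and> fv \<phi> \<subseteq> {..<length xs + length cs} \<longrightarrow>
        (holds N \<phi> (xs @ cs) \<longleftrightarrow> holds N \<phi> (ys @ cs)))"

definition acl :: "('s, 'r, 'e) fostruct \<Rightarrow> 'e set \<Rightarrow> 'e set" where
  "acl N A = {e \<in> total N. \<exists>\<phi> cs. set cs \<subseteq> A \<and> fv \<phi> \<subseteq> {..<Suc (length cs)} \<and>
      holds N \<phi> (e # cs) \<and> finite {x \<in> total N. holds N \<phi> (x # cs)}}"

definition elementary_on :: "('s, 'r, 'e) fostruct \<Rightarrow> 'e set \<Rightarrow> ('e \<Rightarrow> 'e) \<Rightarrow> bool" where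
  "elementary_on N A h \<longleftrightarrow> (\<forall>xs \<phi>. set xs \<subseteq> A \<and> fv \<phi> \<subseteq> {..<length xs} \<longrightarrow>
      (holds N \<phi> xs \<longleftrightarrow> holds N \<phi> (map h xs)))"


section \<open>Thorn-independence\<close>

text \<open>
  In these definitions the formula is \<open>\<phi>(x, a)\<close> with \<open>x\<close> of length \<open>m\<close>.  The tuple \<open>a\<close> being
  non-algebraic over \<open>A\<close> means that some entry is not in \<open>acl(A)\<close>.
\<close>

definition strongly_divides ::
  "('s, 'r, 'e) fostruct \<Rightarrow> 'e set \<Rightarrow> ('s, 'r) fm \<Rightarrow> nat \<Rightarrow> 'e list \<Rightarrow> bool" where
  "strongly_divides N A \<phi> m a \<longleftrightarrow>
     \<not> set a \<subseteq> acl N A \<and>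
     (\<exists>k>0. \<forall>F. F \<subseteq> {a'. set a' \<subseteq> total N \<and> same_type N A a a'} \<and> finite F \<and> card F = k \<longrightarrow>
        \<not> (\<exists>xs \<in> tuples (total N) m. \<forall>a' \<in> F. holds N \<phi> (xs @ a')))"

definition thorn_divides ::
  "('s, 'r, 'e) fostruct \<Rightarrow> 'e set \<Rightarrow> ('s, 'r) fm \<Rightarrow> nat \<Rightarrow> 'e list \<Rightarrow> bool" where
  "thorn_divides N A \<phi> m a \<longleftrightarrow>
     (\<exists>c. set c \<subseteq> total N \<and> strongly_divides N (A \<union> set c) \<phi> m a)"

definition thorn_forks ::
  "('s, 'r, 'e) fostruct \<Rightarrow> 'e set \<Rightarrow> ('s, 'r) fm \<Rightarrow> nat \<Rightarrow> 'e list \<Rightarrow> bool" where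
  "thorn_forks N A \<phi> m a \<longleftrightarrow>
     (\<exists>D. finite D \<and>
        (\<forall>(\<psi>, b) \<in> D. set b \<subseteq> total N \<and> fv \<psi> \<subseteq> {..<m + length b} \<and> thorn_divides N A \<psi> m b) \<and>
        (\<forall>xs \<in> tuples (total N) m. holds N \<phi> (xs @ a) \<longrightarrow> (\<exists>(\<psi>, b) \<in> D. holds N \<psi> (xs @ b))))"

text \<open>\<open>X\<close> is thorn-independent from \<open>Y\<close> over \<open>C\<close>.\<close>
definition thorn_indep ::
  "('s, 'r, 'e) fostruct \<Rightarrow> 'e set \<Rightarrow> 'e set \<Rightarrow> 'e set \<Rightarrow> bool" where
  "thorn_indep N X Y C \<longleftrightarrow>
     (\<forall>xs \<phi> b. set xs \<subseteq> X \<and> set b \<subseteq> Y \<union> C \<and> fv \<phi> \<subseteq> {..<length xs + length b} \<and>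
        holds N \<phi> (xs @ b) \<longrightarrow> \<not> thorn_forks N C \<phi> (length xs) b)"

definition indep_family ::
  "('s, 'r, 'e) fostruct \<Rightarrow> 'i set \<Rightarrow> ('i \<Rightarrow> 'e set) \<Rightarrow> 'e set \<Rightarrow> bool" where
  "indep_family N I F C \<longleftrightarrow> (\<forall>i \<in> I. thorn_indep N (F i) (\<Union>j \<in> I - {i}. F j) C)"


section \<open>The structures \<open>M\<^sub>n\<close>\<close>

record 'a rotstruct =
  univ :: "'a set"
  cyc :: "'a \<Rightarrow> 'a \<Rightarrow> 'a \<Rightarrow> bool"
  rot :: "'a \<Rightarrow> 'a"

text \<open>Multiplication by \<open>cis (- t)\<close> is the clockwise rotation by the angle \<open>t\<close>.\<close>
definition circle :: "nat \<Rightarrow> complex rotstruct" where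
  "circle n = \<lparr> univ = {z. cmod z = 1},
     cyc = (\<lambda>a b c. \<exists>\<beta> \<gamma>. 0 < \<beta> \<and> \<beta> < \<gamma> \<and> \<gamma> < 2 * pi \<and> b = a * cis (- \<beta>) \<and> c = a * cis (- \<gamma>)),
     rot = (\<lambda>a. a * cis (- (2 * pi / real n))) \<rparr>"

datatype sym = S_sym | g_sym

definition fo :: "'a rotstruct \<Rightarrow> (unit, sym, 'a) fostruct" where
  "fo M = \<lparr> Univ = (\<lambda>_. univ M),
     Interp = (\<lambda>r. case r of
         S_sym \<Rightarrow> {[a, b, c] | a b c. {a, b, c} \<subseteq> univ M \<and> cyc M a b c}
       | g_sym \<Rightarrow> {[a, rot M a] | a. {a, rot M a} \<subseteq> univ M}) \<rparr>"

definition elem_equiv :: "'a rotstruct \<Rightarrow> 'b rotstruct \<Rightarrow> bool" where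
  "elem_equiv M N \<longleftrightarrow> (\<forall>\<phi>. fv \<phi> = {} \<longrightarrow> (holds (fo M) \<phi> [] \<longleftrightarrow> holds (fo N) \<phi> []))"

definition saturated :: "'c rel \<Rightarrow> 'a rotstruct \<Rightarrow> bool" where
  "saturated \<kappa> M \<longleftrightarrow>
     (\<forall>A p. A \<subseteq> univ M \<and> |A| <o \<kappa> \<and>
        (\<forall>(\<phi>, cs) \<in> p. set cs \<subseteq> A \<and> fv \<phi> \<subseteq> {..<Suc (length cs)}) \<and>
        (\<forall>q \<subseteq> p. finite q \<longrightarrow> (\<exists>x \<in> univ M. \<forall>(\<phi>, cs) \<in> q. holds (fo M) \<phi> (x # cs))) \<longrightarrow>
        (\<exists>x \<in> univ M. \<forall>(\<phi>, cs) \<in> p. holds (fo M) \<phi> (x # cs)))"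

text \<open>
  \<open>M\<close> is a \<open>\<kappa>\<close>-saturated model of \<open>Th(M\<^sub>n)\<close>, where \<open>\<kappa>\<close> is uncountable, i.e. larger than the
  language; ``small'' below means of size less than \<open>\<kappa>\<close>.  The case \<open>\<kappa> = |univ M|\<close> is that of an
  uncountable saturated model.  (Such a \<open>\<kappa>\<close> is at most \<open>|univ M|\<close>, so it can be represented on \<open>'a\<close>.)
\<close>
definition big_model :: "nat \<Rightarrow> 'a rel \<Rightarrow> 'a rotstruct \<Rightarrow> bool" where
  "big_model n \<kappa> M \<longleftrightarrow>
     Card_order \<kappa> \<and> natLeq <o \<kappa> \<and> elem_equiv M (circle n) \<and> saturated \<kappa> M"

definition rot_pow :: "'a rotstruct \<Rightarrow> int \<Rightarrow> 'a \<Rightarrow> 'a" where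
  "rot_pow M k = (if k \<ge> 0 then rot M ^^ nat k
                  else inv_into (univ M) (rot M) ^^ nat (- k))"

definition S_hat :: "'a rotstruct \<Rightarrow> 'a \<Rightarrow> 'a \<Rightarrow> 'a \<Rightarrow> bool" where
  "S_hat M x y z \<longleftrightarrow> (x \<noteq> z \<and> cyc M x y z) \<or> (x = z \<and> x \<noteq> y)"

text \<open>The complete 1-type over \<open>\<emptyset>\<close> isolated by \<open>x = x\<close>.\<close>
definition p_type :: "'a rotstruct \<Rightarrow> (unit, sym) fm set" where
  "p_type M = {\<phi>. fv \<phi> \<subseteq> {0} \<and> (\<forall>a \<in> univ M. holds (fo M) \<phi> [a])}"

definition realizes :: "'a rotstruct \<Rightarrow> (unit, sym) fm set \<Rightarrow> 'a \<Rightarrow> bool" where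
  "realizes M p b \<longleftrightarrow> b \<in> univ M \<and> (\<forall>\<phi> \<in> p. holds (fo M) \<phi> [b])"


section \<open>Imaginaries\<close>

text \<open>
  The sorts of \<open>M\<^sup>e\<^sup>q\<close> are the \<open>\<emptyset>\<close>-definable equivalence relations \<open>E\<close> on powers of \<open>M\<close>; an
  element of sort \<open>E\<close> is a pair \<open>(E, X)\<close> with \<open>X\<close> an \<open>E\<close>-class.  For all other \<open>E\<close> the universe
  of sort \<open>E\<close> is empty.  The home sort is given by equality on \<open>M\<^sup>1\<close>.
\<close>

type_synonym 'a esort = "('a list \<times> 'a list) set"
type_synonym 'a imag = "'a esort \<times> 'a list set"

definition def_equiv :: "'a rotstruct \<Rightarrow> nat \<Rightarrow> 'a esort \<Rightarrow> bool" where
  "def_equiv M k E \<longleftrightarrow> 0 < k \<and> equiv (tuples (univ M) k) E \<and>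
     (\<exists>\<phi>. fv \<phi> \<subseteq> {..<k + k} \<and>
        E = {(xs, ys). xs \<in> tuples (univ M) k \<and> ys \<in> tuples (univ M) k \<and> holds (fo M) \<phi> (xs @ ys)})"

definition home :: "'a rotstruct \<Rightarrow> 'a \<Rightarrow> 'a imag" where
  "home M a = (Id_on (tuples (univ M) 1), {[a]})"

text \<open>\<open>Proj E\<close> denotes the graph of the projection of tuples of home elements to their \<open>E\<close>-class.\<close>
datatype 'a eqsym = Base sym | Proj "'a esort"

definition eq_struct :: "'a rotstruct \<Rightarrow> ('a esort, 'a eqsym, 'a imag) fostruct" where
  "eq_struct M = \<lparr>
     Univ = (\<lambda>E. {(E, X) | X k. def_equiv M k E \<and> X \<in> tuples (univ M) k // E}),
     Interp = (\<lambda>r. case r of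
         Base r' \<Rightarrow> map (home M) ` Interp (fo M) r'
       | Proj E \<Rightarrow> {map (home M) xs @ [(E, E `` {xs})] | xs k.
                      def_equiv M k E \<and> xs \<in> tuples (univ M) k}) \<rparr>"

definition acl_eq :: "'a rotstruct \<Rightarrow> 'a imag set \<Rightarrow> 'a imag set" where
  "acl_eq M A = acl (eq_struct M) A"

definition B0 :: "'a rotstruct \<Rightarrow> 'a imag set" where
  "B0 M = acl_eq M {}"

definition S_hat_d :: "'a rotstruct \<Rightarrow> 'a \<Rightarrow> 'a \<Rightarrow> int \<Rightarrow> bool" where
  "S_hat_d M a b k \<longleftrightarrow> {a, b} \<subseteq> univ M \<and> acl_eq M {home M a} \<noteq> acl_eq M {home M b} \<and>
     S_hat M (rot_pow M k a) b (rot_pow M (k + 1) a)"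


section \<open>Closed independent functors\<close>

definition primitive_category :: "nat set set \<Rightarrow> bool" where
  "primitive_category X \<longleftrightarrow> X \<noteq> {} \<and> (\<exists>s. finite s \<and> X \<subseteq> Pow s) \<and> (\<forall>u \<in> X. \<forall>v \<subseteq> u. v \<in> X)"

text \<open>The category \<open>\<C>\<close>.  Morphisms are extensional functions, as equality of functors matters.\<close>

definition C_obj :: "'a rel \<Rightarrow> 'a rotstruct \<Rightarrow> 'a imag set \<Rightarrow> bool" where
  "C_obj \<kappa> M A \<longleftrightarrow> A \<subseteq> total (eq_struct M) \<and> |A| <o \<kappa> \<and> B0 M \<subseteq> A"

definition C_mor :: "'a rotstruct \<Rightarrow> 'a imag set \<Rightarrow> 'a imag set \<Rightarrow> ('a imag \<Rightarrow> 'a imag) \<Rightarrow> bool" where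
  "C_mor M A B h \<longleftrightarrow> h \<in> A \<rightarrow>\<^sub>E B \<and> elementary_on (eq_struct M) A h \<and> (\<forall>e \<in> B0 M. h e = e)"

record 'e sfunctor =
  Dom :: "nat set set"
  Ob :: "nat set \<Rightarrow> 'e set"
  Mor :: "nat set \<Rightarrow> nat set \<Rightarrow> 'e \<Rightarrow> 'e"   \<comment> \<open>\<open>Mor f u v\<close> is \<open>f\<^sup>u\<^sub>v\<close>\<close>

definition C_functor :: "'a rel \<Rightarrow> 'a rotstruct \<Rightarrow> 'a imag sfunctor \<Rightarrow> bool" where
  "C_functor \<kappa> M f \<longleftrightarrow>
     primitive_category (Dom f) \<and>
     Ob f \<in> extensional (Dom f) \<and>
     (\<forall>u v. \<not> (u \<in> Dom f \<and> v \<in> Dom f \<and> u \<subseteq> v) \<longrightarrow> Mor f u v = undefined) \<and>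
     (\<forall>u \<in> Dom f. C_obj \<kappa> M (Ob f u)) \<and>
     (\<forall>u \<in> Dom f. \<forall>v \<in> Dom f. u \<subseteq> v \<longrightarrow> C_mor M (Ob f u) (Ob f v) (Mor f u v)) \<and>
     (\<forall>u \<in> Dom f. Mor f u u = restrict id (Ob f u)) \<and>
     (\<forall>u \<in> Dom f. \<forall>v \<in> Dom f. \<forall>w \<in> Dom f. u \<subseteq> v \<and> v \<subseteq> w \<longrightarrow>
        Mor f u w = compose (Ob f u) (Mor f v w) (Mor f u v))"

text \<open>\<open>f\<^sup>u\<^sub>v(u)\<close>\<close>
definition img :: "'e sfunctor \<Rightarrow> nat set \<Rightarrow> nat set \<Rightarrow> 'e set" where
  "img f u v = Mor f u v ` Ob f u"

text \<open>The family \<open>\<A>(p)\<close> for a 1-type \<open>p\<close> of the home sort.\<close>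
definition closed_indep_functors ::
  "'a rel \<Rightarrow> 'a rotstruct \<Rightarrow> (unit, sym) fm set \<Rightarrow> 'a imag sfunctor set" where
  "closed_indep_functors \<kappa> M p = {f. C_functor \<kappa> M f \<and>
     (\<forall>i. {i} \<in> Dom f \<longrightarrow>
        (\<exists>b. realizes M p b \<and>
           Ob f {i} = acl_eq M (img f {} {i} \<union> {home M b}) \<and>
           thorn_indep (eq_struct M) {home M b} (img f {} {i}) (B0 M))) \<and>
     (\<forall>u \<in> Dom f. u \<noteq> {} \<longrightarrow>
        Ob f u = acl_eq M (\<Union>i \<in> u. img f {i} u) \<and>
        indep_family (eq_struct M) u (\<lambda>i. img f {i} u) (img f {} u))}"

definition A_fam :: "'a rel \<Rightarrow> 'a rotstruct \<Rightarrow> 'a imag sfunctor set" where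
  "A_fam \<kappa> M = closed_indep_functors \<kappa> M (p_type M)"


section \<open>Simplices, chains and shells\<close>

definition simplices :: "'a rel \<Rightarrow> 'a rotstruct \<Rightarrow> nat \<Rightarrow> 'a imag sfunctor set" where
  "simplices \<kappa> M k = {f \<in> A_fam \<kappa> M.
     (\<exists>s. finite s \<and> card s = k + 1 \<and> Dom f = Pow s) \<and> Ob f {} = B0 M}"

definition supp :: "'e sfunctor \<Rightarrow> nat set" where
  "supp f = \<Union> (Dom f)"

definition restr :: "'e sfunctor \<Rightarrow> nat set set \<Rightarrow> 'e sfunctor" where
  "restr f X = \<lparr> Dom = X, Ob = restrict (Ob f) X,
     Mor = (\<lambda>u v. if u \<in> X \<and> v \<in> X \<and> u \<subseteq> v then Mor f u v else undefined) \<rparr>"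

definition face :: "nat \<Rightarrow> 'e sfunctor \<Rightarrow> 'e sfunctor" where
  "face i f = restr f (Pow (supp f - {sorted_list_of_set (supp f) ! i}))"

definition chains :: "'a rel \<Rightarrow> 'a rotstruct \<Rightarrow> nat \<Rightarrow> ('a imag sfunctor \<Rightarrow>\<^sub>0 int) set" where
  "chains \<kappa> M k = {\<tau>. Poly_Mapping.keys \<tau> \<subseteq> simplices \<kappa> M k}"

definition boundary :: "nat \<Rightarrow> ('e sfunctor \<Rightarrow>\<^sub>0 int) \<Rightarrow> ('e sfunctor \<Rightarrow>\<^sub>0 int)" where
  "boundary k = frag_extend (\<lambda>f. \<Sum>i\<le>k. frag_cmul ((- 1) ^ i) (frag_of (face i f)))"

definition chain_length :: "('b \<Rightarrow>\<^sub>0 int) \<Rightarrow> nat" where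
  "chain_length \<tau> = (\<Sum>f \<in> Poly_Mapping.keys \<tau>. nat \<bar>Poly_Mapping.lookup \<tau> f\<bar>)"

definition one_shells :: "'a rel \<Rightarrow> 'a rotstruct \<Rightarrow> ('a imag sfunctor \<Rightarrow>\<^sub>0 int) set" where
  "one_shells \<kappa> M = {c. \<exists>f :: nat \<Rightarrow> 'a imag sfunctor.
     (\<forall>i \<le> 2. f i \<in> simplices \<kappa> M 1) \<and>
     (\<forall>i j. i < j \<and> j \<le> 2 \<longrightarrow> face i (f j) = face (j - 1) (f i)) \<and>
     (c = frag_of (f 0) - frag_of (f 1) + frag_of (f 2) \<or>
      c = - (frag_of (f 0) - frag_of (f 1) + frag_of (f 2)))}"

definition B_shell :: "'a rel \<Rightarrow> 'a rotstruct \<Rightarrow> ('a imag sfunctor \<Rightarrow>\<^sub>0 int) \<Rightarrow> ereal" where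
  "B_shell \<kappa> M s =
     (if \<exists>\<tau> \<in> chains \<kappa> M 2. boundary 2 \<tau> = s
      then ereal (real (LEAST m. \<exists>\<tau> \<in> chains \<kappa> M 2. boundary 2 \<tau> = s \<and> chain_length \<tau> = m))
      else - \<infinity>)"

definition B_max :: "'a rel \<Rightarrow> 'a rotstruct \<Rightarrow> ereal" where
  "B_max \<kappa> M = Max (B_shell \<kappa> M ` one_shells \<kappa> M)"


section \<open>The data attached to a 1-shell\<close>

text \<open>\<open>f({i, j}) \<equiv> [x, y]\<close> with respect to the chosen generators \<open>v\<^sub>i\<close>, \<open>v\<^sub>j\<close> of the vertices\<close>
definition bracket ::
  "'a rotstruct \<Rightarrow> (nat \<Rightarrow> 'a) \<Rightarrow> 'a imag sfunctor \<Rightarrow> nat \<Rightarrow> nat \<Rightarrow> 'a \<Rightarrow> 'a \<Rightarrow> bool" where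
  "bracket M v f i j x y \<longleftrightarrow>
     same_type (eq_struct M) {}
       [Mor f {i} {i, j} (home M (v i)), Mor f {j} {i, j} (home M (v j))] [home M x, home M y]"

text \<open>
  \<open>s = s\<^sub>1\<^sub>2 - s\<^sub>0\<^sub>2 + s\<^sub>0\<^sub>1\<close> is a 1-shell with \<open>supp(s\<^sub>i\<^sub>j) = {i, j}\<close>, and \<open>v\<^sub>i\<close> is a fixed element of \<open>M\<close>
  whose algebraic closure is the common value of the shell at the vertex \<open>i\<close>.
\<close>
definition marked_shell ::
  "'a rel \<Rightarrow> 'a rotstruct \<Rightarrow> ('a imag sfunctor \<Rightarrow>\<^sub>0 int) \<Rightarrow>
   'a imag sfunctor \<Rightarrow> 'a imag sfunctor \<Rightarrow> 'a imag sfunctor \<Rightarrow> (nat \<Rightarrow> 'a) \<Rightarrow> bool" where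
  "marked_shell \<kappa> M s s12 s02 s01 v \<longleftrightarrow>
     s \<in> one_shells \<kappa> M \<and> s = frag_of s12 - frag_of s02 + frag_of s01 \<and>
     {s12, s02, s01} \<subseteq> simplices \<kappa> M 1 \<and>
     supp s12 = {1, 2} \<and> supp s02 = {0, 2} \<and> supp s01 = {0, 1} \<and>
     (\<forall>i \<in> {0, 1, 2}. v i \<in> univ M) \<and>
     Ob s01 {0} = acl_eq M {home M (v 0)} \<and> Ob s02 {0} = acl_eq M {home M (v 0)} \<and>
     Ob s01 {1} = acl_eq M {home M (v 1)} \<and> Ob s12 {1} = acl_eq M {home M (v 1)} \<and>
     Ob s02 {2} = acl_eq M {home M (v 2)} \<and> Ob s12 {2} = acl_eq M {home M (v 2)}"

text \<open>Note the order in the last conjunct: \<open>s\<^sub>1\<^sub>2\<close> is \<open>[c', b]\<close>, whereas \<open>k\<^sub>3\<close> is read off from \<open>(b, c')\<close>.\<close>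
definition shell_data ::
  "nat \<Rightarrow> 'a rotstruct \<Rightarrow> 'a imag sfunctor \<Rightarrow> 'a imag sfunctor \<Rightarrow> 'a imag sfunctor \<Rightarrow> (nat \<Rightarrow> 'a) \<Rightarrow>
   'a \<Rightarrow> 'a \<Rightarrow> 'a \<Rightarrow> 'a \<Rightarrow> int \<Rightarrow> int \<Rightarrow> int \<Rightarrow> bool" where
  "shell_data n M s12 s02 s01 v a b c c' k1 k2 k3 \<longleftrightarrow>
     {a, b, c, c'} \<subseteq> univ M \<and> {k1, k2, k3} \<subseteq> {0..<int n} \<and>
     S_hat_d M a c k1 \<and> S_hat_d M a b k2 \<and> S_hat_d M b c' k3 \<and>
     bracket M v s01 0 1 a c \<and> bracket M v s02 0 2 a b \<and> bracket M v s12 1 2 c' b"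

definition n_shell :: "nat \<Rightarrow> int \<Rightarrow> int \<Rightarrow> int \<Rightarrow> int" where
  "n_shell n k1 k2 k3 =
     (let k4 = (k2 - (k1 - k3)) mod int n in min (2 * (int n - k4) - 1) (2 * k4 + 1))"

end

theory Submission
  imports Defs "HOL-Library.Countable_Set_Type"
begin

text \<open>
  A rotation structure is covered by a dense linear order \<open>K\<close> with a cofinal automorphism \<open>sh 1\<close>
  lifting the rotation; the fibres are the orbits of \<open>sh n\<close>.  Finite partial isomorphisms that
  lift to \<open>K\<close> extend by back and forth, hence preserve all formulas.  Therefore every imaginary has
  a least rotation-closed support.  The supports describe algebraic closure and
  thorn-independence and make the functors rigid: once generators of the vertices are chosen,
  a functor is a family of points.  So an edge has a distance modulo \<open>n\<close>, and the alternating sum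
  of the distances in a triangle is \<open>0\<close> or \<open>- 1\<close> modulo \<open>n\<close>.

  Let \<open>P\<close> and \<open>Q\<close> be the numbers of positive and negative triangles of a filling.  Summing
  coefficients gives \<open>P - Q = 1\<close>; summing the distances gives \<open>P \<ge> k\<^sub>4 + 1\<close> or \<open>Q \<ge> n - k\<^sub>4 - 1\<close>.
  Conversely, replacing an edge by one whose distance differs by one costs two triangles, and a
  shell whose distances match bounds a single triangle.
\<close>

text \<open>Comparing positions on a circle splits into cases according to a starting point. On
  \<open>K\<close> a new point falls into a cut of a linear order, and density alone fills the image
  cut. Since a full turn is n shifts, integer parts measured in single shifts make sense on the
  circle only modulo n. The functors take values in the imaginary structure. There, finite partial
  isomorphisms with the relation \<open>transports\<close> do the work of automorphisms, and a
  formula isolating the type of a finite tuple leads back from elementary maps to partial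
  isomorphisms. The constants arise as follows. Integer parts are additive up to a carry, which is
  the error 0 or -1 of a triangle. Reversing an edge turns a distance d into -1 - d; as k_3 is read
  off from (b, c'), the alternating sum of a shell is -1 - k_4 modulo n. With P - Q = 1 the length P
  + Q equals 2P - 1 and 2Q + 1, so the bounds k_4 + 1 on P and n - k_4 - 1 on Q become 2 k_4 + 1 and
  2 (n - k_4) - 1.\<close>

locale rotation_cover =
  fixes M :: "'a rotstruct" and n :: nat and K :: "'k set"
    and lt :: "'k \<Rightarrow> 'k \<Rightarrow> bool" (infix "\<prec>" 50)
    and sh :: "int \<Rightarrow> 'k \<Rightarrow> 'k" and pr :: "'k \<Rightarrow> 'a"
  assumes n_gt_1: "1 < n"
    and K_ne: "K \<noteq> {}"
    and lt_K: "a \<prec> b \<Longrightarrow> a \<in> K \<and> b \<in> K"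
    and lt_irrefl: "\<not> a \<prec> a"
    and lt_trans: "a \<prec> b \<Longrightarrow> b \<prec> c \<Longrightarrow> a \<prec> c"
    and lt_total: "a \<in> K \<Longrightarrow> b \<in> K \<Longrightarrow> a \<noteq> b \<Longrightarrow> a \<prec> b \<or> b \<prec> a"
    and lt_dense: "a \<prec> b \<Longrightarrow> \<exists>c. a \<prec> c \<and> c \<prec> b"
    and sh_K: "a \<in> K \<Longrightarrow> sh k a \<in> K"
    and sh_0: "sh 0 a = a"
    and sh_add: "sh (j + k) a = sh j (sh k a)"
    and sh_mono: "a \<prec> b \<Longrightarrow> sh k a \<prec> sh k b"
    and sh_pos: "a \<in> K \<Longrightarrow> a \<prec> sh 1 a"
    and sh_arch: "a \<in> K \<Longrightarrow> b \<in> K \<Longrightarrow> \<exists>k. b \<prec> sh k a"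
    and pr_univ: "a \<in> K \<Longrightarrow> pr a \<in> univ M"
    and pr_surj: "x \<in> univ M \<Longrightarrow> \<exists>a\<in>K. pr a = x"
    and pr_sh: "a \<in> K \<Longrightarrow> rot M (pr a) = pr (sh 1 a)"
    and pr_eq_iff: "a \<in> K \<Longrightarrow> b \<in> K \<Longrightarrow> pr a = pr b \<longleftrightarrow> (\<exists>k. b = sh (int n * k) a)"
    and cyc_iff: "a \<in> K \<Longrightarrow> b \<in> K \<Longrightarrow> c \<in> K \<Longrightarrow> cyc M (pr a) (pr b) (pr c) \<longleftrightarrow>
      (\<exists>i j. a \<prec> sh (int n * i) b \<and> sh (int n * i) b \<prec> sh (int n * j) c \<and>
         sh (int n * j) c \<prec> sh (int n) a)"
begin

section \<open>The shift on the cover\<close>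

lemma lt_asym: "a \<prec> b \<Longrightarrow> \<not> b \<prec> a"
  using lt_trans lt_irrefl by blast

lemma sh_inv [simp]: "sh k (sh (- k) a) = a" "sh (- k) (sh k a) = a"
  by (simp_all add: sh_add[symmetric] sh_0)

lemma sh_sh: "sh j (sh k a) = sh (j + k) a"
  by (simp add: sh_add)

lemma sh_lt_iff [simp]: "sh k a \<prec> sh k b \<longleftrightarrow> a \<prec> b"
  using sh_mono[of "sh k a" "sh k b" "- k"] sh_mono[of a b k] by auto

lemma sh_K_iff [simp]: "sh k a \<in> K \<longleftrightarrow> a \<in> K"
  using sh_K[of "sh k a" "- k"] sh_K[of a k] by auto

lemma sh_inj [simp]: "sh k a = sh k b \<longleftrightarrow> a = b"
  by (metis sh_inv(2))

lemma sh_nat_pos: "a \<in> K \<Longrightarrow> a \<prec> sh (int (Suc m)) a"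
proof (induction m)
  case 0
  then show ?case using sh_pos by simp
next
  case (Suc m)
  have "sh (int (Suc (Suc m))) a = sh 1 (sh (int (Suc m)) a)"
    by (simp add: sh_sh)
  then show ?case using sh_pos[of "sh (int (Suc m)) a"] Suc lt_trans by (metis sh_K_iff)
qed

lemma sh_gt0: assumes "a \<in> K" "0 < k" shows "a \<prec> sh k a"
proof -
  have "k = int (Suc (nat k - 1))" using assms(2) by simp
  then show ?thesis using sh_nat_pos[OF assms(1)] by metis
qed

lemma sh_lt_sh_same [simp]: assumes "a \<in> K" shows "sh j a \<prec> sh k a \<longleftrightarrow> j < k"
proof -
  have *: "i < l \<Longrightarrow> sh i a \<prec> sh l a" for i l
    using sh_mono[OF sh_gt0[OF assms, of "l - i"], of i] by (simp add: sh_sh)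
  show ?thesis
    using *[of j k] *[of k j] lt_asym lt_irrefl by (metis linorder_neqE)
qed

lemma sh_eq_sh_same [simp]: "a \<in> K \<Longrightarrow> sh j a = sh k a \<longleftrightarrow> j = k"
  by (metis sh_lt_sh_same lt_irrefl linorder_neqE)

lemma lt_sh_same [simp]: "a \<in> K \<Longrightarrow> a \<prec> sh k a \<longleftrightarrow> 0 < k"
  using sh_lt_sh_same[of a 0 k] by (simp add: sh_0)

lemma sh_lt_same [simp]: "a \<in> K \<Longrightarrow> sh k a \<prec> a \<longleftrightarrow> k < 0"
  using sh_lt_sh_same[of a k 0] by (simp add: sh_0)

lemma sh_lt_move: "sh k a \<prec> b \<longleftrightarrow> a \<prec> sh (- k) b"
  using sh_lt_iff[of "- k" "sh k a" b] by simp

lemma lt_sh_move: "a \<prec> sh k b \<longleftrightarrow> sh (- k) a \<prec> b"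
  using sh_lt_iff[of "- k" a "sh k b"] by simp

lemma not_lt_trans: "a \<in> K \<Longrightarrow> b \<in> K \<Longrightarrow> \<not> b \<prec> a \<Longrightarrow> b \<prec> c \<Longrightarrow> a \<prec> c"
  using lt_total lt_trans by metis

lemma lt_not_trans: "a \<prec> b \<Longrightarrow> c \<in> K \<Longrightarrow> \<not> c \<prec> b \<Longrightarrow> a \<prec> c"
  using lt_total lt_trans lt_K by metis

lemma floor_unique:
  assumes "a \<in> K" "b \<in> K" "\<not> b \<prec> sh j a" "b \<prec> sh (j + 1) a" "\<not> b \<prec> sh k a" "b \<prec> sh (k + 1) a"
  shows "j = k"
proof -
  have "sh j a \<prec> sh (k + 1) a"
    by (rule not_lt_trans[OF _ assms(2,3,6)]) (use assms in simp)
  moreover have "sh k a \<prec> sh (j + 1) a"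
    by (rule not_lt_trans[OF _ assms(2,5,4)]) (use assms in simp)
  ultimately show ?thesis using assms(1) by simp
qed

text \<open>The Archimedean property bounds b from both sides by shifts of a. The least shift
  exceeding b, searched for from the lower bound upwards, is one above the integer part.\<close>

lemma floor_exists:
  assumes a: "a \<in> K" and b: "b \<in> K"
  shows "\<exists>k. \<not> b \<prec> sh k a \<and> b \<prec> sh (k + 1) a"
proof -
  obtain j where j: "b \<prec> sh j a" using sh_arch a b by blast
  obtain i where "a \<prec> sh i b" using sh_arch a b by blast
  then have i: "sh (- i) a \<prec> b" using lt_sh_move by blast
  have "sh (- i) a \<prec> sh j a" using i j lt_trans by blast
  then have ij: "- i < j" using a by simp
  have "\<exists>m. b \<prec> sh (- i + int m) a \<and> (\<forall>m' < m. \<not> b \<prec> sh (- i + int m') a)"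
  proof -
    have "b \<prec> sh (- i + int (nat (j + i))) a" using j ij by simp
    then have "\<exists>m. b \<prec> sh (- i + int m) a" by blast
    then show ?thesis using exists_least_iff[of "\<lambda>m. b \<prec> sh (- i + int m) a"] by blast
  qed
  then obtain m where m: "b \<prec> sh (- i + int m) a" "\<forall>m' < m. \<not> b \<prec> sh (- i + int m') a" by blast
  \<comment> \<open>The search starts at a shift already below b, so it does not stop at once and
    \<open>m - 1\<close> is a genuine predecessor.\<close>
  have "m \<noteq> 0"
  proof
    assume "m = 0"
    then have "b \<prec> sh (- i) a" using m(1) by simp
    then show False using i lt_asym by blast
  qed
  then have "m - 1 < m" by simp
  then have "\<not> b \<prec> sh (- i + int (m - 1)) a" using m(2) by blast
  moreover have "- i + int (m - 1) + 1 = - i + int m" using \<open>m \<noteq> 0\<close> by simp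
  ultimately show ?thesis using m(1) by metis
qed

text \<open>Here b is moved and a stays: the integer part k is rounded down to the multiple
  \<open>N * q\<close>, and shifting back by it puts b into the window from a to
  \<open>sh N a\<close>.\<close>

lemma floor_exists_n:
  assumes a: "a \<in> K" and b: "b \<in> K" and "0 < N"
  shows "\<exists>k. \<not> sh (N * k) b \<prec> a \<and> sh (N * k) b \<prec> sh N a"
proof -
  obtain k where k: "\<not> b \<prec> sh k a" "b \<prec> sh (k + 1) a" using floor_exists[OF a b] by blast
  define q where "q = k div N"
  have 1: "N * q \<le> k" "k + 1 \<le> N * q + N"
    unfolding q_def using \<open>0 < N\<close> pos_mod_bound[of N k] pos_mod_sign[of N k] mult_div_mod_eq[of N k]
    by linarith+
  have "\<not> b \<prec> sh (N * q) a"
    using 1 k a by (metis b le_less lt_total lt_trans sh_K_iff sh_lt_sh_same)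
  moreover have "b \<prec> sh (N * q + N) a"
    using 1 k a by (metis le_less lt_trans sh_lt_sh_same)
  ultimately have "\<not> sh (- (N * q)) b \<prec> a \<and> sh (- (N * q)) b \<prec> sh N a"
    by (simp add: sh_lt_move sh_sh)
  then show ?thesis by (metis minus_mult_right)
qed

lemma lt_finite_min:
  "finite P \<Longrightarrow> P \<noteq> {} \<Longrightarrow> P \<subseteq> K \<Longrightarrow> \<exists>p\<in>P. \<forall>c\<in>P. c = p \<or> p \<prec> c"
proof (induction rule: finite_ne_induct)
  case (insert x F)
  then obtain p where p: "p \<in> F" "\<forall>c\<in>F. c = p \<or> p \<prec> c" by auto
  then show ?case using insert lt_total[of x p] lt_trans by (metis insert_iff insert_subset subsetD)
qed auto

lemma lt_finite_max:
  "finite P \<Longrightarrow> P \<noteq> {} \<Longrightarrow> P \<subseteq> K \<Longrightarrow> \<exists>p\<in>P. \<forall>c\<in>P. c = p \<or> c \<prec> p"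
proof (induction rule: finite_ne_induct)
  case (insert x F)
  then obtain p where p: "p \<in> F" "\<forall>c\<in>F. c = p \<or> c \<prec> p" by auto
  then show ?case using insert lt_total[of x p] lt_trans by (metis insert_iff insert_subset subsetD)
qed auto

lemma pr_sh_n [simp]: "a \<in> K \<Longrightarrow> pr (sh (int n * k) a) = pr a"
  using pr_eq_iff[of a "sh (int n * k) a"] by auto

lemma pr_sh_cong: "a \<in> K \<Longrightarrow> b \<in> K \<Longrightarrow> pr a = pr b \<Longrightarrow> pr (sh k a) = pr (sh k b)"
  by (auto simp: pr_eq_iff sh_sh add.commute)

text \<open>The half-open window from a to \<open>sh (int n) a\<close> is a fundamental domain for
  the fibres: two of its points in one fibre differ by a shift of n k with -n < n k < n.\<close>

lemma pr_inj_window: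
  assumes "a \<in> K" "\<not> b \<prec> a" "b \<prec> sh (int n) a" "\<not> c \<prec> a" "c \<prec> sh (int n) a" "pr b = pr c"
  shows "b = c"
proof -
  have K: "b \<in> K" "c \<in> K" using assms lt_K by auto
  then obtain k where k: "c = sh (int n * k) b" using pr_eq_iff assms by blast
  have "sh (int n * k) b \<prec> sh (int n) b"
    using lt_not_trans[OF assms(5), of "sh (int n) b"] assms(2) k K by simp
  moreover have "sh (- int n) b \<prec> sh (int n * k) b"
    using lt_not_trans[of "sh (- int n) b" a c] assms(3,4) k K by (simp add: sh_lt_move)
  ultimately have "int n * k < int n * 1" "int n * (-1) < int n * k"
    using K by auto
  then have "k < 1" "-1 < k" using n_gt_1 by (simp_all only: mult_less_cancel_left_pos)
  then have "k = 0" by simp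
  then show ?thesis using k sh_0 by simp
qed

text \<open>Inside the window the witnesses of \<open>cyc_iff\<close> shift b and c by nothing, by
  \<open>pr_inj_window\<close>; so the cyclic order seen from a is the linear order of the
  lifts.\<close>

lemma cyc_window:
  assumes "a \<in> K" "\<not> b \<prec> a" "b \<prec> sh (int n) a" "\<not> c \<prec> a" "c \<prec> sh (int n) a"
  shows "cyc M (pr a) (pr b) (pr c) \<longleftrightarrow> a \<prec> b \<and> b \<prec> c"
proof -
  have K: "b \<in> K" "c \<in> K" using assms lt_K by auto
  show ?thesis
  proof
    assume "cyc M (pr a) (pr b) (pr c)"
    then obtain i j where ij: "a \<prec> sh (int n * i) b" "sh (int n * i) b \<prec> sh (int n * j) c"
         "sh (int n * j) c \<prec> sh (int n) a"
      using cyc_iff[OF assms(1) K] by blast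
    have "sh (int n * i) b = b"
      by (rule pr_inj_window[OF assms(1) lt_asym[OF ij(1)] lt_trans[OF ij(2,3)] assms(2,3)])
         (use K in simp)
    moreover have "sh (int n * j) c = c"
      by (rule pr_inj_window[OF assms(1) lt_asym[OF lt_trans[OF ij(1,2)]] ij(3) assms(4,5)])
         (use K in simp)
    ultimately show "a \<prec> b \<and> b \<prec> c" using ij by simp
  next
    assume "a \<prec> b \<and> b \<prec> c"
    then have "a \<prec> sh (int n * 0) b \<and> sh (int n * 0) b \<prec> sh (int n * 0) c \<and> sh (int n * 0) c \<prec> sh (int n) a"
      using assms by (simp add: sh_0)
    then show "cyc M (pr a) (pr b) (pr c)" using cyc_iff[OF assms(1) K] by blast
  qed
qed


section \<open>Rotation-closed sets\<close>

lemma rot_pow_pr: "a \<in> K \<Longrightarrow> (rot M ^^ i) (pr a) = pr (sh (int i) a)"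
  by (induction i) (auto simp: sh_0 pr_sh sh_sh)

lemma rot_univ: "x \<in> univ M \<Longrightarrow> rot M x \<in> univ M"
  by (metis pr_surj pr_sh pr_univ sh_K)

definition orb :: "'a set \<Rightarrow> 'a set" where
  "orb A = (\<Union>x\<in>A. (\<lambda>i. (rot M ^^ i) x) ` {..<n})"

text \<open>These are the finite algebraically closed subsets of the home sort. Domains of partial
  isomorphisms and least supports of imaginaries are of this kind.\<close>

definition gset :: "'a set \<Rightarrow> bool" where
  "gset D \<longleftrightarrow> finite D \<and> D \<subseteq> univ M \<and> (\<forall>x\<in>D. rot M x \<in> D)"

text \<open>Negative shifts cause no trouble although \<open>gset\<close> only speaks of
  \<open>rot M\<close>: modulo the fibres, a shift by k is a rotation by \<open>k mod int n\<close>
  steps.\<close>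

lemma gset_sh: assumes "gset D" "a \<in> K" "pr a \<in> D" shows "pr (sh k a) \<in> D"
proof -
  have *: "(rot M ^^ i) (pr a) \<in> D" for i
    by (induction i) (use assms gset_def in auto)
  have "pr (sh k a) = pr (sh (k mod int n) a)"
    using pr_sh_n[of "sh (k mod int n) a" "k div int n"] assms(2)
    by (simp add: sh_sh)
  moreover have "k mod int n = int (nat (k mod int n))" using n_gt_1 by simp
  ultimately show ?thesis using * rot_pow_pr[OF assms(2)] by metis
qed

lemma gset_sh_iff [simp]: "gset D \<Longrightarrow> a \<in> K \<Longrightarrow> pr (sh k a) \<in> D \<longleftrightarrow> pr a \<in> D"
  using gset_sh[of D "sh k a" "- k"] gset_sh[of D a k] by auto

lemma orb_pr: assumes "a \<in> K" shows "orb {pr a} = {pr (sh k a) | k. True}"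
proof -
  have "pr (sh k a) \<in> orb {pr a}" for k
  proof -
    have "pr (sh k a) = pr (sh (k mod int n) a)"
      using pr_sh_n[of "sh (k mod int n) a" "k div int n"] assms by (simp add: sh_sh)
    also have "\<dots> = (rot M ^^ nat (k mod int n)) (pr a)"
      using rot_pow_pr[OF assms, of "nat (k mod int n)"] n_gt_1 by simp
    finally show ?thesis unfolding orb_def using n_gt_1 by (auto simp: nat_less_iff)
  qed
  then show ?thesis unfolding orb_def using rot_pow_pr[OF assms] by auto
qed

lemma orb_Un: "orb (A \<union> B) = orb A \<union> orb B" by (auto simp: orb_def)
lemma orb_empty [simp]: "orb {} = {}" by (simp add: orb_def)
lemma orb_UN: "orb A = (\<Union>x\<in>A. orb {x})" by (auto simp: orb_def)
lemma orb_mono: "A \<subseteq> B \<Longrightarrow> orb A \<subseteq> orb B" by (auto simp: orb_def)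
lemma orb_refl: "A \<subseteq> orb A"
proof
  fix x assume "x \<in> A"
  moreover have "x = (rot M ^^ 0) x" "0 \<in> {..<n}" using n_gt_1 by auto
  ultimately show "x \<in> orb A" unfolding orb_def by blast
qed

lemma orb_gset: assumes "finite A" "A \<subseteq> univ M" shows "gset (orb A)"
proof -
  have 1: "finite (orb A)" unfolding orb_def using assms by auto
  have 2: "orb {x} \<subseteq> univ M" "\<forall>y\<in>orb {x}. rot M y \<in> orb {x}" if "x \<in> A" for x
  proof -
    have "x \<in> univ M" using that assms(2) by auto
    then obtain a where a: "a \<in> K" "pr a = x" using pr_surj by blast
    show "orb {x} \<subseteq> univ M" using orb_pr[OF a(1)] a pr_univ by auto
    have "rot M (pr (sh k a)) = pr (sh (1 + k) a)" for k using pr_sh[of "sh k a"] a by (simp add: sh_sh)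
    then show "\<forall>y\<in>orb {x}. rot M y \<in> orb {x}" using orb_pr[OF a(1)] a by auto
  qed
  have "orb A \<subseteq> univ M" using 2(1) by (subst orb_UN) blast
  moreover have "\<forall>y\<in>orb A. rot M y \<in> orb A" using 2(2) by (subst (1 2) orb_UN) blast
  ultimately show ?thesis unfolding gset_def using 1 by blast
qed

lemma gset_Un: "gset A \<Longrightarrow> gset B \<Longrightarrow> gset (A \<union> B)" by (auto simp: gset_def)
lemma gset_empty [simp]: "gset {}" by (simp add: gset_def)

lemma orb_subset: assumes "gset D" "A \<subseteq> D" shows "orb A \<subseteq> D"
proof -
  have "(rot M ^^ i) x \<in> D" if "x \<in> D" for x i
    by (induction i) (use assms that gset_def in auto)
  then show ?thesis unfolding orb_def using assms by auto
qed

lemma orb_sym: assumes "x \<in> univ M" "y \<in> orb {x}" shows "x \<in> orb {y}"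
proof -
  obtain a where a: "a \<in> K" "pr a = x" using assms pr_surj by blast
  then obtain k where "y = pr (sh k a)" using assms orb_pr by blast
  then show ?thesis using orb_pr[of "sh k a"] a by (auto intro!: exI[of _ "- k"])
qed

lemma orb_eq: assumes "x \<in> univ M" "y \<in> orb {x}" shows "orb {y} = orb {x}"
proof -
  have g: "gset (orb {x})" using orb_gset assms by simp
  then have "y \<in> univ M" using assms gset_def by auto
  then have "gset (orb {y})" using orb_gset by simp
  then show ?thesis using orb_subset[OF g, of "{y}"] orb_subset[of "orb {y}" "{x}"] orb_sym[OF assms] assms by auto
qed

lemma gset_Diff_orb: assumes "gset D" "x \<in> univ M" shows "gset (D - orb {x})"
  unfolding gset_def
proof (intro conjI ballI)
  show "finite (D - orb {x})" "D - orb {x} \<subseteq> univ M" using assms gset_def by auto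
  fix y assume y: "y \<in> D - orb {x}"
  have yU: "y \<in> univ M" using y assms gset_def by auto
  have "rot M y \<notin> orb {x}"
  proof
    assume r: "rot M y \<in> orb {x}"
    have "rot M y \<in> orb {y}" unfolding orb_def using n_gt_1 by (auto intro!: image_eqI[of _ _ 1])
    then have "orb {y} = orb {x}" using orb_eq[OF yU] orb_eq[OF assms(2) r] by metis
    then show False using y orb_refl[of "{y}"] by auto
  qed
  then show "rot M y \<in> D - orb {x}" using y assms gset_def by auto
qed


section \<open>Partial isomorphisms\<close>

definition lifts :: "'a set \<Rightarrow> 'k set" where
  "lifts D = {a \<in> K. pr a \<in> D}"

text \<open>Commuting with the shifts makes \<open>t\<close> descend to the circle and respect the
  rotation; monotonicity makes it respect the cyclic order. Values of \<open>h\<close> outside D are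
  arbitrary.\<close>

definition lifting :: "'a set \<Rightarrow> ('a \<Rightarrow> 'a) \<Rightarrow> ('k \<Rightarrow> 'k) \<Rightarrow> bool" where
  "lifting D h t \<longleftrightarrow>
     (\<forall>a\<in>lifts D. t a \<in> K \<and> pr (t a) = h (pr a) \<and> (\<forall>k. t (sh k a) = sh k (t a))) \<and>
     (\<forall>a\<in>lifts D. \<forall>b\<in>lifts D. a \<prec> b \<longrightarrow> t a \<prec> t b)"

definition piso :: "'a set \<Rightarrow> ('a \<Rightarrow> 'a) \<Rightarrow> bool" where
  "piso D h \<longleftrightarrow> gset D \<and> (\<exists>t. lifting D h t)"

lemma lifts_sh [simp]: "gset D \<Longrightarrow> sh k a \<in> lifts D \<longleftrightarrow> a \<in> lifts D"
  unfolding lifts_def by auto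

lemma liftsK: "a \<in> lifts D \<Longrightarrow> a \<in> K" by (simp add: lifts_def)

lemma lifting_lt_iff:
  assumes "lifting D h t" "a \<in> lifts D" "b \<in> lifts D" shows "t a \<prec> t b \<longleftrightarrow> a \<prec> b"
proof
  have m: "c \<prec> d \<Longrightarrow> t c \<prec> t d" if "c \<in> lifts D" "d \<in> lifts D" for c d
    using assms(1) that unfolding lifting_def by blast
  show "a \<prec> b \<Longrightarrow> t a \<prec> t b" using m assms by blast
  assume "t a \<prec> t b"
  then show "a \<prec> b"
    using m[OF assms(3,2)] lt_asym lt_irrefl lt_total[OF liftsK[OF assms(2)] liftsK[OF assms(3)]] by blast
qed

lemma lifting_inj:
  assumes "lifting D h t" "a \<in> lifts D" "b \<in> lifts D" "t a = t b" shows "a = b"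
  using lifting_lt_iff[OF assms(1,2,3)] lifting_lt_iff[OF assms(1,3,2)] assms(4)
    lt_total[OF liftsK[OF assms(2)] liftsK[OF assms(3)]] lt_irrefl by auto

lemma piso_gset: "piso D h \<Longrightarrow> gset D" by (simp add: piso_def)
lemma piso_univ: "piso D h \<Longrightarrow> D \<subseteq> univ M" by (simp add: piso_def gset_def)

lemma piso_lift: assumes "piso D h" "x \<in> D" obtains a where "a \<in> lifts D" "pr a = x" "a \<in> K"
proof -
  have "x \<in> univ M" using assms piso_univ by auto
  then obtain a where "a \<in> K" "pr a = x" using pr_surj by blast
  then show ?thesis using that assms(2) lifts_def by auto
qed

lemma piso_in_univ: assumes "piso D h" "x \<in> D" shows "h x \<in> univ M"
proof -
  obtain t where t: "lifting D h t" using assms piso_def by blast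
  obtain a where "a \<in> lifts D" "pr a = x" using piso_lift[OF assms] by blast
  then show ?thesis using t \<open>pr a = x\<close> unfolding lifting_def by (metis pr_univ)
qed

lemma piso_id: "gset D \<Longrightarrow> piso D (\<lambda>x. x)"
  unfolding piso_def lifting_def lifts_def by (auto intro!: exI[of _ "\<lambda>x. x"])

lemma lifting_cong: "(\<And>x. x \<in> D \<Longrightarrow> h' x = h x) \<Longrightarrow> lifting D h t \<longleftrightarrow> lifting D h' t"
  unfolding lifting_def lifts_def by auto

lemma lifts_mono: "D \<subseteq> D' \<Longrightarrow> lifts D \<subseteq> lifts D'" by (auto simp: lifts_def)

lemma piso_subset: "piso D h \<Longrightarrow> gset D' \<Longrightarrow> D' \<subseteq> D \<Longrightarrow> piso D' h"
  unfolding piso_def lifting_def using lifts_mono by (meson subsetD)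

lemma piso_comp: assumes "piso D h" "piso D' k" "h ` D \<subseteq> D'" shows "piso D (\<lambda>x. k (h x))"
proof -
  obtain t u where t: "lifting D h t" and u: "lifting D' k u" using assms piso_def by auto
  have "t a \<in> lifts D'" if "a \<in> lifts D" for a
    using t that assms(3) unfolding lifting_def lifts_def by auto
  then have "lifting D (\<lambda>x. k (h x)) (\<lambda>a. u (t a))"
    using t u unfolding lifting_def by auto
  then show ?thesis using assms unfolding piso_def by auto
qed

lemma piso_rot: assumes "piso D h" "x \<in> D" shows "h (rot M x) = rot M (h x)"
proof -
  obtain t where t: "lifting D h t" using assms piso_def by blast
  obtain a where a: "a \<in> K" "pr a = x" and al: "a \<in> lifts D" using piso_lift[OF assms] by blast
  then have "sh 1 a \<in> lifts D" using assms piso_gset by simp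
  then have "h (pr (sh 1 a)) = pr (t (sh 1 a))" using t unfolding lifting_def by auto
  also have "\<dots> = rot M (h x)" using t al a pr_sh unfolding lifting_def by (metis)
  finally show ?thesis using a pr_sh by auto
qed

lemma piso_rot_pow: assumes "piso D h" "x \<in> D" shows "h ((rot M ^^ i) x) = (rot M ^^ i) (h x)"
proof -
  have "(rot M ^^ i) x \<in> D" for i
    by (induction i) (use assms piso_gset gset_def in auto)
  then show ?thesis by (induction i) (simp_all add: piso_rot[OF assms(1)])
qed

text \<open>If x and y have the same image, the images of their lifts differ by a shift of a
  multiple of n. As \<open>t\<close> is injective and commutes with shifts, the lifts themselves
  differ by that shift.\<close>

lemma piso_inj: assumes "piso D h" shows "inj_on h D"
proof (rule inj_onI)
  fix x y assume xy: "x \<in> D" "y \<in> D" "h x = h y"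
  obtain t where t: "lifting D h t" using assms piso_def by blast
  obtain a where a: "a \<in> K" "pr a = x" "a \<in> lifts D" using piso_lift[OF assms xy(1)] by blast
  obtain b where b: "b \<in> K" "pr b = y" "b \<in> lifts D" using piso_lift[OF assms xy(2)] by blast
  note ab = a(1,2) b(1,2) and al = a(3) b(3)
  have "pr (t a) = pr (t b)" "t a \<in> K" "t b \<in> K" using t xy ab al unfolding lifting_def by auto
  then obtain k where "t b = sh (int n * k) (t a)" using pr_eq_iff by blast
  then have "t b = t (sh (int n * k) a)" using t al unfolding lifting_def by auto
  moreover have "sh (int n * k) a \<in> lifts D" using al assms piso_gset by simp
  ultimately have "b = sh (int n * k) a"
    using lifting_inj[OF t al(2)] by simp
  then show "x = y" using ab pr_eq_iff by blast
qed

text \<open>By \<open>cyc_iff\<close> the cyclic order is a statement about the order of shifts of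
  three lifts, and \<open>t\<close> preserves and reflects that order.\<close>

lemma piso_cyc:
  assumes "piso D h" "x \<in> D" "y \<in> D" "z \<in> D"
  shows "cyc M (h x) (h y) (h z) \<longleftrightarrow> cyc M x y z"
proof -
  obtain t where t: "lifting D h t" using assms piso_def by blast
  obtain a where a: "a \<in> K" "pr a = x" "a \<in> lifts D" using piso_lift[OF assms(1,2)] by blast
  obtain b where b: "b \<in> K" "pr b = y" "b \<in> lifts D" using piso_lift[OF assms(1,3)] by blast
  obtain c where c: "c \<in> K" "pr c = z" "c \<in> lifts D" using piso_lift[OF assms(1,4)] by blast
  note abc = a(1,2) b(1,2) c(1,2) and al = a(3) b(3) c(3)
  have g: "gset D" using assms piso_gset by simp
  have tt: "t a \<in> K" "t b \<in> K" "t c \<in> K" "pr (t a) = h x" "pr (t b) = h y" "pr (t c) = h z"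
    using t al abc unfolding lifting_def by auto
  have ts: "sh k (t a) = t (sh k a)" "sh k (t b) = t (sh k b)" "sh k (t c) = t (sh k c)" for k
    using t al unfolding lifting_def by auto
  show ?thesis
    using cyc_iff[OF tt(1-3)] cyc_iff[of a b c] abc tt lifting_lt_iff[OF t] al g
    by (simp add: ts)
qed

lemma piso_image_gset: assumes "piso D h" shows "gset (h ` D)"
  unfolding gset_def
  using assms piso_rot[OF assms] piso_in_univ[OF assms] piso_gset[OF assms] unfolding gset_def
  by (metis (no_types, lifting) finite_imageI image_iff image_subsetI)

text \<open>The inverse of \<open>t\<close> lifts the inverse of \<open>h\<close>. That
  \<open>t\<close> hits every lift of the image uses the shifts, since any two lifts of one point
  differ by full turns.\<close>

lemma piso_inv: assumes "piso D h" shows "piso (h ` D) (inv_into D h)"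
proof -
  obtain t where t: "lifting D h t" using assms piso_def by blast
  have g: "gset D" using assms piso_gset by simp
  have *: "\<exists>a\<in>lifts D. t a = b" if b: "b \<in> lifts (h ` D)" for b
  proof -
    obtain x where x: "x \<in> D" "pr b = h x" using b lifts_def by auto
    then obtain a where a: "a \<in> K" "pr a = x" and al: "a \<in> lifts D" using piso_lift[OF assms x(1)] by blast
    then have "pr (t a) = pr b" "t a \<in> K" using t a x unfolding lifting_def by auto
    then obtain k where "b = sh (int n * k) (t a)" using pr_eq_iff b liftsK by blast
    then have "b = t (sh (int n * k) a)" using t al unfolding lifting_def by auto
    then show ?thesis using al g by auto
  qed
  have tinj: "inj_on t (lifts D)"
    using lifting_inj[OF t] by (auto intro!: inj_onI)
  define u where "u = inv_into (lifts D) t"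
  have u: "u b \<in> lifts D" "t (u b) = b" if "b \<in> lifts (h ` D)" for b
    using *[OF that] unfolding u_def by (metis imageI inv_into_into, metis imageI f_inv_into_f)
  have ut: "u (t a) = a" if "a \<in> lifts D" for a unfolding u_def using tinj that by simp
  have "lifting (h ` D) (inv_into D h) u"
    unfolding lifting_def
  proof (intro conjI ballI allI impI)
    fix b assume b: "b \<in> lifts (h ` D)"
    show "u b \<in> K" using u b liftsK by blast
    have "pr b = h (pr (u b))" using t u b unfolding lifting_def by metis
    then show "pr (u b) = inv_into D h (pr b)"
      using piso_inj[OF assms] u[OF b] lifts_def by auto
    show "u (sh k b) = sh k (u b)" for k
    proof -
      have "t (sh k (u b)) = sh k b" using t u[OF b] unfolding lifting_def by metis
      then show ?thesis using ut[of "sh k (u b)"] u[OF b] g by auto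
    qed
    fix b' assume b': "b' \<in> lifts (h ` D)" "b \<prec> b'"
    then show "u b \<prec> u b'" using u b lifting_lt_iff[OF t] by metis
  qed
  then show ?thesis using piso_image_gset[OF assms] piso_def by auto
qed

text \<open>The basic extension step: a value b in the cut prescribed at a settles the whole orbit,
  by sending \<open>sh k a\<close> to \<open>sh k b\<close>. The cut condition at a, translated by
  shifts, yields the one at each \<open>sh k a\<close>.\<close>

lemma lifting_extend:
  assumes g: "gset D" and t: "lifting D h t" and a: "a \<in> K" "pr a \<notin> D" and b: "b \<in> K"
    and cut: "\<And>c. c \<in> lifts D \<Longrightarrow> c \<prec> a \<Longrightarrow> t c \<prec> b" "\<And>c. c \<in> lifts D \<Longrightarrow> a \<prec> c \<Longrightarrow> b \<prec> t c"
  shows "\<exists>h' t'. lifting (D \<union> orb {pr a}) h' t' \<and> (\<forall>x\<in>D. h' x = h x) \<and> h' (pr a) = pr b \<and>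
    (\<forall>c\<in>lifts D. t' c = t c) \<and> t' a = b"
proof -
  \<comment> \<open>The exponent picked by \<open>SOME\<close> is unique, because the shifts of a
    point of \<open>K\<close> are pairwise distinct.\<close>
  define t' where "t' c = (if pr c \<in> D then t c else sh (SOME k. c = sh k a) b)" for c
  have notD: "pr (sh k a) \<notin> D" for k using g a by simp
  have ta: "t' (sh k a) = sh k b" for k
    using notD a unfolding t'_def by (simp add: eq_commute[of k])
  have tc: "t' c = t c" if "c \<in> lifts D" for c using that unfolding t'_def lifts_def by auto
  have L: "c \<in> lifts D \<or> (\<exists>k. c = sh k a)" if c: "c \<in> lifts (D \<union> orb {pr a})" for c
  proof -
    have "c \<in> K" "pr c \<in> D \<or> pr c \<in> orb {pr a}" using c lifts_def by auto
    moreover have "\<exists>k. c = sh k a" if cK: "c \<in> K" and pc: "pr c \<in> orb {pr a}"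
    proof -
      obtain k where "pr (sh k a) = pr c" using pc orb_pr[OF a(1)] by auto
      then obtain j where "c = sh (int n * j) (sh k a)" using pr_eq_iff[of "sh k a" c] a cK by auto
      then show ?thesis using sh_sh by blast
    qed
    ultimately show ?thesis using lifts_def by auto
  qed
  define h' where "h' x = (if x \<in> D then h x else pr (t' (SOME c. c \<in> K \<and> pr c = x)))" for x
  have ha: "h' (pr (sh k a)) = pr (sh k b)" for k
  proof -
    let ?c = "SOME c. c \<in> K \<and> pr c = pr (sh k a)"
    have "?c \<in> K \<and> pr ?c = pr (sh k a)" by (rule someI[of _ "sh k a"]) (use a in auto)
    then obtain j where "?c = sh (int n * j) (sh k a)" using pr_eq_iff[of "sh k a" ?c] a by auto
    then have "t' ?c = sh (int n * j) (sh k b)" using ta sh_sh by metis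
    then show ?thesis using notD b unfolding h'_def by auto
  qed
  have hD: "h' x = h x" if "x \<in> D" for x using that h'_def by simp
  have cmp: "t c \<prec> sh k b" if "c \<in> lifts D" "c \<prec> sh k a" for c k
  proof -
    have "t (sh (- k) c) \<prec> b" using cut(1)[of "sh (- k) c"] that g by (simp add: sh_lt_move)
    then show ?thesis using t that unfolding lifting_def by (metis lt_sh_move)
  qed
  have cmp2: "sh k b \<prec> t c" if "c \<in> lifts D" "sh k a \<prec> c" for c k
  proof -
    have "b \<prec> t (sh (- k) c)" using cut(2)[of "sh (- k) c"] that g by (simp add: sh_lt_move)
    then show ?thesis using t that unfolding lifting_def by (metis sh_lt_move)
  qed
  have "lifting (D \<union> orb {pr a}) h' t'"
    unfolding lifting_def
  proof (intro conjI ballI impI allI)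
    fix c assume c: "c \<in> lifts (D \<union> orb {pr a})"
    show "t' c \<in> K" using L[OF c] tc ta t b unfolding lifting_def by auto
    show "pr (t' c) = h' (pr c)"
      using L[OF c] tc ta ha hD t unfolding lifting_def lifts_def by auto
    show "t' (sh k c) = sh k (t' c)" for k
      using L[OF c]
    proof
      assume "c \<in> lifts D" then show ?thesis using tc[of c] tc[of "sh k c"] g t unfolding lifting_def by auto
    next
      assume "\<exists>k. c = sh k a" then show ?thesis using ta sh_sh by metis
    qed
    fix d assume d: "d \<in> lifts (D \<union> orb {pr a})" and cd: "c \<prec> d"
    show "t' c \<prec> t' d"
      using L[OF c] L[OF d] cd tc ta cmp cmp2 t a b unfolding lifting_def by auto
  qed
  then show ?thesis using hD ha[of 0] ta[of 0] tc by (auto simp: sh_0)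
qed

lemma finite_lifts_window:
  assumes "finite D" "a \<in> K"
  shows "finite {c \<in> lifts D. \<not> c \<prec> a \<and> c \<prec> sh (int n) a}"
proof (rule inj_on_finite[of pr _ D])
  show "inj_on pr {c \<in> lifts D. \<not> c \<prec> a \<and> c \<prec> sh (int n) a}"
    using pr_inj_window[OF assms(2)] by (auto intro!: inj_onI)
qed (use assms lifts_def in auto)

lemma sh1_lt_n: "a \<in> K \<Longrightarrow> b \<prec> sh 1 a \<Longrightarrow> b \<prec> sh (int n) a"
  using lt_trans[of b "sh 1 a" "sh (int n) a"] n_gt_1 by simp

text \<open>Only the two neighbours p and q of a among the lifts of D matter. They exist because D
  is rotation-closed, hence has lifts within one shift on either side of a, and finite, hence has
  only finitely many there.\<close>

lemma cut_exists:
  assumes g: "gset D" and t: "lifting D h t" and a: "a \<in> K" "pr a \<notin> D"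
  shows "\<exists>b\<in>K. (\<forall>c\<in>lifts D. c \<prec> a \<longrightarrow> t c \<prec> b) \<and> (\<forall>c\<in>lifts D. a \<prec> c \<longrightarrow> b \<prec> t c)"
proof (cases "lifts D = {}")
  case True
  then show ?thesis using K_ne by auto
next
  case False
  then obtain c0 where c0: "c0 \<in> lifts D" by auto
  have ne: "c \<noteq> a" if "c \<in> lifts D" for c using that a lifts_def by auto
  obtain k where k: "\<not> a \<prec> sh k c0" "a \<prec> sh (k + 1) c0"
    using floor_exists[OF liftsK[OF c0] a(1)] by blast
  have k1: "sh k c0 \<prec> a" 
  proof -
    have "sh k c0 \<in> lifts D" using c0 g by simp
    then show ?thesis using k(1) ne lt_total[OF a(1) liftsK] by metis
  qed
  define P where "P = {c \<in> lifts D. sh (- 1) a \<prec> c \<and> c \<prec> a}"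
  define Q where "Q = {c \<in> lifts D. a \<prec> c \<and> c \<prec> sh 1 a}"
  have "sh (- 1) a \<prec> sh (- 1) (sh (k + 1) c0)" using k(2) by (simp only: sh_lt_iff)
  then have "sh k c0 \<in> P" unfolding P_def using k1 c0 g by (simp add: sh_sh)
  then have P0: "P \<noteq> {}" by blast
  have "sh 1 (sh k c0) \<prec> sh 1 a" using k1 by (simp only: sh_lt_iff)
  then have "sh (k + 1) c0 \<in> Q" unfolding Q_def using k(2) c0 g by (simp add: sh_sh add.commute)
  then have Q0: "Q \<noteq> {}" by blast
  have Pf: "finite P"
  proof (rule finite_subset)
    show "P \<subseteq> {c \<in> lifts D. \<not> c \<prec> sh (- 1) a \<and> c \<prec> sh (int n) (sh (- 1) a)}"
    proof
      fix c assume "c \<in> P"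
      then have c: "c \<in> lifts D" "sh (- 1) a \<prec> c" "c \<prec> a" using P_def by auto
      moreover have "c \<prec> sh (int n) (sh (- 1) a)"
        by (rule sh1_lt_n) (use c a in \<open>simp_all add: sh_sh sh_0\<close>)
      ultimately show "c \<in> {c \<in> lifts D. \<not> c \<prec> sh (- 1) a \<and> c \<prec> sh (int n) (sh (- 1) a)}"
        using lt_asym[OF c(2)] by blast
    qed
    show "finite {c \<in> lifts D. \<not> c \<prec> sh (- 1) a \<and> c \<prec> sh (int n) (sh (- 1) a)}"
      by (rule finite_lifts_window) (use g gset_def a in auto)
  qed
  have Qf: "finite Q"
  proof (rule finite_subset)
    show "Q \<subseteq> {c \<in> lifts D. \<not> c \<prec> a \<and> c \<prec> sh (int n) a}"
      unfolding Q_def using lt_asym sh1_lt_n[OF a(1)] by blast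
    show "finite {c \<in> lifts D. \<not> c \<prec> a \<and> c \<prec> sh (int n) a}"
      by (rule finite_lifts_window) (use g gset_def a in auto)
  qed
  have PK: "P \<subseteq> K" "Q \<subseteq> K" using P_def Q_def liftsK by auto
  obtain p where p: "p \<in> P" "\<forall>c\<in>P. c = p \<or> c \<prec> p" using lt_finite_max[OF Pf P0 PK(1)] by blast
  obtain q where q: "q \<in> Q" "\<forall>c\<in>Q. c = q \<or> q \<prec> c" using lt_finite_min[OF Qf Q0 PK(2)] by blast
  have pl: "p \<in> lifts D" "q \<in> lifts D" "p \<prec> a" "a \<prec> q" "sh (- 1) a \<prec> p" "q \<prec> sh 1 a" using p q P_def Q_def by auto
  \<comment> \<open>Lifts at or below \<open>sh (- 1) a\<close> lie below p anyway, so p bounds all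
    lifts below a.\<close>
  have P1: "c = p \<or> c \<prec> p" if "c \<in> lifts D" "c \<prec> a" for c
  proof (cases "sh (- 1) a \<prec> c")
    case True then show ?thesis using that p P_def by auto
  next
    case False
    then show ?thesis using not_lt_trans[OF liftsK[OF that(1)] _ False pl(5)] a by simp
  qed
  have Q1: "c = q \<or> q \<prec> c" if "c \<in> lifts D" "a \<prec> c" for c
  proof (cases "c \<prec> sh 1 a")
    case True then show ?thesis using that q Q_def by auto
  next
    case False
    then show ?thesis using lt_not_trans[OF pl(6) liftsK[OF that(1)] False] by simp
  qed
  have "t p \<prec> t q" using t pl lt_trans unfolding lifting_def by blast
  then obtain b where b: "t p \<prec> b" "b \<prec> t q" using lt_dense by blast
  have "t c \<prec> b" if "c \<in> lifts D" "c \<prec> a" for c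
    using P1[OF that] t pl that b lt_trans unfolding lifting_def by blast
  moreover have "b \<prec> t c" if "c \<in> lifts D" "a \<prec> c" for c
    using Q1[OF that] t pl that b lt_trans unfolding lifting_def by blast
  ultimately show ?thesis using b lt_K by blast
qed

section \<open>Extending partial isomorphisms by further points, forth and back\<close>

lemma piso_extend1:
  assumes "piso D h" "x \<in> univ M"
  shows "\<exists>D' h'. piso D' h' \<and> D \<subseteq> D' \<and> x \<in> D' \<and> (\<forall>y\<in>D. h' y = h y)"
proof (cases "x \<in> D")
  case True then show ?thesis using assms by auto
next
  case False
  obtain t where t: "lifting D h t" using assms piso_def by blast
  have g: "gset D" using assms piso_gset by simp
  obtain a where a: "a \<in> K" "pr a = x" using pr_surj assms by blast
  obtain b where b: "b \<in> K" "\<forall>c\<in>lifts D. c \<prec> a \<longrightarrow> t c \<prec> b" "\<forall>c\<in>lifts D. a \<prec> c \<longrightarrow> b \<prec> t c"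
    using cut_exists[OF g t a(1)] a(2) False by auto
  obtain h' t' where "lifting (D \<union> orb {pr a}) h' t'" "\<forall>x\<in>D. h' x = h x"
    using lifting_extend[OF g t a(1) _ b(1)] a(2) False b by blast
  moreover have "gset (D \<union> orb {pr a})" using g assms a gset_Un orb_gset by auto
  ultimately show ?thesis using a orb_refl[of "{x}"] unfolding piso_def
    by (intro exI[of _ "D \<union> orb {pr a}"] exI[of _ h']) auto
qed

lemma piso_extend:
  assumes "piso D h" "finite F" "F \<subseteq> univ M"
  shows "\<exists>D' h'. piso D' h' \<and> D \<subseteq> D' \<and> F \<subseteq> D' \<and> (\<forall>y\<in>D. h' y = h y)"
  using assms(2,3)
proof (induction rule: finite_induct)
  case empty then show ?case using assms by blast
next
  case (insert x F)
  then obtain D' h' where 1: "piso D' h'" "D \<subseteq> D'" "F \<subseteq> D'" "\<forall>y\<in>D. h' y = h y" by auto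
  obtain D'' h'' where 2: "piso D'' h''" "D' \<subseteq> D''" "x \<in> D''" "\<forall>y\<in>D'. h'' y = h' y"
    using piso_extend1[OF 1(1), of x] insert by auto
  show ?case by (rule exI[of _ D''], rule exI[of _ h'']) (use 1 2 in auto)
qed

text \<open>The inverse is extended forth, and the result is inverted again.\<close>

lemma piso_extend_back:
  assumes "piso D h" "finite F" "F \<subseteq> univ M"
  shows "\<exists>D' h'. piso D' h' \<and> D \<subseteq> D' \<and> F \<subseteq> h' ` D' \<and> (\<forall>y\<in>D. h' y = h y)"
proof -
  obtain E k where E: "piso E k" "h ` D \<subseteq> E" "F \<subseteq> E" "\<forall>y\<in>h ` D. k y = inv_into D h y"
    using piso_extend[OF piso_inv[OF assms(1)] assms(2,3)] by blast
  let ?h = "inv_into E k"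
  have 1: "piso (k ` E) ?h" using piso_inv[OF E(1)] .
  have ke: "?h (k y) = y" if "y \<in> E" for y using piso_inj[OF E(1)] that by simp
  have kh: "k (h x) = x" if "x \<in> D" for x using E(4) piso_inj[OF assms(1)] that by simp
  have "D \<subseteq> k ` E" using kh E(2) by (metis image_subset_iff rev_image_eqI subsetI)
  moreover have "F \<subseteq> ?h ` (k ` E)" using E(3) ke by (force simp: image_image)
  moreover have "\<forall>y\<in>D. ?h y = h y" using ke kh E(2) by (metis image_subset_iff)
  ultimately show ?thesis using 1 by blast
qed


text \<open>The fundamental domain starting at c meets every fibre.\<close>

lemma window_lift:
  assumes "c \<in> K" "a \<in> K"
  shows "\<exists>b\<in>K. pr b = pr a \<and> \<not> b \<prec> c \<and> b \<prec> sh (int n) c"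
proof -
  obtain k where "\<not> sh (int n * k) a \<prec> c" "sh (int n * k) a \<prec> sh (int n) c"
    using floor_exists_n[OF assms, of "int n"] n_gt_1 by force
  then show ?thesis using assms by (intro bexI[of _ "sh (int n * k) a"]) simp_all
qed

text \<open>This is the semantic content of quantifier elimination. By induction on the index set,
  the lift of each new point has to land in the right cut among the lifts already placed, and that
  cut can be read off from the cyclic order seen from a reference point.\<close>

lemma piso_of_diagram:
  assumes "finite I" "\<And>i. i \<in> I \<Longrightarrow> x i \<in> univ M" "\<And>i. i \<in> I \<Longrightarrow> y i \<in> univ M"
    and "\<And>i j q. i \<in> I \<Longrightarrow> j \<in> I \<Longrightarrow> q < n \<Longrightarrow> x i = (rot M ^^ q) (x j) \<longleftrightarrow> y i = (rot M ^^ q) (y j)"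
    and "\<And>i j l q. i \<in> I \<Longrightarrow> j \<in> I \<Longrightarrow> l \<in> I \<Longrightarrow> q < n \<Longrightarrow>
      cyc M (x i) ((rot M ^^ q) (x j)) (x l) \<longleftrightarrow> cyc M (y i) ((rot M ^^ q) (y j)) (y l)"
  shows "\<exists>h. piso (orb (x ` I)) h \<and> (\<forall>i\<in>I. h (x i) = y i)"
  using assms
proof (induction I rule: finite_induct)
  case empty
  then show ?case using piso_id[of "{}"] by auto
next
  case (insert i I)
  let ?D = "orb (x ` I)"
  have g: "gset ?D" by (rule orb_gset) (use insert in auto)
  have "\<exists>h. piso ?D h \<and> (\<forall>i\<in>I. h (x i) = y i)"
    by (rule insert.IH; rule insert.prems; simp)
  then obtain h where h: "piso ?D h" "\<forall>i\<in>I. h (x i) = y i" by blast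
  have xI: "x j \<in> ?D" if "j \<in> I" for j using orb_refl that by blast
  have ins: "orb (x ` insert i I) = ?D \<union> orb {x i}" using orb_Un[of "x ` I" "{x i}"] by simp
  show ?case
  proof (cases "x i \<in> ?D")
    case True
    then obtain j q where j: "j \<in> I" "q < n" "x i = (rot M ^^ q) (x j)" unfolding orb_def by auto
    then have "y i = (rot M ^^ q) (y j)" using insert.prems(3) by blast
    then have "h (x i) = y i" using j h piso_rot_pow[OF h(1) xI] by metis
    moreover have "orb (x ` insert i I) = ?D" using ins orb_subset[OF g, of "{x i}"] True by auto
    ultimately show ?thesis using h by auto
  next
    case False
    obtain t where t: "lifting ?D h t" using h piso_def by blast
    have U: "x i \<in> univ M" "y i \<in> univ M" using insert by auto
    have n0: "0 < int n" using n_gt_1 by simp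
    have "\<exists>a b. a \<in> K \<and> pr a = x i \<and> b \<in> K \<and> pr b = y i \<and>
        (\<forall>c\<in>lifts ?D. (c \<prec> a \<longrightarrow> t c \<prec> b) \<and> (a \<prec> c \<longrightarrow> b \<prec> t c))"
    proof (cases "I = {}")
      case True
      then have "lifts ?D = {}" by (simp add: lifts_def)
      then show ?thesis using pr_surj[OF U(1)] pr_surj[OF U(2)] by auto
    next
      case False
      then obtain i0 where i0: "i0 \<in> I" by auto
      then obtain c0 where c0: "c0 \<in> K" "pr c0 = x i0" 
        using pr_surj[OF insert.prems(1)[OF insertI2]] by blast
      have c0l: "c0 \<in> lifts ?D" using c0 xI[OF i0] lifts_def by auto
      have tc0: "t c0 \<in> K" "pr (t c0) = y i0" using t c0l c0 h i0 unfolding lifting_def by auto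
      obtain a0 where "a0 \<in> K" "pr a0 = x i" using pr_surj U by blast
      then obtain a where a: "a \<in> K" "pr a = x i" "\<not> a \<prec> c0" "a \<prec> sh (int n) c0"
        using window_lift[OF c0(1)] by metis
      obtain b0 where "b0 \<in> K" "pr b0 = y i" using pr_surj U by blast
      then obtain b where b: "b \<in> K" "pr b = y i" "\<not> b \<prec> t c0" "b \<prec> sh (int n) (t c0)"
        using window_lift[OF tc0(1)] by metis
      have ab: "c0 \<prec> a" "t c0 \<prec> b"
      proof -
        have "pr c0 \<in> ?D" using c0l lifts_def by auto
        then have "c0 \<noteq> a" using a(2) \<open>x i \<notin> ?D\<close> by auto
        then show "c0 \<prec> a" using a(3) lt_total[OF c0(1) a(1)] by blast
        have "x i \<noteq> x i0" using xI[OF i0] \<open>x i \<notin> ?D\<close> by metis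
        then have "y i \<noteq> y i0" using insert.prems(3)[of i i0 0] i0 n_gt_1 by auto
        then have "t c0 \<noteq> b" using b(2) tc0(2) by auto
        then show "t c0 \<prec> b" using b(3) lt_total[OF tc0(1) b(1)] by blast
      qed
      \<comment> \<open>A lift c in the window lies over some rotated \<open>x j\<close>. The
        hypothesis on \<open>cyc\<close> with first argument \<open>x i0\<close> then transfers the
        comparison of c with a.\<close>
      have main: "(c \<prec> a \<longleftrightarrow> t c \<prec> b)" if c: "c \<in> lifts ?D" "\<not> c \<prec> c0" "c \<prec> sh (int n) c0" for c
      proof -
        have "pr c \<in> ?D" using c lifts_def by auto
        then obtain j q where j: "j \<in> I" "q < n" "pr c = (rot M ^^ q) (x j)" unfolding orb_def by auto
        then have hc: "h (pr c) = (rot M ^^ q) (y j)" using h piso_rot_pow[OF h(1) xI] by metis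
        have tc: "pr (t c) = h (pr c)" "t c \<in> K" using t c unfolding lifting_def by auto
        have tw: "\<not> t c \<prec> t c0" "t c \<prec> sh (int n) (t c0)"
        proof -
          show "\<not> t c \<prec> t c0" using lifting_lt_iff[OF t c(1) c0l] c by simp
          have "t c \<prec> t (sh (int n) c0)" using lifting_lt_iff[OF t c(1), of "sh (int n) c0"] c c0l g by simp
          then show "t c \<prec> sh (int n) (t c0)" using t c0l unfolding lifting_def by metis
        qed
        have "cyc M (x i0) ((rot M ^^ q) (x j)) (x i) \<longleftrightarrow> cyc M (y i0) ((rot M ^^ q) (y j)) (y i)"
          by (rule insert.prems(4)) (use i0 j in simp_all)
        then have e1: "cyc M (x i0) (pr c) (x i) \<longleftrightarrow> cyc M (y i0) (pr (t c)) (y i)"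
          using hc tc j by simp
        have e2: "cyc M (x i0) (pr c) (x i) \<longleftrightarrow> c0 \<prec> c \<and> c \<prec> a"
          using cyc_window[OF c0(1) c(2,3) a(3,4)] c0 a by simp
        have e3: "cyc M (y i0) (pr (t c)) (y i) \<longleftrightarrow> t c0 \<prec> t c \<and> t c \<prec> b"
          using cyc_window[OF tc0(1) tw b(3,4)] tc0 b by simp
        show ?thesis
        proof (cases "c = c0")
          case True then show ?thesis using ab by simp
        next
          case False
          then have "c0 \<prec> c" using c(2) lt_total[OF c0(1) liftsK[OF c(1)]] by blast
          moreover then have "t c0 \<prec> t c" using lifting_lt_iff[OF t] c0l c by metis
          ultimately show ?thesis using e1 e2 e3 by simp
        qed
      qed
      have cut: "(c \<prec> a \<longrightarrow> t c \<prec> b) \<and> (a \<prec> c \<longrightarrow> b \<prec> t c)" if c: "c \<in> lifts ?D" for c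
      proof -
        have cK: "c \<in> K" using c liftsK by auto
        obtain k where k: "\<not> sh (int n * k) c \<prec> c0" "sh (int n * k) c \<prec> sh (int n) c0"
          using floor_exists_n[OF c0(1) cK n0] by auto
        let ?c = "sh (int n * k) c"
        have cl: "?c \<in> lifts ?D" using c g by simp
        have m: "?c \<prec> a \<longleftrightarrow> t ?c \<prec> b" using main[OF cl k] .
        have tcs: "t ?c = sh (int n * k) (t c)" using t c unfolding lifting_def by auto
        have ne1: "c \<noteq> a" using c \<open>x i \<notin> ?D\<close> a lifts_def by auto
        have ne2: "t c \<noteq> b"
        proof
          assume "t c = b"
          then have "h (pr c) = y i" using t c b unfolding lifting_def by auto
          moreover obtain j q where j: "j \<in> I" "q < n" "pr c = (rot M ^^ q) (x j)"
            using c unfolding orb_def lifts_def by auto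
          ultimately have "y i = (rot M ^^ q) (y j)" using h piso_rot_pow[OF h(1) xI] by metis
          then have "x i = pr c" using insert.prems(3)[of i j q] j by auto
          then show False using c \<open>x i \<notin> ?D\<close> lifts_def by auto
        qed
        have tcK: "t c \<in> K" using t c unfolding lifting_def by auto
        have tk: "\<not> t ?c \<prec> t c0" "t ?c \<prec> sh (int n) (t c0)"
        proof -
          show "\<not> t ?c \<prec> t c0" using lifting_lt_iff[OF t cl c0l] k by simp
          have "t ?c \<prec> t (sh (int n) c0)" using lifting_lt_iff[OF t cl, of "sh (int n) c0"] k c0l g by simp
          then show "t ?c \<prec> sh (int n) (t c0)" using t c0l unfolding lifting_def by metis
        qed
        \<comment> \<open>A shift by \<open>int n * k\<close> moves c into the window. For k = 0 the
          comparison has been made; for k > 0 the point c lies below the window and for k < 0 at or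
          beyond its end, and the same holds for the images.\<close>
        consider "k = 0" | "0 < k" | "k < 0" by linarith
        then show ?thesis
        proof cases
          case 1
          then have "c \<prec> a \<longleftrightarrow> t c \<prec> b" using m by (simp add: sh_0)
          then show ?thesis using ne1 ne2 lt_total[OF cK a(1)] lt_total[OF tcK b(1)] lt_asym by blast
        next
          case 2
          have k1: "int n \<le> int n * k" using 2 n0 by simp
          have "sh (int n) c0 = sh (int n * k) c0 \<or> sh (int n) c0 \<prec> sh (int n * k) c0"
            using k1 c0 by auto
          then have "sh (int n * k) c \<prec> sh (int n * k) c0"
          proof
            assume "sh (int n) c0 \<prec> sh (int n * k) c0"
            then show ?thesis using k(2) lt_trans by blast
          qed (use k(2) in simp)
          then have "c \<prec> c0" by (simp only: sh_lt_iff)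
          then have "c \<prec> a" "t c \<prec> b" using ab lt_trans lifting_lt_iff[OF t c c0l] by blast+
          then show ?thesis using lt_asym by blast
        next
          case 3
          have k1: "int n * k + int n \<le> 0"
            using mult_nonneg_nonpos[of "int n" "k + 1"] 3 by (simp add: algebra_simps)
          have big: "sh (int n) d \<prec> e \<or> sh (int n) d = e" if "d \<in> K" "e \<in> K" "\<not> sh (int n * k) e \<prec> d" for d e
          proof -
            have "\<not> e \<prec> sh (- (int n * k)) d" using that(3) by (simp add: sh_lt_move)
            then have *: "sh (- (int n * k)) d = e \<or> sh (- (int n * k)) d \<prec> e"
              using that(1,2) lt_total[of "sh (- (int n * k)) d" e] by (metis sh_K)
            have "int n \<le> - (int n * k)" using k1 by simp
            then have "sh (int n) d = sh (- (int n * k)) d \<or> sh (int n) d \<prec> sh (- (int n * k)) d"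
              using that(1) by auto
            then show ?thesis using * lt_trans by auto
          qed
          have "sh (int n) c0 \<prec> c \<or> sh (int n) c0 = c" using big[OF c0(1) cK k(1)] .
          then have "a \<prec> c" using a(4) lt_trans by metis
          moreover have "sh (int n) (t c0) \<prec> t c \<or> sh (int n) (t c0) = t c"
            using big[OF tc0(1) tcK] tk tcs by simp
          then have "b \<prec> t c" using b(4) lt_trans by metis
          ultimately show ?thesis using lt_asym by blast
        qed
      qed
      show ?thesis using a b cut by blast
    qed
    then obtain a b where ab: "a \<in> K" "pr a = x i" "b \<in> K" "pr b = y i"
       "\<forall>c\<in>lifts ?D. (c \<prec> a \<longrightarrow> t c \<prec> b) \<and> (a \<prec> c \<longrightarrow> b \<prec> t c)" by blast
    obtain h' t' where h': "lifting (?D \<union> orb {pr a}) h' t'" "\<forall>x\<in>?D. h' x = h x" "h' (pr a) = pr b"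
      using lifting_extend[OF g t ab(1) _ ab(3)] ab(2,5) False by metis
    have "gset (?D \<union> orb {x i})" using g U gset_Un orb_gset by auto
    then have "piso (?D \<union> orb {x i}) h'" using h' ab piso_def by auto
    moreover have "\<forall>j\<in>insert i I. h' (x j) = y j" using h' ab h xI by auto
    ultimately show ?thesis using ins by auto
  qed
qed


section \<open>Cells\<close>

definition same_cut :: "'a set \<Rightarrow> 'k \<Rightarrow> 'k \<Rightarrow> bool" where
  "same_cut A a b \<longleftrightarrow> (\<forall>c\<in>lifts A. (c \<prec> a \<longrightarrow> c \<prec> b) \<and> (a \<prec> c \<longrightarrow> b \<prec> c))"

text \<open>For a \<open>gset\<close> A, \<open>cell_piso\<close> and \<open>piso_cell\<close>
  identify this relation with conjugacy over A, for points outside A, by a partial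
  isomorphism.\<close>

definition cell :: "'a set \<Rightarrow> 'a \<Rightarrow> 'a \<Rightarrow> bool" where
  "cell A x y \<longleftrightarrow> (\<exists>a\<in>K. \<exists>b\<in>K. pr a = x \<and> pr b = y \<and> x \<notin> A \<and> y \<notin> A \<and> same_cut A a b)"

text \<open>The bound \<open>sh 1 a\<close> and the absence of lifts of A from the closed interval
  leave only one type of pair over A for each cell of the first point; this is
  \<open>near_iso\<close>.\<close>

definition near :: "'a set \<Rightarrow> 'a \<Rightarrow> 'a \<Rightarrow> bool" where
  "near A y z \<longleftrightarrow> (\<exists>a b. a \<prec> b \<and> b \<prec> sh 1 a \<and> pr a = y \<and> pr b = z \<and> (\<forall>c\<in>lifts A. c \<prec> a \<or> b \<prec> c))"

lemma same_cut_sym: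
  assumes "same_cut A a b" "a \<in> K" "pr a \<notin> A" "b \<in> K" "pr b \<notin> A" shows "same_cut A b a"
  unfolding same_cut_def
proof (intro ballI conjI impI)
  fix c assume c: "c \<in> lifts A"
  have ne: "c \<noteq> a" "c \<noteq> b" using c assms lifts_def by auto
  have cut: "c \<prec> a \<Longrightarrow> c \<prec> b" "a \<prec> c \<Longrightarrow> b \<prec> c" using c assms(1) same_cut_def by auto
  show "c \<prec> b \<Longrightarrow> c \<prec> a" "b \<prec> c \<Longrightarrow> a \<prec> c"
    using cut ne lt_total[OF liftsK[OF c] assms(2)] lt_asym by blast+
qed

lemma same_cut_trans: "same_cut A a b \<Longrightarrow> same_cut A b c \<Longrightarrow> same_cut A a c"
  unfolding same_cut_def by blast

lemma same_cut_sh: assumes "gset A" "same_cut A a b" shows "same_cut A (sh k a) (sh k b)"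
  unfolding same_cut_def
proof (intro ballI conjI impI)
  fix c assume c: "c \<in> lifts A"
  then have c': "sh (- k) c \<in> lifts A" using assms by simp
  show "c \<prec> sh k b" if "c \<prec> sh k a"
    using assms(2) c' that unfolding same_cut_def lt_sh_move by blast
  show "sh k b \<prec> c" if "sh k a \<prec> c"
    using assms(2) c' that unfolding same_cut_def sh_lt_move by blast
qed

lemma cell_notin: "cell A x y \<Longrightarrow> x \<notin> A \<and> y \<notin> A" unfolding cell_def by auto

lemma cell_univ: "cell A x y \<Longrightarrow> x \<in> univ M \<and> y \<in> univ M" unfolding cell_def using pr_univ by auto

lemma cell_refl: assumes "x \<in> univ M" "x \<notin> A" shows "cell A x x"
proof -
  obtain a where "a \<in> K" "pr a = x" using pr_surj assms by blast
  then show ?thesis using assms unfolding cell_def same_cut_def by blast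
qed

lemma cell_sym: "cell A x y \<Longrightarrow> cell A y x"
  unfolding cell_def using same_cut_sym by blast

lemma cell_lift:
  assumes "gset A" "cell A x y" "a \<in> K" "pr a = x"
  obtains b where "b \<in> K" "pr b = y" "same_cut A a b"
proof -
  obtain a' b' where 1: "a' \<in> K" "b' \<in> K" "pr a' = x" "pr b' = y" "same_cut A a' b'"
    using assms unfolding cell_def by blast
  then obtain k where k: "a = sh (int n * k) a'" using assms pr_eq_iff[of a' a] by auto
  show ?thesis
    by (rule that[of "sh (int n * k) b'"]) (use 1 k same_cut_sh[OF assms(1) 1(5)] in simp_all)
qed

lemma cell_trans: assumes "gset A" "cell A x y" "cell A y z" shows "cell A x z"
proof -
  obtain a where a: "a \<in> K" "pr a = x" using assms unfolding cell_def by blast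
  obtain b where b: "b \<in> K" "pr b = y" "same_cut A a b" using cell_lift[OF assms(1,2) a] .
  obtain c where c: "c \<in> K" "pr c = z" "same_cut A b c" using cell_lift[OF assms(1,3) b(1,2)] .
  show ?thesis unfolding cell_def
    using a b c same_cut_trans assms(2,3) cell_notin by blast
qed

lemma same_cut_between:
  assumes "\<forall>c\<in>lifts A. c \<prec> a \<or> b \<prec> c" "a \<prec> b"
  shows "same_cut A a b" "pr a \<notin> A" "pr b \<notin> A"
proof -
  show "same_cut A a b" unfolding same_cut_def using assms lt_trans lt_asym by blast
  have "a \<notin> lifts A" "b \<notin> lifts A" using assms lt_irrefl lt_asym by blast+
  then show "pr a \<notin> A" "pr b \<notin> A" using lt_K[OF assms(2)] lifts_def by auto
qed

lemma near_cell: assumes "near A y z" shows "cell A y z"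
proof -
  obtain a b where ab: "a \<prec> b" "pr a = y" "pr b = z" "\<forall>c\<in>lifts A. c \<prec> a \<or> b \<prec> c"
    using assms unfolding near_def by blast
  show ?thesis unfolding cell_def
    using ab same_cut_between[OF ab(4,1)] lt_K[OF ab(1)] by blast
qed

lemma near_ne: assumes "near A y z" shows "y \<noteq> z"
proof
  assume eq: "y = z"
  obtain a b where ab: "a \<prec> b" "b \<prec> sh 1 a" "pr a = y" "pr b = z"
    using assms unfolding near_def by blast
  then have K: "a \<in> K" using lt_K by blast
  have "a = b"
    by (rule pr_inj_window[OF K]) (use ab K eq lt_irrefl lt_asym[OF ab(1)] sh1_lt_n[OF K ab(2)] n_gt_1 in simp_all)
  then show False using ab lt_irrefl by blast
qed

lemma near_mono: "near B y z \<Longrightarrow> A \<subseteq> B \<Longrightarrow> near A y z"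
  unfolding near_def using lifts_mono by blast

lemma cell_piso:
  assumes "gset A" "cell A x y"
  shows "\<exists>h. piso (A \<union> orb {x}) h \<and> (\<forall>z\<in>A. h z = z) \<and> h x = y"
proof -
  obtain a b where ab: "a \<in> K" "b \<in> K" "pr a = x" "pr b = y" "x \<notin> A" "same_cut A a b"
    using assms unfolding cell_def by blast
  have l: "lifting A (\<lambda>x. x) (\<lambda>x. x)" unfolding lifting_def lifts_def by auto
  obtain h t where ht: "lifting (A \<union> orb {pr a}) h t" "\<forall>x\<in>A. h x = x" "h (pr a) = pr b"
    using lifting_extend[OF assms(1) l ab(1) _ ab(2)] ab unfolding same_cut_def by blast
  moreover have "gset (A \<union> orb {x})" using assms ab gset_Un orb_gset[of "{x}"] pr_univ by auto
  ultimately show ?thesis using ab unfolding piso_def by blast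
qed

text \<open>A lift of a map that fixes A pointwise may still translate the lifts of A by full turns.
  The number k of turns at one lift \<open>c0\<close> is forced on all others by the order, and the
  opposite translation removes it.\<close>

lemma lifting_normal:
  assumes "gset D" "lifting D h t" "gset A" "A \<subseteq> D" "\<forall>z\<in>A. h z = z"
  obtains t' where "lifting D h t'" "\<forall>c\<in>lifts A. t' c = c"
proof (cases "lifts A = {}")
  case True
  then show ?thesis using that assms by blast
next
  case False
  then obtain c0 where c0: "c0 \<in> lifts A" by blast
  have AD: "c \<in> lifts D" if "c \<in> lifts A" for c using that assms lifts_mono by blast
  have tA: "t c \<in> K" "pr (t c) = pr c" "\<And>k. t (sh k c) = sh k (t c)" if c: "c \<in> lifts A" for c
    using assms(2,5) AD[OF c] c unfolding lifting_def lifts_def by auto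
  obtain k where k: "t c0 = sh (int n * k) c0" using pr_eq_iff[of c0 "t c0"] tA[OF c0] liftsK[OF c0] by auto
  have main: "t c = sh (int n * k) c" if c: "c \<in> lifts A" for c
  proof -
    have n0: "0 < int n" using n_gt_1 by simp
    obtain j where j: "\<not> sh (int n * j) c \<prec> c0" "sh (int n * j) c \<prec> sh (int n) c0"
      using floor_exists_n[OF liftsK[OF c0] liftsK[OF c] n0] by blast
    define d where "d = sh (int n * j) c"
    have d: "d \<in> lifts A" unfolding d_def using c assms by simp
    have "t d = sh (int n * k) d"
    proof (rule pr_inj_window[of "t c0"])
      show "t c0 \<in> K" using tA c0 by blast
      show "\<not> t d \<prec> t c0" using lifting_lt_iff[OF assms(2) AD[OF d] AD[OF c0]] j d_def by simp
      have "t d \<prec> t (sh (int n) c0)"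
        using lifting_lt_iff[OF assms(2) AD[OF d] AD, of "sh (int n) c0"] j d_def assms c0 by simp
      then show "t d \<prec> sh (int n) (t c0)" using tA c0 by simp
      show "\<not> sh (int n * k) d \<prec> t c0" using k j d_def by simp
      have "sh (int n * k) d \<prec> sh (int n * k) (sh (int n) c0)" using j d_def by simp
      then show "sh (int n * k) d \<prec> sh (int n) (t c0)" using k by (simp add: sh_sh add.commute)
      show "pr (t d) = pr (sh (int n * k) d)" using tA[OF d] liftsK[OF d] by simp
    qed
    then have "sh (int n * j) (t c) = sh (int n * j) (sh (int n * k) c)"
      using tA(3)[OF c] d_def by (simp add: sh_sh add.commute)
    then show ?thesis by simp
  qed
  define t' where "t' c = sh (int n * (- k)) (t c)" for c
  have "lifting D h t'" using assms(2) unfolding lifting_def t'_def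
    by (auto simp: sh_sh add.commute simp del: mult_minus_right)
  moreover have "\<forall>c\<in>lifts A. t' c = c" using main by (simp add: t'_def)
  ultimately show ?thesis using that by blast
qed

lemma piso_cell:
  assumes "piso D h" "gset A" "A \<subseteq> D" "\<forall>z\<in>A. h z = z" "x \<in> D" "x \<notin> A"
  shows "cell A x (h x)"
proof -
  obtain t0 where "lifting D h t0" using assms piso_def by blast
  then obtain t where t: "lifting D h t" "\<forall>c\<in>lifts A. t c = c"
    using lifting_normal[OF piso_gset[OF assms(1)] _ assms(2-4)] by blast
  obtain a where a: "a \<in> lifts D" "pr a = x" "a \<in> K" using piso_lift[OF assms(1,5)] .
  have ta: "t a \<in> K" "pr (t a) = h x" using t a unfolding lifting_def by auto
  have "h x \<notin> A"
  proof
    assume "h x \<in> A"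
    then have "h (h x) = h x" "h x \<in> D" using assms by auto
    then show False using piso_inj[OF assms(1)] assms(5,6) \<open>h x \<in> A\<close> inj_onD by metis
  qed
  moreover have "same_cut A a (t a)" unfolding same_cut_def
  proof (intro ballI conjI impI)
    fix c assume c: "c \<in> lifts A"
    then have cD: "c \<in> lifts D" using assms lifts_mono by blast
    show "c \<prec> t a" if "c \<prec> a" using lifting_lt_iff[OF t(1) cD a(1)] t(2) c that by simp
    show "t a \<prec> c" if "a \<prec> c" using lifting_lt_iff[OF t(1) a(1) cD] t(2) c that by simp
  qed
  ultimately show ?thesis unfolding cell_def using a ta assms by blast
qed

text \<open>First y is moved to z. Afterwards the lifts to respect are those of A and the shifts of
  a, and y' and z' occupy corresponding cuts because each lies strictly between its partner and the
  next shift of that partner.\<close>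

lemma near_iso:
  assumes A: "gset A" and y: "near A y y'" and z: "near A z z'" and yz: "cell A y z"
  shows "\<exists>h. piso (A \<union> orb {y} \<union> orb {y'}) h \<and> (\<forall>w\<in>A. h w = w) \<and> h y = z \<and> h y' = z'"
proof -
  obtain a a' where a: "a \<prec> a'" "a' \<prec> sh 1 a" "pr a = y" "pr a' = y'" "\<forall>c\<in>lifts A. c \<prec> a \<or> a' \<prec> c"
    using y unfolding near_def by blast
  obtain b0 b0' where b0: "b0 \<prec> b0'" "b0' \<prec> sh 1 b0" "pr b0 = z" "pr b0' = z'" "\<forall>c\<in>lifts A. c \<prec> b0 \<or> b0' \<prec> c"
    using z unfolding near_def by blast
  have aK: "a \<in> K" "a' \<in> K" using lt_K a by blast+
  obtain b where b: "b \<in> K" "pr b = z" "same_cut A a b" using cell_lift[OF A yz aK(1) a(3)] .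
  obtain k where k: "b = sh (int n * k) b0" using pr_eq_iff[of b0 b] b b0 lt_K[OF b0(1)] by auto
  define b' where "b' = sh (int n * k) b0'"
  have b': "b \<prec> b'" "b' \<prec> sh 1 b" "pr b' = z'" "b' \<in> K"
    using b0 k lt_K[OF b0(1)] sh_mono[OF b0(2), of "int n * k"] unfolding b'_def
    by (simp_all add: sh_sh add.commute)
  have nA: "pr a \<notin> A" "pr a' \<notin> A" using same_cut_between[OF a(5,1)] by auto
  have b0A: "same_cut A b0 b0'" using same_cut_between[OF b0(5,1)] by blast
  have bA: "same_cut A b b'" unfolding k b'_def by (rule same_cut_sh[OF A b0A])
  have l: "lifting A (\<lambda>x. x) (\<lambda>x. x)" unfolding lifting_def lifts_def by auto
  let ?D = "A \<union> orb {pr a}"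
  obtain h t where ht: "lifting ?D h t" "\<forall>x\<in>A. h x = x" "h (pr a) = pr b" "\<forall>c\<in>lifts A. t c = c" "t a = b"
    using lifting_extend[OF A l aK(1) nA(1) b(1)] b(3) unfolding same_cut_def by blast
  have gD: "gset ?D" using A gset_Un orb_gset[of "{pr a}"] pr_univ aK by auto
  have L: "(c \<in> lifts A) \<or> (\<exists>i. c = sh i a)" if c: "c \<in> lifts ?D" for c
  proof (cases "pr c \<in> A")
    case True then show ?thesis using c lifts_def by auto
  next
    case False
    then obtain i where i: "pr (sh i a) = pr c" using c orb_pr[OF aK(1)] lifts_def by auto
    then obtain j where "c = sh (int n * j) (sh i a)" using pr_eq_iff[of "sh i a" c] aK liftsK[OF c] by auto
    then show ?thesis using sh_sh by blast
  qed
  have al: "a \<in> lifts ?D" using aK orb_refl[of "{pr a}"] lifts_def by auto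
  have ts: "t (sh i a) = sh i b" for i using ht(1,5) al unfolding lifting_def by auto
  have ia: "sh i a \<prec> a' \<longleftrightarrow> i \<le> 0" for i
  proof
    show "sh i a \<prec> a'" if "i \<le> 0"
      using that a(1) lt_trans[of "sh i a" a a'] aK by (cases "i = 0") (auto simp: sh_0)
    show "i \<le> 0" if "sh i a \<prec> a'" using lt_trans[OF that a(2)] aK by simp
  qed
  have ai: "a' \<prec> sh i a \<longleftrightarrow> 1 \<le> i" for i
  proof
    show "a' \<prec> sh i a" if "1 \<le> i"
      using that a(2) lt_trans[of a' "sh 1 a" "sh i a"] aK by (cases "i = 1") auto
    show "1 \<le> i" if "a' \<prec> sh i a" using lt_trans[OF a(1) that] aK by simp
  qed
  have ib: "sh i b \<prec> b'" if "i \<le> 0" for i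
    using that b'(1) lt_trans[of "sh i b" b b'] b by (cases "i = 0") (auto simp: sh_0)
  have bi: "b' \<prec> sh i b" if "1 \<le> i" for i
    using that b'(2) lt_trans[of b' "sh 1 b" "sh i b"] b by (cases "i = 1") auto
  have a'D: "pr a' \<notin> ?D"
  proof
    assume "pr a' \<in> ?D"
    then have "a' \<in> lifts ?D" using aK lifts_def by auto
    then consider "a' \<in> lifts A" | i where "a' = sh i a" using L by blast
    then show False
    proof cases
      case 1 then show False using nA lifts_def by auto
    next
      case 2
      then have "\<not> i \<le> 0" "\<not> 1 \<le> i" using ia[of i] ai[of i] lt_irrefl by auto
      then show False by linarith
    qed
  qed
  have aa: "same_cut A a a'" using same_cut_between[OF a(5,1)] by blast
  have cA: "same_cut A a' b'"
    using same_cut_trans[OF same_cut_sym[OF aa aK(1) nA(1) aK(2) nA(2)] same_cut_trans[OF b(3) bA]] .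
  have c1: "t c \<prec> b'" if "c \<in> lifts ?D" "c \<prec> a'" for c
    using L[OF that(1)] that(2) ht(4) cA ia ib ts unfolding same_cut_def by auto
  have c2: "b' \<prec> t c" if "c \<in> lifts ?D" "a' \<prec> c" for c
    using L[OF that(1)] that(2) ht(4) cA ai bi ts unfolding same_cut_def by auto
  obtain h' t' where h': "lifting (?D \<union> orb {pr a'}) h' t'" "\<forall>x\<in>?D. h' x = h x" "h' (pr a') = pr b'"
    using lifting_extend[OF gD ht(1) aK(2) a'D b'(4)] c1 c2 by blast
  have "gset (?D \<union> orb {pr a'})" using gD gset_Un orb_gset[of "{pr a'}"] pr_univ aK by auto
  then have "piso (?D \<union> orb {pr a'}) h'" using h' piso_def by blast
  moreover have "pr a \<in> ?D" using orb_refl[of "{pr a}"] by auto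
  ultimately show ?thesis using h' ht a b b' by (intro exI[of _ h']) auto
qed

text \<open>Nearness links any two points of a cell. Over non-empty A a cut is shorter than one
  shift and a single step suffices; over the empty set everything is one cell, and the number k of
  shifts separating the lifts is the induction parameter.\<close>

lemma cell_chain:
  assumes A: "gset A" and P: "\<And>y y'. cell A x y \<Longrightarrow> near A y y' \<Longrightarrow> P y \<longleftrightarrow> P y'"
    and xz: "cell A x z" and Px: "P x"
  shows "P z"
proof -
  have step: "P (pr a) \<longleftrightarrow> P (pr b)"
    if "a \<prec> b" "b \<prec> sh (int k) a" "same_cut A a b" "pr a \<notin> A" "pr b \<notin> A" "cell A x (pr a)" for a b k
    using that
  proof (induction k arbitrary: b)
    case 0
    then show ?case using lt_asym by (simp add: sh_0)
  next
    case (Suc k)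
    have K: "a \<in> K" "b \<in> K" using lt_K[OF Suc.prems(1)] by auto
    have nb: "P (pr a) \<longleftrightarrow> P (pr b)" if "b \<prec> sh 1 a"
    proof (rule P[OF Suc.prems(6)])
      have "\<forall>c\<in>lifts A. c \<prec> a \<or> b \<prec> c"
      proof
        fix c assume c: "c \<in> lifts A"
        have "c \<noteq> a" using c Suc.prems(4) lifts_def by auto
        then show "c \<prec> a \<or> b \<prec> c"
          using lt_total[OF liftsK[OF c] K(1)] Suc.prems(3) c unfolding same_cut_def by blast
      qed
      then show "near A (pr a) (pr b)" unfolding near_def using Suc.prems(1) that by blast
    qed
    show ?case
    proof (cases "b \<prec> sh 1 a")
      case True then show ?thesis by (rule nb)
    next
      case False
      show ?thesis
      proof (cases "lifts A = {}")
        case ne: False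
        \<comment> \<open>Consecutive shifts of \<open>c0\<close> enclose the cut, which contradicts
          that b is at least one shift above a.\<close>
        then obtain c0 where c0: "c0 \<in> lifts A" by blast
        obtain i where i: "\<not> a \<prec> sh i c0" "a \<prec> sh (i + 1) c0"
          using floor_exists[OF liftsK[OF c0] K(1)] by blast
        have il: "sh i c0 \<in> lifts A" "sh (i + 1) c0 \<in> lifts A" using c0 A by auto
        have "sh i c0 \<noteq> a" using il Suc.prems(4) lifts_def by auto
        then have "sh i c0 \<prec> a" using i lt_total[OF K(1) liftsK[OF il(1)]] by blast
        then have "sh 1 (sh i c0) \<prec> sh 1 a" by simp
        then have "sh (i + 1) c0 \<prec> sh 1 a" by (simp add: sh_sh add.commute)
        moreover have "b \<prec> sh (i + 1) c0" using Suc.prems(3) il i unfolding same_cut_def by blast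
        ultimately have "b \<prec> sh 1 a" using lt_trans by blast
        then show ?thesis using False by blast
      next
        case True
        have cutT: "same_cut A c d" for c d unfolding same_cut_def True by blast
        have notA: "pr c \<notin> A" if "c \<in> K" for c using True that lifts_def by auto
        have 1: "sh 1 a = b \<or> sh 1 a \<prec> b" using False lt_total[of "sh 1 a" b] K by auto
        have "0 < k"
        proof (rule ccontr)
          assume "\<not> 0 < k" then show False using Suc.prems(2) False by simp
        qed
        have kk: "sh (- 1) b \<prec> sh (int k) a"
        proof -
          have "sh (- 1) b \<prec> sh (- 1) (sh (int (Suc k)) a)" using Suc.prems(2) by (simp only: sh_lt_iff)
          then show ?thesis by (simp add: sh_sh)
        qed
        have ab1: "sh (- 1) b = a \<or> a \<prec> sh (- 1) b"
          using 1 sh_mono[of "sh 1 a" b "- 1"] by (auto simp: sh_sh sh_0)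
        \<comment> \<open>An intermediate point less than one shift below b, and less than k shifts
          above a, reduces the claim to the induction hypothesis and one near step.\<close>
        obtain d where d: "sh (- 1) b \<prec> d" "d \<prec> b" "d \<prec> sh (int k) a"
        proof (cases "b \<prec> sh (int k) a")
          case T: True
          obtain d where "sh (- 1) b \<prec> d" "d \<prec> b"
            using lt_dense[of "sh (- 1) b" b] K by auto
          then show ?thesis using that T lt_trans by blast
        next
          case F: False
          obtain d where d: "sh (- 1) b \<prec> d" "d \<prec> sh (int k) a" using lt_dense[OF kk] by blast
          then have "d \<prec> b" using lt_not_trans[OF d(2) K(2) F] by blast
          then show ?thesis using that d by blast
        qed
        have dK: "d \<in> K" using lt_K[OF d(1)] by blast
        have ad: "a \<prec> d" using ab1 d lt_trans by blast
        have "cell A (pr a) (pr d)" unfolding cell_def using K dK notA cutT by blast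
        then have xd: "cell A x (pr d)" using cell_trans[OF A Suc.prems(6)] by blast
        have "P (pr a) \<longleftrightarrow> P (pr d)"
          by (rule Suc.IH[OF ad d(3) cutT]) (use notA K dK Suc.prems in auto)
        moreover have "near A (pr d) (pr b)" unfolding near_def
          using d by (intro exI[of _ d] exI[of _ b]) (auto simp: True lt_sh_move)
        then have "P (pr d) \<longleftrightarrow> P (pr b)" by (rule P[OF xd])
        ultimately show ?thesis by simp
      qed
    qed
  qed
  obtain a where a: "a \<in> K" "pr a = x" using xz unfolding cell_def by blast
  obtain b where b: "b \<in> K" "pr b = z" "same_cut A a b" using cell_lift[OF A xz a] .
  have nA: "x \<notin> A" "z \<notin> A" using cell_notin[OF xz] by auto
  have xx: "cell A x x" using cell_refl cell_univ[OF xz] nA by blast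
  have arch: "\<exists>k. d \<prec> sh (int k) c" if "c \<prec> d" for c d
  proof -
    have K: "c \<in> K" "d \<in> K" using lt_K that by auto
    then obtain k where k: "d \<prec> sh k c" using sh_arch by blast
    then have "c \<prec> sh k c" using that lt_trans by blast
    then have "0 < k" using K by simp
    then show ?thesis using k by (intro exI[of _ "nat k"]) simp
  qed
  consider "a = b" | "a \<prec> b" | "b \<prec> a" using lt_total a b by blast
  then show ?thesis
  proof cases
    case 1 then show ?thesis using a b Px by blast
  next
    case 2
    then obtain k where "b \<prec> sh (int k) a" using arch by blast
    then show ?thesis using step[OF 2 _ b(3)] a b nA xx Px by auto
  next
    case 3
    then obtain k where "a \<prec> sh (int k) b" using arch by blast
    then show ?thesis
      using step[OF 3 _ same_cut_sym[OF b(3)]] a b nA xz Px by auto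
  qed
qed

section \<open>Infinitely many pairwise near points in a cell\<close>

lemma infinite_interval: assumes "a \<prec> q" shows "infinite {b. a \<prec> b \<and> b \<prec> q}"
proof
  assume f: "finite {b. a \<prec> b \<and> b \<prec> q}"
  have "{b. a \<prec> b \<and> b \<prec> q} \<noteq> {}" using lt_dense[OF assms] by blast
  moreover have "{b. a \<prec> b \<and> b \<prec> q} \<subseteq> K" using lt_K by blast
  ultimately obtain p where p: "a \<prec> p" "p \<prec> q" "\<forall>c. a \<prec> c \<and> c \<prec> q \<longrightarrow> c = p \<or> p \<prec> c"
    using lt_finite_min[OF f] by blast
  obtain c where c: "a \<prec> c" "c \<prec> p" using lt_dense[OF p(1)] by blast
  then have "c = p \<or> p \<prec> c" using p lt_trans by blast
  then show False using c lt_irrefl lt_asym by blast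
qed

text \<open>To the right of a lift a of x there is an interval free of lifts of B, ending at the
  next such lift or at \<open>sh 1 a\<close>, whichever comes first. It is infinite by density,
  \<open>pr\<close> is injective on it, and any two of its points are near in one order.\<close>

lemma near_infinite:
  assumes B: "gset B" and x: "x \<in> univ M" "x \<notin> B"
  shows "\<exists>Y. infinite Y \<and> (\<forall>y\<in>Y. cell B x y \<and> near B x y) \<and>
    (\<forall>y\<in>Y. \<forall>z\<in>Y. y \<noteq> z \<longrightarrow> near B y z \<or> near B z y)"
proof -
  obtain a where a: "a \<in> K" "pr a = x" using pr_surj x by blast
  obtain q where q: "a \<prec> q" "\<not> sh 1 a \<prec> q" "\<forall>c\<in>lifts B. c \<prec> a \<or> \<not> c \<prec> q"
  proof -
    define Q where "Q = insert (sh 1 a) {c \<in> lifts B. \<not> c \<prec> a \<and> c \<prec> sh (int n) a}"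
    have "finite Q" unfolding Q_def using finite_lifts_window[OF _ a(1)] B gset_def by simp
    moreover have "Q \<subseteq> K" unfolding Q_def using a liftsK by auto
    ultimately obtain q where q: "q \<in> Q" "\<forall>c\<in>Q. c = q \<or> q \<prec> c"
      using lt_finite_min[of Q] Q_def by blast
    have qK: "q \<in> K" using q \<open>Q \<subseteq> K\<close> by blast
    have "sh 1 a \<noteq> a" using sh_pos[OF a(1)] lt_irrefl[of a] by metis
    then have "\<not> q \<prec> a \<and> q \<noteq> a" using q(1) x a lifts_def lt_asym[OF sh_pos[OF a(1)]] unfolding Q_def
      by auto
    then have "a \<prec> q" using lt_total[OF a(1) qK] by blast
    moreover have q1: "\<not> sh 1 a \<prec> q" using q(2) Q_def lt_irrefl lt_asym by (metis insertI1)
    moreover have "\<forall>c\<in>lifts B. c \<prec> a \<or> \<not> c \<prec> q"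
    proof (intro ballI, rule ccontr)
      fix c assume c: "c \<in> lifts B" "\<not> (c \<prec> a \<or> \<not> c \<prec> q)"
      then have "c \<prec> sh 1 a" using lt_not_trans[of c q "sh 1 a"] q1 a by auto
      then have "c \<in> Q" unfolding Q_def using c sh1_lt_n[OF a(1)] by auto
      then show False using q(2) c lt_irrefl lt_asym by metis
    qed
    ultimately show ?thesis using that by blast
  qed
  have nr: "near B (pr b) (pr c)" if "b = a \<or> a \<prec> b" "b \<prec> c" "c \<prec> q" for b c
  proof -
    have "c \<prec> sh 1 a" using lt_not_trans[OF that(3) _ q(2)] a by simp
    moreover have "sh 1 a = sh 1 b \<or> sh 1 a \<prec> sh 1 b" using that(1) by auto
    ultimately have "c \<prec> sh 1 b" using lt_trans by auto
    moreover have "\<forall>d\<in>lifts B. d \<prec> b \<or> c \<prec> d"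
    proof
      fix d assume d: "d \<in> lifts B"
      then consider "d \<prec> a" | "\<not> d \<prec> q" using q(3) by blast
      then show "d \<prec> b \<or> c \<prec> d"
      proof cases
        case 1 then show ?thesis using that(1) lt_trans by blast
      next
        case 2 then show ?thesis using lt_not_trans[OF that(3) liftsK[OF d]] by blast
      qed
    qed
    ultimately show ?thesis unfolding near_def using that(2) by blast
  qed
  define Y where "Y = pr ` {b. a \<prec> b \<and> b \<prec> q}"
  have "inj_on pr {b. a \<prec> b \<and> b \<prec> q}"
  proof (rule inj_onI)
    fix b c assume bc: "b \<in> {b. a \<prec> b \<and> b \<prec> q}" "c \<in> {b. a \<prec> b \<and> b \<prec> q}" "pr b = pr c"
    show "b = c"
    proof (rule pr_inj_window[OF a(1) _ _ _ _ bc(3)])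
      show "\<not> b \<prec> a" "\<not> c \<prec> a" using bc lt_asym by auto
      show "b \<prec> sh (int n) a" "c \<prec> sh (int n) a"
        using bc lt_not_trans[of _ q "sh 1 a"] q(2) a sh1_lt_n[OF a(1)] by auto
    qed
  qed
  then have inf: "infinite Y" unfolding Y_def using infinite_interval[OF q(1)] finite_image_iff by blast
  have 1: "near B x y" if "y \<in> Y" for y using that nr[of a] a unfolding Y_def by auto
  have 2: "near B y z \<or> near B z y" if yz: "y \<in> Y" "z \<in> Y" "y \<noteq> z" for y z
  proof -
    obtain b c where bc: "y = pr b" "z = pr c" "a \<prec> b" "b \<prec> q" "a \<prec> c" "c \<prec> q"
      using yz unfolding Y_def by blast
    then have "b \<prec> c \<or> c \<prec> b" using lt_total lt_K yz(3) by metis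
    then show ?thesis using nr bc by blast
  qed
  show ?thesis by (intro exI[of _ Y] conjI ballI impI inf) (use near_cell[OF 1] 1 2 in blast)+
qed

lemma near_exists: assumes "gset B" "x \<in> univ M" "x \<notin> B" shows "\<exists>y. cell B x y \<and> near B x y"
proof -
  obtain Y where Y: "infinite Y" "\<forall>y\<in>Y. cell B x y \<and> near B x y" using near_infinite[OF assms] by blast
  then have "Y \<noteq> {}" by auto
  then show ?thesis using Y(2) by blast
qed


section \<open>Invariance of formulas\<close>

lemma Interp_S: "xs \<in> Interp (fo M) S_sym \<longleftrightarrow>
    length xs = 3 \<and> set xs \<subseteq> univ M \<and> cyc M (xs ! 0) (xs ! 1) (xs ! 2)"
  by (auto simp: fo_def numeral_3_eq_3 length_Suc_conv)

lemma Interp_g: "xs \<in> Interp (fo M) g_sym \<longleftrightarrow>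
    length xs = 2 \<and> set xs \<subseteq> univ M \<and> xs ! 1 = rot M (xs ! 0)"
  by (auto simp: fo_def numeral_2_eq_2 length_Suc_conv)

lemma piso_Interp:
  assumes "piso D h" "set xs \<subseteq> D"
  shows "map h xs \<in> Interp (fo M) r \<longleftrightarrow> xs \<in> Interp (fo M) r"
proof -
  have U: "set xs \<subseteq> univ M" "set (map h xs) \<subseteq> univ M"
    using assms piso_univ piso_in_univ by (auto dest: subsetD)
  have D: "xs ! i \<in> D" if "i < length xs" for i using assms that by auto
  show ?thesis
  proof (cases r)
    case S_sym
    have "cyc M (h (xs ! 0)) (h (xs ! 1)) (h (xs ! 2)) \<longleftrightarrow> cyc M (xs ! 0) (xs ! 1) (xs ! 2)" if "length xs = 3"
      using piso_cyc[OF assms(1) D D D] that by simp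
    then show ?thesis using U unfolding S_sym Interp_S by auto
  next
    case g_sym
    have "h (xs ! 1) = rot M (h (xs ! 0)) \<longleftrightarrow> xs ! 1 = rot M (xs ! 0)" if l: "length xs = 2"
    proof -
      have 0: "xs ! 0 \<in> D" "xs ! 1 \<in> D" using D l by auto
      then have "rot M (xs ! 0) \<in> D" using piso_gset[OF assms(1)] gset_def by auto
      then show ?thesis
        using piso_rot[OF assms(1) 0(1)] inj_on_eq_iff[OF piso_inj[OF assms(1)] 0(2)] by metis
    qed
    then show ?thesis using U unfolding g_sym Interp_g by auto
  qed
qed

text \<open>The quantifier step is the one with content: a witness on either side is matched by
  extending the partial isomorphism forth, respectively back.\<close>

lemma sat_fo:
  assumes "piso D h" "\<forall>i\<in>fv \<phi>. \<sigma> i \<in> D \<and> \<tau> i = h (\<sigma> i)"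
  shows "sat (fo M) \<phi> \<sigma> \<longleftrightarrow> sat (fo M) \<phi> \<tau>"
  using assms
proof (induction \<phi> arbitrary: D h \<sigma> \<tau>)
  case (Eq i j)
  then show ?case using inj_on_eq_iff[OF piso_inj[OF Eq(1)], of "\<sigma> i" "\<sigma> j"] by auto
next
  case (Rel r js)
  have "map \<tau> js = map h (map \<sigma> js)" using Rel by auto
  moreover have "set (map \<sigma> js) \<subseteq> D" using Rel by auto
  ultimately show ?case using piso_Interp[OF Rel(1)] by (simp only: sat.simps)
next
  case (Neg \<phi>)
  then show ?case by simp
next
  case (Conj \<phi> \<psi>)
  have "sat (fo M) \<phi> \<sigma> \<longleftrightarrow> sat (fo M) \<phi> \<tau>" by (rule Conj.IH(1)[OF Conj.prems(1)]) (use Conj.prems in auto)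
  moreover have "sat (fo M) \<psi> \<sigma> \<longleftrightarrow> sat (fo M) \<psi> \<tau>" by (rule Conj.IH(2)[OF Conj.prems(1)]) (use Conj.prems in auto)
  ultimately show ?case by simp
next
  case (Ex s i \<phi>)
  have U: "Univ (fo M) s = univ M" by (simp add: fo_def)
  show ?case
  proof
    assume "sat (fo M) (Ex s i \<phi>) \<sigma>"
    then obtain x where x: "x \<in> univ M" "sat (fo M) \<phi> (\<sigma>(i := x))" using U by auto
    obtain D' h' where h': "piso D' h'" "D \<subseteq> D'" "x \<in> D'" "\<forall>y\<in>D. h' y = h y"
      using piso_extend1[OF Ex.prems(1) x(1)] by blast
    have "sat (fo M) \<phi> (\<sigma>(i := x)) \<longleftrightarrow> sat (fo M) \<phi> (\<tau>(i := h' x))"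
      by (rule Ex.IH[OF h'(1)]) (use Ex.prems h' in auto)
    then show "sat (fo M) (Ex s i \<phi>) \<tau>" using x U piso_in_univ[OF h'(1,3)] by auto
  next
    assume "sat (fo M) (Ex s i \<phi>) \<tau>"
    then obtain y where y: "y \<in> univ M" "sat (fo M) \<phi> (\<tau>(i := y))" using U by auto
    obtain D' h' where h': "piso D' h'" "D \<subseteq> D'" "{y} \<subseteq> h' ` D'" "\<forall>y\<in>D. h' y = h y"
      using piso_extend_back[OF Ex.prems(1), of "{y}"] y by auto
    then obtain x where x: "x \<in> D'" "y = h' x" by auto
    have "sat (fo M) \<phi> (\<sigma>(i := x)) \<longleftrightarrow> sat (fo M) \<phi> (\<tau>(i := h' x))"
      by (rule Ex.IH[OF h'(1)]) (use Ex.prems h' x in auto)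
    then show "sat (fo M) (Ex s i \<phi>) \<sigma>" using x y U piso_univ[OF h'(1)] by auto
  qed
qed

lemma holds_fo:
  assumes "piso D h" "set xs \<subseteq> D" "fv \<phi> \<subseteq> {..<length xs}"
  shows "holds (fo M) \<phi> (map h xs) \<longleftrightarrow> holds (fo M) \<phi> xs"
proof -
  have "xs ! i \<in> D" "map h xs ! i = h (xs ! i)" if "i \<in> fv \<phi>" for i
  proof -
    have "i < length xs" using assms(3) that by auto
    then show "xs ! i \<in> D" "map h xs ! i = h (xs ! i)" using assms(2) nth_mem[of i xs] by auto
  qed
  then show ?thesis unfolding holds_def by (intro sat_fo[OF assms(1), symmetric]) blast
qed

lemma def_equivD:
  assumes "def_equiv M k E"
  shows "equiv (tuples (univ M) k) E" "0 < k" "E \<subseteq> tuples (univ M) k \<times> tuples (univ M) k"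
  using assms unfolding def_equiv_def by auto

lemma def_equiv_inv:
  assumes "def_equiv M k E" "piso D h" "set xs \<subseteq> D" "set ys \<subseteq> D"
  shows "(map h xs, map h ys) \<in> E \<longleftrightarrow> (xs, ys) \<in> E"
proof -
  obtain \<phi> where \<phi>: "fv \<phi> \<subseteq> {..<k + k}"
    "E = {(xs, ys). xs \<in> tuples (univ M) k \<and> ys \<in> tuples (univ M) k \<and> holds (fo M) \<phi> (xs @ ys)}"
    using assms(1) unfolding def_equiv_def by blast
  have t: "map h zs \<in> tuples (univ M) k \<longleftrightarrow> zs \<in> tuples (univ M) k" if "set zs \<subseteq> D" for zs
    using that piso_univ[OF assms(2)] piso_in_univ[OF assms(2)] unfolding tuples_def by auto
  have "holds (fo M) \<phi> (map h (xs @ ys)) \<longleftrightarrow> holds (fo M) \<phi> (xs @ ys)"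
    if "length xs = k" "length ys = k"
    by (rule holds_fo[OF assms(2)]) (use assms \<phi> that in auto)
  then show ?thesis using t[OF assms(3)] t[OF assms(4)] unfolding \<phi>(2) tuples_def by auto
qed

text \<open>A sort E does not carry its arity explicitly; the reflexive pair at a tuple reveals
  it.\<close>

lemma def_equiv_arity:
  assumes "def_equiv M k E" "def_equiv M k' E" "xs \<in> tuples (univ M) k"
  shows "k' = k"
proof -
  have "(xs, xs) \<in> E" using def_equivD(1)[OF assms(1)] assms(3) by (simp add: equiv_def refl_on_def)
  then show ?thesis using def_equivD(3)[OF assms(2)] assms(3) unfolding tuples_def by auto
qed

lemma def_equiv_class_eq:
  assumes "def_equiv M k E" "xs \<in> tuples (univ M) k" "ys \<in> tuples (univ M) k"
  shows "E `` {xs} = E `` {ys} \<longleftrightarrow> (xs, ys) \<in> E"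
  using eq_equiv_class_iff[OF def_equivD(1)[OF assms(1)] assms(2,3)] .


section \<open>Transport of imaginaries\<close>

abbreviation "N \<equiv> eq_struct M"

text \<open>The action of a partial isomorphism on imaginaries. It is a relation because only
  classes with a representative inside D can be moved; by \<open>transports_eq_iff\<close> the image
  does not depend on the representative.\<close>

definition transports :: "'a set \<Rightarrow> ('a \<Rightarrow> 'a) \<Rightarrow> 'a imag \<Rightarrow> 'a imag \<Rightarrow> bool" where
  "transports D h e e' \<longleftrightarrow> (\<exists>k E d. def_equiv M k E \<and> d \<in> tuples D k \<and>
     e = (E, E `` {d}) \<and> e' = (E, E `` {map h d}))"

lemma Univ_eq_iff: "e \<in> Univ N E \<longleftrightarrow> (\<exists>k d. def_equiv M k E \<and> d \<in> tuples (univ M) k \<and> e = (E, E `` {d}))"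
  by (auto simp: eq_struct_def quotient_def)

lemma total_eq_iff: "e \<in> total N \<longleftrightarrow> (\<exists>k E d. def_equiv M k E \<and> d \<in> tuples (univ M) k \<and> e = (E, E `` {d}))"
  by (simp add: total_def Univ_eq_iff) blast

lemma tuples_map: "piso D h \<Longrightarrow> d \<in> tuples D k \<Longrightarrow> map h d \<in> tuples (univ M) k \<and> map h d \<in> tuples (h ` D) k"
  using piso_in_univ[of D h] unfolding tuples_def by auto

lemma tuples_mono: "D \<subseteq> D' \<Longrightarrow> d \<in> tuples D k \<Longrightarrow> d \<in> tuples D' k"
  unfolding tuples_def by auto

lemma transports_Univ:
  assumes "piso D h" "transports D h e e'" shows "\<exists>E. e \<in> Univ N E \<and> e' \<in> Univ N E"
proof -
  obtain k E d where *: "def_equiv M k E" "d \<in> tuples D k" "e = (E, E `` {d})" "e' = (E, E `` {map h d})"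
    using assms(2) unfolding transports_def by blast
  have "d \<in> tuples (univ M) k" using tuples_mono[OF piso_univ[OF assms(1)] *(2)] .
  moreover have "map h d \<in> tuples (univ M) k" using tuples_map[OF assms(1) *(2)] by blast
  ultimately have "e \<in> Univ N E" "e' \<in> Univ N E" unfolding Univ_eq_iff using * by blast+
  then show ?thesis by blast
qed

lemma transports_total:
  assumes "piso D h" "transports D h e e'" shows "e \<in> total N \<and> e' \<in> total N"
proof -
  obtain E where "e \<in> Univ N E" "e' \<in> Univ N E" using transports_Univ[OF assms] by blast
  then show ?thesis unfolding total_def by blast
qed


text \<open>The equivalence relations are definable, hence invariant under partial isomorphisms.
  This gives well-definedness and injectivity of the action at once.\<close>

lemma transports_eq_iff:
  assumes "piso D h" "transports D h e e'" "transports D h f f'"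
  shows "e = f \<longleftrightarrow> e' = f'"
proof -
  obtain k E d where e: "def_equiv M k E" "d \<in> tuples D k" "e = (E, E `` {d})" "e' = (E, E `` {map h d})"
    using assms(2) unfolding transports_def by blast
  obtain l F c where f: "def_equiv M l F" "c \<in> tuples D l" "f = (F, F `` {c})" "f' = (F, F `` {map h c})"
    using assms(3) unfolding transports_def by blast
  have U: "d \<in> tuples (univ M) k" "c \<in> tuples (univ M) l" using e f tuples_mono[OF piso_univ[OF assms(1)]] by auto
  show ?thesis
  proof (cases "E = F")
    case True
    have l: "l = k" using def_equiv_arity[OF e(1) _ U(1)] f(1) True by simp
    have 1: "e = f \<longleftrightarrow> (d, c) \<in> E" using def_equiv_class_eq[OF e(1) U(1)] U(2) l True e f by simp
    have 2: "e' = f' \<longleftrightarrow> (map h d, map h c) \<in> E"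
      using def_equiv_class_eq[OF e(1)] tuples_map[OF assms(1) e(2)] tuples_map[OF assms(1) f(2)] l True e f by simp
    show ?thesis unfolding 1 2
      using def_equiv_inv[OF e(1) assms(1)] e(2) f(2) unfolding tuples_def by auto
  next
    case False then show ?thesis using e f by auto
  qed
qed

lemma transports_fun: "piso D h \<Longrightarrow> transports D h e e' \<Longrightarrow> transports D h e f' \<Longrightarrow> e' = f'"
  using transports_eq_iff by blast

lemma transports_mono:
  assumes "transports D h e e'" "D \<subseteq> D'" "\<forall>x\<in>D. h' x = h x" shows "transports D' h' e e'"
proof -
  obtain k E d where e: "def_equiv M k E" "d \<in> tuples D k" "e = (E, E `` {d})" "e' = (E, E `` {map h d})"
    using assms(1) unfolding transports_def by blast
  have "map h' d = map h d" using e(2) assms(3) unfolding tuples_def by auto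
  then show ?thesis unfolding transports_def using e tuples_mono[OF assms(2)] by metis
qed

lemma transports_inv:
  assumes "piso D h" "transports D h e e'" shows "transports (h ` D) (inv_into D h) e' e"
proof -
  obtain k E d where e: "def_equiv M k E" "d \<in> tuples D k" "e = (E, E `` {d})" "e' = (E, E `` {map h d})"
    using assms(2) unfolding transports_def by blast
  have "map (inv_into D h) (map h d) = d"
    using e(2) piso_inj[OF assms(1)] unfolding tuples_def by (auto intro!: map_idI simp: subset_iff)
  then show ?thesis unfolding transports_def using e tuples_map[OF assms(1) e(2)] by metis
qed

lemma transports_comp:
  assumes "piso D h" "piso D' k" "h ` D \<subseteq> D'" "transports D h e e'" "transports D' k e' e''"
  shows "transports D (\<lambda>x. k (h x)) e e''"
proof -
  obtain m E d where e: "def_equiv M m E" "d \<in> tuples D m" "e = (E, E `` {d})" "e' = (E, E `` {map h d})"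
    using assms(4) unfolding transports_def by blast
  have "map h d \<in> tuples D' m" using tuples_mono[OF assms(3)] tuples_map[OF assms(1) e(2)] by blast
  then have "transports D' k e' (E, E `` {map k (map h d)})" unfolding transports_def using e by blast
  then have "e'' = (E, E `` {map k (map h d)})" using transports_fun[OF assms(2,5)] by blast
  then show ?thesis unfolding transports_def using e(1-3)
    by (intro exI[of _ m] exI[of _ E] exI[of _ d]) (simp add: comp_def)
qed

lemma transports_exist:
  assumes "piso D h" "e \<in> total N"
  shows "\<exists>D' h' e'. piso D' h' \<and> D \<subseteq> D' \<and> (\<forall>x\<in>D. h' x = h x) \<and> transports D' h' e e'"
proof -
  obtain k E d where e: "def_equiv M k E" "d \<in> tuples (univ M) k" "e = (E, E `` {d})"
    using assms(2) unfolding total_eq_iff by blast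
  have fU: "finite (set d)" "set d \<subseteq> univ M" using e unfolding tuples_def by auto
  obtain D' h' where h: "piso D' h'" "D \<subseteq> D'" "set d \<subseteq> D'" "\<forall>y\<in>D. h' y = h y"
    using piso_extend[OF assms(1) fU] by blast
  then have "d \<in> tuples D' k" using e unfolding tuples_def by auto
  then have "transports D' h' e (E, E `` {map h' d})" unfolding transports_def using e by blast
  then show ?thesis using h by blast
qed

lemma transports_exist_list:
  assumes "piso D h" "set es \<subseteq> total N"
  shows "\<exists>D' h' es'. piso D' h' \<and> D \<subseteq> D' \<and> (\<forall>x\<in>D. h' x = h x) \<and> list_all2 (transports D' h') es es'"
  using assms(2)
proof (induction es)
  case Nil
  then show ?case using assms by blast
next
  case (Cons e es)
  then obtain D' h' es' where 1: "piso D' h'" "D \<subseteq> D'" "\<forall>x\<in>D. h' x = h x" "list_all2 (transports D' h') es es'"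
    by auto
  obtain D'' h'' e' where 2: "piso D'' h''" "D' \<subseteq> D''" "\<forall>x\<in>D'. h'' x = h' x" "transports D'' h'' e e'"
    using transports_exist[OF 1(1), of e] Cons.prems by auto
  have "list_all2 (transports D'' h'') es es'"
    using 1(4) by (rule list_all2_mono) (rule transports_mono[OF _ 2(2,3)])
  then show ?case using 1 2 by (intro exI[of _ D''] exI[of _ h''] exI[of _ "e' # es'"]) auto
qed

section \<open>Home elements as imaginaries, and invariance of formulas about imaginaries\<close>

lemma U_ne: "\<exists>x. x \<in> univ M" using K_ne pr_univ by auto

lemma def_equiv_home: "def_equiv M 1 (Id_on (tuples (univ M) 1))"
  unfolding def_equiv_def
proof (intro conjI exI)
  show "equiv (tuples (univ M) 1) (Id_on (tuples (univ M) 1))"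
    by (auto simp: equiv_def refl_on_def sym_on_def trans_on_def)
  show "fv (Eq 0 1 :: (unit, sym) fm) \<subseteq> {..<1 + 1}" by auto
  show "Id_on (tuples (univ M) 1) = {(xs, ys). xs \<in> tuples (univ M) 1 \<and> ys \<in> tuples (univ M) 1 \<and>
      holds (fo M) (Eq 0 1) (xs @ ys)}"
    by (auto simp: tuples_def holds_def length_Suc_conv)
qed simp

lemma home_class: "x \<in> univ M \<Longrightarrow> home M x = (Id_on (tuples (univ M) 1), Id_on (tuples (univ M) 1) `` {[x]})"
  unfolding home_def tuples_def by auto

lemma home_inj [simp]: "home M x = home M y \<longleftrightarrow> x = y" by (simp add: home_def)

lemma transports_home: assumes "piso D h" "x \<in> D" shows "transports D h (home M x) (home M (h x))"
proof -
  have "x \<in> univ M" "h x \<in> univ M" using piso_univ piso_in_univ assms by auto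
  then show ?thesis unfolding transports_def
    using def_equiv_home home_class assms
    by (intro exI[of _ 1] exI[of _ "Id_on (tuples (univ M) 1)"] exI[of _ "[x]"]) (auto simp: tuples_def)
qed

text \<open>The class of a home element is a singleton, so the only possible representative is
  \<open>[x]\<close> itself.\<close>

lemma transports_home_iff:
  assumes "piso D h" "transports D h (home M x) e'" shows "x \<in> D \<and> e' = home M (h x)"
proof -
  obtain k E d where e: "def_equiv M k E" "d \<in> tuples D k" "home M x = (E, E `` {d})" "e' = (E, E `` {map h d})"
    using assms(2) unfolding transports_def by blast
  have E: "E = Id_on (tuples (univ M) 1)" "{[x]} = E `` {d}" using e(3) unfolding home_def by auto
  have "[x] \<in> E `` {d}" using E(2) by blast
  then have "(d, [x]) \<in> E" by blast
  then have "(d, [x]) \<in> Id_on (tuples (univ M) 1)" unfolding E(1) .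
  then have "d = [x]" by blast
  then have "x \<in> D" using e(2) unfolding tuples_def by auto
  then show ?thesis using transports_fun[OF assms transports_home[OF assms(1)]] by blast
qed

lemma home_total: "x \<in> univ M \<Longrightarrow> home M x \<in> total N"
  using transports_total[OF _ transports_home[of "orb {x}" "\<lambda>x. x" x]] piso_id orb_gset[of "{x}"] orb_refl[of "{x}"] by auto

lemma transports_Interp:
  assumes p: "piso D h" and t: "list_all2 (transports D h) es es'" and e: "es \<in> Interp N r"
  shows "es' \<in> Interp N r"
proof (cases r)
  case (Base r')
  obtain xs where xs: "xs \<in> Interp (fo M) r'" "es = map (home M) xs"
    using e unfolding Base eq_struct_def by auto
  have "set xs \<subseteq> D \<and> es' = map (home M) (map h xs)"
    using t unfolding xs(2)
    by (induction xs arbitrary: es') (auto simp: list_all2_Cons1 dest: transports_home_iff[OF p])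
  moreover then have "map h xs \<in> Interp (fo M) r'" using piso_Interp[OF p] xs by blast
  ultimately show ?thesis unfolding Base eq_struct_def by (auto simp del: map_map)
next
  case (Proj E)
  obtain xs k where xs: "es = map (home M) xs @ [(E, E `` {xs})]" "def_equiv M k E" "xs \<in> tuples (univ M) k"
    using e unfolding Proj eq_struct_def by auto
  obtain fs f where f: "es' = fs @ [f]" "list_all2 (transports D h) (map (home M) xs) fs" "transports D h (E, E `` {xs}) f"
    using t unfolding xs(1) by (auto simp: list_all2_append1 list_all2_Cons1)
  have 1: "set xs \<subseteq> D \<and> fs = map (home M) (map h xs)"
    using f(2)
    by (induction xs arbitrary: fs) (auto simp: list_all2_Cons1 dest: transports_home_iff[OF p])
  then have d: "xs \<in> tuples D k" using xs(3) unfolding tuples_def by auto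
  then have "transports D h (E, E `` {xs}) (E, E `` {map h xs})" unfolding transports_def using xs(2) by blast
  then have "f = (E, E `` {map h xs})" using transports_fun[OF p f(3)] by blast
  moreover have "map h xs \<in> tuples (univ M) k" using tuples_map[OF p d] by blast
  ultimately show ?thesis unfolding Proj eq_struct_def f(1) using 1 xs(2) by (auto simp del: map_map)
qed

text \<open>As in \<open>sat_fo\<close>, except that a quantifier ranges over one sort. A
  transported element stays in its sort by \<open>transports_Univ\<close>, and the converse
  direction is the same argument for the inverse partial isomorphism.\<close>

lemma sat_eq:
  assumes "piso D h" "\<forall>i\<in>fv \<phi>. transports D h (\<sigma> i) (\<tau> i)"
  shows "sat N \<phi> \<sigma> \<longleftrightarrow> sat N \<phi> \<tau>"
  using assms
proof (induction \<phi> arbitrary: D h \<sigma> \<tau>)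
  case (Eq i j)
  then show ?case using transports_eq_iff[OF Eq(1), of "\<sigma> i" "\<tau> i" "\<sigma> j" "\<tau> j"] by auto
next
  case (Rel r js)
  have 1: "list_all2 (transports D h) (map \<sigma> js) (map \<tau> js)"
    using Rel(2) by (auto simp: list_all2_conv_all_nth)
  have 2: "list_all2 (transports (h ` D) (inv_into D h)) (map \<tau> js) (map \<sigma> js)"
    using Rel(2) transports_inv[OF Rel(1)] by (auto simp: list_all2_conv_all_nth)
  show ?case using transports_Interp[OF Rel(1) 1] transports_Interp[OF piso_inv[OF Rel(1)] 2] by auto
next
  case (Neg \<phi>)
  then show ?case by simp
next
  case (Conj \<phi> \<psi>)
  have "sat N \<phi> \<sigma> \<longleftrightarrow> sat N \<phi> \<tau>" by (rule Conj.IH(1)[OF Conj.prems(1)]) (use Conj.prems in auto)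
  moreover have "sat N \<psi> \<sigma> \<longleftrightarrow> sat N \<psi> \<tau>" by (rule Conj.IH(2)[OF Conj.prems(1)]) (use Conj.prems in auto)
  ultimately show ?case by simp
next
  case (Ex s i \<phi>)
  have *: "sat N (Ex s i \<phi>) \<tau>'"
    if p: "piso D h" and v: "\<forall>j\<in>fv \<phi> - {i}. transports D h (\<sigma>' j) (\<tau>' j)" and sat: "sat N (Ex s i \<phi>) \<sigma>'"
    for D h \<sigma>' \<tau>'
  proof -
    obtain x where x: "x \<in> Univ N s" "sat N \<phi> (\<sigma>'(i := x))" using sat by auto
    then have "x \<in> total N" unfolding total_def by blast
    then obtain D' h' x' where h': "piso D' h'" "D \<subseteq> D'" "\<forall>x\<in>D. h' x = h x" "transports D' h' x x'"
      using transports_exist[OF p] by blast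
    have "sat N \<phi> (\<sigma>'(i := x)) \<longleftrightarrow> sat N \<phi> (\<tau>'(i := x'))"
    proof (rule Ex.IH[OF h'(1)], intro ballI)
      fix j assume "j \<in> fv \<phi>"
      then show "transports D' h' ((\<sigma>'(i := x)) j) ((\<tau>'(i := x')) j)"
        using v h'(4) transports_mono[OF _ h'(2,3)] by auto
    qed
    moreover have "x' \<in> Univ N s"
    proof -
      obtain E where "x \<in> Univ N E" "x' \<in> Univ N E" using transports_Univ[OF h'(1,4)] by blast
      moreover then have "E = s" using x(1) Univ_eq_iff[of x E] Univ_eq_iff[of x s] by auto
      ultimately show ?thesis by simp
    qed
    ultimately show ?thesis using x by auto
  qed
  have "\<forall>j\<in>fv \<phi> - {i}. transports (h ` D) (inv_into D h) (\<tau> j) (\<sigma> j)"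
    using Ex.prems transports_inv by auto
  then show ?case using *[OF Ex.prems(1), of \<sigma> \<tau>] *[OF piso_inv[OF Ex.prems(1)], of \<tau> \<sigma>] Ex.prems(2)
    by (metis fv.simps(5))
qed

lemma holds_eq:
  assumes "piso D h" "list_all2 (transports D h) es es'" "fv \<phi> \<subseteq> {..<length es}"
  shows "holds N \<phi> es \<longleftrightarrow> holds N \<phi> es'"
  unfolding holds_def
  by (rule sat_eq[OF assms(1)]) (use assms(2,3) in \<open>auto simp: list_all2_conv_all_nth subset_iff\<close>)


section \<open>Supports\<close>

text \<open>Invariance under all partial isomorphisms over A whose domain contains a representative
  of e stands in for invariance under the automorphisms fixing A.\<close>

definition supports :: "'a set \<Rightarrow> 'a imag \<Rightarrow> bool" where
  "supports A e \<longleftrightarrow> e \<in> total N \<and> (\<forall>D h e'. piso D h \<and> A \<subseteq> D \<and> (\<forall>x\<in>A. h x = x) \<and> transports D h e e' \<longrightarrow> e' = e)"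

lemma supports_mono: "supports A e \<Longrightarrow> A \<subseteq> B \<Longrightarrow> supports B e"
  unfolding supports_def by (meson subset_trans subsetD)

lemma supportsD: "supports A e \<Longrightarrow> piso D h \<Longrightarrow> A \<subseteq> D \<Longrightarrow> \<forall>x\<in>A. h x = x \<Longrightarrow> transports D h e e' \<Longrightarrow> e' = e"
  unfolding supports_def by blast

lemma gsetD: "gset D \<Longrightarrow> finite D" "gset D \<Longrightarrow> D \<subseteq> univ M"
  unfolding gset_def by auto

text \<open>Composing an extension of h with the inverse of h' gives a partial isomorphism that
  fixes A, hence e. Some map thus carries both images back to e, and injectivity of the action
  identifies them.\<close>

lemma transports_unique:
  assumes s: "supports A e" and h: "piso D h" "A \<subseteq> D" "transports D h e e1"
    and h': "piso D' h'" "A \<subseteq> D'" "transports D' h' e e2" and eq: "\<forall>x\<in>A. h x = h' x"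
  shows "e1 = e2"
proof -
  obtain D1 h1 where h1: "piso D1 h1" "D \<subseteq> D1" "D' \<subseteq> D1" "\<forall>y\<in>D. h1 y = h y"
    using piso_extend[OF h(1) gsetD[OF piso_gset[OF h'(1)]]] by blast
  have t1: "transports D1 h1 e e1" using transports_mono[OF h(3) h1(2,4)] .
  obtain E k where k: "piso E k" "h' ` D' \<subseteq> E" "h1 ` D1 \<subseteq> E" "\<forall>y\<in>h' ` D'. k y = inv_into D' h' y"
    using piso_extend[OF piso_inv[OF h'(1)] gsetD[OF piso_image_gset[OF h1(1)]]] by blast
  have t2: "transports E k e2 e" using transports_mono[OF transports_inv[OF h'(1,3)] k(2,4)] .
  have e1: "e1 \<in> total N" using transports_total[OF h(1,3)] by blast
  obtain E' k' e3 where k': "piso E' k'" "E \<subseteq> E'" "\<forall>x\<in>E. k' x = k x" "transports E' k' e1 e3"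
    using transports_exist[OF k(1) e1] by blast
  have "transports D1 (\<lambda>x. k' (h1 x)) e e3"
    by (rule transports_comp[OF h1(1) k'(1) _ t1 k'(4)]) (use k k' in blast)
  moreover have "piso D1 (\<lambda>x. k' (h1 x))" by (rule piso_comp[OF h1(1) k'(1)]) (use k k' in blast)
  moreover have "\<forall>a\<in>A. k' (h1 a) = a"
  proof
    fix a assume a: "a \<in> A"
    then have "h1 a = h' a" using h1(4) h(2) eq by auto
    moreover have "h' a \<in> h' ` D'" using a h'(2) by auto
    ultimately have "k' (h1 a) = inv_into D' h' (h' a)" using k k' by auto
    then show "k' (h1 a) = a" using piso_inj[OF h'(1)] a h'(2) by auto
  qed
  ultimately have "e3 = e" using supportsD[OF s, of D1] h(2) h1(2) by blast
  then have "transports E' k' e1 e" "transports E' k' e2 e" using k'(4) transports_mono[OF t2 k'(2,3)] by auto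
  then show ?thesis using transports_eq_iff[OF k'(1)] by blast
qed

lemma supports_image:
  assumes s: "supports A e" and h: "piso D h" "A \<subseteq> D" "transports D h e e'"
  shows "supports (h ` A) e'"
  unfolding supports_def
proof (intro conjI allI impI)
  show "e' \<in> total N" using transports_total[OF h(1,3)] by blast
  fix E k e'' assume "piso E k \<and> h ` A \<subseteq> E \<and> (\<forall>x\<in>h ` A. k x = x) \<and> transports E k e' e''"
  then have k: "piso E k" "\<forall>x\<in>A. k (h x) = h x" "h ` A \<subseteq> E" "transports E k e' e''" by auto
  obtain E1 k1 where k1: "piso E1 k1" "E \<subseteq> E1" "h ` D \<subseteq> E1" "\<forall>y\<in>E. k1 y = k y"
    using piso_extend[OF k(1) gsetD[OF piso_image_gset[OF h(1)]]] by blast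
  have "transports D (\<lambda>x. k1 (h x)) e e''"
    by (rule transports_comp[OF h(1) k1(1) k1(3) h(3) transports_mono[OF k(4) k1(2,4)]])
  moreover have "piso D (\<lambda>x. k1 (h x))" by (rule piso_comp[OF h(1) k1(1,3)])
  moreover have "\<forall>x\<in>A. k1 (h x) = h x" using k k1 by auto
  ultimately show "e'' = e'"
    using transports_unique[OF s _ h(2) _ h(1,2,3)] by blast
qed

lemma supports_exists: assumes "e \<in> total N" shows "\<exists>A. gset A \<and> supports A e"
proof -
  obtain k E d where e: "def_equiv M k E" "d \<in> tuples (univ M) k" "e = (E, E `` {d})"
    using assms unfolding total_eq_iff by blast
  have g: "gset (orb (set d))" using e(2) orb_gset unfolding tuples_def by auto
  have "supports (orb (set d)) e" unfolding supports_def
  proof (intro conjI allI impI)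
    fix D h e' assume a: "piso D h \<and> orb (set d) \<subseteq> D \<and> (\<forall>x\<in>orb (set d). h x = x) \<and> transports D h e e'"
    have "d \<in> tuples D k" using e(2) a orb_refl unfolding tuples_def by auto
    then have "transports D h e (E, E `` {map h d})" unfolding transports_def using e by blast
    moreover have "map h d = d" using a orb_refl by (auto intro!: map_idI)
    ultimately show "e' = e" using transports_fun a e(3) by metis
  qed (use assms in blast)
  then show ?thesis using g by blast
qed

text \<open>The image of e when x is moved to y over A. By \<open>moves_fun\<close> it is determined
  as soon as A together with the orbit of x supports e.\<close>

definition moves :: "'a set \<Rightarrow> 'a \<Rightarrow> 'a \<Rightarrow> 'a imag \<Rightarrow> 'a imag \<Rightarrow> bool" where
  "moves A x y e e' \<longleftrightarrow> (\<exists>D h. piso D h \<and> A \<union> orb {x} \<subseteq> D \<and> (\<forall>z\<in>A. h z = z) \<and> h x = y \<and> transports D h e e')"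

lemma orb_single_refl [simp]: "x \<in> orb {x}" using orb_refl[of "{x}"] by auto

lemma moves_fun:
  assumes "supports (A \<union> orb {x}) e" "moves A x y e e'" "moves A x y e f'" shows "e' = f'"
proof -
  obtain D h where h: "piso D h" "A \<union> orb {x} \<subseteq> D" "\<forall>z\<in>A. h z = z" "h x = y" "transports D h e e'"
    using assms(2) unfolding moves_def by blast
  obtain D' h' where h': "piso D' h'" "A \<union> orb {x} \<subseteq> D'" "\<forall>z\<in>A. h' z = z" "h' x = y" "transports D' h' e f'"
    using assms(3) unfolding moves_def by blast
  have x: "x \<in> D" "x \<in> D'" using h(2) h'(2) by auto
  have "h z = h' z" if "z \<in> orb {x}" for z
  proof -
    obtain i where "z = (rot M ^^ i) x" using \<open>z \<in> orb {x}\<close> unfolding orb_def by auto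
    then show ?thesis using piso_rot_pow[OF h(1) x(1)] piso_rot_pow[OF h'(1) x(2)] h(4) h'(4) by metis
  qed
  then have "\<forall>z\<in>A \<union> orb {x}. h z = h' z" using h h' by auto
  then show ?thesis using transports_unique[OF assms(1) h(1,2,5) h'(1,2,5)] by blast
qed

lemma moves_mono:
  assumes "moves B x y e f" "A \<subseteq> B" shows "moves A x y e f"
proof -
  obtain D h where "piso D h" "B \<union> orb {x} \<subseteq> D" "\<forall>z\<in>B. h z = z" "h x = y" "transports D h e f"
    using assms(1) unfolding moves_def by blast
  then show ?thesis unfolding moves_def using assms(2) by (intro exI[of _ D] exI[of _ h]) auto
qed

lemma moves_refl: assumes "e \<in> total N" "gset A" "x \<in> univ M" shows "moves A x x e e"
proof -
  have "gset (A \<union> orb {x})" using assms gset_Un orb_gset by auto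
  then obtain D h e' where h: "piso D h" "A \<union> orb {x} \<subseteq> D" "\<forall>y\<in>A \<union> orb {x}. h y = y" "transports D h e e'"
    using transports_exist[OF piso_id assms(1)] by blast
  then have "transports D (\<lambda>x. x) e e"
    unfolding transports_def by auto
  then show ?thesis using h piso_id[OF piso_gset[OF h(1)]] unfolding moves_def by blast
qed

lemma moves_exist: assumes "e \<in> total N" "gset A" "cell A x y" shows "\<exists>e'. moves A x y e e'"
proof -
  obtain h where h: "piso (A \<union> orb {x}) h" "\<forall>z\<in>A. h z = z" "h x = y" using cell_piso[OF assms(2,3)] by blast
  obtain D' h' e' where "piso D' h'" "A \<union> orb {x} \<subseteq> D'" "\<forall>z\<in>A \<union> orb {x}. h' z = h z" "transports D' h' e e'"
    using transports_exist[OF h(1) assms(1)] by blast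
  then show ?thesis unfolding moves_def using h by (intro exI[of _ e'] exI[of _ D'] exI[of _ h']) auto
qed

text \<open>Moving the point \<open>x\<close> inside its cell over \<open>A\<close> induces an equivalence relation on that
  cell; since near pairs are all alike, one coincidence makes it trivial.\<close>

lemma supports_drop:
  assumes A: "gset A" and x: "x \<notin> A" and s: "supports (A \<union> orb {x}) e"
    and c: "cell A x y" and nr: "near A y y'" and m: "moves A x y e f" "moves A x y' e f"
  shows "supports A e"
proof -
  have xU: "x \<in> univ M" using cell_univ[OF c] by blast
  have eN: "e \<in> total N" using s unfolding supports_def by blast
  \<comment> \<open>\<open>near_iso\<close> carries the pair y, y' to the pair z, z' over A; the
    common image f of e is carried along and becomes a common image for z and z'.\<close>
  have i: "\<exists>f'. moves A x z e f' \<and> moves A x z' e f'" if z: "cell A x z" "near A z z'" for z z'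
  proof -
    have "cell A y z" using cell_trans[OF A cell_sym[OF c] z(1)] .
    then obtain k where k: "piso (A \<union> orb {y} \<union> orb {y'}) k" "\<forall>w\<in>A. k w = w" "k y = z" "k y' = z'"
      using near_iso[OF A nr z(2)] by blast
    obtain D h where h: "piso D h" "A \<union> orb {x} \<subseteq> D" "\<forall>z\<in>A. h z = z" "h x = y" "transports D h e f"
      using m unfolding moves_def by blast
    obtain D2 h2 where h2: "piso D2 h2" "A \<union> orb {x} \<subseteq> D2" "\<forall>z\<in>A. h2 z = z" "h2 x = y'" "transports D2 h2 e f"
      using m unfolding moves_def by blast
    have fin: "finite (h ` D \<union> h2 ` D2)" "h ` D \<union> h2 ` D2 \<subseteq> univ M"
      using piso_image_gset[OF h(1)] piso_image_gset[OF h2(1)] unfolding gset_def by auto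
    obtain E k1 where k1: "piso E k1" "A \<union> orb {y} \<union> orb {y'} \<subseteq> E" "h ` D \<union> h2 ` D2 \<subseteq> E"
      "\<forall>w\<in>A \<union> orb {y} \<union> orb {y'}. k1 w = k w"
      using piso_extend[OF k(1) fin] by blast
    have "f \<in> total N" using transports_total[OF h(1,5)] by blast
    then obtain E' k2 f' where k2: "piso E' k2" "E \<subseteq> E'" "\<forall>w\<in>E. k2 w = k1 w" "transports E' k2 f f'"
      using transports_exist[OF k1(1)] by blast
    have yE: "y \<in> E" "y' \<in> E" using k1(2) by auto
    have kA: "k2 w = w" if "w \<in> A" for w using k k1 k2 that by auto
    have ky: "k2 y = z" "k2 y' = z'" using k k1 k2 yE by auto
    have sub: "h ` D \<subseteq> E'" "h2 ` D2 \<subseteq> E'" using k1 k2 by auto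
    have "moves A x z e f'" unfolding moves_def
      by (intro exI[of _ D] exI[of _ "\<lambda>w. k2 (h w)"] conjI piso_comp[OF h(1) k2(1) sub(1)] h(2)
            transports_comp[OF h(1) k2(1) sub(1) h(5) k2(4)]) (use h kA ky in auto)
    moreover have "moves A x z' e f'" unfolding moves_def
      by (intro exI[of _ D2] exI[of _ "\<lambda>w. k2 (h2 w)"] conjI piso_comp[OF h2(1) k2(1) sub(2)] h2(2)
            transports_comp[OF h2(1) k2(1) sub(2) h2(5) k2(4)]) (use h2 kA ky in auto)
    ultimately show ?thesis by blast
  qed
  \<comment> \<open>Near points of the cell give equal images of e, so the property that moving x to
    z fixes e spreads from z = x through the whole cell.\<close>
  have P: "moves A x z e e" if "cell A x z" for z
  proof (rule cell_chain[OF A _ that, where P = "\<lambda>z. moves A x z e e"])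
    show "moves A x x e e" by (rule moves_refl[OF eN A xU])
    fix z z' assume "cell A x z" "near A z z'"
    then obtain f' where "moves A x z e f'" "moves A x z' e f'" using i by blast
    then show "moves A x z e e \<longleftrightarrow> moves A x z' e e" using moves_fun[OF s] by blast
  qed
  show ?thesis unfolding supports_def
  proof (intro conjI allI impI)
    show "e \<in> total N" by fact
    fix D h e' assume "piso D h \<and> A \<subseteq> D \<and> (\<forall>x\<in>A. h x = x) \<and> transports D h e e'"
    then have h: "piso D h" "A \<subseteq> D" "\<forall>x\<in>A. h x = x" "transports D h e e'" by auto
    obtain D' h' where h': "piso D' h'" "D \<subseteq> D'" "x \<in> D'" "\<forall>y\<in>D. h' y = h y" using piso_extend1[OF h(1) xU] by blast
    have fix_A: "\<forall>x\<in>A. h' x = x" using h h' by auto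
    have "cell A x (h' x)" by (rule piso_cell[OF h'(1) A _ fix_A h'(3) x]) (use h h' in auto)
    then have "moves A x (h' x) e e" by (rule P)
    moreover have "orb {x} \<subseteq> D'" using orb_subset[OF piso_gset[OF h'(1)], of "{x}"] h'(3) by auto
    then have "moves A x (h' x) e e'" unfolding moves_def
      using h' h fix_A transports_mono[OF h(4) h'(2,4)] by blast
    ultimately show "e' = e" using moves_fun[OF s] by blast
  qed
qed

text \<open>Let A be a support of least cardinality and B another support. A point x of A outside B
  could be moved to a near point while B and the other orbits of A stay fixed. This fixes e because
  B supports it, so by \<open>supports_drop\<close> the orbit of x could be removed from A, against
  minimality.\<close>

lemma least_support:
  assumes "e \<in> total N"
  shows "\<exists>A. gset A \<and> supports A e \<and> (\<forall>B. gset B \<and> supports B e \<longrightarrow> A \<subseteq> B)"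
proof -
  obtain A where A: "gset A" "supports A e" and min: "\<And>B. gset B \<Longrightarrow> supports B e \<Longrightarrow> card A \<le> card B"
    using ex_has_least_nat[of "\<lambda>A. gset A \<and> supports A e" _ card] supports_exists[OF assms] by metis
  have "A \<subseteq> B" if B: "gset B" "supports B e" for B
  proof
    fix x assume xA: "x \<in> A"
    show "x \<in> B"
    proof (rule ccontr)
      assume xB: "x \<notin> B"
      have xU: "x \<in> univ M" using xA A unfolding gset_def by auto
      define A0 where "A0 = A - orb {x}"
      have A0: "gset A0" unfolding A0_def by (rule gset_Diff_orb[OF A(1) xU])
      have AA: "A0 \<union> orb {x} = A" unfolding A0_def using orb_subset[OF A(1), of "{x}"] xA by auto
      have "x \<notin> A0" "A0 \<subseteq> A" unfolding A0_def by auto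
      then have "A0 \<subset> A" using xA by blast
      then have "card A0 < card A" using A(1) psubset_card_mono unfolding gset_def by blast
      then have ns: "\<not> supports A0 e" using min[OF A0] by auto
      have g: "gset (B \<union> A0)" using gset_Un[OF B(1) A0] .
      have xn: "x \<notin> B \<union> A0" using xB unfolding A0_def by auto
      obtain y where y: "cell (B \<union> A0) x y" "near (B \<union> A0) x y" using near_exists[OF g xU xn] by blast
      obtain f where f: "moves (B \<union> A0) x y e f" using moves_exist[OF assms g y(1)] by blast
      obtain D h where h: "piso D h" "B \<union> A0 \<union> orb {x} \<subseteq> D" "\<forall>z\<in>B \<union> A0. h z = z" "transports D h e f"
        using f unfolding moves_def by blast
      have "f = e" by (rule supportsD[OF B(2) h(1) _ _ h(4)]) (use h(2,3) in auto)
      then have m: "moves A0 x y e e" using moves_mono[OF f] by simp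
      have xA0: "x \<notin> A0" using xn by blast
      have "supports A0 e"
        by (rule supports_drop[OF A0 xA0 _ cell_refl[OF xU xA0] near_mono[OF y(2)] moves_refl[OF assms A0 xU] m])
           (use AA A(2) in auto)
      then show False using ns by blast
    qed
  qed
  then show ?thesis using A by blast
qed

definition support :: "'a imag \<Rightarrow> 'a set" where
  "support e = (THE A. gset A \<and> supports A e \<and> (\<forall>B. gset B \<and> supports B e \<longrightarrow> A \<subseteq> B))"

lemma supp_props:
  assumes "e \<in> total N"
  shows "gset (support e)" "supports (support e) e" "gset B \<Longrightarrow> supports B e \<Longrightarrow> support e \<subseteq> B"
proof -
  have "\<exists>!A. gset A \<and> supports A e \<and> (\<forall>B. gset B \<and> supports B e \<longrightarrow> A \<subseteq> B)"
    using least_support[OF assms] by (metis subset_antisym)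
  then have "gset (support e) \<and> supports (support e) e \<and> (\<forall>B. gset B \<and> supports B e \<longrightarrow> support e \<subseteq> B)"
    unfolding support_def by (rule theI')
  then show "gset (support e)" "supports (support e) e" "gset B \<Longrightarrow> supports B e \<Longrightarrow> support e \<subseteq> B" by blast+
qed

lemma supports_iff: "e \<in> total N \<Longrightarrow> gset B \<Longrightarrow> supports B e \<longleftrightarrow> support e \<subseteq> B"
  using supp_props supports_mono by blast

lemma supp_fix:
  assumes "piso D h" "support e \<subseteq> D" "\<forall>x\<in>support e. h x = x" "transports D h e e'" shows "e' = e"
  using supportsD[OF supp_props(2) assms(1,2,3,4)] transports_total[OF assms(1,4)] by blast

text \<open>One inclusion is \<open>supports_image\<close>, the other is the same for the inverse
  map.\<close>

lemma supp_transports: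
  assumes "piso D h" "support e \<subseteq> D" "transports D h e e'" shows "support e' = h ` support e"
proof -
  have eN: "e \<in> total N" "e' \<in> total N" using transports_total[OF assms(1,3)] by auto
  have p: "piso (support e) h" using piso_subset[OF assms(1) supp_props(1)[OF eN(1)] assms(2)] .
  have s1: "support e' \<subseteq> h ` support e"
    using supports_image[OF supp_props(2)[OF eN(1)] assms(1,2,3)] piso_image_gset[OF p] supp_props(3)[OF eN(2)] by blast
  have sub: "support e' \<subseteq> h ` D" using s1 assms(2) by auto
  have p': "piso (support e') (inv_into D h)"
    using piso_subset[OF piso_inv[OF assms(1)] supp_props(1)[OF eN(2)] sub] .
  have s2: "support e \<subseteq> inv_into D h ` support e'"
    using supports_image[OF supp_props(2)[OF eN(2)] piso_inv[OF assms(1)] sub transports_inv[OF assms(1,3)]]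
      piso_image_gset[OF p'] supp_props(3)[OF eN(1)] by blast
  have "h ` support e \<subseteq> support e'"
  proof
    fix y assume "y \<in> h ` support e"
    then obtain z where z: "z \<in> support e'" "y = h (inv_into D h z)" using s2 by auto
    then have "y = z" using sub f_inv_into_f[of z h D] by auto
    then show "y \<in> support e'" using z by simp
  qed
  then show ?thesis using s1 by blast
qed

text \<open>If x were outside the least support, moving x to a near point, which is different from
  x, would fix \<open>home M x\<close>.\<close>

lemma supp_home: assumes "x \<in> univ M" shows "support (home M x) = orb {x}"
proof -
  have g: "gset (orb {x})" using orb_gset assms by auto
  have hN: "home M x \<in> total N" using home_total assms by blast
  have "supports (orb {x}) (home M x)" unfolding supports_def
  proof (intro conjI allI impI)
    fix D h e' assume a: "piso D h \<and> orb {x} \<subseteq> D \<and> (\<forall>x\<in>orb {x}. h x = x) \<and> transports D h (home M x) e'"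
    then have "e' = home M (h x)" using transports_home_iff by blast
    moreover have "h x = x" using a by simp
    ultimately show "e' = home M x" by simp
  qed (rule hN)
  then have 1: "support (home M x) \<subseteq> orb {x}" using supp_props(3)[OF hN g] by blast
  have "x \<in> support (home M x)"
  proof (rule ccontr)
    assume a: "x \<notin> support (home M x)"
    obtain y where y: "cell (support (home M x)) x y" "near (support (home M x)) x y"
      using near_exists[OF supp_props(1)[OF hN] assms a] by blast
    obtain h where h: "piso (support (home M x) \<union> orb {x}) h" "\<forall>z\<in>support (home M x). h z = z" "h x = y"
      using cell_piso[OF supp_props(1)[OF hN] y(1)] by blast
    have "home M y = home M x"
      using supp_fix[OF h(1) _ h(2) transports_home[OF h(1), of x, unfolded h(3)]] by auto
    then show False using near_ne[OF y(2)] by simp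
  qed
  then show ?thesis using 1 orb_subset[OF supp_props(1)[OF hN], of "{x}"] by auto
qed

text \<open>Some x of the support lies outside A. Moving it to infinitely many pairwise near points,
  with the other orbits fixed, gives distinct images of e, since by \<open>supports_drop\<close> one
  repetition would remove the orbit of x from the support.\<close>

lemma infinite_conjugates:
  assumes A: "gset A" and e: "e \<in> total N" and n: "\<not> support e \<subseteq> A"
  shows "infinite {e'. \<exists>D h. piso D h \<and> A \<subseteq> D \<and> (\<forall>x\<in>A. h x = x) \<and> transports D h e e'}"
proof -
  obtain x where x: "x \<in> support e" "x \<notin> A" using n by blast
  have gS: "gset (support e)" using supp_props[OF e] by blast
  have xU: "x \<in> univ M" using x gS unfolding gset_def by auto
  define A0 where "A0 = A \<union> (support e - orb {x})"
  have A0: "gset A0" unfolding A0_def by (rule gset_Un[OF A gset_Diff_orb[OF gS xU]])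
  have xA: "x \<notin> A0" unfolding A0_def using x by auto
  have s: "supports (A0 \<union> orb {x}) e" by (rule supports_mono[OF supp_props(2)[OF e]]) (auto simp: A0_def)
  have ns: "\<not> supports A0 e" using supports_iff[OF e A0] x xA by auto
  obtain Y where "infinite Y \<and> (\<forall>y\<in>Y. cell A0 x y \<and> near A0 x y) \<and>
      (\<forall>y\<in>Y. \<forall>z\<in>Y. y \<noteq> z \<longrightarrow> near A0 y z \<or> near A0 z y)"
    using near_infinite[OF A0 xU xA] ..
  then have Y: "infinite Y" "\<And>y. y \<in> Y \<Longrightarrow> cell A0 x y"
      "\<And>y z. y \<in> Y \<Longrightarrow> z \<in> Y \<Longrightarrow> y \<noteq> z \<Longrightarrow> near A0 y z \<or> near A0 z y" by blast+
  define f where "f y = (SOME e'. moves A0 x y e e')" for y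
  have f: "moves A0 x y e (f y)" if "y \<in> Y" for y
    unfolding f_def using someI_ex[OF moves_exist[OF e A0 Y(2)[OF that]]] .
  have "inj_on f Y"
  proof (rule inj_onI, rule ccontr)
    fix y z assume yz: "y \<in> Y" "z \<in> Y" "f y = f z" "y \<noteq> z"
    then consider "near A0 y z" | "near A0 z y" using Y(3) by blast
    then have "supports A0 e"
    proof cases
      case 1
      show ?thesis by (rule supports_drop[OF A0 xA s Y(2)[OF yz(1)] 1 f[OF yz(1)]]) (use f[OF yz(2)] yz in simp)
    next
      case 2
      show ?thesis by (rule supports_drop[OF A0 xA s Y(2)[OF yz(2)] 2 f[OF yz(2)]]) (use f[OF yz(1)] yz in simp)
    qed
    then show False using ns by blast
  qed
  then have "infinite (f ` Y)" using Y(1) finite_image_iff by blast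
  moreover have "f ` Y \<subseteq> {e'. \<exists>D h. piso D h \<and> A \<subseteq> D \<and> (\<forall>x\<in>A. h x = x) \<and> transports D h e e'}"
  proof (rule image_subsetI)
    fix y assume "y \<in> Y"
    then have "moves A x y e (f y)" using moves_mono[OF f] unfolding A0_def by blast
    then show "f y \<in> {e'. \<exists>D h. piso D h \<and> A \<subseteq> D \<and> (\<forall>x\<in>A. h x = x) \<and> transports D h e e'}"
      unfolding moves_def by blast
  qed
  ultimately show ?thesis using infinite_super by blast
qed


section \<open>Definable relations in the imaginary structure\<close>

text \<open>Formulas are needed only up to their meaning. This predicate keeps track of their free
  variables without naming the formulas.\<close>

definition definable :: "nat set \<Rightarrow> ((nat \<Rightarrow> 'a imag) \<Rightarrow> bool) \<Rightarrow> bool" where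
  "definable V R \<longleftrightarrow> (\<exists>\<phi>. fv \<phi> \<subseteq> V \<and> (\<forall>\<sigma>. sat N \<phi> \<sigma> \<longleftrightarrow> R \<sigma>))"

lemma definable_mono: "definable V R \<Longrightarrow> V \<subseteq> W \<Longrightarrow> definable W R"
  unfolding definable_def by blast

lemma definable_conj: "definable V R \<Longrightarrow> definable V S \<Longrightarrow> definable V (\<lambda>\<sigma>. R \<sigma> \<and> S \<sigma>)"
  unfolding definable_def by (metis Un_subset_iff fv.simps(4) sat.simps(4))

lemma definable_neg: "definable V R \<Longrightarrow> definable V (\<lambda>\<sigma>. \<not> R \<sigma>)"
  unfolding definable_def by (metis fv.simps(3) sat.simps(3))

lemma definable_true: "definable V (\<lambda>\<sigma>. True)"
  unfolding definable_def
  by (rule exI[of _ "Neg (Ex undefined 0 (Neg (Eq 0 0)))"]) auto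

lemma definable_iff_const: "definable V R \<Longrightarrow> definable V (\<lambda>\<sigma>. b \<longleftrightarrow> R \<sigma>)"
  by (cases b) (use definable_neg in auto)

lemma definable_ball: assumes "finite F" "\<And>k. k \<in> F \<Longrightarrow> definable V (R k)" shows "definable V (\<lambda>\<sigma>. \<forall>k\<in>F. R k \<sigma>)"
  using assms
proof (induction F rule: finite_induct)
  case empty
  show ?case using definable_true by simp
next
  case (insert k F)
  have "definable V (\<lambda>\<sigma>. R k \<sigma> \<and> (\<forall>k\<in>F. R k \<sigma>))" by (rule definable_conj) (use insert in auto)
  then show ?case by simp
qed

abbreviation "home_sort \<equiv> Id_on (tuples (univ M) 1)"

lemma Univ_home: "Univ N home_sort = home M ` univ M"
proof (intro set_eqI iffI)
  fix e assume "e \<in> Univ N home_sort"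
  then obtain k d where d: "def_equiv M k home_sort" "d \<in> tuples (univ M) k" "e = (home_sort, home_sort `` {d})"
    unfolding Univ_eq_iff by blast
  have "k = 1" using def_equiv_arity[OF d(1) def_equiv_home d(2)] by simp
  then obtain x where "d = [x]" "x \<in> univ M" using d(2) unfolding tuples_def by (auto simp: length_Suc_conv)
  then show "e \<in> home M ` univ M" using d(3) home_class by auto
next
  fix e assume "e \<in> home M ` univ M"
  then obtain x where "x \<in> univ M" "e = home M x" by blast
  then show "e \<in> Univ N home_sort" unfolding Univ_eq_iff using def_equiv_home home_class
    by (intro exI[of _ 1] exI[of _ "[x]"]) (auto simp: tuples_def)
qed

lemma definable_ex:
  assumes "definable V R" shows "definable (V - {i}) (\<lambda>\<sigma>. \<exists>x\<in>univ M. R (\<sigma>(i := home M x)))"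
proof -
  obtain \<phi> where \<phi>: "fv \<phi> \<subseteq> V" "\<And>\<sigma>. sat N \<phi> \<sigma> \<longleftrightarrow> R \<sigma>" using assms unfolding definable_def by blast
  show ?thesis unfolding definable_def
    by (rule exI[of _ "Ex home_sort i \<phi>"]) (use \<phi> Univ_home in auto)
qed

lemma definable_ex_list:
  "definable V R \<Longrightarrow> definable (V - {m..<m + k}) (\<lambda>\<sigma>. \<exists>z. (\<forall>j<k. z j \<in> univ M) \<and>
     R (\<lambda>i. if m \<le> i \<and> i < m + k then home M (z (i - m)) else \<sigma> i))"
proof (induction k arbitrary: V R)
  case 0
  have "(\<lambda>i. if m \<le> i \<and> i < m then home M (z (i - m)) else \<sigma> i) = \<sigma>" for z \<sigma> by (rule ext) auto
  then show ?case using 0 by simp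
next
  case (Suc k)
  let ?R = "\<lambda>\<sigma>. \<exists>x\<in>univ M. R (\<sigma>(m + k := home M x))"
  have "definable (V - {m + k} - {m..<m + k}) (\<lambda>\<sigma>. \<exists>z. (\<forall>j<k. z j \<in> univ M) \<and>
     ?R (\<lambda>i. if m \<le> i \<and> i < m + k then home M (z (i - m)) else \<sigma> i))"
    by (rule Suc.IH[OF definable_ex[OF Suc.prems]])
  moreover have "V - {m + k} - {m..<m + k} = V - {m..<m + Suc k}" by auto
  moreover have "(\<exists>z. (\<forall>j<k. z j \<in> univ M) \<and>
       ?R (\<lambda>i. if m \<le> i \<and> i < m + k then home M (z (i - m)) else \<sigma> i)) \<longleftrightarrow>
     (\<exists>z. (\<forall>j<Suc k. z j \<in> univ M) \<and>
       R (\<lambda>i. if m \<le> i \<and> i < m + Suc k then home M (z (i - m)) else \<sigma> i))" (is "?l \<longleftrightarrow> ?r") for \<sigma>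
  proof
    assume ?l
    then obtain z x where z: "\<forall>j<k. z j \<in> univ M" "x \<in> univ M"
      "R ((\<lambda>i. if m \<le> i \<and> i < m + k then home M (z (i - m)) else \<sigma> i)(m + k := home M x))" by blast
    have "(\<lambda>i. if m \<le> i \<and> i < m + k then home M (z (i - m)) else \<sigma> i)(m + k := home M x) =
      (\<lambda>i. if m \<le> i \<and> i < m + Suc k then home M ((z(k := x)) (i - m)) else \<sigma> i)"
      by (auto simp: fun_eq_iff)
    then show ?r using z by (intro exI[of _ "z(k := x)"]) (auto simp: less_Suc_eq)
  next
    assume ?r
    then obtain z where z: "\<forall>j<Suc k. z j \<in> univ M"
      "R (\<lambda>i. if m \<le> i \<and> i < m + Suc k then home M (z (i - m)) else \<sigma> i)" by blast
    have "(\<lambda>i. if m \<le> i \<and> i < m + k then home M (z (i - m)) else \<sigma> i)(m + k := home M (z k)) =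
      (\<lambda>i. if m \<le> i \<and> i < m + Suc k then home M (z (i - m)) else \<sigma> i)"
      by (auto simp: fun_eq_iff)
    then show ?l using z by (intro exI[of _ z] conjI bexI[of _ "z k"]) auto
  qed
  ultimately show ?case by simp
qed

section \<open>Definability of the rotations and of the cyclic order on home elements\<close>

definition is_rot :: "nat \<Rightarrow> 'a imag \<Rightarrow> 'a imag \<Rightarrow> bool" where
  "is_rot q e f \<longleftrightarrow> (\<exists>y\<in>univ M. f = home M y \<and> e = home M ((rot M ^^ q) y))"

definition is_cyc :: "nat \<Rightarrow> 'a imag \<Rightarrow> 'a imag \<Rightarrow> 'a imag \<Rightarrow> bool" where
  "is_cyc q e f l \<longleftrightarrow> (\<exists>x\<in>univ M. \<exists>y\<in>univ M. \<exists>z\<in>univ M. e = home M x \<and> f = home M y \<and> l = home M z \<and>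
     cyc M x ((rot M ^^ q) y) z)"

lemma rot_pow_univ: "x \<in> univ M \<Longrightarrow> (rot M ^^ q) x \<in> univ M"
  by (induction q) (auto simp: rot_univ)

lemma Interp_Base: "Interp N (Base r) = map (home M) ` Interp (fo M) r"
  by (simp add: eq_struct_def)

lemma sat_rot: "sat N (Rel (Base g_sym) [i, j]) \<sigma> \<longleftrightarrow> (\<exists>x\<in>univ M. \<sigma> i = home M x \<and> \<sigma> j = home M (rot M x))"
proof
  assume "\<exists>x\<in>univ M. \<sigma> i = home M x \<and> \<sigma> j = home M (rot M x)"
  then obtain x where x: "x \<in> univ M" "\<sigma> i = home M x" "\<sigma> j = home M (rot M x)" by blast
  have 1: "[x, rot M x] \<in> Interp (fo M) g_sym" using x by (auto simp: fo_def rot_univ)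
  have 2: "map \<sigma> [i, j] = map (home M) [x, rot M x]" using x by simp
  show "sat N (Rel (Base g_sym) [i, j]) \<sigma>" unfolding sat.simps Interp_Base 2 using 1 by (rule imageI)
qed (auto simp: eq_struct_def fo_def)

lemma sat_cyc: "sat N (Rel (Base S_sym) [i, j, l]) \<sigma> \<longleftrightarrow> (\<exists>x\<in>univ M. \<exists>y\<in>univ M. \<exists>z\<in>univ M.
    \<sigma> i = home M x \<and> \<sigma> j = home M y \<and> \<sigma> l = home M z \<and> cyc M x y z)"
proof
  assume "\<exists>x\<in>univ M. \<exists>y\<in>univ M. \<exists>z\<in>univ M.
    \<sigma> i = home M x \<and> \<sigma> j = home M y \<and> \<sigma> l = home M z \<and> cyc M x y z"
  then obtain x y z where x: "x \<in> univ M" "y \<in> univ M" "z \<in> univ M"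
    "\<sigma> i = home M x" "\<sigma> j = home M y" "\<sigma> l = home M z" "cyc M x y z" by blast
  have 1: "[x, y, z] \<in> Interp (fo M) S_sym" using x by (auto simp: fo_def)
  have 2: "map \<sigma> [i, j, l] = map (home M) [x, y, z]" using x by simp
  show "sat N (Rel (Base S_sym) [i, j, l]) \<sigma>" unfolding sat.simps Interp_Base 2 using 1 by (rule imageI)
qed (auto simp: eq_struct_def fo_def)

lemma definable_is_rot: "definable {i, j} (\<lambda>\<sigma>. is_rot q (\<sigma> i) (\<sigma> j))"
proof (induction q arbitrary: i j)
  case 0
  \<comment> \<open>\<open>Suc (i + j)\<close> is a variable different from i and j. The quantifier
    over it says, even for q = 0, that the entries belong to the home sort.\<close>
  let ?k = "Suc (i + j)"
  have "definable ({i, j, ?k} - {?k}) (\<lambda>\<sigma>. \<exists>x\<in>univ M. (\<sigma>(?k := home M x)) ?k = (\<sigma>(?k := home M x)) i \<and>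
      (\<sigma>(?k := home M x)) ?k = (\<sigma>(?k := home M x)) j)"
    by (rule definable_ex, rule definable_conj; unfold definable_def)
       (rule exI[of _ "Eq ?k i"], simp, rule exI[of _ "Eq ?k j"], simp)
  moreover have "{i, j, ?k} - {?k} = {i, j}" by auto
  moreover have "(\<exists>x\<in>univ M. (\<sigma>(?k := home M x)) ?k = (\<sigma>(?k := home M x)) i \<and>
      (\<sigma>(?k := home M x)) ?k = (\<sigma>(?k := home M x)) j) \<longleftrightarrow> is_rot 0 (\<sigma> i) (\<sigma> j)" for \<sigma>
    unfolding is_rot_def by (simp add: eq_commute conj_commute)
  ultimately show ?case by simp
next
  case (Suc q)
  let ?k = "Suc (i + j)"
  have "definable ({i, j, ?k} - {?k}) (\<lambda>\<sigma>. \<exists>x\<in>univ M. is_rot q ((\<sigma>(?k := home M x)) ?k) ((\<sigma>(?k := home M x)) j) \<and>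
      sat N (Rel (Base g_sym) [?k, i]) (\<sigma>(?k := home M x)))"
    by (rule definable_ex, rule definable_conj, rule definable_mono[OF Suc.IH], simp, unfold definable_def)
       (rule exI[of _ "Rel (Base g_sym) [?k, i]"], simp)
  moreover have "{i, j, ?k} - {?k} = {i, j}" by auto
  moreover have "(\<exists>x\<in>univ M. is_rot q ((\<sigma>(?k := home M x)) ?k) ((\<sigma>(?k := home M x)) j) \<and>
      sat N (Rel (Base g_sym) [?k, i]) (\<sigma>(?k := home M x))) \<longleftrightarrow> is_rot (Suc q) (\<sigma> i) (\<sigma> j)" for \<sigma>
    unfolding sat_rot is_rot_def by (auto simp: rot_pow_univ)
  ultimately show ?case by simp
qed

lemma definable_is_cyc: "definable {i, j, l} (\<lambda>\<sigma>. is_cyc q (\<sigma> i) (\<sigma> j) (\<sigma> l))"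
proof -
  let ?k = "Suc (i + j + l)"
  have "definable ({i, j, l, ?k} - {?k}) (\<lambda>\<sigma>. \<exists>x\<in>univ M. is_rot q ((\<sigma>(?k := home M x)) ?k) ((\<sigma>(?k := home M x)) j) \<and>
      sat N (Rel (Base S_sym) [i, ?k, l]) (\<sigma>(?k := home M x)))"
    by (rule definable_ex, rule definable_conj, rule definable_mono[OF definable_is_rot], simp, unfold definable_def)
       (rule exI[of _ "Rel (Base S_sym) [i, ?k, l]"], simp)
  moreover have "{i, j, l, ?k} - {?k} = {i, j, l}" by auto
  moreover have "(\<exists>x\<in>univ M. is_rot q ((\<sigma>(?k := home M x)) ?k) ((\<sigma>(?k := home M x)) j) \<and>
      sat N (Rel (Base S_sym) [i, ?k, l]) (\<sigma>(?k := home M x))) \<longleftrightarrow> is_cyc q (\<sigma> i) (\<sigma> j) (\<sigma> l)" for \<sigma>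
    unfolding sat_cyc is_rot_def is_cyc_def by (auto simp: rot_pow_univ)
  ultimately show ?thesis by simp
qed

lemma is_rot_home [simp]: "y \<in> univ M \<Longrightarrow> is_rot q (home M x) (home M y) \<longleftrightarrow> x = (rot M ^^ q) y"
  unfolding is_rot_def by auto

lemma is_cyc_home [simp]: "x \<in> univ M \<Longrightarrow> y \<in> univ M \<Longrightarrow> z \<in> univ M \<Longrightarrow>
    is_cyc q (home M x) (home M y) (home M z) \<longleftrightarrow> cyc M x ((rot M ^^ q) y) z"
  unfolding is_cyc_def by auto

text \<open>The entries of \<open>es\<close> are given by representatives, which are stored in blocks of a common
  length \<open>L\<close> of one long tuple \<open>x\<close>; the formula says that there is a tuple with the same
  diagram as \<open>x\<close> whose blocks represent the entries.\<close>

lemma isolating_formula: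
  assumes "set es \<subseteq> total N"
  shows "\<exists>\<chi>. fv \<chi> \<subseteq> {..<length es} \<and> holds N \<chi> es \<and>
    (\<forall>es'. length es' = length es \<and> holds N \<chi> es' \<longrightarrow> (\<exists>D h. piso D h \<and> list_all2 (transports D h) es es'))"
proof -
  define m where "m = length es"
  have "\<forall>i<m. \<exists>p. def_equiv M (fst p) (fst (snd p)) \<and> snd (snd p) \<in> tuples (univ M) (fst p) \<and>
      es ! i = (fst (snd p), fst (snd p) `` {snd (snd p)})"
  proof (intro allI impI)
    fix i assume "i < m"
    then have "es ! i \<in> total N" using assms m_def by auto
    then obtain k E d where "def_equiv M k E" "d \<in> tuples (univ M) k" "es ! i = (E, E `` {d})"
      unfolding total_eq_iff by blast
    then show "\<exists>p. def_equiv M (fst p) (fst (snd p)) \<and> snd (snd p) \<in> tuples (univ M) (fst p) \<and>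
      es ! i = (fst (snd p), fst (snd p) `` {snd (snd p)})" by (intro exI[of _ "(k, E, d)"]) simp
  qed
  then obtain p where p: "\<forall>i<m. def_equiv M (fst (p i)) (fst (snd (p i))) \<and> snd (snd (p i)) \<in> tuples (univ M) (fst (p i)) \<and>
      es ! i = (fst (snd (p i)), fst (snd (p i)) `` {snd (snd (p i))})" by metis
  define ar where "ar i = fst (p i)" for i
  define E where "E i = fst (snd (p i))" for i
  define d where "d i = snd (snd (p i))" for i
  have rep: "def_equiv M (ar i) (E i)" "d i \<in> tuples (univ M) (ar i)" "es ! i = (E i, E i `` {d i})" if "i < m" for i
    using p that unfolding ar_def E_def d_def by auto
  have len: "length (d i) = ar i" "set (d i) \<subseteq> univ M" if "i < m" for i using rep(2)[OF that] unfolding tuples_def by auto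
  \<comment> \<open>The successor makes every block longer than the representative stored in it and
    keeps \<open>L\<close> positive, so that \<open>div\<close> and \<open>mod\<close> decode
    positions; the places left over are filled with \<open>u0\<close>.\<close>
  define L where "L = Suc (Max (insert 0 (ar ` {..<m})))"
  have arL: "ar i < L" if "i < m" for i
    unfolding L_def using that Max_ge[of "insert 0 (ar ` {..<m})" "ar i"] by (auto simp: less_Suc_eq_le)
  have L0: "0 < L" unfolding L_def by simp
  obtain u0 where u0: "u0 \<in> univ M" using U_ne by blast
  define x where "x j = (if j mod L < ar (j div L) then d (j div L) ! (j mod L) else u0)" for j
  have block: "j div L < m" if "j < m * L" for j using that L0 by (simp add: less_mult_imp_div_less)
  have xU: "x j \<in> univ M" if "j < m * L" for j
    unfolding x_def using block[OF that] len[of "j div L"] u0 by (auto dest: nth_mem)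
  have xd: "map x [i * L..<i * L + ar i] = d i" if "i < m" for i
  proof (rule nth_equalityI)
    show "length (map x [i * L..<i * L + ar i]) = length (d i)" using len that by simp
    fix j assume "j < length (map x [i * L..<i * L + ar i])"
    then have j: "j < ar i" by simp
    then have "j < L" using arL[OF that] by simp
    then have "(i * L + j) div L = i" "(i * L + j) mod L = j" by auto
    then show "map x [i * L..<i * L + ar i] ! j = d i ! j" using j by (simp add: x_def)
  qed
  have bound: "i * L + j < m * L" if "i < m" "j < ar i" for i j
  proof -
    have "i * L + j < Suc i * L" using that arL[of i] by simp
    also have "\<dots> \<le> m * L" using that by (intro mult_right_mono) auto
    finally show ?thesis .
  qed
  \<comment> \<open>Variables below m hold the entries of the tuple, the next \<open>m * L\<close>
    variables hold the home elements of the blocks.\<close>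
  let ?V = "{..<m + m * L}"
  let ?I = "{..<m * L}"
  \<comment> \<open>\<open>R1\<close> and \<open>R2\<close> state the diagram of x in the form that
    \<open>piso_of_diagram\<close> asks for; \<open>R3\<close> ties each block to the class that it
    represents.\<close>
  define R1 where "R1 \<sigma> \<longleftrightarrow> (\<forall>t\<in>?I \<times> ?I \<times> {..<n}. case t of (i, j, q) \<Rightarrow>
     x i = (rot M ^^ q) (x j) \<longleftrightarrow> is_rot q (\<sigma> (m + i)) (\<sigma> (m + j)))" for \<sigma> :: "nat \<Rightarrow> 'a imag"
  define R2 where "R2 \<sigma> \<longleftrightarrow> (\<forall>t\<in>?I \<times> ?I \<times> ?I \<times> {..<n}. case t of (i, j, l, q) \<Rightarrow>
     cyc M (x i) ((rot M ^^ q) (x j)) (x l) \<longleftrightarrow> is_cyc q (\<sigma> (m + i)) (\<sigma> (m + j)) (\<sigma> (m + l)))" for \<sigma> :: "nat \<Rightarrow> 'a imag"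
  define R3 where "R3 \<sigma> \<longleftrightarrow> (\<forall>i\<in>{..<m}. sat N (Rel (Proj (E i)) ([m + i * L..<m + i * L + ar i] @ [i])) \<sigma>)" for \<sigma>
  have d1: "definable ?V R1" unfolding R1_def
  proof (rule definable_ball)
    fix t assume "t \<in> ?I \<times> ?I \<times> {..<n}"
    then obtain i j q where t: "t = (i, j, q)" "i < m * L" "j < m * L" by auto
    show "definable ?V (\<lambda>\<sigma>. case t of (i, j, q) \<Rightarrow>
     x i = (rot M ^^ q) (x j) \<longleftrightarrow> is_rot q (\<sigma> (m + i)) (\<sigma> (m + j)))"
      unfolding t(1) prod.case
      by (rule definable_mono[OF definable_iff_const[OF definable_is_rot]]) (use t in auto)
  qed simp
  have d2: "definable ?V R2" unfolding R2_def
  proof (rule definable_ball)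
    fix t assume "t \<in> ?I \<times> ?I \<times> ?I \<times> {..<n}"
    then obtain i j l q where t: "t = (i, j, l, q)" "i < m * L" "j < m * L" "l < m * L" by auto
    show "definable ?V (\<lambda>\<sigma>. case t of (i, j, l, q) \<Rightarrow>
     cyc M (x i) ((rot M ^^ q) (x j)) (x l) \<longleftrightarrow> is_cyc q (\<sigma> (m + i)) (\<sigma> (m + j)) (\<sigma> (m + l)))"
      unfolding t(1) prod.case
      by (rule definable_mono[OF definable_iff_const[OF definable_is_cyc]]) (use t in auto)
  qed simp
  have d3: "definable ?V R3" unfolding R3_def
  proof (rule definable_ball)
    fix i assume i: "i \<in> {..<m}"
    have "{m + i * L..<m + i * L + ar i} \<union> {i} \<subseteq> ?V"
    proof
      fix w assume "w \<in> {m + i * L..<m + i * L + ar i} \<union> {i}"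
      then consider "w = i" | j where "w = m + (i * L + j)" "j < ar i"
        by (metis Un_iff add.assoc add_less_cancel_left atLeastLessThan_iff le_iff_add singletonD)
      then show "w \<in> ?V" using i bound[of i] by cases auto
    qed
    then show "definable ?V (sat N (Rel (Proj (E i)) ([m + i * L..<m + i * L + ar i] @ [i])))"
      unfolding definable_def by (intro exI[of _ "Rel (Proj (E i)) ([m + i * L..<m + i * L + ar i] @ [i])"]) auto
  qed simp
  have "definable ?V (\<lambda>\<sigma>. R1 \<sigma> \<and> R2 \<sigma> \<and> R3 \<sigma>)" by (intro definable_conj d1 d2 d3)
  from definable_ex_list[OF this, of m "m * L"]
  have "definable {..<m} (\<lambda>\<sigma>. \<exists>z. (\<forall>j<m * L. z j \<in> univ M) \<and>
     (let \<sigma>' = (\<lambda>i. if m \<le> i \<and> i < m + m * L then home M (z (i - m)) else \<sigma> i) in R1 \<sigma>' \<and> R2 \<sigma>' \<and> R3 \<sigma>'))"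
    unfolding Let_def by (rule definable_mono) auto
  then obtain \<chi> where fv: "fv \<chi> \<subseteq> {..<m}" and \<chi>: "\<And>\<sigma>. sat N \<chi> \<sigma> \<longleftrightarrow> (\<exists>z. (\<forall>j<m * L. z j \<in> univ M) \<and>
     (let \<sigma>' = (\<lambda>i. if m \<le> i \<and> i < m + m * L then home M (z (i - m)) else \<sigma> i) in R1 \<sigma>' \<and> R2 \<sigma>' \<and> R3 \<sigma>'))"
    unfolding definable_def by blast
  have R12: "R1 (\<lambda>i. if m \<le> i \<and> i < m + m * L then home M (z (i - m)) else \<sigma> i) \<longleftrightarrow>
       (\<forall>i<m * L. \<forall>j<m * L. \<forall>q<n. x i = (rot M ^^ q) (x j) \<longleftrightarrow> z i = (rot M ^^ q) (z j))"
      "R2 (\<lambda>i. if m \<le> i \<and> i < m + m * L then home M (z (i - m)) else \<sigma> i) \<longleftrightarrow>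
       (\<forall>i<m * L. \<forall>j<m * L. \<forall>l<m * L. \<forall>q<n.
          cyc M (x i) ((rot M ^^ q) (x j)) (x l) \<longleftrightarrow> cyc M (z i) ((rot M ^^ q) (z j)) (z l))"
    if "\<forall>j<m * L. z j \<in> univ M" for z \<sigma>
    unfolding R1_def R2_def using that by (auto simp: Ball_def)
  have R3: "R3 (\<lambda>i. if m \<le> i \<and> i < m + m * L then home M (z (i - m)) else \<sigma> i) \<longleftrightarrow>
       (\<forall>i<m. \<sigma> i = (E i, E i `` {map z [i * L..<i * L + ar i]}))"
    if z: "\<forall>j<m * L. z j \<in> univ M" for z \<sigma>
  proof -
    let ?\<sigma> = "\<lambda>i. if m \<le> i \<and> i < m + m * L then home M (z (i - m)) else \<sigma> i"
    have "sat N (Rel (Proj (E i)) ([m + i * L..<m + i * L + ar i] @ [i])) ?\<sigma> \<longleftrightarrow>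
        \<sigma> i = (E i, E i `` {map z [i * L..<i * L + ar i]})" if i: "i < m" for i
    proof -
      let ?zs = "map z [i * L..<i * L + ar i]"
      have "map ?\<sigma> [m + i * L..<m + i * L + ar i] = map (home M) ?zs"
      proof (rule nth_equalityI)
        fix j assume "j < length (map ?\<sigma> [m + i * L..<m + i * L + ar i])"
        then have "j < ar i" by simp
        then show "map ?\<sigma> [m + i * L..<m + i * L + ar i] ! j = map (home M) ?zs ! j"
          using bound[OF i] by simp
      qed simp
      then have e1: "map ?\<sigma> ([m + i * L..<m + i * L + ar i] @ [i]) = map (home M) ?zs @ [\<sigma> i]"
        using i by simp
      have zt: "?zs \<in> tuples (univ M) (ar i)"
      proof -
        have "z j \<in> univ M" if "j \<in> set [i * L..<i * L + ar i]" for j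
          using that z bound[OF i, of "j - i * L"] by auto
        then show ?thesis unfolding tuples_def by auto
      qed
      have inj: "map (home M) xs = map (home M) ys \<longleftrightarrow> xs = ys" for xs ys
        by (rule inj_map_eq_map) (simp add: inj_def)
      have "sat N (Rel (Proj (E i)) ([m + i * L..<m + i * L + ar i] @ [i])) ?\<sigma> \<longleftrightarrow>
          map (home M) ?zs @ [\<sigma> i] \<in> Interp N (Proj (E i))"
        using e1 by (simp only: sat.simps)
      also have "\<dots> \<longleftrightarrow> (\<exists>xs k. map (home M) ?zs @ [\<sigma> i] = map (home M) xs @ [(E i, E i `` {xs})] \<and>
          def_equiv M k (E i) \<and> xs \<in> tuples (univ M) k)"
        by (auto simp: eq_struct_def simp del: map_map)
      also have "\<dots> \<longleftrightarrow> \<sigma> i = (E i, E i `` {?zs})"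
        using rep(1)[OF i] zt inj by (auto simp del: map_map)
      finally show ?thesis .
    qed
    then have "R3 ?\<sigma> \<longleftrightarrow> (\<forall>i\<in>{..<m}. \<sigma> i = (E i, E i `` {map z [i * L..<i * L + ar i]}))"
      unfolding R3_def by (intro ball_cong[OF refl]) (simp only: lessThan_iff)
    then show ?thesis by (simp only: Ball_def lessThan_iff)
  qed
  have "holds N \<chi> es" unfolding holds_def \<chi> Let_def
  proof (intro exI[of _ x] conjI)
    show "\<forall>j<m * L. x j \<in> univ M" using xU by blast
    show "R1 (\<lambda>i. if m \<le> i \<and> i < m + m * L then home M (x (i - m)) else es ! i)" using R12(1)[of x] xU by simp
    show "R2 (\<lambda>i. if m \<le> i \<and> i < m + m * L then home M (x (i - m)) else es ! i)" using R12(2)[of x] xU by simp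
    show "R3 (\<lambda>i. if m \<le> i \<and> i < m + m * L then home M (x (i - m)) else es ! i)" using R3[of x] xU xd rep(3) by simp
  qed
  moreover have "\<exists>D h. piso D h \<and> list_all2 (transports D h) es es'" if l: "length es' = length es" "holds N \<chi> es'" for es'
  proof -
    obtain z where z: "\<forall>j<m * L. z j \<in> univ M"
      and r: "R1 (\<lambda>i. if m \<le> i \<and> i < m + m * L then home M (z (i - m)) else es' ! i)"
        "R2 (\<lambda>i. if m \<le> i \<and> i < m + m * L then home M (z (i - m)) else es' ! i)"
        "R3 (\<lambda>i. if m \<le> i \<and> i < m + m * L then home M (z (i - m)) else es' ! i)"
      using l(2) unfolding holds_def \<chi> Let_def by blast
    have "\<exists>h. piso (orb (x ` ?I)) h \<and> (\<forall>i\<in>?I. h (x i) = z i)"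
      by (rule piso_of_diagram) (use z xU r(1)[unfolded R12(1)[OF z]] r(2)[unfolded R12(2)[OF z]] in auto)
    then obtain h where h: "piso (orb (x ` ?I)) h" "\<forall>i\<in>?I. h (x i) = z i" by blast
    have "list_all2 (transports (orb (x ` ?I)) h) es es'"
      unfolding list_all2_conv_all_nth
    proof (intro conjI allI impI)
      show "length es = length es'" using l by simp
      fix i assume "i < length es"
      then have i: "i < m" using m_def by simp
      have js: "j \<in> ?I" if "j \<in> set [i * L..<i * L + ar i]" for j
        using that bound[OF i, of "j - i * L"] by auto
      have "map h (d i) = map z [i * L..<i * L + ar i]"
        unfolding xd[OF i, symmetric] map_map using h(2) js by (intro map_cong) auto
      moreover have "d i \<in> tuples (orb (x ` ?I)) (ar i)"
      proof -
        have "set (map x [i * L..<i * L + ar i]) \<subseteq> x ` ?I" using js by auto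
        then show ?thesis using len(1)[OF i] orb_refl[of "x ` ?I"] unfolding xd[OF i] tuples_def by auto
      qed
      moreover have "es' ! i = (E i, E i `` {map z [i * L..<i * L + ar i]})" using r(3)[unfolded R3[OF z]] i by blast
      ultimately show "transports (orb (x ` ?I)) h (es ! i) (es' ! i)"
        unfolding transports_def using rep[OF i] by metis
    qed
    then show ?thesis using h by blast
  qed
  ultimately show ?thesis using fv m_def by blast
qed


text \<open>An elementary map preserves the isolating formula of a tuple, so on each finite tuple it
  agrees with a partial isomorphism.\<close>

lemma elementary_transports:
  assumes "elementary_on N A k" "set es \<subseteq> A" "set es \<subseteq> total N"
  shows "\<exists>D h. piso D h \<and> list_all2 (transports D h) es (map k es)"
proof -
  obtain \<chi> where \<chi>: "fv \<chi> \<subseteq> {..<length es}" "holds N \<chi> es"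
    "\<forall>es'. length es' = length es \<and> holds N \<chi> es' \<longrightarrow> (\<exists>D h. piso D h \<and> list_all2 (transports D h) es es')"
    using isolating_formula[OF assms(3)] by blast
  have "holds N \<chi> (map k es)" using assms(1,2) \<chi>(1,2) unfolding elementary_on_def by blast
  then show ?thesis using \<chi>(3) by simp
qed

lemma same_type_transports:
  assumes "same_type N {} es es'" "set es \<subseteq> total N"
  shows "\<exists>D h. piso D h \<and> list_all2 (transports D h) es es'"
proof -
  obtain \<chi> where \<chi>: "fv \<chi> \<subseteq> {..<length es}" "holds N \<chi> es"
    "\<forall>es'. length es' = length es \<and> holds N \<chi> es' \<longrightarrow> (\<exists>D h. piso D h \<and> list_all2 (transports D h) es es')"
    using isolating_formula[OF assms(2)] by blast
  have l: "length es = length es'" and h: "\<And>\<phi> cs. set cs \<subseteq> {} \<and> fv \<phi> \<subseteq> {..<length es + length cs} \<Longrightarrow>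
        holds N \<phi> (es @ cs) \<longleftrightarrow> holds N \<phi> (es' @ cs)"
    using assms(1) unfolding same_type_def by blast+
  have "holds N \<chi> es'" using h[of "[]" \<chi>] \<chi>(1,2) by simp
  then show ?thesis using \<chi>(3) l by simp
qed

lemma transports_same_type:
  assumes "piso D h" "list_all2 (transports D h) es es'"
  shows "same_type N {} es es'"
  unfolding same_type_def
  using holds_eq[OF assms] list_all2_lengthD[OF assms(2)] by auto

lemma transports_total_list:
  assumes "piso D h" "list_all2 (transports D h) es es'"
  shows "set es \<subseteq> total N" "set es' \<subseteq> total N"
  using assms(2)
proof (induction rule: list_all2_induct)
  case (Cons e es e' es')
  { case 1 show ?case using Cons transports_total[OF assms(1)] by auto }
  { case 2 show ?case using Cons transports_total[OF assms(1)] by auto }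
qed auto

text \<open>Parameters supported by the fixed set A are carried to themselves, once the domain is
  enlarged to contain representatives of them.\<close>

lemma transports_append_fixed:
  assumes h: "piso D h" and es: "list_all2 (transports D h) es es'"
    and A: "A \<subseteq> D" "\<forall>x\<in>A. h x = x" and cs: "set cs \<subseteq> total N" "\<And>c. c \<in> set cs \<Longrightarrow> support c \<subseteq> A"
  shows "\<exists>D' h'. piso D' h' \<and> D \<subseteq> D' \<and> (\<forall>x\<in>D. h' x = h x) \<and> list_all2 (transports D' h') (es @ cs) (es' @ cs)"
proof -
  obtain D' h' cs' where h': "piso D' h'" "D \<subseteq> D'" "\<forall>x\<in>D. h' x = h x" "list_all2 (transports D' h') cs cs'"
    using transports_exist_list[OF h cs(1)] by blast
  have "cs' = cs"
  proof (rule nth_equalityI)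
    show "length cs' = length cs" using h'(4) list_all2_lengthD by metis
    fix i assume "i < length cs'"
    then have i: "i < length cs" using h'(4) list_all2_lengthD by metis
    then have t: "transports D' h' (cs ! i) (cs' ! i)" using h'(4) list_all2_nthD by blast
    have "support (cs ! i) \<subseteq> A" using cs(2) i by simp
    moreover have "h' x = x" "x \<in> D'" if "x \<in> A" for x using that A h'(2,3) by auto
    ultimately show "cs' ! i = cs ! i" by (intro supp_fix[OF h'(1) _ _ t]) blast+
  qed
  moreover have "list_all2 (transports D' h') es es'"
    using es by (rule list_all2_mono) (rule transports_mono[OF _ h'(2,3)])
  ultimately show ?thesis using h' by (intro exI[of _ D'] exI[of _ h']) (auto intro: list_all2_appendI)
qed


section \<open>Algebraic closure\<close>

lemma gset_UN: assumes "finite I" "\<And>i. i \<in> I \<Longrightarrow> gset (F i)" shows "gset (\<Union>i\<in>I. F i)"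
  using assms by (induction I rule: finite_induct) (auto intro!: gset_Un)

text \<open>If the supports of the parameters do not cover that of e,
  \<open>infinite_conjugates\<close> produces infinitely many solutions of any formula that e
  satisfies. If they do, the isolating formula of e with suitable parameters is algebraic, since a
  solution is determined by a map of a finite set to itself.\<close>

lemma acl_eq_supp:
  assumes "Y \<subseteq> total N"
  shows "acl N Y = {e \<in> total N. support e \<subseteq> (\<Union>y\<in>Y. support y)}"
proof (intro set_eqI iffI)
  fix e assume "e \<in> acl N Y"
  then obtain \<phi> cs where eN: "e \<in> total N" and cs: "set cs \<subseteq> Y" and fv: "fv \<phi> \<subseteq> {..<Suc (length cs)}"
    and h: "holds N \<phi> (e # cs)" and fin: "finite {x \<in> total N. holds N \<phi> (x # cs)}"
    unfolding acl_def by blast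
  define A where "A = (\<Union>c\<in>set cs. support c)"
  have csN: "set cs \<subseteq> total N" using cs assms by auto
  have gc: "gset (support c)" if "c \<in> set cs" for c using supp_props csN that by blast
  have A: "gset A" unfolding A_def by (rule gset_UN) (use gc in auto)
  have "support e \<subseteq> A"
  proof (rule ccontr)
    assume "\<not> support e \<subseteq> A"
    from infinite_conjugates[OF A eN this]
    have inf: "infinite {e'. \<exists>D h. piso D h \<and> A \<subseteq> D \<and> (\<forall>x\<in>A. h x = x) \<and> transports D h e e'}" .
    have "{e'. \<exists>D h. piso D h \<and> A \<subseteq> D \<and> (\<forall>x\<in>A. h x = x) \<and> transports D h e e'} \<subseteq> {x \<in> total N. holds N \<phi> (x # cs)}"
    proof
      fix e' assume "e' \<in> {e'. \<exists>D h. piso D h \<and> A \<subseteq> D \<and> (\<forall>x\<in>A. h x = x) \<and> transports D h e e'}"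
      then obtain D h where dh: "piso D h" "A \<subseteq> D" "\<forall>x\<in>A. h x = x" "transports D h e e'" by blast
      have "\<exists>D' h'. piso D' h' \<and> D \<subseteq> D' \<and> (\<forall>x\<in>D. h' x = h x) \<and> list_all2 (transports D' h') ([e] @ cs) ([e'] @ cs)"
        by (rule transports_append_fixed[OF dh(1) _ dh(2,3) csN]) (use dh(4) in \<open>auto simp: A_def\<close>)
      then obtain D' h' where "piso D' h'" "list_all2 (transports D' h') (e # cs) (e' # cs)" by auto
      then have "holds N \<phi> (e # cs) \<longleftrightarrow> holds N \<phi> (e' # cs)" by (rule holds_eq) (use fv in simp)
      then show "e' \<in> {x \<in> total N. holds N \<phi> (x # cs)}" using h transports_total[OF dh(1,4)] by simp
    qed
    then show False using inf fin finite_subset by blast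
  qed
  then show "e \<in> {e \<in> total N. support e \<subseteq> (\<Union>y\<in>Y. support y)}" using eN cs unfolding A_def by blast
next
  fix e assume "e \<in> {e \<in> total N. support e \<subseteq> (\<Union>y\<in>Y. support y)}"
  then have eN: "e \<in> total N" and sub: "support e \<subseteq> (\<Union>y\<in>Y. support y)" by auto
  have fS: "finite (support e)" using supp_props(1)[OF eN] gsetD by blast
  have "\<forall>x\<in>support e. \<exists>y\<in>Y. x \<in> support y" using sub by blast
  \<comment> \<open>One parameter is chosen for each point of the support of e, so finitely many
    elements of Y suffice.\<close>
  then obtain w where w: "\<forall>x\<in>support e. w x \<in> Y \<and> x \<in> support (w x)" by metis
  obtain cs where cs: "set cs = w ` support e" using finite_list[OF finite_imageI[OF fS, of w]] ..
  have csY: "set cs \<subseteq> Y" using cs w by auto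
  define A where "A = (\<Union>c\<in>set cs. support c)"
  have SA: "support e \<subseteq> A" unfolding A_def cs using w by auto
  have csN: "set cs \<subseteq> total N" using csY assms by auto
  have gc: "gset (support c)" if "c \<in> set cs" for c using supp_props csN that by blast
  have A: "gset A" unfolding A_def by (rule gset_UN) (use gc in auto)
  have "set (e # cs) \<subseteq> total N" using eN csN by simp
  from isolating_formula[OF this] obtain \<chi> where \<chi>: "fv \<chi> \<subseteq> {..<length (e # cs)}" "holds N \<chi> (e # cs)"
    "\<forall>es'. length es' = length (e # cs) \<and> holds N \<chi> es' \<longrightarrow> (\<exists>D h. piso D h \<and> list_all2 (transports D h) (e # cs) es')"
    by blast
  let ?G = "{x \<in> total N. holds N \<chi> (x # cs)}"
  \<comment> \<open>A partial isomorphism that fixes a parameter maps its support onto itself, hence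
    A into A; the image of e depends only on the restriction to A.\<close>
  have "\<forall>e'\<in>?G. \<exists>h. (\<exists>D. piso D h \<and> A \<subseteq> D \<and> transports D h e e') \<and> h ` A \<subseteq> A"
  proof
    fix e' assume "e' \<in> ?G"
    then have "length (e' # cs) = length (e # cs) \<and> holds N \<chi> (e' # cs)" by simp
    then have "\<exists>D h. piso D h \<and> list_all2 (transports D h) (e # cs) (e' # cs)"
      using \<chi>(3) by blast
    then obtain D0 h0 where h0: "piso D0 h0" "list_all2 (transports D0 h0) (e # cs) (e' # cs)" by blast
    obtain D h where h: "piso D h" "D0 \<subseteq> D" "A \<subseteq> D" "\<forall>y\<in>D0. h y = h0 y"
      using piso_extend[OF h0(1) gsetD[OF A]] by blast
    have t: "list_all2 (transports D h) (e # cs) (e' # cs)"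
      using h0(2) by (rule list_all2_mono) (rule transports_mono[OF _ h(2,4)])
    have "h ` support c \<subseteq> A" if c: "c \<in> set cs" for c
    proof -
      have "list_all2 (transports D h) cs cs" using t by simp
      then have "transports D h c c" using c by (auto simp: in_set_conv_nth list_all2_conv_all_nth)
      moreover have "support c \<subseteq> A" using c A_def by auto
      ultimately show ?thesis using supp_transports[OF h(1), of c c] h(3) by auto
    qed
    then have "h ` A \<subseteq> A" unfolding A_def by blast
    moreover have "transports D h e e'" using t by simp
    ultimately show "\<exists>h. (\<exists>D. piso D h \<and> A \<subseteq> D \<and> transports D h e e') \<and> h ` A \<subseteq> A" using h by blast
  qed
  then have "\<exists>H. \<forall>e'\<in>?G. (\<exists>D. piso D (H e') \<and> A \<subseteq> D \<and> transports D (H e') e e') \<and> H e' ` A \<subseteq> A"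
    by (rule bchoice)
  then obtain H where H: "\<And>e'. e' \<in> ?G \<Longrightarrow> (\<exists>D. piso D (H e') \<and> A \<subseteq> D \<and> transports D (H e') e e') \<and> H e' ` A \<subseteq> A" by blast
  have "inj_on (\<lambda>e'. restrict (H e') A) ?G"
  proof (rule inj_onI)
    fix f g assume fg: "f \<in> ?G" "g \<in> ?G" "restrict (H f) A = restrict (H g) A"
    obtain D where D: "piso D (H f)" "A \<subseteq> D" "transports D (H f) e f" using H[OF fg(1)] by blast
    obtain D' where D': "piso D' (H g)" "A \<subseteq> D'" "transports D' (H g) e g" using H[OF fg(2)] by blast
    have "\<forall>x\<in>A. H f x = H g x" using fg(3) by (metis restrict_apply')
    then show "f = g" using transports_unique[OF supports_mono[OF supp_props(2)[OF eN] SA] D D'] by blast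
  qed
  moreover have "(\<lambda>e'. restrict (H e') A) ` ?G \<subseteq> A \<rightarrow>\<^sub>E A" using H by fastforce
  moreover have "finite (A \<rightarrow>\<^sub>E A)" using gsetD(1)[OF A] by (intro finite_PiE) auto
  ultimately have "finite ?G" using inj_on_finite by blast
  then show "e \<in> acl N Y" unfolding acl_def using eN csY \<chi>(1,2)
    by (intro CollectI conjI exI[of _ \<chi>] exI[of _ cs]) auto
qed

text \<open>For a set A of home elements this is their algebraic closure among the imaginaries, in
  the form given by \<open>acl_eq_supp\<close>.\<close>

definition cl :: "'a set \<Rightarrow> 'a imag set" where
  "cl A = {e \<in> total N. support e \<subseteq> orb A}"

lemma cl_home: "A \<subseteq> univ M \<Longrightarrow> x \<in> A \<Longrightarrow> home M x \<in> cl A"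
  unfolding cl_def using home_total[of x] supp_home[of x] orb_mono[of "{x}" A] by auto

lemma B0_eq: "B0 M = cl {}"
  unfolding B0_def acl_eq_def cl_def using acl_eq_supp[of "{}"] by simp

lemma UN_supp_cl: assumes "A \<subseteq> univ M" shows "(\<Union>e\<in>cl A. support e) = orb A"
proof
  show "(\<Union>e\<in>cl A. support e) \<subseteq> orb A" unfolding cl_def by blast
  show "orb A \<subseteq> (\<Union>e\<in>cl A. support e)"
  proof
    fix y assume "y \<in> orb A"
    then obtain x where x: "x \<in> A" "y \<in> orb {x}" using orb_UN[of A] by blast
    then have "y \<in> support (home M x)" using supp_home assms by auto
    then show "y \<in> (\<Union>e\<in>cl A. support e)" using cl_home[OF assms x(1)] by blast
  qed
qed

lemma cl_total: "cl A \<subseteq> total N" unfolding cl_def by blast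

lemma cl_mono: "A \<subseteq> B \<Longrightarrow> cl A \<subseteq> cl B" unfolding cl_def using orb_mono by blast

lemma acl_UN_cl:
  assumes "\<And>i. i \<in> I \<Longrightarrow> F i \<subseteq> univ M"
  shows "acl_eq M (\<Union>i\<in>I. cl (F i)) = cl (\<Union>i\<in>I. F i)"
proof -
  have "(\<Union>y\<in>(\<Union>i\<in>I. cl (F i)). support y) = (\<Union>i\<in>I. orb (F i))" using UN_supp_cl[OF assms] by blast
  also have "\<dots> = orb (\<Union>i\<in>I. F i)" unfolding orb_def by blast
  finally show ?thesis unfolding acl_eq_def using acl_eq_supp[of "\<Union>i\<in>I. cl (F i)"] cl_total by (auto simp: cl_def)
qed

lemma acl_home: "x \<in> univ M \<Longrightarrow> acl_eq M {home M x} = cl {x}"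
  unfolding acl_eq_def cl_def using acl_eq_supp[of "{home M x}"] home_total supp_home by simp

lemma acl_B0_home: "x \<in> univ M \<Longrightarrow> acl_eq M (B0 M \<union> {home M x}) = cl {x}"
proof -
  assume x: "x \<in> univ M"
  have "(\<Union>y\<in>B0 M \<union> {home M x}. support y) = orb {x}" using supp_home[OF x] UN_supp_cl[of "{}"] B0_eq by auto
  moreover have "B0 M \<union> {home M x} \<subseteq> total N" using B0_eq cl_total home_total[OF x] by auto
  ultimately show ?thesis unfolding acl_eq_def cl_def using acl_eq_supp[of "B0 M \<union> {home M x}"] by simp
qed

lemma supp_B0: "e \<in> B0 M \<Longrightarrow> e \<in> total N \<and> support e = {}"
  unfolding B0_eq cl_def by simp

lemma B0_cl: "B0 M \<subseteq> cl A" unfolding B0_eq by (rule cl_mono) simp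


section \<open>Thorn-independence\<close>

lemma rot_pow_inj: "x \<in> univ M \<Longrightarrow> y \<in> univ M \<Longrightarrow> (rot M ^^ q) x = (rot M ^^ q) y \<Longrightarrow> x = y"
proof -
  assume a: "x \<in> univ M" "y \<in> univ M" "(rot M ^^ q) x = (rot M ^^ q) y"
  obtain b c where bc: "b \<in> K" "pr b = x" "c \<in> K" "pr c = y" using pr_surj a by metis
  then have "pr (sh (int q) b) = pr (sh (int q) c)" using a(3) rot_pow_pr by metis
  then have "pr (sh (- int q) (sh (int q) b)) = pr (sh (- int q) (sh (int q) c))"
    by (rule pr_sh_cong[rotated 2]) (use bc in auto)
  then show ?thesis using bc by simp
qed

text \<open>The formula saying that one home element is the q-th rotation of another strongly
  divides over \<open>B0 M\<close> with k = 2: different points cannot have the same q-th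
  rotation.\<close>

lemma not_thorn_indep:
  assumes y: "y \<in> univ M" and x: "x \<in> orb {y}" and X: "home M x \<in> X" and Y: "home M y \<in> Y"
  shows "\<not> thorn_indep N X Y (B0 M)"
proof
  assume ind: "thorn_indep N X Y (B0 M)"
  obtain q where q: "x = (rot M ^^ q) y" using x unfolding orb_def by auto
  obtain \<phi> where fv: "fv \<phi> \<subseteq> {0, 1}" and \<phi>: "\<And>\<sigma>. sat N \<phi> \<sigma> \<longleftrightarrow> is_rot q (\<sigma> 0) (\<sigma> 1)"
    using definable_is_rot[of 0 1 q] unfolding definable_def by blast
  have h: "holds N \<phi> ([home M x] @ [home M y])" unfolding holds_def \<phi> using q y by simp
  have sd: "strongly_divides N (B0 M \<union> set []) \<phi> 1 [home M y]"
    unfolding strongly_divides_def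
  proof (intro conjI exI[of _ 2] allI impI notI)
    assume "set [home M y] \<subseteq> acl N (B0 M \<union> set [])"
    then have "support (home M y) \<subseteq> (\<Union>y\<in>B0 M. support y)" using acl_eq_supp[of "B0 M"] B0_eq cl_total by auto
    moreover have "(\<Union>y\<in>B0 M. support y) = {}" using supp_B0 by blast
    ultimately show False using supp_home[OF y] orb_single_refl[of y] by blast
  next
    fix F assume F: "F \<subseteq> {a'. set a' \<subseteq> total N \<and> same_type N (B0 M \<union> set []) [home M y] a'} \<and> finite F \<and> card F = 2"
    assume "\<exists>xs\<in>tuples (total N) 1. \<forall>a'\<in>F. holds N \<phi> (xs @ a')"
    then obtain xs where xs: "length xs = 1" "\<forall>a'\<in>F. holds N \<phi> (xs @ a')" unfolding tuples_def by auto
    have form: "\<exists>z\<in>univ M. a = [home M z] \<and> xs ! 0 = home M ((rot M ^^ q) z)" if a: "a \<in> F" for a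
    proof -
      have "same_type N (B0 M \<union> set []) [home M y] a" using F a by blast
      then have "length a = 1" unfolding same_type_def by simp
      then obtain f where f: "a = [f]" by (auto simp: length_Suc_conv)
      have "is_rot q ((xs @ a) ! 0) ((xs @ a) ! 1)" using xs(2) a \<phi> unfolding holds_def by blast
      moreover have "(xs @ a) ! 0 = xs ! 0" "(xs @ a) ! 1 = f" using xs(1) f by (simp_all add: nth_append)
      ultimately show ?thesis unfolding is_rot_def using f by auto
    qed
    obtain a b where ab: "a \<in> F" "b \<in> F" "a \<noteq> b" using F by (metis card_2_iff insertI1 insertI2)
    obtain z where z: "z \<in> univ M" "a = [home M z]" "xs ! 0 = home M ((rot M ^^ q) z)" using form[OF ab(1)] by blast
    obtain w where w: "w \<in> univ M" "b = [home M w]" "xs ! 0 = home M ((rot M ^^ q) w)" using form[OF ab(2)] by blast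
    have "(rot M ^^ q) z = (rot M ^^ q) w" using z(3) w(3) by simp
    then have "z = w" by (rule rot_pow_inj[OF z(1) w(1)])
    then show False using z w ab by simp
  qed simp
  have "thorn_forks N (B0 M) \<phi> 1 [home M y]"
    unfolding thorn_forks_def
  proof (intro exI[of _ "{(\<phi>, [home M y])}"] conjI)
    show "\<forall>(\<psi>, b)\<in>{(\<phi>, [home M y])}. set b \<subseteq> total N \<and> fv \<psi> \<subseteq> {..<1 + length b} \<and> thorn_divides N (B0 M) \<psi> 1 b"
      using sd fv home_total[OF y] unfolding thorn_divides_def by (auto intro!: exI[of _ "[]"])
  qed auto
  moreover have "\<not> thorn_forks N (B0 M) \<phi> (length [home M x]) [home M y]"
    by (rule ind[unfolded thorn_indep_def, rule_format]) (use X Y h fv in auto)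
  ultimately show False by simp
qed

lemma infinite_conjugate_lists:
  assumes A: "gset A" and es: "set es \<subseteq> total N" and e: "e \<in> set es" "\<not> support e \<subseteq> A"
  shows "infinite {es'. \<exists>D h. piso D h \<and> A \<subseteq> D \<and> (\<forall>x\<in>A. h x = x) \<and> list_all2 (transports D h) es es'}"
    (is "infinite ?L")
proof
  assume fin: "finite ?L"
  obtain i where i: "i < length es" "es ! i = e" using e by (auto simp: in_set_conv_nth)
  have "{e'. \<exists>D h. piso D h \<and> A \<subseteq> D \<and> (\<forall>x\<in>A. h x = x) \<and> transports D h e e'} \<subseteq> (\<lambda>es'. es' ! i) ` ?L"
  proof
    fix e' assume "e' \<in> {e'. \<exists>D h. piso D h \<and> A \<subseteq> D \<and> (\<forall>x\<in>A. h x = x) \<and> transports D h e e'}"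
    then obtain D h where h: "piso D h" "A \<subseteq> D" "\<forall>x\<in>A. h x = x" "transports D h e e'" by blast
    obtain D' h' es' where h': "piso D' h'" "D \<subseteq> D'" "\<forall>x\<in>D. h' x = h x" "list_all2 (transports D' h') es es'"
      using transports_exist_list[OF h(1) es] by blast
    have "transports D' h' e (es' ! i)" using list_all2_nthD[OF h'(4) i(1)] i(2) by simp
    then have "es' ! i = e'" using transports_fun[OF h'(1)] transports_mono[OF h(4) h'(2,3)] by blast
    moreover have "\<forall>x\<in>A. h' x = x" "A \<subseteq> D'" using h h' by auto
    then have "es' \<in> ?L" using h' by blast
    ultimately show "e' \<in> (\<lambda>es'. es' ! i) ` ?L" by blast
  qed
  moreover have "e \<in> total N" using es e by auto
  ultimately show False using infinite_conjugates[OF A _ e(2)] finite_imageI[OF fin] finite_subset by blast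
qed

text \<open>A forking cover involves finitely many parameters. The point x is moved inside its cell
  over B to some y avoiding their supports. The conjugate tuple over y satisfies one of the covering
  formulas; the parameters of that formula have infinitely many conjugates over the auxiliary tuple
  and y, and the same tuple satisfies the formula for all of them, which contradicts strong
  dividing.\<close>

lemma thorn_indep_orb:
  assumes x: "x \<in> univ M" and B: "gset B" "x \<notin> B"
    and X: "X \<subseteq> total N" "\<And>e. e \<in> X \<Longrightarrow> support e \<subseteq> orb {x}"
    and Y: "Y \<subseteq> total N" "\<And>e. e \<in> Y \<Longrightarrow> support e \<subseteq> B"
  shows "thorn_indep N X Y (B0 M)"
  unfolding thorn_indep_def
proof (intro allI impI notI)
  fix xs \<phi> b
  assume a: "set xs \<subseteq> X \<and> set b \<subseteq> Y \<union> B0 M \<and> fv \<phi> \<subseteq> {..<length xs + length b} \<and> holds N \<phi> (xs @ b)"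
    and "thorn_forks N (B0 M) \<phi> (length xs) b"
  then obtain \<D> where fin: "finite \<D>"
    and \<D>0: "\<forall>(\<psi>, b)\<in>\<D>. set b \<subseteq> total N \<and> fv \<psi> \<subseteq> {..<length xs + length b} \<and> thorn_divides N (B0 M) \<psi> (length xs) b"
    and cov: "\<forall>ys\<in>tuples (total N) (length xs). holds N \<phi> (ys @ b) \<longrightarrow> (\<exists>(\<psi>, b)\<in>\<D>. holds N \<psi> (ys @ b))"
    unfolding thorn_forks_def by blast
  have \<D>: "set (snd p) \<subseteq> total N" "fv (fst p) \<subseteq> {..<length xs + length (snd p)}"
    "thorn_divides N (B0 M) (fst p) (length xs) (snd p)" if "p \<in> \<D>" for p
  proof -
    obtain \<psi> b' where "p = (\<psi>, b')" by (cases p)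
    then show "set (snd p) \<subseteq> total N" "fv (fst p) \<subseteq> {..<length xs + length (snd p)}"
      "thorn_divides N (B0 M) (fst p) (length xs) (snd p)" using \<D>0 that by auto
  qed
  have "\<forall>p\<in>\<D>. \<exists>c. set c \<subseteq> total N \<and> strongly_divides N (B0 M \<union> set c) (fst p) (length xs) (snd p)"
    using \<D>(3) unfolding thorn_divides_def by blast
  from bchoice[OF this] obtain c where c: "\<forall>p\<in>\<D>. set (c p) \<subseteq> total N \<and> strongly_divides N (B0 M \<union> set (c p)) (fst p) (length xs) (snd p)"
    ..
  have fin_supp: "finite (\<Union>e\<in>set es. support e)" if "set es \<subseteq> total N" for es
  proof -
    have "finite (support e)" if "e \<in> set es" for e
      using supp_props(1) gsetD(1) \<open>set es \<subseteq> total N\<close> that by blast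
    then show ?thesis by blast
  qed
  \<comment> \<open>T collects the supports of the parameters of the dividing formulas and of the
    auxiliary tuples \<open>c p\<close> over which these strongly divide.\<close>
  define T where "T = (\<Union>p\<in>\<D>. (\<Union>e\<in>set (snd p @ c p). support e))"
  have DN: "set (snd p @ c p) \<subseteq> total N" if "p \<in> \<D>" for p using \<D>(1)[OF that] c that by simp
  have "finite T" unfolding T_def by (intro finite_UN_I fin fin_supp DN)
  obtain Z where Z: "infinite Z" "\<forall>y\<in>Z. cell B x y" using near_infinite[OF B(1) x B(2)] by blast
  have "\<not> Z \<subseteq> T" using Z(1) \<open>finite T\<close> finite_subset by blast
  then obtain y where y: "y \<in> Z" "y \<notin> T" by blast
  have yU: "y \<in> univ M" using Z y cell_univ by blast
  obtain h where h: "piso (B \<union> orb {x}) h" "\<forall>z\<in>B. h z = z" "h x = y"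
    using cell_piso[OF B(1)] Z(2) y(1) by blast
  have xsN: "set xs \<subseteq> total N" using a X by auto
  obtain D0 h0 xs' where h0: "piso D0 h0" "B \<union> orb {x} \<subseteq> D0" "\<forall>z\<in>B \<union> orb {x}. h0 z = h z"
      "list_all2 (transports D0 h0) xs xs'"
    using transports_exist_list[OF h(1) xsN] by blast
  have bN: "set b \<subseteq> total N" using a Y(1) B0_eq cl_total by blast
  have "\<exists>D' h'. piso D' h' \<and> D0 \<subseteq> D' \<and> (\<forall>z\<in>D0. h' z = h0 z) \<and> list_all2 (transports D' h') (xs @ b) (xs' @ b)"
  proof (rule transports_append_fixed[OF h0(1,4) _ _ bN, of B])
    show "B \<subseteq> D0" "\<forall>z\<in>B. h0 z = z" using h(2) h0(2,3) by auto
    fix e assume "e \<in> set b"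
    then have "e \<in> Y \<or> e \<in> B0 M" using a by blast
    then show "support e \<subseteq> B" using Y(2) supp_B0 by blast
  qed
  then obtain D h1 where h1: "piso D h1" "D0 \<subseteq> D" "\<forall>z\<in>D0. h1 z = h0 z" "list_all2 (transports D h1) (xs @ b) (xs' @ b)"
    by blast
  have "holds N \<phi> (xs @ b) \<longleftrightarrow> holds N \<phi> (xs' @ b)" by (rule holds_eq[OF h1(1,4)]) (use a in simp)
  then have h': "holds N \<phi> (xs' @ b)" using a by simp
  have l: "length xs' = length xs" using h0(4) list_all2_lengthD by metis
  have xs'N: "set xs' \<subseteq> total N" using transports_total_list[OF h0(1,4)] by blast
  have xs'support: "support e \<subseteq> orb {y}" if e: "e \<in> set xs'" for e
  proof -
    obtain i where i: "i < length xs'" "xs' ! i = e" using e by (auto simp: in_set_conv_nth)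
    then have t: "transports D0 h0 (xs ! i) e" using h0(4) l list_all2_nthD by fastforce
    have s: "support (xs ! i) \<subseteq> orb {x}" using i l a X by (metis nth_mem subsetD)
    then have "support e = h0 ` support (xs ! i)" using supp_transports[OF h0(1) _ t] h0(2) by blast
    also have "\<dots> \<subseteq> h0 ` orb {x}" using s by blast
    also have "\<dots> \<subseteq> orb {y}"
    proof
      fix w assume "w \<in> h0 ` orb {x}"
      then obtain q where "w = h0 ((rot M ^^ q) x)" "q < n" unfolding orb_def by auto
      moreover have "x \<in> D0" using h0(2) by auto
      moreover have "h0 x = y" using h0(3) h(3) by simp
      ultimately show "w \<in> orb {y}" using piso_rot_pow[OF h0(1), of x q] unfolding orb_def by auto
    qed
    finally show ?thesis .
  qed
  have "xs' \<in> tuples (total N) (length xs)" using l xs'N unfolding tuples_def by simp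
  then have "\<exists>(\<psi>, b)\<in>\<D>. holds N \<psi> (xs' @ b)" using cov h' by blast
  then obtain p where p: "p \<in> \<D>" "holds N (fst p) (xs' @ snd p)" by (auto simp: case_prod_unfold)
  note p2 = \<D>(1,2)[OF p(1)]
  have sd: "set (c p) \<subseteq> total N" "strongly_divides N (B0 M \<union> set (c p)) (fst p) (length xs) (snd p)" using c p(1) by auto
  then obtain k where k: "0 < k" "\<not> set (snd p) \<subseteq> acl N (B0 M \<union> set (c p))"
    "\<forall>F. F \<subseteq> {a'. set a' \<subseteq> total N \<and> same_type N (B0 M \<union> set (c p)) (snd p) a'} \<and> finite F \<and> card F = k \<longrightarrow>
        \<not> (\<exists>xs \<in> tuples (total N) (length xs). \<forall>a' \<in> F. holds N (fst p) (xs @ a'))"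
    unfolding strongly_divides_def by blast
  have bcN: "B0 M \<union> set (c p) \<subseteq> total N" using sd(1) B0_eq cl_total by auto
  obtain e where e: "e \<in> set (snd p)" "e \<notin> acl N (B0 M \<union> set (c p))" using k(2) by blast
  define C where "C = (\<Union>f\<in>set (c p). support f)"
  have gc: "gset (support f)" if "f \<in> set (c p)" for f using supp_props sd(1) that by blast
  have C: "gset C" unfolding C_def by (rule gset_UN) (use gc in auto)
  have eC: "\<not> support e \<subseteq> C"
  proof
    assume "support e \<subseteq> C"
    then have "support e \<subseteq> (\<Union>f\<in>B0 M \<union> set (c p). support f)" unfolding C_def by blast
    then have "e \<in> acl N (B0 M \<union> set (c p))" using acl_eq_supp[OF bcN] e(1) p2(1) by auto
    then show False using e(2) by blast
  qed
  define A0 where "A0 = C \<union> orb {y}"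
  have A0: "gset A0" unfolding A0_def using C gset_Un orb_gset[of "{y}"] yU by auto
  have "support e \<subseteq> T" unfolding T_def using p(1) e(1) by auto
  then have "y \<notin> support e" using y(2) by blast
  have "gset (support e)" using supp_props(1) e(1) p2(1) by blast
  have "support e \<inter> orb {y} = {}"
  proof (rule ccontr)
    assume "support e \<inter> orb {y} \<noteq> {}"
    then obtain w where w: "w \<in> support e" "w \<in> orb {y}" by blast
    then have "y \<in> orb {w}" using orb_sym[OF yU] by blast
    then show False using orb_subset[OF \<open>gset (support e)\<close>, of "{w}"] w(1) \<open>y \<notin> support e\<close> by blast
  qed
  then have eA0: "\<not> support e \<subseteq> A0" using eC unfolding A0_def by blast
  let ?L = "{es'. \<exists>D h. piso D h \<and> A0 \<subseteq> D \<and> (\<forall>x\<in>A0. h x = x) \<and> list_all2 (transports D h) (snd p) es'}"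
  \<comment> \<open>\<open>A0\<close> contains the supports of \<open>c p\<close> and the orbit
    supporting \<open>xs'\<close>. Conjugates over \<open>A0\<close> therefore keep both the type
    over \<open>c p\<close> and the formula with \<open>xs'\<close>, and k of them give the
    contradiction.\<close>
  have inf: "infinite ?L" by (rule infinite_conjugate_lists[OF A0 p2(1) e(1) eA0])
  obtain F where F0: "finite F \<and> card F = k \<and> F \<subseteq> ?L" using infinite_arbitrarily_large[OF inf, of k] ..
  note F = conjunct1[OF F0] conjunct1[OF conjunct2[OF F0]] conjunct2[OF conjunct2[OF F0]]
  have good: "set es' \<subseteq> total N \<and> same_type N (B0 M \<union> set (c p)) (snd p) es' \<and> holds N (fst p) (xs' @ es')"
    if es': "es' \<in> ?L" for es'
  proof -
    obtain D h where h: "piso D h" "A0 \<subseteq> D" "\<forall>x\<in>A0. h x = x" "list_all2 (transports D h) (snd p) es'"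
      using es' by blast
    have l2: "length (snd p) = length es'" using h(4) list_all2_lengthD by blast
    have ext: "holds N \<phi> (snd p @ cs) \<longleftrightarrow> holds N \<phi> (es' @ cs)"
      if cs: "set cs \<subseteq> total N" "\<And>f. f \<in> set cs \<Longrightarrow> support f \<subseteq> A0" and fv: "fv \<phi> \<subseteq> {..<length (snd p) + length cs}" for \<phi> cs
    proof -
      obtain D' h' where "piso D' h'" "list_all2 (transports D' h') (snd p @ cs) (es' @ cs)"
        using transports_append_fixed[OF h(1,4,2,3) cs(1)] cs(2) by blast
      then show ?thesis by (rule holds_eq) (use fv in simp)
    qed
    have "same_type N (B0 M \<union> set (c p)) (snd p) es'"
      unfolding same_type_def
    proof (intro conjI allI impI)
      fix \<phi> :: "('a esort, 'a eqsym) fm" and cs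
      assume cs: "set cs \<subseteq> B0 M \<union> set (c p) \<and> fv \<phi> \<subseteq> {..<length (snd p) + length cs}"
      show "holds N \<phi> (snd p @ cs) \<longleftrightarrow> holds N \<phi> (es' @ cs)"
      proof (rule ext)
        show "set cs \<subseteq> total N" using cs bcN by blast
        fix f assume "f \<in> set cs"
        then have "f \<in> B0 M \<or> f \<in> set (c p)" using cs by blast
        then show "support f \<subseteq> A0" unfolding A0_def C_def using supp_B0[of f] by auto
      qed (use cs in blast)
    qed (rule l2)
    moreover have "holds N (fst p) (xs' @ es')"
    proof -
      have xs'2: "list_all2 (transports D1 h1) xs' xs'" if h1: "piso D1 h1" "A0 \<subseteq> D1" "\<forall>x\<in>A0. h1 x = x"
        "list_all2 (transports D1 h1) (snd p @ xs') (es' @ xs')" for D1 h1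
        using h1(4) l2 by (simp add: list_all2_append)
      have "\<exists>D' h'. piso D' h' \<and> D \<subseteq> D' \<and> (\<forall>x\<in>D. h' x = h x) \<and> list_all2 (transports D' h') (snd p @ xs') (es' @ xs')"
        by (rule transports_append_fixed[OF h(1,4,2,3) xs'N]) (use xs'support A0_def in blast)
      then obtain D' h' where h'': "piso D' h'" "list_all2 (transports D' h') (snd p @ xs') (es' @ xs')"
        by blast
      have "list_all2 (transports D' h') (xs' @ snd p) (xs' @ es')"
        using h''(2) l2 by (simp add: list_all2_append)
      then have "holds N (fst p) (xs' @ snd p) \<longleftrightarrow> holds N (fst p) (xs' @ es')"
        by (rule holds_eq[OF h''(1)]) (use p2 l in simp)
      then show ?thesis using p(2) by blast
    qed
    moreover have "set es' \<subseteq> total N" using transports_total_list[OF h(1,4)] by blast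
    ultimately show ?thesis by blast
  qed
  have "F \<subseteq> {a'. set a' \<subseteq> total N \<and> same_type N (B0 M \<union> set (c p)) (snd p) a'}" using good F(3) by blast
  moreover have "\<forall>a'\<in>F. holds N (fst p) (xs' @ a')" using good F(3) by blast
  ultimately show False using k(3) F(1,2) \<open>xs' \<in> tuples (total N) (length xs)\<close> by blast
qed

end

instance sym :: countable by countable_datatype
instance fm :: (countable, countable) countable by countable_datatype

context rotation_cover
begin

section \<open>Cardinality of closures\<close>

text \<open>The language has two relation symbols, hence countably many formulas, and a formula with
  an arity determines the relation.\<close>

lemma countable_def_equiv: "countable {E. \<exists>k. def_equiv M k E}"
proof -
  have "{E. \<exists>k. def_equiv M k E} \<subseteq> range (\<lambda>(k, \<phi>). {(xs, ys). xs \<in> tuples (univ M) k \<and> ys \<in> tuples (univ M) k \<and>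
      holds (fo M) \<phi> (xs @ ys)})"
    unfolding def_equiv_def by auto
  then show ?thesis by (rule countable_subset) simp
qed

lemma piso_fix_orb:
  assumes "piso D h" "A \<subseteq> D" "\<forall>x\<in>A. h x = g x" "\<forall>x\<in>A. \<forall>i. g ((rot M ^^ i) x) = (rot M ^^ i) (g x)"
  shows "\<forall>x\<in>orb A. h x = g x"
proof
  fix y assume "y \<in> orb A"
  then obtain x i where x: "x \<in> A" "y = (rot M ^^ i) x" unfolding orb_def by auto
  then have "h y = (rot M ^^ i) (h x)" using piso_rot_pow[OF assms(1)] assms(2) by blast
  then show "h y = g y" using x assms(3,4) by metis
qed

text \<open>Such an element is determined by the diagram of a representative joined with a list of
  A: equal diagrams give a partial isomorphism fixing A that carries one element to the other. There
  are finitely many diagrams.\<close>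

lemma finite_cl_sort:
  assumes A: "finite A" "A \<subseteq> univ M" and E: "def_equiv M k E"
  shows "finite {e \<in> Univ N E. support e \<subseteq> orb A}" (is "finite ?S")
proof -
  obtain as where as: "set as = A" using finite_list[OF A(1)] by blast
  define L where "L = k + length as"
  define rep where "rep e = (SOME d. d \<in> tuples (univ M) k \<and> e = (E, E `` {d}))" for e :: "'a imag"
  have rep: "rep e \<in> tuples (univ M) k \<and> e = (E, E `` {rep e})" if "e \<in> ?S" for e
  proof -
    obtain k' d where d: "def_equiv M k' E" "d \<in> tuples (univ M) k'" "e = (E, E `` {d})"
      using \<open>e \<in> ?S\<close> unfolding Univ_eq_iff by blast
    have "k' = k" using def_equiv_arity[OF d(1) E d(2)] by simp
    then have "d \<in> tuples (univ M) k \<and> e = (E, E `` {d})" using d by simp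
    then show ?thesis unfolding rep_def by (rule someI)
  qed
  define x where "x e i = (if i < k then rep e ! i else as ! (i - k))" for e i
  have xU: "x e i \<in> univ M" if "e \<in> ?S" "i < L" for e i
  proof (cases "i < k")
    case True
    then show ?thesis using rep[OF that(1)] unfolding x_def tuples_def by auto
  next
    case False
    then have "as ! (i - k) \<in> set as" using that(2) L_def by simp
    then show ?thesis using False as A(2) unfolding x_def by auto
  qed
  define D1 where "D1 e = {(i, j, q). i < L \<and> j < L \<and> q < n \<and> x e i = (rot M ^^ q) (x e j)}" for e
  define D2 where "D2 e = {(i, j, l, q). i < L \<and> j < L \<and> l < L \<and> q < n \<and> cyc M (x e i) ((rot M ^^ q) (x e j)) (x e l)}" for e
  have "inj_on (\<lambda>e. (D1 e, D2 e)) ?S"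
  proof (rule inj_onI)
    fix e f assume e: "e \<in> ?S" and f: "f \<in> ?S" and eq: "(D1 e, D2 e) = (D1 f, D2 f)"
    have d1: "x e i = (rot M ^^ q) (x e j) \<longleftrightarrow> x f i = (rot M ^^ q) (x f j)" if "i < L" "j < L" "q < n" for i j q
    proof -
      have "(i, j, q) \<in> D1 e \<longleftrightarrow> (i, j, q) \<in> D1 f" using eq by simp
      then show ?thesis unfolding D1_def using that by simp
    qed
    have d2: "cyc M (x e i) ((rot M ^^ q) (x e j)) (x e l) \<longleftrightarrow> cyc M (x f i) ((rot M ^^ q) (x f j)) (x f l)"
      if "i < L" "j < L" "l < L" "q < n" for i j l q
    proof -
      have "(i, j, l, q) \<in> D2 e \<longleftrightarrow> (i, j, l, q) \<in> D2 f" using eq by simp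
      then show ?thesis unfolding D2_def using that by simp
    qed
    have "\<exists>h. piso (orb (x e ` {..<L})) h \<and> (\<forall>i\<in>{..<L}. h (x e i) = x f i)"
      by (rule piso_of_diagram) (simp_all add: xU[OF e] xU[OF f] d1 d2)
    then obtain h where h: "piso (orb (x e ` {..<L})) h" "\<forall>i<L. h (x e i) = x f i" by auto
    have AL: "\<exists>i<L. a = x e i \<and> a = x f i" if "a \<in> A" for a
    proof -
      have "a \<in> set as" using that as by simp
      then obtain j where j: "j < length as" "a = as ! j" unfolding in_set_conv_nth by blast
      then show ?thesis unfolding x_def L_def by (intro exI[of _ "k + j"]) simp
    qed
    have AD: "A \<subseteq> orb (x e ` {..<L})" using AL orb_refl[of "x e ` {..<L}"] by blast
    have "\<forall>a\<in>A. h a = a"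
    proof
      fix a assume "a \<in> A"
      then obtain i where "i < L" "a = x e i" "a = x f i" using AL by blast
      then show "h a = a" using h(2) by simp
    qed
    then have fx: "\<forall>a\<in>orb A. h a = a" using piso_fix_orb[OF h(1) AD, of "\<lambda>x. x"] by simp
    have re: "rep e = map (x e) [0..<k]" "rep f = map (x f) [0..<k]"
      using rep[OF e] rep[OF f] unfolding x_def tuples_def by (auto intro!: nth_equalityI)
    have hr: "map h (rep e) = rep f" unfolding re using h(2) L_def by simp
    have rt: "rep e \<in> tuples (orb (x e ` {..<L})) k"
      using orb_refl[of "x e ` {..<L}"] unfolding re tuples_def L_def by auto
    have t: "transports (orb (x e ` {..<L})) h e f"
      unfolding transports_def
      by (rule exI[of _ k], rule exI[of _ E], rule exI[of _ "rep e"])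
         (use rep[OF e] rep[OF f] E rt hr in simp)
    have "f = e"
    proof (rule supp_fix[OF h(1) _ _ t])
      have "support e \<subseteq> orb A" using e by blast
      then show "support e \<subseteq> orb (x e ` {..<L})" "\<forall>x\<in>support e. h x = x"
        using orb_subset[OF piso_gset[OF h(1)] AD] fx by blast+
    qed
    then show "e = f" by simp
  qed
  moreover have "(\<lambda>e. (D1 e, D2 e)) ` ?S \<subseteq> Pow ({..<L} \<times> {..<L} \<times> {..<n}) \<times> Pow ({..<L} \<times> {..<L} \<times> {..<L} \<times> {..<n})"
    unfolding D1_def D2_def by auto
  ultimately show ?thesis by (rule inj_on_finite) simp
qed

text \<open>This makes the closures small enough to be objects of the category, as \<kappa> is
  uncountable.\<close>

lemma countable_cl: assumes "finite A" "A \<subseteq> univ M" shows "countable (cl A)"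
proof -
  have "cl A \<subseteq> (\<Union>E\<in>{E. \<exists>k. def_equiv M k E}. {e \<in> Univ N E. support e \<subseteq> orb A})"
  proof
    fix e assume e: "e \<in> cl A"
    then obtain k E d where d: "def_equiv M k E" "d \<in> tuples (univ M) k" "e = (E, E `` {d})"
      unfolding cl_def total_eq_iff by blast
    then have "e \<in> Univ N E" unfolding Univ_eq_iff by blast
    then show "e \<in> (\<Union>E\<in>{E. \<exists>k. def_equiv M k E}. {e \<in> Univ N E. support e \<subseteq> orb A})"
      using d(1) e unfolding cl_def by blast
  qed
  moreover have "countable (\<Union>E\<in>{E. \<exists>k. def_equiv M k E}. {e \<in> Univ N E. support e \<subseteq> orb A})"
    by (rule countable_UN[OF countable_def_equiv]) (use finite_cl_sort[OF assms] countable_finite in blast)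
  ultimately show ?thesis using countable_subset by blast
qed


section \<open>Transport along families of points\<close>

definition realign :: "nat set \<Rightarrow> (nat \<Rightarrow> 'a) \<Rightarrow> (nat \<Rightarrow> 'a) \<Rightarrow> 'a set \<Rightarrow> ('a \<Rightarrow> 'a) \<Rightarrow> bool" where
  "realign s p q D h \<longleftrightarrow> piso D h \<and> (\<forall>i\<in>s. p i \<in> D \<and> h (p i) = q i)"

text \<open>For finite families this is equality of types over the empty set.\<close>

definition alike :: "nat set \<Rightarrow> (nat \<Rightarrow> 'a) \<Rightarrow> (nat \<Rightarrow> 'a) \<Rightarrow> bool" where
  "alike s p q \<longleftrightarrow> (\<exists>D h. realign s p q D h)"

text \<open>The induced map between closures. On the closure of the family the description is
  proper, because there the image is forced by the images of the points
  (\<open>shift_eq\<close>).\<close>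

definition shift :: "nat set \<Rightarrow> (nat \<Rightarrow> 'a) \<Rightarrow> (nat \<Rightarrow> 'a) \<Rightarrow> 'a imag \<Rightarrow> 'a imag" where
  "shift s p q e = (THE e'. \<exists>D h. realign s p q D h \<and> transports D h e e')"

lemma alike_univ: assumes "alike s p q" shows "p ` s \<subseteq> univ M \<and> q ` s \<subseteq> univ M"
proof -
  obtain D h where h: "piso D h" "\<forall>i\<in>s. p i \<in> D \<and> h (p i) = q i"
    using assms unfolding alike_def realign_def by blast
  have "p i \<in> univ M" "q i \<in> univ M" if "i \<in> s" for i
  proof -
    have "p i \<in> D" "h (p i) = q i" using h(2) that by auto
    then show "p i \<in> univ M" "q i \<in> univ M" using piso_univ[OF h(1)] piso_in_univ[OF h(1), of "p i"] by auto
  qed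
  then show ?thesis by blast
qed

lemma alike_refl: assumes "finite s" "p ` s \<subseteq> univ M" shows "alike s p p"
proof -
  have "piso (orb (p ` s)) (\<lambda>x. x)" using piso_id orb_gset assms by auto
  then show ?thesis unfolding alike_def realign_def using orb_refl by blast
qed

lemma alike_subset: "alike s p q \<Longrightarrow> t \<subseteq> s \<Longrightarrow> alike t p q"
  unfolding alike_def realign_def by blast

lemma alike_cong: "alike s p q \<Longrightarrow> (\<And>i. i \<in> s \<Longrightarrow> p' i = p i) \<Longrightarrow> (\<And>i. i \<in> s \<Longrightarrow> q' i = q i) \<Longrightarrow> alike s p' q'"
  unfolding alike_def realign_def by auto

lemma realign_inv: assumes "realign s p q D h" shows "realign s q p (h ` D) (inv_into D h)"
proof -
  have h: "piso D h" "\<forall>i\<in>s. p i \<in> D \<and> h (p i) = q i" using assms unfolding realign_def by blast+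
  have "q i \<in> h ` D \<and> inv_into D h (q i) = p i" if "i \<in> s" for i
  proof -
    have i: "p i \<in> D" "h (p i) = q i" using h(2) that by auto
    then show ?thesis using inv_into_f_f[OF piso_inj[OF h(1)] i(1)] imageI[OF i(1), of h] by simp
  qed
  then show ?thesis unfolding realign_def using piso_inv[OF h(1)] by simp
qed

lemma alike_sym: "alike s p q \<Longrightarrow> alike s q p"
  unfolding alike_def using realign_inv by blast

lemma realign_comp:
  assumes "realign s p q D h" "realign s q r E k"
  obtains E' k' where "realign s q r E' k'" "h ` D \<subseteq> E'" "realign s p r D (\<lambda>x. k' (h x))"
proof -
  have h: "piso D h" "\<forall>i\<in>s. p i \<in> D \<and> h (p i) = q i" and k: "piso E k" "\<forall>i\<in>s. q i \<in> E \<and> k (q i) = r i"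
    using assms unfolding realign_def by auto
  obtain E' k' where k': "piso E' k'" "E \<subseteq> E'" "h ` D \<subseteq> E'" "\<forall>y\<in>E. k' y = k y"
    using piso_extend[OF k(1) gsetD[OF piso_image_gset[OF h(1)]]] by blast
  have "realign s q r E' k'" unfolding realign_def using k k' by auto
  moreover have "realign s p r D (\<lambda>x. k' (h x))"
    unfolding realign_def using piso_comp[OF h(1) k'(1,3)] h(2) k(2) k'(4) by auto
  ultimately show ?thesis using that k'(3) by blast
qed

lemma cl_supports: assumes "e \<in> cl A" shows "supports (orb A) e"
  using assms supp_props(2)[of e] supports_mono[of "support e" e "orb A"] unfolding cl_def by blast

lemma realign_orb:
  assumes "realign s p q D h" shows "gset D" "orb (p ` s) \<subseteq> D" "h ` orb (p ` s) = orb (q ` s)"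
proof -
  have h: "piso D h" "\<forall>i\<in>s. p i \<in> D \<and> h (p i) = q i" using assms unfolding realign_def by auto
  show "gset D" using piso_gset[OF h(1)] .
  show "orb (p ` s) \<subseteq> D" using orb_subset[OF \<open>gset D\<close>] h(2) by blast
  have "h ((rot M ^^ i) (p j)) = (rot M ^^ i) (q j)" if "j \<in> s" for i j
    using piso_rot_pow[OF h(1)] h(2) that by metis
  then show "h ` orb (p ` s) = orb (q ` s)" unfolding orb_def by (force simp: image_UN image_image)
qed

lemma shift_eq:
  assumes e: "e \<in> cl (p ` s)" and h: "realign s p q D h" "transports D h e e'"
  shows "shift s p q e = e'"
  unfolding shift_def
proof (rule the_equality)
  show "\<exists>D h. realign s p q D h \<and> transports D h e e'" using h by blast
  fix f assume "\<exists>D h. realign s p q D h \<and> transports D h e f"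
  then obtain E k where k: "realign s p q E k" "transports E k e f" by blast
  have "k x = h x" if "x \<in> orb (p ` s)" for x
  proof -
    obtain j i where j: "j \<in> s" "x = (rot M ^^ i) (p j)" using \<open>x \<in> orb (p ` s)\<close> unfolding orb_def by auto
    have "k x = (rot M ^^ i) (q j)" "h x = (rot M ^^ i) (q j)"
      using piso_rot_pow[of E k "p j" i] piso_rot_pow[of D h "p j" i] h(1) k(1) j unfolding realign_def by metis+
    then show ?thesis by simp
  qed
  then show "f = e'"
    using transports_unique[OF cl_supports[OF e] _ realign_orb(2)[OF k(1)] k(2) _ realign_orb(2)[OF h(1)] h(2)]
      h(1) k(1) unfolding realign_def by blast
qed

text \<open>A single partial isomorphism realises \<open>shift\<close> on a whole list, which is
  what elementarity of \<open>shift\<close> requires.\<close>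

lemma shift_list:
  assumes "alike s p q" "set es \<subseteq> cl (p ` s)"
  shows "\<exists>D h. realign s p q D h \<and> list_all2 (transports D h) es (map (shift s p q) es)"
proof -
  obtain D h where h: "realign s p q D h" using assms unfolding alike_def by blast
  have esN: "set es \<subseteq> total N" using assms(2) cl_total by blast
  have "piso D h" using h unfolding realign_def by blast
  then obtain D' h' es' where h': "piso D' h'" "D \<subseteq> D'" "\<forall>x\<in>D. h' x = h x" "list_all2 (transports D' h') es es'"
    using transports_exist_list[OF _ esN] by blast
  have r: "realign s p q D' h'" using h h' unfolding realign_def by auto
  have "es' = map (shift s p q) es"
  proof (rule nth_equalityI)
    show "length es' = length (map (shift s p q) es)" using h'(4) list_all2_lengthD by fastforce
    fix i assume "i < length es'"
    then have i: "i < length es" using h'(4) list_all2_lengthD by fastforce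
    then have "transports D' h' (es ! i) (es' ! i)" using h'(4) list_all2_nthD by blast
    then have "shift s p q (es ! i) = es' ! i" using shift_eq[OF _ r] assms(2) i nth_mem by blast
    then show "es' ! i = map (shift s p q) es ! i" using i by simp
  qed
  then show ?thesis using r h'(4) by blast
qed

lemma shift_ex:
  assumes "alike s p q" "e \<in> cl (p ` s)"
  obtains D h where "realign s p q D h" "transports D h e (shift s p q e)"
  using shift_list[OF assms(1), of "[e]"] assms(2) by auto

lemma shift_home: assumes "alike s p q" "i \<in> s" shows "shift s p q (home M (p i)) = home M (q i)"
proof -
  obtain D h where h: "realign s p q D h" using assms unfolding alike_def by blast
  then have 1: "piso D h" "p i \<in> D" "h (p i) = q i" using assms(2) unfolding realign_def by auto
  have "home M (p i) \<in> cl (p ` s)" using cl_home alike_univ[OF assms(1)] assms(2) by blast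
  then show ?thesis using shift_eq[OF _ h] transports_home[OF 1(1,2)] 1(3) by metis
qed

lemma shift_cl: assumes "alike s p q" "e \<in> cl (p ` s)" shows "shift s p q e \<in> cl (q ` s)"
proof -
  obtain D h where h: "realign s p q D h" "transports D h e (shift s p q e)" using shift_ex[OF assms] .
  have p: "piso D h" using h unfolding realign_def by blast
  have "support e \<subseteq> orb (p ` s)" using assms unfolding cl_def by blast
  then have "support (shift s p q e) \<subseteq> orb (q ` s)"
    using supp_transports[OF p _ h(2)] realign_orb[OF h(1)] by blast
  then show ?thesis unfolding cl_def using transports_total[OF p h(2)] by blast
qed

text \<open>To compose the two partial isomorphisms, the second is enlarged until its domain
  contains the image of the first.\<close>

lemma shift_comp:
  assumes "alike s p q" "alike s q r" "e \<in> cl (p ` s)"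
  shows "shift s q r (shift s p q e) = shift s p r e"
proof -
  obtain D h where h: "realign s p q D h" "transports D h e (shift s p q e)" using shift_ex[OF assms(1,3)] .
  have c: "shift s p q e \<in> cl (q ` s)" by (rule shift_cl[OF assms(1,3)])
  obtain E k where k: "realign s q r E k" "transports E k (shift s p q e) (shift s q r (shift s p q e))"
    using shift_ex[OF assms(2) c] .
  obtain E' k' where k': "realign s q r E' k'" "h ` D \<subseteq> E'" "realign s p r D (\<lambda>x. k' (h x))"
    using realign_comp[OF h(1) k(1)] .
  have p: "piso D h" "piso E' k'" using h(1) k'(1) unfolding realign_def by auto
  have "shift s p q e \<in> total N" using c cl_total by blast
  then obtain E'' k'' f where k'': "piso E'' k''" "E' \<subseteq> E''" "\<forall>x\<in>E'. k'' x = k' x" "transports E'' k'' (shift s p q e) f"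
    using transports_exist[OF p(2)] by blast
  have r2: "realign s q r E'' k''" using k'(1) k'' unfolding realign_def by auto
  have sub: "h ` D \<subseteq> E''" using k'(2) k''(2) by blast
  have r3: "realign s p r D (\<lambda>x. k'' (h x))"
    using piso_comp[OF p(1) k''(1) sub] r2 h(1) unfolding realign_def by simp
  have "shift s q r (shift s p q e) = f" by (rule shift_eq[OF c r2 k''(4)])
  moreover have "shift s p r e = f"
    by (rule shift_eq[OF assms(3) r3 transports_comp[OF p(1) k''(1) sub h(2) k''(4)]])
  ultimately show ?thesis by simp
qed

lemma shift_subset:
  assumes "alike s p q" "t \<subseteq> s" "e \<in> cl (p ` t)" shows "shift t p q e = shift s p q e"
proof -
  have "e \<in> cl (p ` s)" using assms cl_mono[OF image_mono[OF assms(2)]] by blast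
  then obtain D h where h: "realign s p q D h" "transports D h e (shift s p q e)" using shift_ex[OF assms(1)] by blast
  have "realign t p q D h" using h(1) assms(2) unfolding realign_def by blast
  then show ?thesis by (rule shift_eq[OF assms(3) _ h(2)])
qed

lemma shift_cong:
  assumes "\<And>i. i \<in> s \<Longrightarrow> p i = p' i" "\<And>i. i \<in> s \<Longrightarrow> q i = q' i" shows "shift s p q e = shift s p' q' e"
proof -
  have "realign s p q = realign s p' q'" unfolding realign_def using assms by (intro ext) auto
  then show ?thesis unfolding shift_def by simp
qed

lemma shift_fixed:
  assumes "alike s p q" "e \<in> cl (p ` s)" "support e = {}" shows "shift s p q e = e"
proof -
  obtain D h where h: "realign s p q D h" "transports D h e (shift s p q e)" using shift_ex[OF assms(1,2)] .
  show ?thesis by (rule supp_fix[OF _ _ _ h(2)]) (use h(1) assms(3) realign_def in auto)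
qed

lemma shift_id: assumes "finite s" "p ` s \<subseteq> univ M" "e \<in> cl (p ` s)" shows "shift s p p e = e"
proof -
  have "shift s p p (shift s p p e) = shift s p p e"
    by (rule shift_comp) (use alike_refl[OF assms(1,2)] assms in auto)
  obtain D h where h: "realign s p p D h" "transports D h e (shift s p p e)"
    using shift_ex[OF alike_refl[OF assms(1,2)] assms(3)] .
  have "\<forall>x\<in>orb (p ` s). h x = x"
    by (rule piso_fix_orb[of D h _ "\<lambda>x. x"]) (use h(1) realign_def in auto)
  then show ?thesis
    using supportsD[OF cl_supports[OF assms(3)] _ realign_orb(2)[OF h(1)] _ h(2)] h(1) unfolding realign_def by blast
qed

lemma shift_elementary:
  assumes "alike s p q" "\<And>e. e \<in> cl (p ` s) \<Longrightarrow> k e = shift s p q e"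
  shows "elementary_on N (cl (p ` s)) k"
  unfolding elementary_on_def
proof (intro allI impI)
  fix es and \<phi> :: "('a esort, 'a eqsym) fm"
  assume a: "set es \<subseteq> cl (p ` s) \<and> fv \<phi> \<subseteq> {..<length es}"
  have eq: "map k es = map (shift s p q) es" using a assms(2) by auto
  obtain D h where h: "realign s p q D h" "list_all2 (transports D h) es (map (shift s p q) es)"
    using shift_list[OF assms(1)] a by blast
  show "holds N \<phi> es \<longleftrightarrow> holds N \<phi> (map k es)"
    unfolding eq by (rule holds_eq[OF _ h(2)]) (use h(1) a realign_def in auto)
qed

lemma shift_image: assumes "alike s p q" shows "shift s p q ` cl (p ` s) = cl (q ` s)"
proof
  show "shift s p q ` cl (p ` s) \<subseteq> cl (q ` s)" using shift_cl[OF assms] by blast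
  show "cl (q ` s) \<subseteq> shift s p q ` cl (p ` s)"
  proof
    fix f assume f: "f \<in> cl (q ` s)"
    obtain D h where h: "realign s q p D h" "transports D h f (shift s q p f)" using shift_ex[OF alike_sym[OF assms] f] .
    have "piso D h" using h(1) unfolding realign_def by blast
    then have "shift s p q (shift s q p f) = f"
      by (intro shift_eq[OF shift_cl[OF alike_sym[OF assms] f] realign_inv[OF h(1)]] transports_inv h(2))
    then show "f \<in> shift s p q ` cl (p ` s)" using shift_cl[OF alike_sym[OF assms] f] by (metis imageI)
  qed
qed

text \<open>Since the closure of home elements is their definable closure, an elementary map on it
  is determined by the images of these elements.\<close>

lemma elementary_rigid:
  assumes s: "finite s" "p ` s \<subseteq> univ M" and k: "elementary_on N (cl (p ` s)) k"
    and v: "\<And>i. i \<in> s \<Longrightarrow> k (home M (p i)) = home M (q i)"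
  shows "alike s p q" "e \<in> cl (p ` s) \<Longrightarrow> k e = shift s p q e"
proof -
  obtain js where js: "set js = s" using finite_list[OF s(1)] by blast
  have hN: "set (map (\<lambda>i. home M (p i)) js) \<subseteq> cl (p ` s)" using js cl_home s(2) by auto
  have main: "\<exists>D h. realign s p q D h \<and> list_all2 (transports D h) es (map k es)" if es: "set es \<subseteq> cl (p ` s)" for es
  proof -
    let ?hs = "map (\<lambda>i. home M (p i)) js"
    have 1: "set (?hs @ es) \<subseteq> cl (p ` s)" using hN es by simp
    obtain D h where h: "piso D h" "list_all2 (transports D h) (?hs @ es) (map k (?hs @ es))"
      using elementary_transports[OF k 1] 1 cl_total by blast
    have h2: "list_all2 (transports D h) ?hs (map k ?hs)" "list_all2 (transports D h) es (map k es)"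
      using h(2) by (simp_all add: list_all2_append)
    have "p i \<in> D \<and> h (p i) = q i" if "i \<in> s" for i
    proof -
      have "transports D h (home M (p i)) (k (home M (p i)))"
        using h2(1) that js by (auto simp: list_all2_map1 list_all2_map2 list_all2_same)
      then have "p i \<in> D \<and> home M (q i) = home M (h (p i))" using transports_home_iff[OF h(1)] v[OF that] by metis
      then show ?thesis by simp
    qed
    then show ?thesis using h(1) h2(2) unfolding realign_def by blast
  qed
  show "alike s p q" using main[of "[]"] unfolding alike_def by auto
  show "k e = shift s p q e" if e: "e \<in> cl (p ` s)"
  proof -
    obtain D h where "realign s p q D h" "transports D h e (k e)" using main[of "[e]"] e by auto
    then show ?thesis using shift_eq[OF e] by simp
  qed
qed

end

lemma mod_diff_add_eq: "(a mod m - b mod m + c mod m) mod m = (a - b + c) mod (m :: int)"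
  by (subst mod_add_eq[symmetric], subst mod_diff_eq, simp add: mod_add_eq)

context rotation_cover
begin

section \<open>Functors given by families of points\<close>

text \<open>\<open>p u i\<close> plays the image in the object at u of the generator of the vertex
  i. The clause with \<open>alike\<close> makes the transition maps elementary. The last clause is
  independence, in the form given by \<open>thorn_indep_orb\<close> and
  \<open>not_thorn_indep\<close>.\<close>

definition coherent :: "nat set \<Rightarrow> (nat set \<Rightarrow> nat \<Rightarrow> 'a) \<Rightarrow> bool" where
  "coherent s p \<longleftrightarrow> finite s \<and> (\<forall>u\<subseteq>s. p u ` u \<subseteq> univ M) \<and> (\<forall>v\<subseteq>s. \<forall>u\<subseteq>v. alike u (p u) (p v)) \<and>
     (\<forall>u\<subseteq>s. \<forall>i\<in>u. \<forall>j\<in>u. i \<noteq> j \<longrightarrow> p u i \<notin> orb {p u j})"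

text \<open>The values off the domain are \<open>undefined\<close> and the maps are restricted, as
  the extensional functors of the category demand; so a functor can be equal to such a
  record.\<close>

definition std :: "nat set \<Rightarrow> (nat set \<Rightarrow> nat \<Rightarrow> 'a) \<Rightarrow> 'a imag sfunctor" where
  "std s p = \<lparr> Dom = Pow s, Ob = restrict (\<lambda>u. cl (p u ` u)) (Pow s),
     Mor = (\<lambda>u v. if v \<subseteq> s \<and> u \<subseteq> v then restrict (shift u (p u) (p v)) (cl (p u ` u)) else undefined) \<rparr>"

lemma std_simps [simp]:
  "Dom (std s p) = Pow s"
  "u \<subseteq> s \<Longrightarrow> Ob (std s p) u = cl (p u ` u)"
  "v \<subseteq> s \<Longrightarrow> u \<subseteq> v \<Longrightarrow> Mor (std s p) u v = restrict (shift u (p u) (p v)) (cl (p u ` u))"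
  "Defs.supp (std s p) = s"
  by (auto simp: std_def Defs.supp_def)

lemma coherentD:
  assumes "coherent s p"
  shows "finite s" "u \<subseteq> s \<Longrightarrow> p u ` u \<subseteq> univ M" "v \<subseteq> s \<Longrightarrow> u \<subseteq> v \<Longrightarrow> alike u (p u) (p v)"
    "u \<subseteq> s \<Longrightarrow> i \<in> u \<Longrightarrow> j \<in> u \<Longrightarrow> i \<noteq> j \<Longrightarrow> p u i \<notin> orb {p u j}" "u \<subseteq> s \<Longrightarrow> i \<in> u \<Longrightarrow> p u i \<in> univ M"
proof -
  note c = assms[unfolded coherent_def]
  note c1 = c[THEN conjunct1] and c2 = c[THEN conjunct2, THEN conjunct1, rule_format]
    and c3 = c[THEN conjunct2, THEN conjunct2, THEN conjunct1, rule_format]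
    and c4 = c[THEN conjunct2, THEN conjunct2, THEN conjunct2, rule_format]
  show "finite s" by (rule c1)
  show "u \<subseteq> s \<Longrightarrow> p u ` u \<subseteq> univ M" by (rule c2)
  show "v \<subseteq> s \<Longrightarrow> u \<subseteq> v \<Longrightarrow> alike u (p u) (p v)" by (rule c3)
  show "u \<subseteq> s \<Longrightarrow> i \<in> u \<Longrightarrow> j \<in> u \<Longrightarrow> i \<noteq> j \<Longrightarrow> p u i \<notin> orb {p u j}" by (rule c4)
  show "u \<subseteq> s \<Longrightarrow> i \<in> u \<Longrightarrow> p u i \<in> univ M" using c2[of u] imageI[of i u "p u"] by (rule subsetD)
qed

lemma coherent_subset:
  assumes c: "coherent s p" and t: "t \<subseteq> s" shows "coherent t p"
  unfolding coherent_def
proof (intro conjI allI impI ballI)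
  show "finite t" using finite_subset[OF t coherentD(1)[OF c]] .
  show "p u ` u \<subseteq> univ M" if "u \<subseteq> t" for u by (rule coherentD(2)[OF c subset_trans[OF that t]])
  show "alike u (p u) (p v)" if "v \<subseteq> t" "u \<subseteq> v" for u v
    by (rule coherentD(3)[OF c subset_trans[OF that(1) t] that(2)])
  show "p u i \<notin> orb {p u j}" if "u \<subseteq> t" "i \<in> u" "j \<in> u" "i \<noteq> j" for u i j
    by (rule coherentD(4)[OF c subset_trans[OF that(1) t] that(2-4)])
qed

lemma std_cong:
  assumes "\<And>u i. u \<subseteq> s \<Longrightarrow> i \<in> u \<Longrightarrow> p u i = q u i" shows "std s p = std s q"
proof -
  have 1: "p u ` u = q u ` u" if "u \<subseteq> s" for u using assms that by auto
  have 2: "shift u (p u) (p v) = shift u (q u) (q v)" if "v \<subseteq> s" "u \<subseteq> v" for u v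
    using assms that by (intro ext shift_cong) blast+
  have "restrict (\<lambda>u. cl (p u ` u)) (Pow s) = restrict (\<lambda>u. cl (q u ` u)) (Pow s)"
    by (rule restrict_ext) (simp add: 1)
  moreover have "(if v \<subseteq> s \<and> u \<subseteq> v then restrict (shift u (p u) (p v)) (cl (p u ` u)) else undefined) =
    (if v \<subseteq> s \<and> u \<subseteq> v then restrict (shift u (q u) (q v)) (cl (q u ` u)) else undefined)" for u v
    using 1[of u] 2[of v u] by auto
  ultimately show ?thesis unfolding std_def by simp
qed

lemma img_std:
  assumes "coherent s p" "v \<subseteq> s" "u \<subseteq> v" shows "img (std s p) u v = cl (p v ` u)"
proof -
  have "u \<subseteq> s" using assms by blast
  then have "img (std s p) u v = shift u (p u) (p v) ` cl (p u ` u)"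
    unfolding img_def using assms by (simp cong: image_cong)
  then show ?thesis using shift_image[OF coherentD(3)[OF assms]] by simp
qed

lemma realizes_p: "x \<in> univ M \<Longrightarrow> realizes M (p_type M) x"
  unfolding realizes_def p_type_def by blast

text \<open>Functoriality is composition of shifts; closedness and independence are read off from
  the supports by \<open>acl_UN_cl\<close> and \<open>thorn_indep_orb\<close>.\<close>

lemma std_in_A_fam:
  assumes c: "coherent s p" and \<kappa>: "natLeq <o (\<kappa> :: 'a rel)"
  shows "std s p \<in> A_fam \<kappa> M"
  unfolding A_fam_def closed_indep_functors_def
proof (intro CollectI conjI allI ballI impI)
  note cD = coherentD[OF c]
  show "C_functor \<kappa> M (std s p)"
    unfolding C_functor_def
  proof (intro conjI allI ballI impI)
    show "primitive_category (Dom (std s p))" unfolding primitive_category_def using cD(1) by auto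
    show "Ob (std s p) \<in> extensional (Dom (std s p))" by (simp add: std_def)
    show "Mor (std s p) u v = undefined" if "\<not> (u \<in> Dom (std s p) \<and> v \<in> Dom (std s p) \<and> u \<subseteq> v)" for u v
      using that by (auto simp: std_def)
    show "C_obj \<kappa> M (Ob (std s p) u)" if "u \<in> Dom (std s p)" for u
    proof -
      have u: "u \<subseteq> s" using that by simp
      have "countable (cl (p u ` u))"
        using countable_cl[of "p u ` u"] finite_subset[OF u cD(1)] cD(2)[OF u] by blast
      then have "|cl (p u ` u)| <o \<kappa>" using countable_card_le_natLeq ordLeq_ordLess_trans[OF _ \<kappa>] by blast
      then show ?thesis unfolding C_obj_def using u cl_total B0_cl by simp
    qed
    show "C_mor M (Ob (std s p) u) (Ob (std s p) v) (Mor (std s p) u v)"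
      if "u \<in> Dom (std s p)" "v \<in> Dom (std s p)" "u \<subseteq> v" for u v
    proof -
      have uv: "u \<subseteq> s" "v \<subseteq> s" using that by auto
      have al: "alike u (p u) (p v)" by (rule cD(3)[OF uv(2) that(3)])
      have "shift u (p u) (p v) e \<in> cl (p v ` v)" if "e \<in> cl (p u ` u)" for e
        using shift_cl[OF al that] cl_mono[OF image_mono[OF \<open>u \<subseteq> v\<close>]] by blast
      moreover have "elementary_on N (cl (p u ` u)) (restrict (shift u (p u) (p v)) (cl (p u ` u)))"
        by (rule shift_elementary[OF al]) simp
      moreover have "restrict (shift u (p u) (p v)) (cl (p u ` u)) e = e" if "e \<in> B0 M" for e
      proof -
        have "e \<in> cl (p u ` u)" using that B0_cl by blast
        then show ?thesis using shift_fixed[OF al] supp_B0[OF that] by simp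
      qed
      ultimately show ?thesis unfolding C_mor_def using uv that by auto
    qed
    show "Mor (std s p) u u = restrict id (Ob (std s p) u)" if "u \<in> Dom (std s p)" for u
    proof -
      have u: "u \<subseteq> s" using that by simp
      show ?thesis using u
        by (auto intro!: restrict_ext shift_id simp: finite_subset[OF u cD(1)] cD(2)[OF u, THEN subsetD])
    qed
    show "Mor (std s p) u w = compose (Ob (std s p) u) (Mor (std s p) v w) (Mor (std s p) u v)"
      if "u \<in> Dom (std s p)" "v \<in> Dom (std s p)" "w \<in> Dom (std s p)" "u \<subseteq> v \<and> v \<subseteq> w" for u v w
    proof -
      have uv: "u \<subseteq> s" "v \<subseteq> s" "w \<subseteq> s" "u \<subseteq> v" "v \<subseteq> w" "u \<subseteq> w" using that by auto
      have "shift u (p u) (p w) e = restrict (shift v (p v) (p w)) (cl (p v ` v)) (shift u (p u) (p v) e)"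
        if e: "e \<in> cl (p u ` u)" for e
      proof -
        have f: "shift u (p u) (p v) e \<in> cl (p v ` u)" by (rule shift_cl[OF cD(3)[OF uv(2,4)] e])
        then have f': "shift u (p u) (p v) e \<in> cl (p v ` v)" using cl_mono[OF image_mono[OF uv(4)]] by blast
        have "shift v (p v) (p w) (shift u (p u) (p v) e) = shift u (p v) (p w) (shift u (p u) (p v) e)"
          by (rule shift_subset[OF cD(3)[OF uv(3,5)] uv(4) f, symmetric])
        also have "\<dots> = shift u (p u) (p w) e"
          by (rule shift_comp[OF cD(3)[OF uv(2,4)] alike_subset[OF cD(3)[OF uv(3,5)] uv(4)] e])
        finally show ?thesis using f' by simp
      qed
      then show ?thesis using uv by (simp add: compose_def cong: restrict_cong)
    qed
  qed
  show "\<exists>b. realizes M (p_type M) b \<and> Ob (std s p) {i} = acl_eq M (img (std s p) {} {i} \<union> {home M b}) \<and>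
      thorn_indep N {home M b} (img (std s p) {} {i}) (B0 M)" if "{i} \<in> Dom (std s p)" for i
  proof (intro exI[of _ "p {i} i"] conjI)
    have i: "{i} \<subseteq> s" using that by simp
    have U: "p {i} i \<in> univ M" using cD(5)[OF i] by simp
    show "realizes M (p_type M) (p {i} i)" using realizes_p[OF U] .
    have im: "img (std s p) {} {i} = B0 M" using img_std[OF c i, of "{}"] B0_eq by simp
    show "Ob (std s p) {i} = acl_eq M (img (std s p) {} {i} \<union> {home M (p {i} i)})"
      unfolding im acl_B0_home[OF U] using i by simp
    show "thorn_indep N {home M (p {i} i)} (img (std s p) {} {i}) (B0 M)"
      unfolding im
      by (rule thorn_indep_orb[OF U gset_empty]) (use home_total[OF U] supp_home[OF U] supp_B0 in auto)
  qed
  fix u assume "u \<in> Dom (std s p)" "u \<noteq> {}"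
  then have u: "u \<subseteq> s" by simp
  have im: "img (std s p) {i} u = cl (p u ` {i})" if "i \<in> u" for i using img_std[OF c u, of "{i}"] that by simp
  have "(\<Union>i\<in>u. img (std s p) {i} u) = (\<Union>i\<in>u. cl (p u ` {i}))" using im by simp
  also have "acl_eq M \<dots> = cl (\<Union>i\<in>u. p u ` {i})" by (rule acl_UN_cl) (use cD(5)[OF u] in auto)
  also have "(\<Union>i\<in>u. p u ` {i}) = p u ` u" by auto
  finally show "Ob (std s p) u = acl_eq M (\<Union>i\<in>u. img (std s p) {i} u)" using u by simp
  show "indep_family N u (\<lambda>i. img (std s p) {i} u) (img (std s p) {} u)"
    unfolding indep_family_def
  proof
    fix i assume i: "i \<in> u"
    have b: "img (std s p) {} u = B0 M" using img_std[OF c u, of "{}"] B0_eq by simp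
    have U: "p u i \<in> univ M" using cD(5)[OF u i] .
    let ?B = "orb (p u ` (u - {i}))"
    have g: "gset ?B" by (rule orb_gset) (use finite_subset[OF u cD(1)] cD(5)[OF u] in auto)
    have nB: "p u i \<notin> ?B"
    proof
      assume "p u i \<in> ?B"
      then obtain j where "j \<in> u" "j \<noteq> i" "p u i \<in> orb {p u j}" unfolding orb_UN[of "p u ` (u - {i})"] by auto
      then show False using cD(4)[OF u i] by auto
    qed
    show "thorn_indep N (img (std s p) {i} u) (\<Union>j\<in>u - {i}. img (std s p) {j} u) (img (std s p) {} u)"
      unfolding b
    proof (rule thorn_indep_orb[OF U g nB])
      show "img (std s p) {i} u \<subseteq> total N" using im[OF i] cl_total by simp
      show "support e \<subseteq> orb {p u i}" if "e \<in> img (std s p) {i} u" for e using that im[OF i] unfolding cl_def by simp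
      show "(\<Union>j\<in>u - {i}. img (std s p) {j} u) \<subseteq> total N" using im cl_total by auto
      fix e assume "e \<in> (\<Union>j\<in>u - {i}. img (std s p) {j} u)"
      then obtain j where j: "j \<in> u - {i}" "e \<in> cl (p u ` {j})" using im by auto
      then have "support e \<subseteq> orb (p u ` {j})" unfolding cl_def by blast
      also have "\<dots> \<subseteq> ?B" by (rule orb_mono) (use j in auto)
      finally show "support e \<subseteq> ?B" .
    qed
  qed
qed

section \<open>From closed independent functors back to families of points\<close>

lemma C_functorD:
  assumes "C_functor \<kappa> M f"
  shows "Ob f \<in> extensional (Dom f)"
    "\<not> (u \<in> Dom f \<and> v \<in> Dom f \<and> u \<subseteq> v) \<Longrightarrow> Mor f u v = undefined"
    "u \<in> Dom f \<Longrightarrow> v \<in> Dom f \<Longrightarrow> u \<subseteq> v \<Longrightarrow> C_mor M (Ob f u) (Ob f v) (Mor f u v)"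
    "u \<in> Dom f \<Longrightarrow> Mor f u u = restrict id (Ob f u)"
    "u \<in> Dom f \<Longrightarrow> v \<in> Dom f \<Longrightarrow> w \<in> Dom f \<Longrightarrow> u \<subseteq> v \<Longrightarrow> v \<subseteq> w \<Longrightarrow>
       Mor f u w = compose (Ob f u) (Mor f v w) (Mor f u v)"
proof -
  note c = assms[unfolded C_functor_def, THEN conjunct2]
  note c1 = c[THEN conjunct1] and c2 = c[THEN conjunct2, THEN conjunct1, rule_format]
    and d = c[THEN conjunct2, THEN conjunct2, THEN conjunct2]
  note d1 = d[THEN conjunct1, rule_format] and d2 = d[THEN conjunct2, THEN conjunct1, rule_format]
    and d3 = d[THEN conjunct2, THEN conjunct2, rule_format]
  show "Ob f \<in> extensional (Dom f)" by (rule c1)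
  show "Mor f u v = undefined" if "\<not> (u \<in> Dom f \<and> v \<in> Dom f \<and> u \<subseteq> v)" by (rule c2[OF that])
  show "C_mor M (Ob f u) (Ob f v) (Mor f u v)" if "u \<in> Dom f" "v \<in> Dom f" "u \<subseteq> v" by (rule d1[OF that])
  show "Mor f u u = restrict id (Ob f u)" if "u \<in> Dom f" by (rule d2[OF that])
  show "Mor f u w = compose (Ob f u) (Mor f v w) (Mor f u v)"
    if "u \<in> Dom f" "v \<in> Dom f" "w \<in> Dom f" "u \<subseteq> v" "v \<subseteq> w" by (rule d3[OF that(1-3) conjI[OF that(4,5)]])
qed

lemma A_famD:
  assumes "f \<in> A_fam \<kappa> M"
  shows "C_functor \<kappa> M f"
    "{i} \<in> Dom f \<Longrightarrow> \<exists>b. realizes M (p_type M) b \<and> Ob f {i} = acl_eq M (img f {} {i} \<union> {home M b})"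
    "u \<in> Dom f \<Longrightarrow> u \<noteq> {} \<Longrightarrow> Ob f u = acl_eq M (\<Union>i\<in>u. img f {i} u)"
    "u \<in> Dom f \<Longrightarrow> u \<noteq> {} \<Longrightarrow> indep_family N u (\<lambda>i. img f {i} u) (img f {} u)"
proof -
  note c = assms[unfolded A_fam_def closed_indep_functors_def, THEN CollectD]
  note c2 = c[THEN conjunct2, THEN conjunct1, rule_format]
    and c3 = c[THEN conjunct2, THEN conjunct2, rule_format]
  show "C_functor \<kappa> M f" by (rule c[THEN conjunct1])
  show "\<exists>b. realizes M (p_type M) b \<and> Ob f {i} = acl_eq M (img f {} {i} \<union> {home M b})" if "{i} \<in> Dom f"
    using c2[OF that] by (elim exE conjE, intro exI conjI)
  show "Ob f u = acl_eq M (\<Union>i\<in>u. img f {i} u)" if "u \<in> Dom f" "u \<noteq> {}" by (rule c3[OF that, THEN conjunct1])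
  show "indep_family N u (\<lambda>i. img f {i} u) (img f {} u)" if "u \<in> Dom f" "u \<noteq> {}"
    by (rule c3[OF that, THEN conjunct2])
qed

lemma img_empty:
  assumes f: "f \<in> A_fam \<kappa> M" "{} \<in> Dom f" "u \<in> Dom f" "Ob f {} = B0 M"
  shows "img f {} u = B0 M"
proof -
  have "C_mor M (Ob f {}) (Ob f u) (Mor f {} u)"
    by (rule C_functorD(3)[OF A_famD(1)[OF f(1)] f(2,3)]) simp
  then have "\<forall>e\<in>B0 M. Mor f {} u e = e" unfolding C_mor_def by simp
  then show ?thesis unfolding img_def f(4) by simp
qed

lemma A_fam_vertex:
  assumes f: "f \<in> A_fam \<kappa> M" "Dom f = Pow s" "Ob f {} = B0 M" and i: "i \<in> s"
  shows "\<exists>v\<in>univ M. Ob f {i} = cl {v}"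
proof -
  have D: "{i} \<in> Dom f" "{} \<in> Dom f" using assms by auto
  obtain b where b: "realizes M (p_type M) b" "Ob f {i} = acl_eq M (img f {} {i} \<union> {home M b})"
    using A_famD(2)[OF f(1) D(1)] by (elim exE conjE)
  have "b \<in> univ M" using b(1) unfolding realizes_def by (rule conjunct1)
  then show ?thesis using b(2) acl_B0_home[of b] img_empty[OF f(1) D(2,1) f(3)] by auto
qed

text \<open>Every functor with domain \<open>Pow s\<close> arises in this way, for any choice of generators of its
  vertices.\<close>

lemma A_fam_std:
  assumes f: "f \<in> A_fam \<kappa> M" "Dom f = Pow s" "Ob f {} = B0 M" "finite s"
    and v: "\<And>i. i \<in> s \<Longrightarrow> v i \<in> univ M \<and> Ob f {i} = cl {v i}"
  shows "\<exists>p. coherent s p \<and> (\<forall>i\<in>s. p {i} i = v i) \<and> f = std s p \<and>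
    (\<forall>u\<subseteq>s. \<forall>i\<in>u. Mor f {i} u (home M (v i)) = home M (p u i))"
proof -
  have cf: "C_functor \<kappa> M f" by (rule A_famD(1)[OF f(1)])
  have mor: "C_mor M (Ob f u) (Ob f w) (Mor f u w)" if "w \<subseteq> s" "u \<subseteq> w" for u w
    by (rule C_functorD(3)[OF cf]) (use that f(2) in auto)
  have el: "elementary_on N (Ob f u) (Mor f u w)" if "w \<subseteq> s" "u \<subseteq> w" for u w
    using mor[OF that] unfolding C_mor_def by blast
  \<comment> \<open>A morphism is elementary and hence sends home elements to home elements; p names
    the image of the generator.\<close>
  define p where "p u i = (SOME y. y \<in> univ M \<and> Mor f {i} u (home M (v i)) = home M y)" for u i
  have p: "p u i \<in> univ M \<and> Mor f {i} u (home M (v i)) = home M (p u i)" if u: "u \<subseteq> s" and i: "i \<in> u" for u i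
  proof -
    have iU: "v i \<in> univ M" "Ob f {i} = cl {v i}" using v[of i] u i by auto
    have h: "set [home M (v i)] \<subseteq> Ob f {i}" using iU cl_home[of "{v i}" "v i"] by simp
    have "\<exists>D h. piso D h \<and> list_all2 (transports D h) [home M (v i)] (map (Mor f {i} u) [home M (v i)])"
      by (rule elementary_transports[OF el[OF u] h]) (use i home_total[OF iU(1)] in auto)
    then obtain D h where h: "piso D h" "transports D h (home M (v i)) (Mor f {i} u (home M (v i)))" by auto
    then have "v i \<in> D \<and> Mor f {i} u (home M (v i)) = home M (h (v i))" by (rule transports_home_iff)
    then have "h (v i) \<in> univ M \<and> Mor f {i} u (home M (v i)) = home M (h (v i))" using piso_in_univ[OF h(1)] by blast
    then show ?thesis unfolding p_def by (rule someI)
  qed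
  have pv: "p {i} i = v i" if "i \<in> s" for i
  proof -
    have "Mor f {i} {i} = restrict id (Ob f {i})" by (rule C_functorD(4)[OF cf]) (use that f(2) in simp)
    moreover have "home M (v i) \<in> Ob f {i}" using v[OF that] cl_home[of "{v i}" "v i"] by simp
    ultimately have "Mor f {i} {i} (home M (v i)) = home M (v i)" by simp
    then show ?thesis using p[of "{i}" i] that by simp
  qed
  have im: "img f {i} u = cl {p u i}" if u: "u \<subseteq> s" and i: "i \<in> u" for u i
  proof -
    have iu: "{i} \<subseteq> u" using i by simp
    have iU: "v ` {i} \<subseteq> univ M" "Ob f {i} = cl (v ` {i})" using v[of i] u i by auto
    have 1: "elementary_on N (cl (v ` {i})) (Mor f {i} u)" using el[OF u iu] iU by simp
    have al: "alike {i} v (p u)"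
      by (rule elementary_rigid(1)[OF _ iU(1) 1]) (use p[OF u i] in auto)
    have "Mor f {i} u e = shift {i} v (p u) e" if "e \<in> cl (v ` {i})" for e
      by (rule elementary_rigid(2)[OF _ iU(1) 1 _ that]) (use p[OF u i] in auto)
    then have "img f {i} u = shift {i} v (p u) ` cl (v ` {i})" unfolding img_def iU(2) by (rule image_cong[OF refl])
    then show ?thesis using shift_image[OF al] by simp
  qed
  have ob: "Ob f u = cl (p u ` u)" if u: "u \<subseteq> s" for u
  proof (cases "u = {}")
    case True
    then show ?thesis using f(3) B0_eq by simp
  next
    case False
    have "Ob f u = acl_eq M (\<Union>i\<in>u. img f {i} u)"
      by (rule A_famD(3)[OF f(1) _ False]) (use u f(2) in simp)
    also have "(\<Union>i\<in>u. img f {i} u) = (\<Union>i\<in>u. cl {p u i})" using im[OF u] by simp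
    also have "acl_eq M \<dots> = cl (\<Union>i\<in>u. {p u i})" by (rule acl_UN_cl) (use p[OF u] in auto)
    also have "(\<Union>i\<in>u. {p u i}) = p u ` u" by auto
    finally show ?thesis .
  qed
  have pU: "p u ` u \<subseteq> univ M" if "u \<subseteq> s" for u using p[OF that] by auto
  have mp: "Mor f u w (home M (p u i)) = home M (p w i)" if uw: "w \<subseteq> s" "u \<subseteq> w" and i: "i \<in> u" for u w i
  proof -
    have us: "u \<subseteq> s" "{i} \<subseteq> u" "i \<in> s" "i \<in> w" using uw i by auto
    have "Mor f {i} w = compose (Ob f {i}) (Mor f u w) (Mor f {i} u)"
      by (rule C_functorD(5)[OF cf]) (use us uw f(2) in auto)
    moreover have "home M (v i) \<in> Ob f {i}" using v[OF us(3)] cl_home[of "{v i}" "v i"] by simp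
    ultimately have "Mor f {i} w (home M (v i)) = Mor f u w (Mor f {i} u (home M (v i)))"
      by (simp add: compose_eq)
    then show ?thesis using p[OF us(1) i] p[OF uw(1) us(4)] by simp
  qed
  have fin: "finite u" if "u \<subseteq> s" for u using finite_subset[OF that f(4)] .
  have al: "alike u (p u) (p w)" if uw: "w \<subseteq> s" "u \<subseteq> w" for u w
  proof -
    have us: "u \<subseteq> s" using uw by blast
    show ?thesis
      by (rule elementary_rigid(1)[OF fin[OF us] pU[OF us] el[OF uw, unfolded ob[OF us]] mp[OF uw]])
  qed
  have sh: "Mor f u w e = shift u (p u) (p w) e" if uw: "w \<subseteq> s" "u \<subseteq> w" and e: "e \<in> cl (p u ` u)" for u w e
  proof -
    have us: "u \<subseteq> s" using uw by blast
    show ?thesis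
      by (rule elementary_rigid(2)[OF fin[OF us] pU[OF us] el[OF uw, unfolded ob[OF us]] mp[OF uw] e])
  qed
  have c: "coherent s p" unfolding coherent_def
  proof (intro conjI allI impI ballI)
    show "finite s" by fact
    show "p u ` u \<subseteq> univ M" if "u \<subseteq> s" for u by (rule pU[OF that])
    show "alike u (p u) (p w)" if "w \<subseteq> s" "u \<subseteq> w" for u w by (rule al[OF that])
    fix u i j assume u: "u \<subseteq> s" and ij: "i \<in> u" "j \<in> u" "i \<noteq> j"
    have b: "img f {} u = B0 M" by (rule img_empty[OF f(1) _ _ f(3)]) (use u f(2) in auto)
    have "u \<noteq> {}" "u \<in> Dom f" using ij u f(2) by auto
    then have "indep_family N u (\<lambda>i. img f {i} u) (img f {} u)"
      by (intro A_famD(4)[OF f(1)])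
    then have ind: "thorn_indep N (img f {i} u) (\<Union>k\<in>u - {i}. img f {k} u) (B0 M)"
      unfolding indep_family_def b using ij(1) by blast
    have h: "home M (p u k) \<in> img f {k} u" if "k \<in> u" for k
      unfolding im[OF u that] by (rule cl_home) (use p[OF u that] in auto)
    have h2: "home M (p u j) \<in> (\<Union>k\<in>u - {i}. img f {k} u)" using h[OF ij(2)] ij by blast
    \<comment> \<open>Two points on one orbit are rotations of each other, and
      \<open>not_thorn_indep\<close> turns that into dependence of the vertices.\<close>
    show "p u i \<notin> orb {p u j}"
      using not_thorn_indep[OF _ _ h[OF ij(1)] h2] ind p[OF u ij(2)] by blast
  qed
  have "f = std s p"
  proof (rule sfunctor.equality)
    show "Dom f = Dom (std s p)" using f(2) by simp
    have "Ob f \<in> extensional (Pow s)" using C_functorD(1)[OF cf] f(2) by simp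
    then show "Ob f = Ob (std s p)"
      by (intro extensionalityI[of _ "Pow s"]) (auto simp: ob std_def)
    show "Mor f = Mor (std s p)"
    proof (intro ext)
      fix u w
      show "Mor f u w x = Mor (std s p) u w x" for x
      proof (cases "w \<subseteq> s \<and> u \<subseteq> w")
        case True
        then have us: "u \<subseteq> s" by blast
        have "Mor f u w \<in> extensional (cl (p u ` u))"
          using mor[of w u] True ob[OF us] unfolding C_mor_def PiE_def by auto
        then have "Mor f u w = restrict (shift u (p u) (p w)) (cl (p u ` u))"
          using sh[of w u] True by (intro extensionalityI[of _ "cl (p u ` u)"]) auto
        then show ?thesis using True by simp
      next
        case False
        then have "\<not> (u \<in> Dom f \<and> w \<in> Dom f \<and> u \<subseteq> w)" using f(2) by auto
        then have "Mor f u w = undefined" by (rule C_functorD(2)[OF cf])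
        then show ?thesis using False by (auto simp: std_def)
      qed
    qed
  qed simp
  then show ?thesis using c pv p by blast
qed

lemma restr_std: "t \<subseteq> s \<Longrightarrow> restr (std s p) (Pow t) = std t p"
  unfolding restr_def std_def by (auto simp: fun_eq_iff restrict_def)

lemma face_std: "face i (std s p) = std (s - {sorted_list_of_set s ! i}) p"
  unfolding face_def std_simps by (rule restr_std) blast


section \<open>Distances\<close>

text \<open>The integer part of the displacement from a to b, one shift being the unit.\<close>

definition gap :: "'k \<Rightarrow> 'k \<Rightarrow> int" where
  "gap a b = (THE k. \<not> b \<prec> sh k a \<and> b \<prec> sh (k + 1) a)"

lemma gap_eqI:
  assumes "a \<in> K" "b \<in> K" "\<not> b \<prec> sh k a" "b \<prec> sh (k + 1) a" shows "gap a b = k"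
  unfolding gap_def by (rule the_equality) (use assms floor_unique in blast)+

lemma gap:
  assumes "a \<in> K" "b \<in> K" shows "\<not> b \<prec> sh (gap a b) a" "b \<prec> sh (gap a b + 1) a"
proof -
  obtain k where k: "\<not> b \<prec> sh k a" "b \<prec> sh (k + 1) a" using floor_exists[OF assms] by blast
  then show "\<not> b \<prec> sh (gap a b) a" "b \<prec> sh (gap a b + 1) a" using gap_eqI[OF assms k] by auto
qed

lemma gap_sh: assumes "a \<in> K" "b \<in> K" shows "gap (sh i a) (sh j b) = gap a b + j - i"
proof (rule gap_eqI)
  have e: "sh (gap a b + j - i) (sh i a) = sh j (sh (gap a b) a)"
    "sh (gap a b + j - i + 1) (sh i a) = sh j (sh (gap a b + 1) a)"
    by (simp_all add: sh_sh algebra_simps)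
  show "\<not> sh j b \<prec> sh (gap a b + j - i) (sh i a)" "sh j b \<prec> sh (gap a b + j - i + 1) (sh i a)"
    unfolding e sh_lt_iff using gap[OF assms] by auto
qed (use assms in auto)

text \<open>Other lifts change the gap by multiples of n. For points on different orbits this is the
  k of \<open>S_hat_d\<close> between 0 and n - 1 (\<open>S_hat_d_iff\<close>).\<close>

definition dist :: "'a \<Rightarrow> 'a \<Rightarrow> int" where
  "dist x y = gap (SOME a. a \<in> K \<and> pr a = x) (SOME b. b \<in> K \<and> pr b = y) mod int n"

lemma dist_pr: assumes "a \<in> K" "b \<in> K" shows "dist (pr a) (pr b) = gap a b mod int n"
proof -
  define a' where "a' = (SOME c. c \<in> K \<and> pr c = pr a)"
  define b' where "b' = (SOME c. c \<in> K \<and> pr c = pr b)"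
  have a': "a' \<in> K" "pr a' = pr a" unfolding a'_def using someI[of "\<lambda>c. c \<in> K \<and> pr c = pr a" a] assms by auto
  have b': "b' \<in> K" "pr b' = pr b" unfolding b'_def using someI[of "\<lambda>c. c \<in> K \<and> pr c = pr b" b] assms by auto
  obtain i where i: "a' = sh (int n * i) a" using pr_eq_iff[of a a'] a' assms by auto
  obtain j where j: "b' = sh (int n * j) b" using pr_eq_iff[of b b'] b' assms by auto
  have "gap a' b' = gap a b + int n * (j - i)" unfolding i j using gap_sh[OF assms] by (simp add: algebra_simps)
  then have "gap a' b' mod int n = gap a b mod int n" by simp
  then show ?thesis unfolding dist_def a'_def b'_def .
qed

lemma dist_range: "0 \<le> dist x y" "dist x y < int n"
  unfolding dist_def using n_gt_1 by auto

lemma notin_orb_lift: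
  assumes "a \<in> K" "b \<in> K" "pr b \<notin> orb {pr a}" shows "b \<noteq> sh k a" "sh (gap a b) a \<prec> b"
proof -
  show ne: "b \<noteq> sh k a" for k using assms(3) orb_pr[OF assms(1)] by auto
  show "sh (gap a b) a \<prec> b" using gap(1)[OF assms(1,2)] ne lt_total[of b "sh (gap a b) a"] assms by auto
qed

text \<open>The gap is defined by comparing lifts with shifts, and \<open>t\<close> respects
  both.\<close>

lemma dist_piso:
  assumes "piso D h" "x \<in> D" "y \<in> D" shows "dist (h x) (h y) = dist x y"
proof -
  obtain t where t: "lifting D h t" using assms piso_def by blast
  obtain a where a: "a \<in> lifts D" "pr a = x" "a \<in> K" using piso_lift[OF assms(1,2)] .
  obtain b where b: "b \<in> lifts D" "pr b = y" "b \<in> K" using piso_lift[OF assms(1,3)] .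
  have ta: "t a \<in> K" "pr (t a) = h x" "\<And>k. t (sh k a) = sh k (t a)" using t a unfolding lifting_def by auto
  have tb: "t b \<in> K" "pr (t b) = h y" using t b unfolding lifting_def by auto
  have sl: "sh k a \<in> lifts D" for k using a(1) piso_gset[OF assms(1)] by simp
  have "gap (t a) (t b) = gap a b"
    by (rule gap_eqI[OF ta(1) tb(1)]; unfold ta(3)[symmetric] lifting_lt_iff[OF t b(1) sl])
       (rule gap[OF a(3) b(3)])+
  then show ?thesis using dist_pr[OF ta(1) tb(1)] dist_pr[OF a(3) b(3)] ta tb a b by simp
qed

text \<open>Shifting the lift of y' by full turns makes the two gaps agree. Then b and b' have the
  same position relative to the shifts of a and a', which are the only lifts to respect.\<close>

lemma piso_of_dist:
  assumes U: "x \<in> univ M" "y \<in> univ M" "x' \<in> univ M" "y' \<in> univ M"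
    and n: "y \<notin> orb {x}" "y' \<notin> orb {x'}" and d: "dist x y = dist x' y'"
  shows "\<exists>D h. piso D h \<and> x \<in> D \<and> y \<in> D \<and> h x = x' \<and> h y = y'"
proof -
  obtain a where a: "a \<in> K" "pr a = x" using pr_surj U by blast
  obtain b where b: "b \<in> K" "pr b = y" using pr_surj U by blast
  obtain a' where a': "a' \<in> K" "pr a' = x'" using pr_surj U by blast
  obtain b0 where b0: "b0 \<in> K" "pr b0 = y'" using pr_surj U by blast
  have "gap a b mod int n = gap a' b0 mod int n"
    using d dist_pr[OF a(1) b(1)] dist_pr[OF a'(1) b0(1)] a b a' b0 by simp
  then have "int n dvd gap a b - gap a' b0" by (metis mod_eq_dvd_iff)
  then obtain j where j: "gap a b = gap a' b0 + int n * j" by (metis add.commute diff_add_cancel dvdE)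
  define b' where "b' = sh (int n * j) b0"
  have b': "b' \<in> K" "pr b' = y'" unfolding b'_def using b0 by auto
  have gb: "gap a' b' = gap a b" unfolding b'_def using gap_sh[OF a'(1) b0(1), of 0 "int n * j"] j by (simp add: sh_0)
  have ab: "sh (gap a b) a \<prec> b" using notin_orb_lift(2)[OF a(1) b(1)] n a b by simp
  have ab': "sh (gap a b) a' \<prec> b'" using notin_orb_lift(2)[OF a'(1) b'(1)] n a' b' gb by simp
  have ab2: "b \<prec> sh (gap a b + 1) a" "b' \<prec> sh (gap a b + 1) a'" using gap(2)[OF a(1) b(1)] gap(2)[OF a'(1) b'(1)] gb by auto
  have l0: "lifting {} (\<lambda>x. x) (\<lambda>x. x)" unfolding lifting_def lifts_def by auto
  obtain h t where h: "lifting ({} \<union> orb {pr a}) h t" "h (pr a) = pr a'" "t a = a'"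
    using lifting_extend[OF gset_empty l0 a(1) _ a'(1)] by (auto simp: lifts_def)
  then have h1: "lifting (orb {x}) h t" using a by simp
  have g: "gset (orb {x})" using orb_gset U by simp
  have al: "a \<in> lifts (orb {x})" using a lifts_def by simp
  have ts: "t (sh i a) = sh i a'" for i using h1 h(3) al unfolding lifting_def by auto
  have L: "\<exists>i. c = sh i a" if c: "c \<in> lifts (orb {x})" for c
  proof -
    have cK: "c \<in> K" "pr c \<in> orb {pr a}" using c a lifts_def by auto
    then obtain i where i: "pr (sh i a) = pr c" using orb_pr[OF a(1)] by auto
    then obtain j where "c = sh (int n * j) (sh i a)" using pr_eq_iff[of "sh i a" c] a cK by auto
    then show ?thesis using sh_sh by blast
  qed
  have i1: "i \<le> gap a b" if "sh i a \<prec> b" for i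
    using lt_trans[OF that ab2(1)] a by simp
  have i2: "gap a b < i" if "b \<prec> sh i a" for i
    using lt_trans[OF ab that] a by simp
  have i1': "sh i a' \<prec> b'" if "i \<le> gap a b" for i
    using that ab' lt_trans[of "sh i a'" "sh (gap a b) a'" b'] a' by (cases "i = gap a b") auto
  have i2': "b' \<prec> sh i a'" if "gap a b < i" for i
    using that ab2(2) lt_trans[of b' "sh (gap a b + 1) a'" "sh i a'"] a' by (cases "i = gap a b + 1") auto
  have cut1: "t c \<prec> b'" if "c \<in> lifts (orb {x})" "c \<prec> b" for c
    using L[OF that(1)] that(2) ts i1 i1' by auto
  have cut2: "b' \<prec> t c" if "c \<in> lifts (orb {x})" "b \<prec> c" for c
    using L[OF that(1)] that(2) ts i2 i2' by auto
  have nb: "pr b \<notin> orb {x}" using n b by simp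
  obtain h' t' where h': "lifting (orb {x} \<union> orb {pr b}) h' t'" "\<forall>z\<in>orb {x}. h' z = h z" "h' (pr b) = pr b'"
    using lifting_extend[OF g h1 b(1) nb b'(1) cut1 cut2] by blast
  have "gset (orb {x} \<union> orb {pr b})" using g gset_Un orb_gset U b by auto
  then have "piso (orb {x} \<union> orb {pr b}) h'" using h' piso_def by blast
  then show ?thesis using h' h a b a' b' by (intro exI[of _ "orb {x} \<union> orb {pr b}"] exI[of _ h']) auto
qed

text \<open>Subtracting the integer parts puts b and c strictly between a and \<open>sh 1 a\<close>,
  where the remaining gap is 0 or -1 according to their order. This carry is \<epsilon>.\<close>

lemma dist_triangle:
  assumes U: "x \<in> univ M" "y \<in> univ M" "z \<in> univ M" and n: "y \<notin> orb {x}" "z \<notin> orb {x}" "z \<notin> orb {y}"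
  shows "\<exists>\<epsilon>\<in>{-1, 0}. (dist y z - dist x z + dist x y) mod int n = \<epsilon> mod int n"
proof -
  obtain a where a: "a \<in> K" "pr a = x" using pr_surj U by blast
  obtain b where b: "b \<in> K" "pr b = y" using pr_surj U by blast
  obtain c where c: "c \<in> K" "pr c = z" using pr_surj U by blast
  define b0 where "b0 = sh (- gap a b) b"
  define c0 where "c0 = sh (- gap a c) c"
  have K0: "b0 \<in> K" "c0 \<in> K" unfolding b0_def c0_def using b c by auto
  have e: "gap b c = gap b0 c0 + gap a c - gap a b"
    unfolding b0_def c0_def using gap_sh[OF b(1) c(1)] by simp
  have b1: "a \<prec> b0" "b0 \<prec> sh 1 a" unfolding b0_def
    using notin_orb_lift(2)[OF a(1) b(1)] gap(2)[OF a(1) b(1)] n a b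
      sh_mono[of b "sh (gap a b + 1) a" "- gap a b"] by (simp_all add: sh_lt_move sh_sh)
  have c1: "a \<prec> c0" "c0 \<prec> sh 1 a" unfolding c0_def
    using notin_orb_lift(2)[OF a(1) c(1)] gap(2)[OF a(1) c(1)] n a c
      sh_mono[of c "sh (gap a c + 1) a" "- gap a c"] by (simp_all add: sh_lt_move sh_sh)
  have "gap b0 c0 \<in> {-1, 0}"
  proof (cases "c0 \<prec> b0")
    case True
    have "gap b0 c0 = -1"
    proof (rule gap_eqI[OF K0])
      have "sh (- 1) b0 \<prec> sh (- 1) (sh 1 a)" using b1(2) by (simp only: sh_lt_iff)
      then have "sh (- 1) b0 \<prec> a" by (simp add: sh_sh sh_0)
      then have "sh (- 1) b0 \<prec> c0" using c1(1) by (rule lt_trans)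
      then show "\<not> c0 \<prec> sh (- 1) b0" using lt_asym by blast
    qed (use True in \<open>simp add: sh_0\<close>)
    then show ?thesis by simp
  next
    case False
    have "gap b0 c0 = 0"
    proof (rule gap_eqI[OF K0])
      have "sh 1 a \<prec> sh 1 b0" using b1(1) by simp
      then have "c0 \<prec> sh 1 b0" by (rule lt_trans[OF c1(2)])
      then show "c0 \<prec> sh (0 + 1) b0" by simp
    qed (use False in \<open>simp add: sh_0\<close>)
    then show ?thesis by simp
  qed
  moreover have "(dist y z - dist x z + dist x y) mod int n = (gap b c - gap a c + gap a b) mod int n"
    using dist_pr[OF a(1) b(1)] dist_pr[OF a(1) c(1)] dist_pr[OF b(1) c(1)] a(2) b(2) c(2)
    by (simp only: mod_diff_add_eq)
  ultimately show ?thesis using e by auto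
qed

text \<open>Two points strictly between a and \<open>sh 1 a\<close>, taken in the order that
  produces the carry \<epsilon>, are shifted by k and by l.\<close>

lemma dist_triangle_exists:
  assumes "\<epsilon> \<in> {-1, 0 :: int}"
  shows "\<exists>x y z. x \<in> univ M \<and> y \<in> univ M \<and> z \<in> univ M \<and> y \<notin> orb {x} \<and> z \<notin> orb {x} \<and> z \<notin> orb {y} \<and>
     dist x y = k mod int n \<and> dist x z = l mod int n \<and> dist y z = (l - k + \<epsilon>) mod int n"
proof -
  obtain a where a: "a \<in> K" using K_ne by blast
  obtain m1 where m1: "a \<prec> m1" "m1 \<prec> sh 1 a" using lt_dense[OF sh_pos[OF a]] by blast
  obtain m2 where m2: "m1 \<prec> m2" "m2 \<prec> sh 1 a" using lt_dense[OF m1(2)] by blast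
  have K12: "m1 \<in> K" "m2 \<in> K" using lt_K[OF m2(1)] by auto
  have am2: "a \<prec> m2" using lt_trans[OF m1(1) m2(1)] .
  have w: "m \<notin> range (\<lambda>k. sh k a) \<and> gap a m = 0" if "a \<prec> m" "m \<prec> sh 1 a" for m
  proof
    show "m \<notin> range (\<lambda>k. sh k a)" using that a by auto
    show "gap a m = 0" by (rule gap_eqI[OF a]) (use that lt_K lt_asym in \<open>auto simp: sh_0\<close>)
  qed
  have g12: "gap m1 m2 = 0"
    by (rule gap_eqI[OF K12]) (use m2 m1 lt_asym lt_trans[OF m2(2), of "sh 1 m1"] in \<open>auto simp: sh_0\<close>)
  have g21: "gap m2 m1 = -1"
  proof (rule gap_eqI[OF K12(2,1)])
    have "sh (- 1) m2 \<prec> sh (- 1) (sh 1 a)" using m2(2) by (simp only: sh_lt_iff)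
    then have "sh (- 1) m2 \<prec> a" by (simp add: sh_sh sh_0)
    then have "sh (- 1) m2 \<prec> m1" using m1(1) by (rule lt_trans)
    then show "\<not> m1 \<prec> sh (- 1) m2" using lt_asym by blast
  qed (use m2(1) in \<open>simp add: sh_0\<close>)
  have n12: "m2 \<noteq> sh i m1" for i
  proof
    assume e: "m2 = sh i m1"
    have "0 < i" using m2(1) K12 e by simp
    moreover have "sh i m1 \<prec> sh 1 m1" using m2(2) m1(1) lt_trans[of "sh i m1" "sh 1 a" "sh 1 m1"] e by simp
    ultimately show False using K12 by simp
  qed
  have no: "pr d \<notin> orb {pr c}" if cd: "c \<in> K" "d \<in> K" "\<And>i. d \<noteq> sh i c" for c d
  proof
    assume "pr d \<in> orb {pr c}"
    then obtain i where "pr (sh i c) = pr d" using orb_pr[OF cd(1)] by auto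
    then obtain j where "d = sh (int n * j) (sh i c)" using pr_eq_iff[of "sh i c" d] cd(1,2) by auto
    then show False using cd(3) sh_sh by metis
  qed
  have main: "\<exists>b c. b \<in> K \<and> c \<in> K \<and> (\<forall>i. b \<noteq> sh i a) \<and> (\<forall>i. c \<noteq> sh i a) \<and> (\<forall>i. c \<noteq> sh i b) \<and>
      gap a b = 0 \<and> gap a c = 0 \<and> gap b c = \<epsilon>"
  proof (cases "\<epsilon> = 0")
    case True
    then show ?thesis using K12 w[OF m1] w[OF am2 m2(2)] g12 n12 by (intro exI[of _ m1] exI[of _ m2]) auto
  next
    case False
    have "m1 \<noteq> sh i m2" for i using n12[of "- i"] by auto
    then show ?thesis using False assms K12 w[OF m1] w[OF am2 m2(2)] g21 by (intro exI[of _ m2] exI[of _ m1]) auto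
  qed
  then obtain b c where bc: "b \<in> K" "c \<in> K" "\<And>i. b \<noteq> sh i a" "\<And>i. c \<noteq> sh i a" "\<And>i. c \<noteq> sh i b"
      "gap a b = 0" "gap a c = 0" "gap b c = \<epsilon>" by blast
  have n1: "sh k b \<noteq> sh i a" for i using bc(3)[of "i - k"] sh_sh[of "- k" i a] by (metis add.commute sh_inv(2) uminus_add_conv_diff)
  have n2: "sh l c \<noteq> sh i a" for i using bc(4)[of "i - l"] sh_sh[of "- l" i a] by (metis add.commute sh_inv(2) uminus_add_conv_diff)
  have n3: "sh l c \<noteq> sh i (sh k b)" for i using bc(5)[of "- l + (i + k)"] sh_sh by (metis sh_inv(2))
  have "gap a (sh k b) = k" "gap a (sh l c) = l" "gap (sh k b) (sh l c) = l - k + \<epsilon>"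
    using gap_sh[OF a bc(1), of 0 k] gap_sh[OF a bc(2), of 0 l] gap_sh[OF bc(1,2), of k l] bc(6-8)
    by (simp_all add: sh_0)
  then have "dist (pr a) (pr (sh k b)) = k mod int n" "dist (pr a) (pr (sh l c)) = l mod int n"
    "dist (pr (sh k b)) (pr (sh l c)) = (l - k + \<epsilon>) mod int n"
    using dist_pr a bc(1,2) by (simp_all only: sh_K_iff)
  then show ?thesis
    using no[OF a, of "sh k b"] no[OF a, of "sh l c"] no[of "sh k b" "sh l c"] n1 n2 n3 a bc(1,2) pr_univ
    by (intro exI[of _ "pr a"] exI[of _ "pr (sh k b)"] exI[of _ "pr (sh l c)"]) auto
qed

text \<open>The integer part of -t is -1 minus that of t if t is not an integer, and different
  orbits are what excludes integers.\<close>

lemma dist_rev: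
  assumes U: "x \<in> univ M" "y \<in> univ M" and n: "y \<notin> orb {x}"
  shows "dist y x = (- 1 - dist x y) mod int n"
proof -
  obtain a where a: "a \<in> K" "pr a = x" using pr_surj U by blast
  obtain b where b: "b \<in> K" "pr b = y" using pr_surj U by blast
  have l: "sh (gap a b) a \<prec> b" using notin_orb_lift(2)[OF a(1) b(1)] n a b by simp
  have "gap b a = - 1 - gap a b"
  proof (rule gap_eqI[OF b(1) a(1)])
    have "sh (- 1 - gap a b) b \<prec> sh (- 1 - gap a b) (sh (gap a b + 1) a)" using gap(2)[OF a(1) b(1)] by (simp only: sh_lt_iff)
    then have "sh (- 1 - gap a b) b \<prec> a" by (simp add: sh_sh sh_0)
    then show "\<not> a \<prec> sh (- 1 - gap a b) b" using lt_asym by blast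
    have "sh (- gap a b) (sh (gap a b) a) \<prec> sh (- gap a b) b" using l by (simp only: sh_lt_iff)
    then show "a \<prec> sh (- 1 - gap a b + 1) b" by simp
  qed
  then show ?thesis using dist_pr[OF a(1) b(1)] dist_pr[OF b(1) a(1)] a b by (simp add: mod_diff_right_eq)
qed

lemma S_hat_d_iff:
  assumes k: "0 \<le> k" "k < int n"
  shows "S_hat_d M x y k \<longleftrightarrow> x \<in> univ M \<and> y \<in> univ M \<and> y \<notin> orb {x} \<and> dist x y = k"
proof (cases "x \<in> univ M \<and> y \<in> univ M")
  case True
  then have U: "x \<in> univ M" "y \<in> univ M" by auto
  obtain a where a: "a \<in> K" "pr a = x" using pr_surj U by blast
  have rp: "rot_pow M k x = pr (sh k a)" "rot_pow M (k + 1) x = pr (sh (k + 1) a)"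
    unfolding rot_pow_def using k a rot_pow_pr[OF a(1), of "nat k"] rot_pow_pr[OF a(1), of "nat (k + 1)"] by auto
  have acl: "acl_eq M {home M x} \<noteq> acl_eq M {home M y} \<longleftrightarrow> y \<notin> orb {x}"
  proof -
    have "cl {x} = cl {y} \<longleftrightarrow> orb {x} = orb {y}"
    proof
      assume "cl {x} = cl {y}"
      then have "(\<Union>e\<in>cl {x}. support e) = (\<Union>e\<in>cl {y}. support e)" by simp
      then show "orb {x} = orb {y}" using UN_supp_cl[of "{x}"] UN_supp_cl[of "{y}"] U by simp
    qed (simp add: cl_def)
    also have "\<dots> \<longleftrightarrow> y \<in> orb {x}"
    proof
      assume "orb {x} = orb {y}"
      then show "y \<in> orb {x}" using orb_single_refl[of y] by simp
    next
      assume "y \<in> orb {x}"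
      then show "orb {x} = orb {y}" by (rule orb_eq[OF U(1), symmetric])
    qed
    finally show ?thesis using acl_home U by simp
  qed
  show ?thesis
  proof (cases "y \<in> orb {x}")
    case True
    then show ?thesis unfolding S_hat_d_def using acl by simp
  next
    case False
    obtain b0 where b0: "b0 \<in> K" "pr b0 = y" using pr_surj U by blast
    \<comment> \<open>With the lift of y taken in the window that starts at \<open>sh k a\<close>,
      the cyclic condition says that b comes before \<open>sh (k + 1) a\<close>, which is a gap of
      k.\<close>
    obtain b where b: "b \<in> K" "pr b = y" "\<not> b \<prec> sh k a" "b \<prec> sh (int n) (sh k a)"
      using window_lift[of "sh k a" b0] a b0 by auto
    have bn: "sh k a \<prec> b" using b(3) notin_orb_lift(1)[OF a(1) b(1)] False a b lt_total[of b "sh k a"] by auto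
    \<comment> \<open>As n > 1, the two ends of the arc are different points, so
      \<open>S_hat\<close> reduces to its first disjunct.\<close>
    have ne: "pr (sh k a) \<noteq> pr (sh (k + 1) a)"
    proof
      assume "pr (sh k a) = pr (sh (k + 1) a)"
      then obtain j where "sh (k + 1) a = sh (int n * j) (sh k a)" using pr_eq_iff[of "sh k a" "sh (k + 1) a"] a by auto
      then have "int n * j = 1" using a by (simp add: sh_sh)
      then show False using n_gt_1 by (simp add: zmult_eq_1_iff)
    qed
    have "cyc M (pr (sh k a)) (pr b) (pr (sh (k + 1) a)) \<longleftrightarrow> sh k a \<prec> b \<and> b \<prec> sh (k + 1) a"
      by (rule cyc_window) (use a b n_gt_1 in \<open>auto simp: sh_sh\<close>)
    then have S: "S_hat M (rot_pow M k x) y (rot_pow M (k + 1) x) \<longleftrightarrow> b \<prec> sh (k + 1) a"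
      unfolding rp S_hat_def using ne bn b by auto
    have g: "k \<le> gap a b" "gap a b < k + int n"
    proof -
      have "sh k a \<prec> sh (gap a b + 1) a" using lt_trans[OF bn gap(2)[OF a(1) b(1)]] .
      then show "k \<le> gap a b" using a by simp
      have "sh (gap a b) a \<prec> sh (int n) (sh k a)"
        using not_lt_trans[OF _ b(1) gap(1)[OF a(1) b(1)] b(4)] a by simp
      then show "gap a b < k + int n" using a by (simp add: sh_sh)
    qed
    have "b \<prec> sh (k + 1) a \<longleftrightarrow> gap a b = k"
      using gap_eqI[OF a(1) b(1,3)] gap(2)[OF a(1) b(1)] by auto
    also have "\<dots> \<longleftrightarrow> gap a b mod int n = k"
    proof
      assume "gap a b mod int n = k"
      then have "(gap a b - k) mod int n = 0" by (simp add: mod_eq_dvd_iff[symmetric] k mod_pos_pos_trivial mod_eq_0_iff_dvd)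
      then show "gap a b = k" using g by (simp add: mod_pos_pos_trivial)
    qed (use k in simp)
    also have "\<dots> \<longleftrightarrow> dist x y = k" using dist_pr[OF a(1) b(1)] a b by simp
    finally show ?thesis unfolding S_hat_d_def using S acl False U by simp
  qed
next
  case False
  then show ?thesis unfolding S_hat_d_def by auto
qed

end

section \<open>Lengths and linear functionals of chains\<close>

lemma chain_length_superset:
  assumes "finite S" "Poly_Mapping.keys \<tau> \<subseteq> S"
  shows "int (chain_length \<tau>) = (\<Sum>f\<in>S. \<bar>Poly_Mapping.lookup \<tau> f\<bar>)"
proof -
  have "int (chain_length \<tau>) = (\<Sum>f\<in>Poly_Mapping.keys \<tau>. \<bar>Poly_Mapping.lookup \<tau> f\<bar>)"
    unfolding chain_length_def by simp
  also have "\<dots> = (\<Sum>f\<in>S. \<bar>Poly_Mapping.lookup \<tau> f\<bar>)"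
    by (rule sum.mono_neutral_left) (use assms in \<open>auto simp: in_keys_iff\<close>)
  finally show ?thesis .
qed

lemma chain_length_add: "chain_length (a + b) \<le> chain_length a + chain_length b"
proof -
  let ?S = "Poly_Mapping.keys a \<union> Poly_Mapping.keys b"
  have "Poly_Mapping.keys (a + b) \<subseteq> ?S" by (rule keys_add)
  then have "int (chain_length (a + b)) = (\<Sum>f\<in>?S. \<bar>Poly_Mapping.lookup (a + b) f\<bar>)"
    by (intro chain_length_superset) auto
  also have "\<dots> \<le> (\<Sum>f\<in>?S. \<bar>Poly_Mapping.lookup a f\<bar> + \<bar>Poly_Mapping.lookup b f\<bar>)"
    by (rule sum_mono) (simp add: lookup_add)
  also have "\<dots> = int (chain_length a) + int (chain_length b)"
    using chain_length_superset[of ?S a] chain_length_superset[of ?S b] by (simp add: sum.distrib)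
  finally show ?thesis by linarith
qed

lemma chain_length_uminus [simp]: "chain_length (- a) = chain_length a"
  unfolding chain_length_def by simp

lemma chain_length_frag_of [simp]: "chain_length (frag_of f) = 1"
  unfolding chain_length_def by simp

lemma chain_length_diff: "chain_length (a - b) \<le> chain_length a + chain_length b"
  using chain_length_add[of a "- b"] by simp

text \<open>The homomorphism from chains to the integers with values w on the generators; it turns a
  boundary equation into a numerical one.\<close>

definition lin :: "('b \<Rightarrow> int) \<Rightarrow> ('b \<Rightarrow>\<^sub>0 int) \<Rightarrow> int" where
  "lin w c = (\<Sum>f\<in>Poly_Mapping.keys c. Poly_Mapping.lookup c f * w f)"

lemma lin_superset:
  assumes "finite S" "Poly_Mapping.keys c \<subseteq> S" shows "lin w c = (\<Sum>f\<in>S. Poly_Mapping.lookup c f * w f)"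
  unfolding lin_def by (rule sum.mono_neutral_left) (use assms in \<open>auto simp: in_keys_iff\<close>)

lemma lin_add: "lin w (a + b) = lin w a + lin w b"
proof -
  let ?S = "Poly_Mapping.keys a \<union> Poly_Mapping.keys b"
  have "lin w (a + b) = (\<Sum>f\<in>?S. Poly_Mapping.lookup (a + b) f * w f)"
    using keys_add[of a b] by (intro lin_superset) auto
  also have "\<dots> = (\<Sum>f\<in>?S. Poly_Mapping.lookup a f * w f) + (\<Sum>f\<in>?S. Poly_Mapping.lookup b f * w f)"
    by (simp add: lookup_add distrib_right sum.distrib)
  also have "\<dots> = lin w a + lin w b" using lin_superset[of ?S a w] lin_superset[of ?S b w] by simp
  finally show ?thesis .
qed

lemma lin_uminus: "lin w (- a) = - lin w a"
  unfolding lin_def by (simp add: sum_negf)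

lemma lin_diff: "lin w (a - b) = lin w a - lin w b"
  using lin_add[of w a "- b"] lin_uminus[of w b] by simp

lemma lin_frag_of [simp]: "lin w (frag_of f) = w f"
  unfolding lin_def by simp

lemma boundary_2_frag_of: "boundary 2 (frag_of f) = frag_of (face 0 f) - frag_of (face 1 f) + frag_of (face 2 f)"
  unfolding boundary_def frag_extend_of by (simp add: numeral_2_eq_2)

lemma boundary_diff: "boundary k (a - b) = boundary k a - boundary k b"
  unfolding boundary_def by (rule frag_extend_diff)

lemma boundary_uminus: "boundary k (- a) = - boundary k a"
  unfolding boundary_def by (rule frag_extend_minus)

lemma boundary_add: "boundary k (a + b) = boundary k a + boundary k b"
  unfolding boundary_def by (rule frag_extend_add)

text \<open>The boundary is moved over to the weight: a weight on edges induces its alternating sum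
  as a weight on triangles.\<close>

lemma lin_boundary: "lin w (boundary 2 \<tau>) = lin (\<lambda>f. w (face 0 f) - w (face 1 f) + w (face 2 f)) \<tau>"
proof (induction \<tau> rule: frag_induction[OF subset_UNIV])
  case 1
  show ?case by (simp add: boundary_def lin_def)
next
  case (2 f)
  show ?case by (simp add: boundary_2_frag_of lin_add lin_diff)
next
  case (3 a b)
  then show ?case by (simp add: boundary_diff lin_diff)
qed

text \<open>Write \<open>P\<close> and \<open>Q\<close> for the sums of the positive and of the negative parts of the coefficients.
  The first functional gives \<open>P - Q = 1\<close>, and the second one is congruent to an integer
  between \<open>- P\<close> and \<open>Q\<close>.\<close>

lemma chain_length_lower_bound:
  assumes n: "0 < n" and one: "lin (\<lambda>f. 1) \<tau> = 1"
    and W: "\<And>f. f \<in> Poly_Mapping.keys \<tau> \<Longrightarrow> \<exists>\<epsilon>\<in>{-1, 0}. W f mod int n = \<epsilon> mod int n"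
    and k: "lin W \<tau> mod int n = (- 1 - k) mod int n" "0 \<le> k" "k < int n"
  shows "min (2 * (int n - k) - 1) (2 * k + 1) \<le> int (chain_length \<tau>)"
proof -
  let ?S = "Poly_Mapping.keys \<tau>"
  let ?l = "Poly_Mapping.lookup \<tau>"
  \<comment> \<open>Replacing W by its residue in {-1, 0} changes the total only modulo n and makes
    it comparable with P and Q.\<close>
  define \<epsilon> :: "_ \<Rightarrow> int" where "\<epsilon> f = (if W f mod int n = 0 then 0 else - 1)" for f
  have \<epsilon>W: "W f mod int n = \<epsilon> f mod int n" if "f \<in> ?S" for f using W[OF that] unfolding \<epsilon>_def by auto
  define P where "P = (\<Sum>f\<in>?S. max (?l f) 0)"
  define Q where "Q = (\<Sum>f\<in>?S. max (- ?l f) 0)"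
  have PQ: "P - Q = 1"
  proof -
    have "P - Q = (\<Sum>f\<in>?S. max (?l f) 0 - max (- ?l f) 0)" unfolding P_def Q_def by (simp add: sum_subtractf)
    also have "\<dots> = (\<Sum>f\<in>?S. ?l f * 1)" by (rule sum.cong) auto
    finally show ?thesis using one unfolding lin_def by simp
  qed
  have len: "int (chain_length \<tau>) = P + Q"
  proof -
    have "int (chain_length \<tau>) = (\<Sum>f\<in>?S. \<bar>?l f\<bar>)" using chain_length_superset[of ?S \<tau>] by simp
    also have "\<dots> = (\<Sum>f\<in>?S. max (?l f) 0 + max (- ?l f) 0)" by (rule sum.cong) auto
    finally show ?thesis unfolding P_def Q_def by (simp add: sum.distrib)
  qed
  define m where "m = lin \<epsilon> \<tau>"
  have "lin W \<tau> mod int n = (\<Sum>f\<in>?S. (?l f * W f) mod int n) mod int n" unfolding lin_def by (simp add: mod_sum_eq)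
  also have "(\<Sum>f\<in>?S. (?l f * W f) mod int n) = (\<Sum>f\<in>?S. (?l f * \<epsilon> f) mod int n)"
    by (rule sum.cong[OF refl]) (use \<epsilon>W in \<open>metis mod_mult_right_eq\<close>)
  also have "\<dots> mod int n = m mod int n" unfolding m_def lin_def by (simp add: mod_sum_eq)
  finally have "m mod int n = (- 1 - k) mod int n" using k(1) by simp
  then have "int n dvd m - (- 1 - k)" by (simp add: mod_eq_dvd_iff)
  then obtain t where t: "m = - 1 - k + int n * t" by (metis add.commute diff_add_cancel dvdE)
  have mQ: "m \<le> Q" unfolding m_def lin_def Q_def
    by (rule sum_mono) (auto simp: \<epsilon>_def)
  have mP: "- P \<le> m" unfolding m_def lin_def P_def sum_negf[symmetric]
    by (rule sum_mono) (auto simp: \<epsilon>_def)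
  show ?thesis
  \<comment> \<open>For t at most 0 the total m is so small that P is at least k + 1; otherwise it
    is so large that Q is at least n - k - 1.\<close>
  proof (cases "t \<le> 0")
    case True
    then have "int n * t \<le> 0" using n by (simp add: mult_nonneg_nonpos)
    then have "k + 1 \<le> P" using t mP by linarith
    then show ?thesis using len PQ by linarith
  next
    case False
    then have "int n * 1 \<le> int n * t" using n by (intro mult_left_mono) auto
    then have "int n - k - 1 \<le> Q" using t mQ by linarith
    then have "2 * (int n - k) - 1 \<le> int (chain_length \<tau>)" using len PQ by (simp add: algebra_simps)
    then show ?thesis by simp
  qed
qed

lemma sorted_list_pair: "i < j \<Longrightarrow> sorted_list_of_set {i, j :: nat} = [i, j]"
  using sorted_list_of_set.idem_if_sorted_distinct[of "[i, j]"] by simp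

lemma sorted_list_triple: "i < j \<Longrightarrow> j < k \<Longrightarrow> sorted_list_of_set {i, j, k :: nat} = [i, j, k]"
  using sorted_list_of_set.idem_if_sorted_distinct[of "[i, j, k]"] by simp

context rotation_cover
begin

section \<open>Edges and triangles\<close>

lemma std_simplex:
  assumes "coherent s p" "natLeq <o (\<kappa> :: 'a rel)" "card s = k + 1" shows "std s p \<in> simplices \<kappa> M k"
  unfolding simplices_def
  using std_in_A_fam[OF assms(1,2)] coherentD(1)[OF assms(1)] assms(3) B0_eq by auto

lemma simplexD:
  assumes "f \<in> simplices \<kappa> M k"
  shows "f \<in> A_fam \<kappa> M" "Dom f = Pow (Defs.supp f)" "finite (Defs.supp f)" "card (Defs.supp f) = k + 1" "Ob f {} = B0 M"
proof -
  show "f \<in> A_fam \<kappa> M" "Ob f {} = B0 M" using assms unfolding simplices_def by auto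
  obtain s where s: "finite s" "card s = k + 1" "Dom f = Pow s" using assms unfolding simplices_def by auto
  then have "Defs.supp f = s" by (simp add: Defs.supp_def)
  then show "Dom f = Pow (Defs.supp f)" "finite (Defs.supp f)" "card (Defs.supp f) = k + 1" using s by auto
qed

lemma simplex_std:
  assumes f: "f \<in> simplices \<kappa> M k" "Defs.supp f = s" and v: "\<And>i. i \<in> s \<Longrightarrow> v i \<in> univ M \<and> Ob f {i} = cl {v i}"
  obtains p where "coherent s p" "\<And>i. i \<in> s \<Longrightarrow> p {i} i = v i" "f = std s p"
proof -
  note D = simplexD[OF f(1)]
  have "\<exists>p. coherent s p \<and> (\<forall>i\<in>s. p {i} i = v i) \<and> f = std s p \<and>
    (\<forall>u\<subseteq>s. \<forall>i\<in>u. Mor f {i} u (home M (v i)) = home M (p u i))"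
    by (rule A_fam_std[OF D(1) _ D(5) _ v]) (use D(2,3) f(2) in auto)
  then show ?thesis using that by metis
qed

lemma simplex_vertex:
  assumes "f \<in> simplices \<kappa> M k" "i \<in> Defs.supp f" shows "\<exists>v\<in>univ M. Ob f {i} = cl {v}"
  by (rule A_fam_vertex[OF simplexD(1,2,5)[OF assms(1)] assms(2)])

lemma alike_single: assumes "p i \<in> univ M" "q i \<in> univ M" shows "alike {i} p q"
proof -
  obtain a b where "a \<in> K" "pr a = p i" "b \<in> K" "pr b = q i" using pr_surj assms by metis
  then have "cell {} (p i) (q i)" unfolding cell_def same_cut_def lifts_def by auto
  then obtain h where "piso ({} \<union> orb {p i}) h" "h (p i) = q i" using cell_piso[OF gset_empty] by blast
  then show ?thesis unfolding alike_def realign_def by (intro exI[of _ "orb {p i}"] exI[of _ h]) simp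
qed

lemma alike_empty: "alike {} p q"
  unfolding alike_def realign_def using piso_id[OF gset_empty] by auto

lemma alike_pair:
  assumes "p i \<in> univ M" "p j \<in> univ M" "q i \<in> univ M" "q j \<in> univ M"
    "p j \<notin> orb {p i}" "q j \<notin> orb {q i}" "dist (p i) (p j) = dist (q i) (q j)"
  shows "alike {i, j} p q"
  using piso_of_dist[OF assms] unfolding alike_def realign_def by auto

lemma alike_dist: assumes "alike s p q" "i \<in> s" "j \<in> s" shows "dist (p i) (p j) = dist (q i) (q j)"
proof -
  obtain D h where "piso D h" "\<forall>i\<in>s. p i \<in> D \<and> h (p i) = q i" using assms(1) unfolding alike_def realign_def by blast
  then show ?thesis using dist_piso[of D h "p i" "p j"] assms(2,3) by simp
qed

lemma std_pair_cong:
  assumes "p {l} l = q {l} l" "p {m} m = q {m} m" "p {l, m} = q {l, m}" shows "std {l, m} p = std {l, m} q"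
proof (rule std_cong)
  fix u i assume u: "u \<subseteq> {l, m}" "i \<in> u"
  then consider "u = {l}" | "u = {m}" | "u = {l, m}" by blast
  then show "p u i = q u i" using u(2) assms by cases auto
qed

text \<open>An edge together with chosen generators v of its end points; d is measured with respect
  to them and may change with them. The condition on \<kappa> is part of the notion so that an edge
  with i and j different is a 1-simplex.\<close>

definition edge :: "'a rel \<Rightarrow> nat \<Rightarrow> nat \<Rightarrow> (nat \<Rightarrow> 'a) \<Rightarrow> 'a imag sfunctor \<Rightarrow> int \<Rightarrow> bool" where
  "edge \<kappa> i j v e d \<longleftrightarrow> natLeq <o \<kappa> \<and> (\<exists>p. coherent {i, j} p \<and> p {i} i = v i \<and> p {j} j = v j \<and> e = std {i, j} p \<and>
     d = dist (p {i, j} i) (p {i, j} j))"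

lemma edge_simplex: assumes "edge \<kappa> i j v e d" "i \<noteq> j" shows "e \<in> simplices \<kappa> M 1"
  using assms std_simplex unfolding edge_def by (auto simp: card_insert_if)

lemma edge_supp: "edge \<kappa> i j v e d \<Longrightarrow> Defs.supp e = {i, j}"
  unfolding edge_def by auto

lemma edge_Ob: "edge \<kappa> i j v e d \<Longrightarrow> Ob e {i} = cl {v i} \<and> Ob e {j} = cl {v j}"
  unfolding edge_def by auto

lemma edge_range: "edge \<kappa> i j v e d \<Longrightarrow> 0 \<le> d \<and> d < int n"
  unfolding edge_def using dist_range by auto

lemma edge_univ: assumes "edge \<kappa> i j v e d" shows "v i \<in> univ M" "v j \<in> univ M"
proof -
  obtain p where p: "coherent {i, j} p" "p {i} i = v i" "p {j} j = v j" using assms unfolding edge_def by blast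
  show "v i \<in> univ M" using coherentD(5)[OF p(1), of "{i}" i] p(2) by simp
  show "v j \<in> univ M" using coherentD(5)[OF p(1), of "{j}" j] p(3) by simp
qed

lemma edge_cong: "edge \<kappa> i j v e d \<Longrightarrow> v' i = v i \<Longrightarrow> v' j = v j \<Longrightarrow> edge \<kappa> i j v' e d"
  unfolding edge_def by simp

lemma edge_of_std:
  assumes c: "coherent s p" and \<kappa>: "natLeq <o (\<kappa> :: 'a rel)" and t: "{i, j} \<subseteq> s" and v: "p {i} i = v i" "p {j} j = v j"
  shows "edge \<kappa> i j v (std {i, j} p) (dist (p s i) (p s j))"
proof -
  have "dist (p {i, j} i) (p {i, j} j) = dist (p s i) (p s j)"
    using alike_dist[OF coherentD(3)[OF c subset_refl t], of i j] by simp
  then show ?thesis unfolding edge_def using \<kappa> coherent_subset[OF c t] v by auto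
qed

lemma edge_of_simplex:
  assumes \<kappa>: "natLeq <o (\<kappa> :: 'a rel)" and f: "f \<in> simplices \<kappa> M 1" "Defs.supp f = {i, j}"
    and v: "v i \<in> univ M" "v j \<in> univ M" "Ob f {i} = cl {v i}" "Ob f {j} = cl {v j}"
  shows "\<exists>d. edge \<kappa> i j v f d"
proof -
  obtain p where p: "coherent {i, j} p" "\<And>l. l \<in> {i, j} \<Longrightarrow> p {l} l = v l" "f = std {i, j} p"
    by (rule simplex_std[OF f]) (use v in auto)
  show ?thesis using edge_of_std[OF p(1) \<kappa> subset_refl] p by blast
qed

lemma edge_Mor:
  assumes "edge \<kappa> i j v e d"
  obtains y z where "Mor e {i} {i, j} (home M (v i)) = home M y" "Mor e {j} {i, j} (home M (v j)) = home M z"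
    "y \<in> univ M" "z \<in> univ M" "i \<noteq> j \<Longrightarrow> z \<notin> orb {y}" "dist y z = d"
proof -
  obtain p where p: "coherent {i, j} p" "p {i} i = v i" "p {j} j = v j" "e = std {i, j} p"
    "d = dist (p {i, j} i) (p {i, j} j)" using assms unfolding edge_def by blast
  have m: "Mor e {l} {i, j} (home M (p {l} l)) = home M (p {i, j} l)" if l: "l \<in> {i, j}" for l
  proof -
    have sub: "{l} \<subseteq> {i, j}" using l by simp
    have "home M (p {l} l) \<in> cl (p {l} ` {l})"
      using coherentD(2)[OF p(1) sub] by (intro cl_home) auto
    then have "Mor e {l} {i, j} (home M (p {l} l)) = shift {l} (p {l}) (p {i, j}) (home M (p {l} l))"
      using p(4) sub by simp
    then show ?thesis using shift_home[OF coherentD(3)[OF p(1) subset_refl sub]] by simp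
  qed
  show ?thesis
    by (rule that[of "p {i, j} i" "p {i, j} j"])
       (use m[of i] m[of j] p coherentD(5)[OF p(1) subset_refl] coherentD(4)[OF p(1) subset_refl, of j i] in auto)
qed

text \<open>The transition maps of e determine the images of the generators, hence the
  distance.\<close>

lemma edge_unique:
  assumes "edge \<kappa> i j v e d" "edge \<kappa> i j v e d'" shows "d = d'"
proof -
  obtain y z where yz: "Mor e {i} {i, j} (home M (v i)) = home M y" "Mor e {j} {i, j} (home M (v j)) = home M z"
    "dist y z = d" using edge_Mor[OF assms(1)] by metis
  obtain y' z' where yz': "Mor e {i} {i, j} (home M (v i)) = home M y'" "Mor e {j} {i, j} (home M (v j)) = home M z'"
    "dist y' z' = d'" using edge_Mor[OF assms(2)] by metis
  have "y = y'" "z = z'" using yz yz' by auto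
  then show ?thesis using yz yz' by simp
qed

text \<open>Single vertices keep the generators v, and the pair gets two points at the required
  distance. The transitions exist because any two one-point families are alike.\<close>

lemma edge_exists:
  assumes \<kappa>: "natLeq <o (\<kappa> :: 'a rel)" and ij: "i \<noteq> j" and v: "v i \<in> univ M" "v j \<in> univ M"
  shows "\<exists>e. edge \<kappa> i j v e (d mod int n)"
proof -
  obtain x y where xy: "x \<in> univ M" "y \<in> univ M" "y \<notin> orb {x}" "dist x y = d mod int n"
    using dist_triangle_exists[of 0 d 0] by auto
  define p where "p u = (if u = {i, j} then (\<lambda>l. if l = i then x else y) else v)" for u
  have xo: "x \<notin> orb {y}" using xy orb_sym by blast
  have sub: "u = {} \<or> u = {i} \<or> u = {j} \<or> u = {i, j}" if "u \<subseteq> {i, j}" for u using that by blast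
  have ne: "{i} \<noteq> {i, j}" "{j} \<noteq> {i, j}" using ij by auto
  have U: "p u l \<in> univ M" if "u \<subseteq> {i, j}" "l \<in> u" for u l
    using sub[OF that(1)] that(2) xy v unfolding p_def by auto
  have c: "coherent {i, j} p" unfolding coherent_def
  proof (intro conjI allI impI ballI)
    show "p u ` u \<subseteq> univ M" if "u \<subseteq> {i, j}" for u using U[OF that] by auto
    show "alike u (p u) (p w)" if "w \<subseteq> {i, j}" "u \<subseteq> w" for u w
    proof -
      have uij: "u \<subseteq> {i, j}" using that by blast
      consider "u = {}" | l where "u = {l}" | "u = {i, j}" using sub[OF uij] by blast
      then show ?thesis
      proof cases
        case 1 then show ?thesis using alike_empty by simp
      next
        case 2 then show ?thesis using alike_single U[OF uij] U[OF that(1)] that(2) by auto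
      next
        case 3
        then have "w = u" using that by blast
        then show ?thesis using alike_refl[of u "p u"] 3 U[OF uij] by auto
      qed
    qed
    show "p u l \<notin> orb {p u m}" if "u \<subseteq> {i, j}" "l \<in> u" "m \<in> u" "l \<noteq> m" for u l m
    proof -
      have "u = {i, j}" using sub[OF that(1)] that by auto
      then show ?thesis using that xy xo ij unfolding p_def by auto
    qed
  qed simp
  have "edge \<kappa> i j v (std {i, j} p) (dist (p {i, j} i) (p {i, j} j))"
    by (rule edge_of_std[OF c \<kappa> subset_refl]) (use ij in \<open>simp_all add: p_def ne\<close>)
  then show ?thesis using xy ij unfolding p_def by auto
qed

text \<open>The family agrees with those of the three edges on pairs, and on the full set it is a
  triple with the prescribed distances. By \<open>alike_pair\<close>, equal distances are all that
  the transitions from the pairs to the triple require.\<close>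

lemma triangle_exists:
  assumes ijk: "i < j" "j < k" and e: "edge \<kappa> i j v e1 d1" "edge \<kappa> i k v e2 d2" "edge \<kappa> j k v e3 d3"
    and d: "\<epsilon> \<in> {-1, 0}" "(d3 - d2 + d1) mod int n = \<epsilon> mod int n"
  shows "\<exists>f\<in>simplices \<kappa> M 2. boundary 2 (frag_of f) = frag_of e3 - frag_of e2 + frag_of e1"
proof -
  have \<kappa>: "natLeq <o \<kappa>" using e(1) unfolding edge_def by blast
  obtain x y z where xyz: "x \<in> univ M" "y \<in> univ M" "z \<in> univ M" "y \<notin> orb {x}" "z \<notin> orb {x}" "z \<notin> orb {y}"
      "dist x y = d1 mod int n" "dist x z = d2 mod int n" "dist y z = (d2 - d1 + \<epsilon>) mod int n"
    using dist_triangle_exists[OF d(1), of d1 d2] by blast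
  \<comment> \<open>The distance from y to z is matched modulo n first; since all distances lie
    between 0 and n - 1, congruent ones are equal.\<close>
  have "(d2 - d1 + \<epsilon>) mod int n = (d2 - d1 + (d3 - d2 + d1)) mod int n"
    using d(2) by (metis mod_add_right_eq)
  then have ds: "dist x y = d1" "dist x z = d2" "dist y z = d3"
    using xyz edge_range[OF e(1)] edge_range[OF e(2)] edge_range[OF e(3)] by auto
  obtain p1 where p1: "coherent {i, j} p1" "p1 {i} i = v i" "p1 {j} j = v j" "e1 = std {i, j} p1"
    "d1 = dist (p1 {i, j} i) (p1 {i, j} j)" using e(1) unfolding edge_def by blast
  obtain p2 where p2: "coherent {i, k} p2" "p2 {i} i = v i" "p2 {k} k = v k" "e2 = std {i, k} p2"
    "d2 = dist (p2 {i, k} i) (p2 {i, k} k)" using e(2) unfolding edge_def by blast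
  obtain p3 where p3: "coherent {j, k} p3" "p3 {j} j = v j" "p3 {k} k = v k" "e3 = std {j, k} p3"
    "d3 = dist (p3 {j, k} j) (p3 {j, k} k)" using e(3) unfolding edge_def by blast
  define p where "p u = (if u = {i, j} then p1 u else if u = {i, k} then p2 u else if u = {j, k} then p3 u
      else if u = {i, j, k} then (\<lambda>l. if l = i then x else if l = j then y else z) else v)" for u
  have "k \<in> {i, j, k} \<and> k \<notin> {i, j}" "j \<in> {i, j, k} \<and> j \<notin> {i, k}" "i \<in> {i, j, k} \<and> i \<notin> {j, k}" using ijk by auto
  then have ne3: "{i, j} \<noteq> {i, j, k}" "{i, k} \<noteq> {i, j, k}" "{j, k} \<noteq> {i, j, k}" by metis+
  have ne2: "i \<noteq> j" "i \<noteq> k" "j \<noteq> k" "{i, j} \<noteq> {i, k}" "{i, j} \<noteq> {j, k}" "{i, k} \<noteq> {j, k}" using ijk by auto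
  note ne = ne2 ne3
  have nl: "{l} \<noteq> {i, j}" "{l} \<noteq> {i, k}" "{l} \<noteq> {j, k}" "{l} \<noteq> {i, j, k}" for l using ne(1-3) by auto
  have pv: "p {i, j} = p1 {i, j}" "p {i, k} = p2 {i, k}" "p {j, k} = p3 {j, k}" "p {i, j, k} i = x" "p {i, j, k} j = y"
    "p {i, j, k} k = z" "p {l} = v" for l using ne nl[of l] unfolding p_def by auto
  have vU: "v i \<in> univ M" "v j \<in> univ M" "v k \<in> univ M" using edge_univ[OF e(1)] edge_univ[OF e(2)] by auto
  have sub: "u = {} \<or> u = {i} \<or> u = {j} \<or> u = {k} \<or> u = {i, j} \<or> u = {i, k} \<or> u = {j, k} \<or> u = {i, j, k}"
    if "u \<subseteq> {i, j, k}" for u using that by (cases "i \<in> u"; cases "j \<in> u"; cases "k \<in> u") blast+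
  note u1 = coherentD(5)[OF p1(1) subset_refl] and u2 = coherentD(5)[OF p2(1) subset_refl] and u3 = coherentD(5)[OF p3(1) subset_refl]
  have U: "p u l \<in> univ M" if "u \<subseteq> {i, j, k}" "l \<in> u" for u l
    using sub[OF that(1)]
  proof (elim disjE)
    assume "u = {i, j}" then show ?thesis using u1[of l] that(2) pv(1) by simp
  next
    assume "u = {i, k}" then show ?thesis using u2[of l] that(2) pv(2) by simp
  next
    assume "u = {j, k}" then show ?thesis using u3[of l] that(2) pv(3) by simp
  next
    assume "u = {i, j, k}" then show ?thesis using that(2) pv(4-6) xyz(1-3) by auto
  qed (use that(2) pv(7) vU in auto)
  note o1 = coherentD(4)[OF p1(1) subset_refl] and o2 = coherentD(4)[OF p2(1) subset_refl] and o3 = coherentD(4)[OF p3(1) subset_refl]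
  have xo: "x \<notin> orb {y}" "x \<notin> orb {z}" "y \<notin> orb {z}" using xyz orb_sym by blast+
  have O: "p u l \<notin> orb {p u m}" if "u \<subseteq> {i, j, k}" "l \<in> u" "m \<in> u" "l \<noteq> m" for u l m
    using sub[OF that(1)]
  proof (elim disjE)
    assume "u = {i, j}" then show ?thesis using o1[of l m] that(2-4) pv(1) by simp
  next
    assume "u = {i, k}" then show ?thesis using o2[of l m] that(2-4) pv(2) by simp
  next
    assume "u = {j, k}" then show ?thesis using o3[of l m] that(2-4) pv(3) by simp
  next
    assume "u = {i, j, k}" then show ?thesis using that(2-4) pv(4-6) xyz(4-6) xo by auto
  qed (use that(2-4) in auto)
  let ?t = "{i, j, k}"
  have al: "alike {l, m} (p {l, m}) (p ?t)" if "{l, m} \<subseteq> ?t" "l \<noteq> m" "dist (p {l, m} l) (p {l, m} m) = dist (p ?t l) (p ?t m)" for l m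
    by (rule alike_pair[where p = "p {l, m}" and q = "p ?t"])
       (use that U[OF that(1)] U[OF subset_refl] O[OF that(1), of m l] O[OF subset_refl, of m l] in auto)
  have c: "coherent ?t p" unfolding coherent_def
  proof (intro conjI allI impI ballI)
    show "p u ` u \<subseteq> univ M" if "u \<subseteq> ?t" for u using U[OF that] by auto
    show "p u l \<notin> orb {p u m}" if "u \<subseteq> ?t" "l \<in> u" "m \<in> u" "l \<noteq> m" for u l m by (rule O[OF that])
    show "alike u (p u) (p w)" if "w \<subseteq> ?t" "u \<subseteq> w" for u w
    proof (cases "w = u")
      case True
      then show ?thesis using alike_refl[of u "p u"] U[OF that(1)] finite_subset[OF that(1)] by auto
    next
      case False
      have us: "u \<subseteq> ?t" using that by blast
      consider "u = {}" | l where "u = {l}" | "u = {i, j}" | "u = {i, k}" | "u = {j, k}" | "u = ?t" using sub[OF us] by blast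
      then show ?thesis
      proof cases
        case 1 then show ?thesis using alike_empty by simp
      next
        case 2 then show ?thesis using alike_single U[OF us] U[OF that(1)] that(2) by auto
      next
        case 3
        then have "w = ?t" using that False by auto
        then show ?thesis using al[of i j] 3 ne pv ds p1(5) by simp
      next
        case 4
        then have "w = ?t" using that False by auto
        then show ?thesis using al[of i k] 4 ne pv ds p2(5) by simp
      next
        case 5
        then have "w = ?t" using that False by auto
        then show ?thesis using al[of j k] 5 ne pv ds p3(5) by simp
      next
        case 6
        then show ?thesis using that False by blast
      qed
    qed
  qed simp
  define f where "f = std ?t p"
  have fs: "f \<in> simplices \<kappa> M 2" unfolding f_def by (rule std_simplex[OF c \<kappa>]) (use ne in simp)
  have srt: "sorted_list_of_set ?t = [i, j, k]" using sorted_list_triple[OF ijk] .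
  have s1: "std {i, j} p = e1" unfolding p1(4) by (rule std_pair_cong) (simp_all add: pv p1)
  have s2: "std {i, k} p = e2" unfolding p2(4) by (rule std_pair_cong) (simp_all add: pv p2)
  have s3: "std {j, k} p = e3" unfolding p3(4) by (rule std_pair_cong) (simp_all add: pv p3)
  have "?t - {i} = {j, k}" "?t - {j} = {i, k}" "?t - {k} = {i, j}" using ne by auto
  then have "face 0 f = e3" "face 1 f = e2" "face 2 f = e1"
    unfolding f_def face_std srt using s1 s2 s3 by simp_all
  then show ?thesis using fs boundary_2_frag_of[of f] by auto
qed

text \<open>Two triangles sharing \<open>e2\<close> and \<open>e3\<close> have boundaries that
  differ by the difference of \<open>e1\<close> and \<open>e1'\<close>. The distance of
  \<open>e3\<close> is chosen so that the alternating sum is -1 with \<open>e1\<close> and 0 with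
  \<open>e1'\<close>.\<close>

lemma edge_exchange:
  assumes ijk: "i < j" "j < k" and \<kappa>: "natLeq <o (\<kappa> :: 'a rel)"
    and e: "edge \<kappa> i j v e1 d1" "edge \<kappa> i j v e1' d1'" "edge \<kappa> i k v e2 d2"
    and d: "d1' mod int n = (d1 + 1) mod int n"
  shows "\<exists>\<tau>\<in>chains \<kappa> M 2. boundary 2 \<tau> = frag_of e1 - frag_of e1' \<and> chain_length \<tau> \<le> 2"
proof -
  have vU: "v j \<in> univ M" "v k \<in> univ M" using edge_univ[OF e(1)] edge_univ[OF e(3)] by auto
  obtain e3 where e3: "edge \<kappa> j k v e3 ((d2 - 1 - d1) mod int n)" using edge_exists[OF \<kappa> _ vU] ijk by blast
  have 1: "((d2 - 1 - d1) mod int n - d2 + d1) mod int n = - 1 mod int n"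
    by (metis (no_types, opaque_lifting) add.commute add_diff_cancel_left' diff_diff_eq mod_diff_left_eq diff_add_cancel diff_diff_eq2 uminus_add_conv_diff)
  have "((d2 - 1 - d1) mod int n - d2 + d1') mod int n = ((d2 - 1 - d1) mod int n - d2 + (d1 + 1)) mod int n"
    using d by (metis mod_add_right_eq)
  also have "\<dots> = (((d2 - 1 - d1) mod int n - d2 + d1) + 1) mod int n" by (simp add: algebra_simps)
  also have "\<dots> = (- 1 + 1) mod int n" using 1 by (metis mod_add_left_eq)
  finally have 2: "((d2 - 1 - d1) mod int n - d2 + d1') mod int n = 0 mod int n" by simp
  obtain f' where f': "f' \<in> simplices \<kappa> M 2" "boundary 2 (frag_of f') = frag_of e3 - frag_of e2 + frag_of e1"
    using triangle_exists[OF ijk e(1,3) e3 _ 1] by auto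
  obtain f where f: "f \<in> simplices \<kappa> M 2" "boundary 2 (frag_of f) = frag_of e3 - frag_of e2 + frag_of e1'"
    using triangle_exists[OF ijk e(2,3) e3 _ 2] by auto
  have "frag_of f' - frag_of f \<in> chains \<kappa> M 2"
    unfolding chains_def using f f' keys_diff[of "frag_of f'" "frag_of f"] by auto
  moreover have "boundary 2 (frag_of f' - frag_of f) = frag_of e1 - frag_of e1'"
    unfolding boundary_diff f(2) f'(2) by simp
  moreover have "chain_length (frag_of f' - frag_of f) \<le> 2"
    using chain_length_diff[of "frag_of f'" "frag_of f"] by simp
  ultimately show ?thesis by blast
qed

lemma chains_add: "a \<in> chains \<kappa> M k \<Longrightarrow> b \<in> chains \<kappa> M k \<Longrightarrow> a + b \<in> chains \<kappa> M k"
  unfolding chains_def using keys_add[of a b] by blast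

lemma chains_uminus: "a \<in> chains \<kappa> M k \<Longrightarrow> - a \<in> chains \<kappa> M k"
  unfolding chains_def by simp

text \<open>Changing the distance of the edge \<open>e1\<close> by one costs two triangles; after \<open>m\<close> changes the
  shell is the boundary of a single triangle.\<close>

lemma filling:
  assumes ijk: "i < j" "j < k" and \<kappa>: "natLeq <o (\<kappa> :: 'a rel)"
    and e: "edge \<kappa> i j v e1 d1" "edge \<kappa> i k v e2 d2" "edge \<kappa> j k v e3 d3"
    and d: "(d3 - d2 + d1) mod int n = (- 1 - int m) mod int n \<or> (d3 - d2 + d1) mod int n = int m mod int n"
  shows "\<exists>\<tau>\<in>chains \<kappa> M 2. boundary 2 \<tau> = frag_of e3 - frag_of e2 + frag_of e1 \<and> chain_length \<tau> \<le> 2 * m + 1"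
  using e(1) d
proof (induction m arbitrary: e1 d1)
  case 0
  then obtain \<epsilon> :: int where "\<epsilon> \<in> {-1, 0}" "(d3 - d2 + d1) mod int n = \<epsilon> mod int n" by fastforce
  then obtain f where "f \<in> simplices \<kappa> M 2" "boundary 2 (frag_of f) = frag_of e3 - frag_of e2 + frag_of e1"
    using triangle_exists[OF ijk 0(1) e(2,3)] by blast
  then show ?case by (intro bexI[of _ "frag_of f"]) (auto simp: chains_def)
next
  case (Suc m)
  have vU: "v i \<in> univ M" "v j \<in> univ M" using edge_univ[OF e(1)] by auto
  have ij: "i \<noteq> j" using ijk by simp
  have step: "(d3 - d2 + (d1 + c) mod int n) mod int n = (x + c) mod int n" if "(d3 - d2 + d1) mod int n = x mod int n" for c x
  proof -
    have "(d3 - d2 + (d1 + c) mod int n) mod int n = (d3 - d2 + (d1 + c)) mod int n"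
      by (simp only: mod_add_right_eq)
    also have "\<dots> = ((d3 - d2 + d1) + c) mod int n" by (simp add: algebra_simps)
    finally have "(d3 - d2 + (d1 + c) mod int n) mod int n = ((d3 - d2 + d1) + c) mod int n" .
    then show ?thesis using that by (metis mod_add_left_eq)
  qed
  \<comment> \<open>In case A the sum is raised by one towards -1, in case B it is lowered by one
    towards 0; either value bounds a triangle.\<close>
  consider (A) "(d3 - d2 + d1) mod int n = (- 1 - int (Suc m)) mod int n"
    | (B) "(d3 - d2 + d1) mod int n = int (Suc m) mod int n" using Suc.prems(2) by blast
  then show ?case
  proof cases
    case A
    obtain e1' where e1': "edge \<kappa> i j v e1' ((d1 + 1) mod int n)" using edge_exists[OF \<kappa> ij vU] by blast
    have "(d3 - d2 + (d1 + 1) mod int n) mod int n = (- 1 - int m) mod int n" using step[OF A, of 1] by simp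
    then obtain \<tau> where \<tau>: "\<tau> \<in> chains \<kappa> M 2" "boundary 2 \<tau> = frag_of e3 - frag_of e2 + frag_of e1'" "chain_length \<tau> \<le> 2 * m + 1"
      using Suc.IH[OF e1'] by blast
    obtain \<rho> where \<rho>: "\<rho> \<in> chains \<kappa> M 2" "boundary 2 \<rho> = frag_of e1 - frag_of e1'" "chain_length \<rho> \<le> 2"
      using edge_exchange[OF ijk \<kappa> Suc.prems(1) e1' e(2)] by auto
    show ?thesis
      by (rule bexI[OF _ chains_add[OF \<tau>(1) \<rho>(1)]])
         (use \<tau> \<rho> chain_length_add[of \<tau> \<rho>] boundary_add[of 2 \<tau> \<rho>] in simp)
  next
    case B
    obtain e1' where e1': "edge \<kappa> i j v e1' ((d1 + - 1) mod int n)" using edge_exists[OF \<kappa> ij vU] by blast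
    have "(d3 - d2 + (d1 + - 1) mod int n) mod int n = int m mod int n" using step[OF B, of "- 1"] by simp
    then obtain \<tau> where \<tau>: "\<tau> \<in> chains \<kappa> M 2" "boundary 2 \<tau> = frag_of e3 - frag_of e2 + frag_of e1'" "chain_length \<tau> \<le> 2 * m + 1"
      using Suc.IH[OF e1'] by blast
    have "d1 mod int n = ((d1 + - 1) mod int n + 1) mod int n" by (simp add: mod_add_left_eq)
    then obtain \<rho> where \<rho>: "\<rho> \<in> chains \<kappa> M 2" "boundary 2 \<rho> = frag_of e1' - frag_of e1" "chain_length \<rho> \<le> 2"
      using edge_exchange[OF ijk \<kappa> e1' Suc.prems(1) e(2)] by auto
    show ?thesis
      by (rule bexI[OF _ chains_add[OF \<tau>(1) chains_uminus[OF \<rho>(1)]]])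
         (use \<tau> \<rho> chain_length_add[of \<tau> "- \<rho>"] boundary_add[of 2 \<tau> "- \<rho>"] boundary_uminus[of 2 \<rho>] in simp)
  qed
qed

end

lemma card_3_sorted: assumes "card (s :: nat set) = 3" shows "\<exists>a b c. a < b \<and> b < c \<and> s = {a, b, c}"
proof -
  have fin: "finite s" using assms by (metis card.infinite zero_neq_numeral)
  define xs where "xs = sorted_list_of_set s"
  have "length xs = 3" using assms xs_def by simp
  then obtain a b c where abc: "xs = [a, b, c]" by (auto simp: numeral_3_eq_3 length_Suc_conv)
  have "sorted_wrt (<) xs" unfolding xs_def by simp
  moreover have "set xs = s" unfolding xs_def using fin by simp
  ultimately show ?thesis using abc by auto
qed

lemma card_2_sorted: assumes "card (s :: nat set) = 2" shows "\<exists>a b. a < b \<and> s = {a, b}"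
proof -
  have fin: "finite s" using assms by (metis card.infinite zero_neq_numeral)
  define xs where "xs = sorted_list_of_set s"
  have "length xs = 2" using assms xs_def by simp
  then obtain a b where ab: "xs = [a, b]" by (auto simp: numeral_2_eq_2 length_Suc_conv)
  have "sorted_wrt (<) xs" unfolding xs_def by simp
  moreover have "set xs = s" unfolding xs_def using fin by simp
  ultimately show ?thesis using ab by auto
qed

lemma mod_reflect: "(- 1 - (- 1 - x) mod m) mod m = x mod (m :: int)"
  by (simp add: mod_diff_right_eq)

context rotation_cover
begin

section \<open>The length of a shell\<close>

text \<open>A functional on chains needs a value on every edge, hence generators for all vertices at
  once. V picks them from the vertex and its object alone, so an edge has the same weight in every
  triangle containing it.\<close>

definition weight :: "'a rel \<Rightarrow> (nat \<Rightarrow> 'a imag set \<Rightarrow> 'a) \<Rightarrow> 'a imag sfunctor \<Rightarrow> int" where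
  "weight \<kappa> V e = (SOME d. \<exists>i j. i < j \<and> edge \<kappa> i j (\<lambda>l. V l (Ob e {l})) e d)"

lemma weight_edge:
  assumes e: "edge \<kappa> i j v e d" and ij: "i < j" and V: "V i (Ob e {i}) = v i" "V j (Ob e {j}) = v j"
  shows "weight \<kappa> V e = d"
  unfolding weight_def
proof (rule some_equality)
  have e': "edge \<kappa> i j (\<lambda>l. V l (Ob e {l})) e d" by (rule edge_cong[OF e]) (use V in auto)
  then show "\<exists>i j. i < j \<and> edge \<kappa> i j (\<lambda>l. V l (Ob e {l})) e d" using ij by blast
  fix d' assume "\<exists>i j. i < j \<and> edge \<kappa> i j (\<lambda>l. V l (Ob e {l})) e d'"
  then obtain i' j' where i': "i' < j'" "edge \<kappa> i' j' (\<lambda>l. V l (Ob e {l})) e d'" by blast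
  have "{i', j'} = {i, j}" using edge_supp[OF e] edge_supp[OF i'(2)] by simp
  then have "i' = i \<and> j' = j" using ij i'(1) by (auto simp: doubleton_eq_iff)
  then show "d' = d" using edge_unique[OF e'] i'(2) by blast
qed

text \<open>With one global choice of generators, each triangle of the filling has alternating sum 0
  or -1 modulo n, and \<open>chain_length_lower_bound\<close> applies.\<close>

lemma shell_lower_bound:
  assumes ijk: "i < j" "j < k"
    and e: "edge \<kappa> i j v e1 d1" "edge \<kappa> i k v e2 d2" "edge \<kappa> j k v e3 d3"
    and \<tau>: "\<tau> \<in> chains \<kappa> M 2" "boundary 2 \<tau> = frag_of e3 - frag_of e2 + frag_of e1"
    and m: "m = (- 1 - (d3 - d2 + d1)) mod int n"
  shows "min (2 * (int n - m) - 1) (2 * m + 1) \<le> int (chain_length \<tau>)"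
proof -
  have \<kappa>: "natLeq <o \<kappa>" using e(1) unfolding edge_def by blast
  have n0: "0 < n" using n_gt_1 by simp
  \<comment> \<open>The choice follows v at the vertices of the shell, where d1, d2 and d3 were
    measured; elsewhere any generator serves.\<close>
  define V where "V l O' = (if l \<in> {i, j, k} \<and> O' = cl {v l} then v l else SOME w. w \<in> univ M \<and> O' = cl {w})" for l O'
  have vU: "v l \<in> univ M" if "l \<in> {i, j, k}" for l using that edge_univ[OF e(1)] edge_univ[OF e(2)] by auto
  have V: "V l O' \<in> univ M \<and> O' = cl {V l O'}" if "\<exists>w\<in>univ M. O' = cl {w}" for l O'
  proof (cases "l \<in> {i, j, k} \<and> O' = cl {v l}")
    case True then show ?thesis using vU unfolding V_def by auto
  next
    case False
    have "\<exists>w. w \<in> univ M \<and> O' = cl {w}" using that by blast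
    then have "(SOME w. w \<in> univ M \<and> O' = cl {w}) \<in> univ M \<and> O' = cl {SOME w. w \<in> univ M \<and> O' = cl {w}}"
      by (rule someI_ex)
    then show ?thesis unfolding V_def if_not_P[OF False] .
  qed
  have Vv: "V l (cl {v l}) = v l" if "l \<in> {i, j, k}" for l using that unfolding V_def by simp
  let ?w = "weight \<kappa> V"
  have w: "?w e1 = d1" "?w e2 = d2" "?w e3 = d3"
    using weight_edge[OF e(1), of V] weight_edge[OF e(2), of V] weight_edge[OF e(3), of V] ijk
      edge_Ob[OF e(1)] edge_Ob[OF e(2)] edge_Ob[OF e(3)] Vv by auto
  let ?W = "\<lambda>f. ?w (face 0 f) - ?w (face 1 f) + ?w (face 2 f)"
  have W: "\<exists>\<epsilon>\<in>{-1, 0}. ?W f mod int n = \<epsilon> mod int n" if f: "f \<in> Poly_Mapping.keys \<tau>" for f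
  proof -
    have fs: "f \<in> simplices \<kappa> M 2" using f \<tau>(1) unfolding chains_def by blast
    obtain a b c where abc: "a < b" "b < c" "Defs.supp f = {a, b, c}"
      using card_3_sorted[of "Defs.supp f"] simplexD(4)[OF fs] by auto
    define v' where "v' l = V l (Ob f {l})" for l
    have v': "v' l \<in> univ M \<and> Ob f {l} = cl {v' l}" if "l \<in> {a, b, c}" for l
      unfolding v'_def by (rule V) (use simplex_vertex[OF fs] abc(3) that in simp)
    obtain p where p: "coherent {a, b, c} p" "\<And>l. l \<in> {a, b, c} \<Longrightarrow> p {l} l = v' l" "f = std {a, b, c} p"
      by (rule simplex_std[OF fs abc(3) v']) auto
    let ?s = "{a, b, c}"
    have wt: "?w (std {l, l'} p) = dist (p ?s l) (p ?s l')" if l: "l \<in> ?s" "l' \<in> ?s" "l < l'" for l l'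
    proof (rule weight_edge[OF _ l(3)])
      show "edge \<kappa> l l' v' (std {l, l'} p) (dist (p ?s l) (p ?s l'))"
        by (rule edge_of_std[OF p(1) \<kappa>]) (use l p(2) in auto)
      have "Ob (std {l, l'} p) {x} = Ob f {x}" if "x \<in> {l, l'}" for x
      proof -
        have "{x} \<subseteq> {l, l'}" "{x} \<subseteq> ?s" using that l by auto
        then show ?thesis unfolding p(3) by simp
      qed
      then show "V l (Ob (std {l, l'} p) {l}) = v' l" "V l' (Ob (std {l, l'} p) {l'}) = v' l'"
        unfolding v'_def by simp_all
    qed
    have srt: "sorted_list_of_set ?s = [a, b, c]" using sorted_list_triple[OF abc(1,2)] .
    have "?s - {a} = {b, c}" "?s - {b} = {a, c}" "?s - {c} = {a, b}" using abc(1,2) by auto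
    then have "face 0 f = std {b, c} p" "face 1 f = std {a, c} p" "face 2 f = std {a, b} p"
      unfolding p(3) face_std srt by simp_all
    then have "?W f = dist (p ?s b) (p ?s c) - dist (p ?s a) (p ?s c) + dist (p ?s a) (p ?s b)"
      using wt abc(1,2) by auto
    moreover have "p ?s l \<in> univ M" if "l \<in> ?s" for l by (rule coherentD(5)[OF p(1) subset_refl that])
    moreover have "p ?s l \<notin> orb {p ?s l'}" if "l \<in> ?s" "l' \<in> ?s" "l \<noteq> l'" for l l'
      by (rule coherentD(4)[OF p(1) subset_refl that])
    ultimately show ?thesis using dist_triangle[of "p ?s a" "p ?s b" "p ?s c"] abc(1,2) by auto
  qed
  have "lin (\<lambda>f. 1) \<tau> = lin (\<lambda>f. 1) (boundary 2 \<tau>)" unfolding lin_boundary by simp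
  also have "\<dots> = 1" unfolding \<tau>(2) by (simp add: lin_add lin_diff)
  finally have one: "lin (\<lambda>f. 1) \<tau> = 1" .
  have "lin ?W \<tau> = d3 - d2 + d1" unfolding lin_boundary[symmetric] \<tau>(2) by (simp add: lin_add lin_diff w)
  moreover have "(- 1 - m) mod int n = (d3 - d2 + d1) mod int n" unfolding m by (rule mod_reflect)
  ultimately have lw: "lin ?W \<tau> mod int n = (- 1 - m) mod int n" by simp
  show ?thesis
    by (rule chain_length_lower_bound[OF n0 one W lw]) (use n0 m in auto)
qed

text \<open>The sum of the distances is -1 - m, that is n - 1 - m modulo n. Raising one edge m times
  leads to -1, lowering it n - 1 - m times leads to 0, and the shorter way is taken.\<close>

lemma shell_upper_bound:
  assumes ijk: "i < j" "j < k"
    and e: "edge \<kappa> i j v e1 d1" "edge \<kappa> i k v e2 d2" "edge \<kappa> j k v e3 d3"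
    and m: "m = (- 1 - (d3 - d2 + d1)) mod int n"
  shows "\<exists>\<tau>\<in>chains \<kappa> M 2. boundary 2 \<tau> = frag_of e3 - frag_of e2 + frag_of e1 \<and>
    int (chain_length \<tau>) \<le> min (2 * (int n - m) - 1) (2 * m + 1)"
proof -
  have \<kappa>: "natLeq <o \<kappa>" using e(1) unfolding edge_def by blast
  have m0: "0 \<le> m" "m < int n" unfolding m using n_gt_1 by auto
  have t: "(d3 - d2 + d1) mod int n = (- 1 - m) mod int n" unfolding m by (rule mod_reflect[symmetric])
  show ?thesis
  proof (cases "2 * m + 1 \<le> 2 * (int n - m) - 1")
    case True
    have "(d3 - d2 + d1) mod int n = (- 1 - int (nat m)) mod int n" using t m0 by simp
    then obtain \<tau> where "\<tau> \<in> chains \<kappa> M 2" "boundary 2 \<tau> = frag_of e3 - frag_of e2 + frag_of e1"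
      "chain_length \<tau> \<le> 2 * nat m + 1" using filling[OF ijk \<kappa> e, of "nat m"] by blast
    then show ?thesis using True m0 by (intro bexI[of _ \<tau>]) auto
  next
    case False
    let ?m = "nat (int n - 1 - m)"
    have "(- 1 - m) mod int n = (- 1 - m + int n) mod int n" by simp
    also have "- 1 - m + int n = int ?m" using m0 by simp
    finally have "(d3 - d2 + d1) mod int n = int ?m mod int n" using t by simp
    then obtain \<tau> where "\<tau> \<in> chains \<kappa> M 2" "boundary 2 \<tau> = frag_of e3 - frag_of e2 + frag_of e1"
      "chain_length \<tau> \<le> 2 * ?m + 1" using filling[OF ijk \<kappa> e, of ?m] by blast
    then show ?thesis using False m0 by (intro bexI[of _ \<tau>]) auto
  qed
qed

lemma B_shell_edges:
  assumes ijk: "i < j" "j < k"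
    and e: "edge \<kappa> i j v e1 d1" "edge \<kappa> i k v e2 d2" "edge \<kappa> j k v e3 d3"
    and m: "m = (- 1 - (d3 - d2 + d1)) mod int n"
  shows "B_shell \<kappa> M (frag_of e3 - frag_of e2 + frag_of e1) =
    ereal (real_of_int (min (2 * (int n - m) - 1) (2 * m + 1)))"
proof -
  let ?s = "frag_of e3 - frag_of e2 + frag_of e1"
  obtain \<tau> where \<tau>: "\<tau> \<in> chains \<kappa> M 2" "boundary 2 \<tau> = ?s"
    "int (chain_length \<tau>) \<le> min (2 * (int n - m) - 1) (2 * m + 1)"
    using shell_upper_bound[OF ijk e m] by blast
  have lb: "min (2 * (int n - m) - 1) (2 * m + 1) \<le> int (chain_length \<rho>)" if "\<rho> \<in> chains \<kappa> M 2" "boundary 2 \<rho> = ?s" for \<rho>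
    by (rule shell_lower_bound[OF ijk e that m])
  have eq: "int (chain_length \<tau>) = min (2 * (int n - m) - 1) (2 * m + 1)" using \<tau>(3) lb[OF \<tau>(1,2)] by (rule order_antisym)
  have "(LEAST l. \<exists>\<tau> \<in> chains \<kappa> M 2. boundary 2 \<tau> = ?s \<and> chain_length \<tau> = l) = chain_length \<tau>"
  proof (rule Least_equality)
    show "\<exists>\<tau>' \<in> chains \<kappa> M 2. boundary 2 \<tau>' = ?s \<and> chain_length \<tau>' = chain_length \<tau>" using \<tau> by blast
    fix l assume "\<exists>\<tau> \<in> chains \<kappa> M 2. boundary 2 \<tau> = ?s \<and> chain_length \<tau> = l"
    then obtain \<rho> where "\<rho> \<in> chains \<kappa> M 2" "boundary 2 \<rho> = ?s" "chain_length \<rho> = l" by blast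
    then show "chain_length \<tau> \<le> l" using lb[of \<rho>] eq by simp
  qed
  then have "B_shell \<kappa> M ?s = ereal (real (chain_length \<tau>))" unfolding B_shell_def using \<tau> by auto
  also have "real (chain_length \<tau>) = real_of_int (min (2 * (int n - m) - 1) (2 * m + 1))" using eq by (metis of_int_of_nat_eq)
  finally show ?thesis .
qed

section \<open>Arbitrary 1-shells and the maximum over them\<close>

lemma face_simplex:
  assumes "f \<in> simplices \<kappa> M 1" "Defs.supp f = {i, j}" "i < j"
  shows "face 0 f = restr f (Pow {j})" "face 1 f = restr f (Pow {i})"
  using assms(3) unfolding face_def assms(2) sorted_list_pair[OF assms(3)]
  by (auto intro!: arg_cong[of _ _ "restr f"])

lemma restr_vertex_eqD:
  assumes "restr f (Pow {i}) = restr g (Pow {j})" shows "i = j" "Ob f {i} = Ob g {i}"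
proof -
  have "Pow {i} = Pow {j}" using arg_cong[OF assms, of Dom] by (simp add: restr_def)
  then show ij: "i = j" by auto
  have "restrict (Ob f) (Pow {i}) {i} = restrict (Ob g) (Pow {j}) {i}"
    using arg_cong[OF assms, of Ob] by (simp add: restr_def)
  then show "Ob f {i} = Ob g {i}" using ij by simp
qed

text \<open>The face identities force the supports to be the three sides of one triangle, with equal
  objects at common vertices, so that common generators can be chosen.\<close>

lemma one_shell_edges:
  assumes \<kappa>: "natLeq <o (\<kappa> :: 'a rel)" and f: "\<And>i. i \<le> 2 \<Longrightarrow> f i \<in> simplices \<kappa> M 1"
    and faces: "\<And>i j. i < j \<Longrightarrow> j \<le> 2 \<Longrightarrow> face i (f j) = face (j - 1) (f i)"
  shows "\<exists>i j k v d1 d2 d3. i < j \<and> j < k \<and> edge \<kappa> i j v (f (2::nat)) d1 \<and> edge \<kappa> i k v (f 1) d2 \<and> edge \<kappa> j k v (f 0) d3"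
proof -
  have f': "f 0 \<in> simplices \<kappa> M 1" "f 1 \<in> simplices \<kappa> M 1" "f 2 \<in> simplices \<kappa> M 1" using f by auto
  obtain a0 b0 where 0: "a0 < b0" "Defs.supp (f 0) = {a0, b0}" using card_2_sorted[of "Defs.supp (f 0)"] simplexD(4)[OF f'(1)] by auto
  obtain a1 b1 where 1: "a1 < b1" "Defs.supp (f 1) = {a1, b1}" using card_2_sorted[of "Defs.supp (f 1)"] simplexD(4)[OF f'(2)] by auto
  obtain a2 b2 where 2: "a2 < b2" "Defs.supp (f 2) = {a2, b2}" using card_2_sorted[of "Defs.supp (f 2)"] simplexD(4)[OF f'(3)] by auto
  note F0 = face_simplex[OF f'(1) 0(2,1)] and F1 = face_simplex[OF f'(2) 1(2,1)] and F2 = face_simplex[OF f'(3) 2(2,1)]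
  have "face 0 (f 1) = face 0 (f 0)" using faces[of 0 1] by simp
  then have 10: "b1 = b0" "Ob (f 1) {b1} = Ob (f 0) {b1}" unfolding F0 F1 by (rule restr_vertex_eqD)+
  have "face 0 (f 2) = face 1 (f 0)" using faces[of 0 2] by simp
  then have 20: "b2 = a0" "Ob (f 2) {b2} = Ob (f 0) {b2}" unfolding F0 F2 by (rule restr_vertex_eqD)+
  have "face 1 (f 2) = face 1 (f 1)" using faces[of 1 2] by simp
  then have 21: "a2 = a1" "Ob (f 2) {a2} = Ob (f 1) {a2}" unfolding F1 F2 by (rule restr_vertex_eqD)+
  obtain x where x: "x \<in> univ M" "Ob (f 2) {a2} = cl {x}" using simplex_vertex[OF f'(3), of a2] 2 by auto
  obtain y where y: "y \<in> univ M" "Ob (f 0) {a0} = cl {y}" using simplex_vertex[OF f'(1), of a0] 0 by auto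
  obtain z where z: "z \<in> univ M" "Ob (f 0) {b0} = cl {z}" using simplex_vertex[OF f'(1), of b0] 0 by auto
  define v where "v l = (if l = a2 then x else if l = a0 then y else z)" for l
  have lt: "a2 < a0" "a0 < b0" using 2 0 20 by auto
  have v: "v a2 = x" "v a0 = y" "v b0 = z" using lt unfolding v_def by auto
  have "\<exists>d. edge \<kappa> a2 a0 v (f 2) d"
    by (rule edge_of_simplex[OF \<kappa> f'(3)]) (use 2 20 v x y in auto)
  moreover have "\<exists>d. edge \<kappa> a2 b0 v (f 1) d"
    by (rule edge_of_simplex[OF \<kappa> f'(2)]) (use 1 10 21 v x z in auto)
  moreover have "\<exists>d. edge \<kappa> a0 b0 v (f 0) d"
    by (rule edge_of_simplex[OF \<kappa> f'(1)]) (use 0 v y z in auto)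
  ultimately show ?thesis using lt by blast
qed

text \<open>\<open>Max\<close> in \<open>B_max\<close> has its intended meaning for finite sets
  only. A filling of the positive shell bounds the length for both signs.\<close>

lemma B_shell_bounded:
  assumes \<kappa>: "natLeq <o (\<kappa> :: 'a rel)" and s: "s \<in> one_shells \<kappa> M"
  shows "B_shell \<kappa> M s \<in> (\<lambda>l. ereal (real l)) ` {..2 * n}"
proof -
  obtain f :: "nat \<Rightarrow> 'a imag sfunctor" where f: "\<forall>i\<le>2. f i \<in> simplices \<kappa> M 1"
      "\<forall>i j. i < j \<and> j \<le> 2 \<longrightarrow> face i (f j) = face (j - 1) (f i)"
      "s = frag_of (f 0) - frag_of (f 1) + frag_of (f 2) \<or> s = - (frag_of (f 0) - frag_of (f 1) + frag_of (f 2))"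
    using s unfolding one_shells_def by blast
  obtain i j k v d1 d2 d3 where e: "i < j" "j < k" "edge \<kappa> i j v (f 2) d1" "edge \<kappa> i k v (f 1) d2" "edge \<kappa> j k v (f 0) d3"
    using one_shell_edges[OF \<kappa>, of f] f(1,2) by blast
  obtain \<tau> where \<tau>: "\<tau> \<in> chains \<kappa> M 2" "boundary 2 \<tau> = frag_of (f 0) - frag_of (f 1) + frag_of (f 2)"
    "int (chain_length \<tau>) \<le> min (2 * (int n - (- 1 - (d3 - d2 + d1)) mod int n) - 1) (2 * ((- 1 - (d3 - d2 + d1)) mod int n) + 1)"
    using shell_upper_bound[OF e refl] by blast
  have "0 \<le> (- 1 - (d3 - d2 + d1)) mod int n" using n_gt_1 by simp
  moreover have "int (chain_length \<tau>) \<le> 2 * (int n - (- 1 - (d3 - d2 + d1)) mod int n) - 1"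
    using \<tau>(3) min.cobounded1 by (rule order_trans)
  ultimately obtain X where "0 \<le> X" "int (chain_length \<tau>) \<le> 2 * (int n - X) - 1" by blast
  then have "int (chain_length \<tau>) \<le> int (2 * n)" by simp
  then have le: "chain_length \<tau> \<le> 2 * n" by (simp only: of_nat_le_iff)
  have "\<exists>\<rho>\<in>chains \<kappa> M 2. boundary 2 \<rho> = s \<and> chain_length \<rho> \<le> 2 * n"
    using f(3)
  proof
    assume "s = - (frag_of (f 0) - frag_of (f 1) + frag_of (f 2))"
    then show ?thesis using \<tau> le chains_uminus[OF \<tau>(1)] by (intro bexI[of _ "- \<tau>"]) (simp_all add: boundary_uminus)
  qed (use \<tau> le in blast)
  then obtain \<rho> where \<rho>: "\<rho> \<in> chains \<kappa> M 2" "boundary 2 \<rho> = s" "chain_length \<rho> \<le> 2 * n" by blast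
  let ?L = "LEAST l. \<exists>\<tau> \<in> chains \<kappa> M 2. boundary 2 \<tau> = s \<and> chain_length \<tau> = l"
  have "?L \<le> chain_length \<rho>" by (rule Least_le) (use \<rho> in blast)
  then have "?L \<in> {..2 * n}" using \<rho>(3) by simp
  moreover have "B_shell \<kappa> M s = ereal (real ?L)" unfolding B_shell_def using \<rho> by auto
  ultimately show ?thesis by blast
qed

lemma B_max_ge:
  assumes "natLeq <o (\<kappa> :: 'a rel)" "s \<in> one_shells \<kappa> M" shows "B_shell \<kappa> M s \<le> B_max \<kappa> M"
proof -
  have "B_shell \<kappa> M ` one_shells \<kappa> M \<subseteq> (\<lambda>l. ereal (real l)) ` {..2 * n}" using B_shell_bounded[OF assms(1)] by blast
  then have "finite (B_shell \<kappa> M ` one_shells \<kappa> M)" using finite_subset by blast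
  then show ?thesis unfolding B_max_def using assms(2) by (intro Max_ge) auto
qed


section \<open>The data of a shell\<close>

lemma marked_shell_edges:
  assumes \<kappa>: "natLeq <o (\<kappa> :: 'a rel)" and m: "marked_shell \<kappa> M s s12 s02 s01 v"
  shows "\<exists>d1 d2 d3. edge \<kappa> 0 1 v s01 d1 \<and> edge \<kappa> 0 2 v s02 d2 \<and> edge \<kappa> 1 2 v s12 d3"
proof -
  have U: "v 0 \<in> univ M" "v 1 \<in> univ M" "v 2 \<in> univ M" using m unfolding marked_shell_def by auto
  have S: "s12 \<in> simplices \<kappa> M 1" "s02 \<in> simplices \<kappa> M 1" "s01 \<in> simplices \<kappa> M 1"
    "Defs.supp s12 = {1, 2}" "Defs.supp s02 = {0, 2}" "Defs.supp s01 = {0, 1}"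
    using m unfolding marked_shell_def by auto
  have O: "Ob s01 {0} = cl {v 0}" "Ob s02 {0} = cl {v 0}" "Ob s01 {1} = cl {v 1}" "Ob s12 {1} = cl {v 1}"
    "Ob s02 {2} = cl {v 2}" "Ob s12 {2} = cl {v 2}"
    using m acl_home[OF U(1)] acl_home[OF U(2)] acl_home[OF U(3)] unfolding marked_shell_def by auto
  have "\<exists>d. edge \<kappa> 0 1 v s01 d" by (rule edge_of_simplex[OF \<kappa> S(3,6) U(1,2) O(1,3)])
  moreover have "\<exists>d. edge \<kappa> 0 2 v s02 d" by (rule edge_of_simplex[OF \<kappa> S(2,5) U(1,3) O(2,5)])
  moreover have "\<exists>d. edge \<kappa> 1 2 v s12 d" by (rule edge_of_simplex[OF \<kappa> S(1,4) U(2,3) O(4,6)])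
  ultimately show ?thesis by blast
qed

text \<open>Equality of types is realised by a partial isomorphism, and partial isomorphisms
  preserve distances.\<close>

lemma edge_bracket:
  assumes e: "edge \<kappa> i j v e d" and b: "bracket M v e i j x y"
  shows "dist x y = d"
proof -
  obtain y' z' where yz: "Mor e {i} {i, j} (home M (v i)) = home M y'" "Mor e {j} {i, j} (home M (v j)) = home M z'"
    "y' \<in> univ M" "z' \<in> univ M" "dist y' z' = d" using edge_Mor[OF e] by metis
  have "same_type N {} [home M y', home M z'] [home M x, home M y]"
    using b unfolding bracket_def yz .
  moreover have "set [home M y', home M z'] \<subseteq> total N" using home_total yz by simp
  ultimately obtain D h where h: "piso D h" "list_all2 (transports D h) [home M y', home M z'] [home M x, home M y]"
    using same_type_transports by blast
  have "y' \<in> D \<and> home M x = home M (h y')" by (rule transports_home_iff[OF h(1)]) (use h(2) in simp)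
  moreover have "z' \<in> D \<and> home M y = home M (h z')" by (rule transports_home_iff[OF h(1)]) (use h(2) in simp)
  ultimately show ?thesis using dist_piso[OF h(1), of y' z'] yz(5) by simp
qed

text \<open>All points have the same type: a partial isomorphism can move either end point of the
  edge to any prescribed point, and the other end follows.\<close>

lemma edge_bracket_exists:
  assumes e: "edge \<kappa> i j v e d" and ij: "i \<noteq> j"
  shows "x \<in> univ M \<Longrightarrow> \<exists>y\<in>univ M. y \<notin> orb {x} \<and> bracket M v e i j x y"
    and "y \<in> univ M \<Longrightarrow> \<exists>x\<in>univ M. x \<notin> orb {y} \<and> bracket M v e i j x y"
proof -
  obtain y' z' where yz: "Mor e {i} {i, j} (home M (v i)) = home M y'" "Mor e {j} {i, j} (home M (v j)) = home M z'"
    "y' \<in> univ M" "z' \<in> univ M" "z' \<notin> orb {y'}" using edge_Mor[OF e] ij by metis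
  have yz': "y' \<notin> orb {z'}" using yz orb_sym by blast
  have br: "bracket M v e i j (h y') (h z')" if "piso D h" "y' \<in> D" "z' \<in> D" for D h
    unfolding bracket_def yz
    by (rule transports_same_type[OF that(1)]) (use transports_home[OF that(1)] that in simp)
  have orb_h: "h b \<notin> orb {h a}" if h: "piso D h" "a \<in> D" "b \<in> D" "b \<notin> orb {a}" for D h a b
  proof
    assume "h b \<in> orb {h a}"
    then obtain q where q: "q < n" "h b = (rot M ^^ q) (h a)" unfolding orb_def by auto
    have qD: "(rot M ^^ q) a \<in> D" using orb_subset[OF piso_gset[OF h(1)], of "{a}"] h(2) q(1) unfolding orb_def by auto
    have "h b = h ((rot M ^^ q) a)" using piso_rot_pow[OF h(1,2)] q by simp
    then have "b = (rot M ^^ q) a" using piso_inj[OF h(1)] h(3) qD by (auto dest: inj_onD)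
    then show False using h(4) q(1) unfolding orb_def by auto
  qed
  have move: "\<exists>D h. piso D h \<and> a \<in> D \<and> b \<in> D \<and> h a = x" if U: "a \<in> univ M" "b \<in> univ M" "x \<in> univ M" for a b x
  proof -
    have "alike {0} (\<lambda>_. a) (\<lambda>_. x)" by (rule alike_single) (use U in auto)
    then obtain D h where h: "piso D h" "a \<in> D" "h a = x" unfolding alike_def realign_def by auto
    obtain D' h' where "piso D' h'" "D \<subseteq> D'" "b \<in> D'" "\<forall>y\<in>D. h' y = h y" using piso_extend1[OF h(1) U(2)] by blast
    then show ?thesis using h by (intro exI[of _ D'] exI[of _ h']) auto
  qed
  show "\<exists>y\<in>univ M. y \<notin> orb {x} \<and> bracket M v e i j x y" if x: "x \<in> univ M"
  proof -
    obtain D h where h: "piso D h" "y' \<in> D" "z' \<in> D" "h y' = x" using move[OF yz(3,4) x] by blast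
    show ?thesis
      by (rule bexI[of _ "h z'"]) (use br[OF h(1-3)] orb_h[OF h(1-3) yz(5)] h(4) piso_in_univ[OF h(1,3)] in auto)
  qed
  show "\<exists>x\<in>univ M. x \<notin> orb {y} \<and> bracket M v e i j x y" if y: "y \<in> univ M"
  proof -
    obtain D h where h: "piso D h" "z' \<in> D" "y' \<in> D" "h z' = y" using move[OF yz(4,3) y] by blast
    show ?thesis
      by (rule bexI[of _ "h y'"]) (use br[OF h(1,3,2)] orb_h[OF h(1-3) yz'] h(4) piso_in_univ[OF h(1,3)] in auto)
  qed
qed

text \<open>The points c and b are found from a, but c' is found from b and need not be c. As the
  third distance is read from b to c', it is the reversed distance of \<open>s12\<close>.\<close>

lemma shell_data_exists:
  assumes e: "edge \<kappa> 0 1 v s01 d1" "edge \<kappa> 0 2 v s02 d2" "edge \<kappa> 1 2 v s12 d3"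
  shows "\<exists>a b c c'. shell_data n M s12 s02 s01 v a b c c' d1 d2 ((- 1 - d3) mod int n)"
proof -
  obtain a where a: "a \<in> univ M" using U_ne by blast
  obtain c where c: "c \<in> univ M" "c \<notin> orb {a}" "bracket M v s01 0 1 a c" using edge_bracket_exists(1)[OF e(1) _ a] by auto
  obtain b where b: "b \<in> univ M" "b \<notin> orb {a}" "bracket M v s02 0 2 a b" using edge_bracket_exists(1)[OF e(2) _ a] by auto
  obtain c' where c': "c' \<in> univ M" "c' \<notin> orb {b}" "bracket M v s12 1 2 c' b" using edge_bracket_exists(2)[OF e(3) _ b(1)] by auto
  have ds: "dist a c = d1" "dist a b = d2" "dist c' b = d3"
    using edge_bracket[OF e(1) c(3)] edge_bracket[OF e(2) b(3)] edge_bracket[OF e(3) c'(3)] a b c c' by auto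
  have "b \<notin> orb {c'}" using c'(1,2) orb_sym b(1) by blast
  then have d3: "dist b c' = (- 1 - d3) mod int n" using dist_rev[OF c'(1) b(1)] ds(3) by simp
  have r: "0 \<le> d1" "d1 < int n" "0 \<le> d2" "d2 < int n" using edge_range[OF e(1)] edge_range[OF e(2)] by auto
  have r3: "0 \<le> (- 1 - d3) mod int n" "(- 1 - d3) mod int n < int n" using n_gt_1 by auto
  have "shell_data n M s12 s02 s01 v a b c c' d1 d2 ((- 1 - d3) mod int n)"
    unfolding shell_data_def
    using a b c c' ds d3 r r3 S_hat_d_iff[OF r(1,2), of a c] S_hat_d_iff[OF r(3,4), of a b] S_hat_d_iff[OF r3, of b c']
    by simp
  then show ?thesis by blast
qed

lemma shell_data_value:
  assumes \<kappa>: "natLeq <o (\<kappa> :: 'a rel)" and m: "marked_shell \<kappa> M s s12 s02 s01 v"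
    and d: "shell_data n M s12 s02 s01 v a b c c' k1 k2 k3"
  shows "B_shell \<kappa> M s = ereal (real_of_int (n_shell n k1 k2 k3))"
proof -
  obtain d1 d2 d3 where e: "edge \<kappa> 0 1 v s01 d1" "edge \<kappa> 0 2 v s02 d2" "edge \<kappa> 1 2 v s12 d3"
    using marked_shell_edges[OF \<kappa> m] by blast
  have U: "a \<in> univ M" "b \<in> univ M" "c \<in> univ M" "c' \<in> univ M" and r: "0 \<le> k1" "k1 < int n" "0 \<le> k2" "k2 < int n" "0 \<le> k3" "k3 < int n"
    and S: "S_hat_d M a c k1" "S_hat_d M a b k2" "S_hat_d M b c' k3"
    and br: "bracket M v s01 0 1 a c" "bracket M v s02 0 2 a b" "bracket M v s12 1 2 c' b"
    using d unfolding shell_data_def by auto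
  have k: "dist a c = k1" "dist a b = k2" "dist b c' = k3" "c' \<notin> orb {b}"
    using S S_hat_d_iff[OF r(1,2)] S_hat_d_iff[OF r(3,4)] S_hat_d_iff[OF r(5,6)] by auto
  have ds: "dist a c = d1" "dist a b = d2" "dist c' b = d3"
    using edge_bracket[OF e(1) br(1)] edge_bracket[OF e(2) br(2)] edge_bracket[OF e(3) br(3)] U by auto
  \<comment> \<open>k_3 is measured from b to c', against the direction of
    \<open>s12\<close>.\<close>
  have d3: "d3 = (- 1 - k3) mod int n" using dist_rev[OF U(2,4) k(4)] ds k by simp
  have "(- 1 - (d3 - d2 + d1)) mod int n = ((- 1 + d2 - d1) - d3) mod int n" by (simp add: algebra_simps)
  also have "\<dots> = ((- 1 + d2 - d1) - (- 1 - k3)) mod int n" unfolding d3 by (simp only: mod_diff_right_eq)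
  also have "\<dots> = (k2 - (k1 - k3)) mod int n" using ds k by (simp add: algebra_simps)
  finally have mm: "(k2 - (k1 - k3)) mod int n = (- 1 - (d3 - d2 + d1)) mod int n" by simp
  have "s = frag_of s12 - frag_of s02 + frag_of s01" using m unfolding marked_shell_def by blast
  then show ?thesis using B_shell_edges[OF _ _ e mm] unfolding n_shell_def Let_def by simp
qed

text \<open>One point can generate all three vertices, since independence concerns only the images
  inside an edge. The distance -1 - k given to the edge from 1 to 2 becomes k after
  reversal.\<close>

lemma special_shell:
  assumes \<kappa>: "natLeq <o (\<kappa> :: 'a rel)" and k: "0 \<le> k" "k < int n"
  shows "\<exists>s s12 s02 s01 v a b c c'. marked_shell \<kappa> M s s12 s02 s01 v \<and> shell_data n M s12 s02 s01 v a b c c' 0 0 k"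
proof -
  obtain o' where o: "o' \<in> univ M" using U_ne by blast
  define v :: "nat \<Rightarrow> 'a" where "v = (\<lambda>_. o')"
  have vU: "v i \<in> univ M" for i using o v_def by simp
  obtain e1 where e1: "edge \<kappa> 0 1 v e1 (0 mod int n)" using edge_exists[OF \<kappa>, of 0 1 v 0] vU by auto
  obtain e2 where e2: "edge \<kappa> 0 2 v e2 (0 mod int n)" using edge_exists[OF \<kappa>, of 0 2 v 0] vU by auto
  obtain e3 where e3: "edge \<kappa> 1 2 v e3 ((- 1 - k) mod int n)" using edge_exists[OF \<kappa>, of 1 2 v "- 1 - k"] vU by auto
  obtain p1 where p1: "coherent {0, 1} p1" "p1 {0} 0 = v 0" "p1 {1} 1 = v 1" "e1 = std {0, 1} p1" using e1 unfolding edge_def by blast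
  obtain p2 where p2: "coherent {0, 2} p2" "p2 {0} 0 = v 0" "p2 {2} 2 = v 2" "e2 = std {0, 2} p2" using e2 unfolding edge_def by blast
  obtain p3 where p3: "coherent {1, 2} p3" "p3 {1} 1 = v 1" "p3 {2} 2 = v 2" "e3 = std {1, 2} p3" using e3 unfolding edge_def by blast
  let ?s = "frag_of e3 - frag_of e2 + frag_of e1"
  define f where "f i = (if i = 0 then e3 else if i = 1 then e2 else e1)" for i :: nat
  have single: "std {i} p = std {i} q" if "p {i} i = q {i} i" for i p q
    by (rule std_cong) (use that in \<open>auto simp: subset_singleton_iff\<close>)
  have srt: "sorted_list_of_set {0, 1 :: nat} = [0, 1]" "sorted_list_of_set {0, 2 :: nat} = [0, 2]" "sorted_list_of_set {1, 2 :: nat} = [1, 2]"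
    using sorted_list_pair by auto
  have df: "{0, 1} - {0} = {1 :: nat}" "{0, 1} - {1} = {0 :: nat}" "{0, 2} - {0} = {2 :: nat}" "{0, 2} - {2} = {0 :: nat}"
    "{1, 2} - {1} = {2 :: nat}" "{1, 2} - {2} = {1 :: nat}" by auto
  have F: "face 0 e1 = std {1} p1" "face 1 e1 = std {0} p1" "face 0 e2 = std {2} p2" "face 1 e2 = std {0} p2"
    "face 0 e3 = std {2} p3" "face 1 e3 = std {1} p3"
    unfolding p1(4) p2(4) p3(4) face_std srt using df by simp_all
  have "face i (f j) = face (j - 1) (f i)" if "i < j \<and> j \<le> 2" for i j
  proof -
    have "(i = 0 \<and> j = 1) \<or> (i = 0 \<and> j = 2) \<or> (i = 1 \<and> j = 2)" using that by auto
    then show ?thesis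
    proof (elim disjE conjE)
      assume "i = 0" "j = 1" then show ?thesis using F single[of p2 2 p3] p2(3) p3(3) by (simp add: f_def)
    next
      assume "i = 0" "j = 2" then show ?thesis using F single[of p1 1 p3] p1(3) p3(2) by (simp add: f_def)
    next
      assume "i = 1" "j = 2" then show ?thesis using F single[of p1 0 p2] p1(2) p2(2) by (simp add: f_def)
    qed
  qed
  moreover have sx: "e1 \<in> simplices \<kappa> M 1" "e2 \<in> simplices \<kappa> M 1" "e3 \<in> simplices \<kappa> M 1"
    using edge_simplex[OF e1] edge_simplex[OF e2] edge_simplex[OF e3] by auto
  then have "f i \<in> simplices \<kappa> M 1" for i unfolding f_def by auto
  ultimately have "?s \<in> one_shells \<kappa> M" unfolding one_shells_def
    by (intro CollectI exI[of _ f] conjI allI impI) (auto simp: f_def)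
  then have "marked_shell \<kappa> M ?s e3 e2 e1 v"
    unfolding marked_shell_def
    using sx edge_supp[OF e1] edge_supp[OF e2] edge_supp[OF e3] edge_Ob[OF e1] edge_Ob[OF e2] edge_Ob[OF e3] vU acl_home by simp
  moreover have "(- 1 - (- 1 - k) mod int n) mod int n = k"
    using k by (simp add: mod_reflect)
  then have "\<exists>a b c c'. shell_data n M e3 e2 e1 v a b c c' 0 0 k" using shell_data_exists[OF e1 e2 e3] by simp
  ultimately show ?thesis by blast
qed

lemma shell_summary:
  assumes \<kappa>: "natLeq <o (\<kappa> :: 'a rel)"
  shows "(\<forall>s s12 s02 s01 v. marked_shell \<kappa> M s s12 s02 s01 v \<longrightarrow>
           (\<exists>a b c c' k1 k2 k3. shell_data n M s12 s02 s01 v a b c c' k1 k2 k3) \<and>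
           (\<forall>a b c c' k1 k2 k3. shell_data n M s12 s02 s01 v a b c c' k1 k2 k3 \<longrightarrow>
              B_shell \<kappa> M s = ereal (real_of_int (n_shell n k1 k2 k3)))) \<and>
        (\<exists>s s12 s02 s01 v a b c c'. marked_shell \<kappa> M s s12 s02 s01 v \<and>
           shell_data n M s12 s02 s01 v a b c c' 0 0 \<lfloor>real n / 2\<rfloor>) \<and>
        n_shell n 0 0 \<lfloor>real n / 2\<rfloor> \<ge> int n - 1 \<and>
        B_max \<kappa> M \<ge> ereal (real n - 1)"
proof -
  have fl: "\<lfloor>real n / 2\<rfloor> = int (n div 2)" using floor_divide_of_nat_eq[of n 2] by simp
  have k: "0 \<le> \<lfloor>real n / 2\<rfloor>" "\<lfloor>real n / 2\<rfloor> < int n" unfolding fl using n_gt_1 by auto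
  \<comment> \<open>Here k_4 is \<open>n div 2\<close>, so 2 (n - k_4) - 1 is at least n - 1 and 2
    k_4 + 1 is at least n.\<close>
  have ns: "n_shell n 0 0 \<lfloor>real n / 2\<rfloor> \<ge> int n - 1"
    unfolding n_shell_def Let_def using k unfolding fl by simp
  obtain s s12 s02 s01 v a b c c' where sp: "marked_shell \<kappa> M s s12 s02 s01 v" "shell_data n M s12 s02 s01 v a b c c' 0 0 \<lfloor>real n / 2\<rfloor>"
    using special_shell[OF \<kappa> k] by blast
  have "s \<in> one_shells \<kappa> M" using sp(1) unfolding marked_shell_def by blast
  then have "B_shell \<kappa> M s \<le> B_max \<kappa> M" by (rule B_max_ge[OF \<kappa>])
  moreover have "ereal (real n - 1) \<le> B_shell \<kappa> M s"
  proof -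
    have "real_of_int (int n - 1) \<le> real_of_int (n_shell n 0 0 \<lfloor>real n / 2\<rfloor>)" using ns by (simp only: of_int_le_iff)
    then show ?thesis unfolding shell_data_value[OF \<kappa> sp] by simp
  qed
  ultimately have B: "ereal (real n - 1) \<le> B_max \<kappa> M" by (rule order_trans[rotated])
  have ex: "\<exists>a b c c' k1 k2 k3. shell_data n M s12 s02 s01 v a b c c' k1 k2 k3" if mm: "marked_shell \<kappa> M s s12 s02 s01 v" for s s12 s02 s01 v
  proof -
    obtain d1 d2 d3 where "edge \<kappa> 0 1 v s01 d1" "edge \<kappa> 0 2 v s02 d2" "edge \<kappa> 1 2 v s12 d3"
      using marked_shell_edges[OF \<kappa> mm] by blast
    from shell_data_exists[OF this] show ?thesis by blast
  qed
  show ?thesis using ex shell_data_value[OF \<kappa>] sp ns B by blast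
qed

end

section \<open>Axioms of the rotation structures\<close>

text \<open>Properties of the circle that suffice to build the cover: a dense cyclic order,
  preserved by a rotation whose powers appear in their natural order. For fixed n they are finitely
  many first-order conditions, so they pass to elementarily equivalent structures.\<close>

definition rotation_axioms :: "nat \<Rightarrow> 'a rotstruct \<Rightarrow> bool" where
  "rotation_axioms n M \<longleftrightarrow> univ M \<noteq> {} \<and>
     (\<forall>x\<in>univ M. rot M x \<in> univ M) \<and> (\<forall>x\<in>univ M. (rot M ^^ n) x = x) \<and>
     (\<forall>x\<in>univ M. \<forall>y\<in>univ M. \<forall>z\<in>univ M. cyc M x y z \<longrightarrow> cyc M y z x) \<and>
     (\<forall>x\<in>univ M. \<forall>y\<in>univ M. \<forall>z\<in>univ M. cyc M x y z \<longrightarrow> \<not> cyc M x z y) \<and>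
     (\<forall>x\<in>univ M. \<forall>y\<in>univ M. \<forall>z\<in>univ M. x \<noteq> y \<longrightarrow> y \<noteq> z \<longrightarrow> x \<noteq> z \<longrightarrow> \<not> cyc M x y z \<longrightarrow> cyc M x z y) \<and>
     (\<forall>x\<in>univ M. \<forall>y\<in>univ M. \<forall>z\<in>univ M. \<forall>w\<in>univ M. cyc M x y z \<longrightarrow> cyc M x z w \<longrightarrow> cyc M x y w) \<and>
     (\<forall>x\<in>univ M. \<forall>y\<in>univ M. x \<noteq> y \<longrightarrow> (\<exists>z\<in>univ M. cyc M x z y)) \<and>
     (\<forall>x\<in>univ M. \<forall>y\<in>univ M. \<forall>z\<in>univ M. cyc M x y z \<longrightarrow> cyc M (rot M x) (rot M y) (rot M z)) \<and>
     (\<forall>i j. 0 < i \<longrightarrow> i < j \<longrightarrow> j < n \<longrightarrow> (\<forall>x\<in>univ M. cyc M x ((rot M ^^ i) x) ((rot M ^^ j) x))) \<and>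
     (\<forall>i. 0 < i \<longrightarrow> i < n \<longrightarrow> (\<forall>x\<in>univ M. (rot M ^^ i) x \<noteq> x))"

lemma rotation_axiomsD:
  assumes "rotation_axioms n M"
  shows
    "univ M \<noteq> {}"
    "\<forall>x\<in>univ M. rot M x \<in> univ M"
    "\<forall>x\<in>univ M. (rot M ^^ n) x = x"
    "\<forall>x\<in>univ M. \<forall>y\<in>univ M. \<forall>z\<in>univ M. cyc M x y z \<longrightarrow> cyc M y z x"
    "\<forall>x\<in>univ M. \<forall>y\<in>univ M. \<forall>z\<in>univ M. cyc M x y z \<longrightarrow> \<not> cyc M x z y"
    "\<forall>x\<in>univ M. \<forall>y\<in>univ M. \<forall>z\<in>univ M. x \<noteq> y \<longrightarrow> y \<noteq> z \<longrightarrow> x \<noteq> z \<longrightarrow> \<not> cyc M x y z \<longrightarrow> cyc M x z y"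
    "\<forall>x\<in>univ M. \<forall>y\<in>univ M. \<forall>z\<in>univ M. \<forall>w\<in>univ M. cyc M x y z \<longrightarrow> cyc M x z w \<longrightarrow> cyc M x y w"
    "\<forall>x\<in>univ M. \<forall>y\<in>univ M. x \<noteq> y \<longrightarrow> (\<exists>z\<in>univ M. cyc M x z y)"
    "\<forall>x\<in>univ M. \<forall>y\<in>univ M. \<forall>z\<in>univ M. cyc M x y z \<longrightarrow> cyc M (rot M x) (rot M y) (rot M z)"
    "\<forall>i j. 0 < i \<longrightarrow> i < j \<longrightarrow> j < n \<longrightarrow> (\<forall>x\<in>univ M. cyc M x ((rot M ^^ i) x) ((rot M ^^ j) x))"
    "\<forall>i. 0 < i \<longrightarrow> i < n \<longrightarrow> (\<forall>x\<in>univ M. (rot M ^^ i) x \<noteq> x)"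
  using assms unfolding rotation_axioms_def by - (elim conjE, assumption)+

section \<open>Sentences expressing the axioms, and their transfer\<close>

definition All_fm :: "nat \<Rightarrow> (unit, 'r) fm \<Rightarrow> (unit, 'r) fm" where "All_fm i \<phi> = Neg (Ex () i (Neg \<phi>))"
definition Imp_fm :: "('s, 'r) fm \<Rightarrow> ('s, 'r) fm \<Rightarrow> ('s, 'r) fm" where "Imp_fm \<phi> \<psi> = Neg (Conj \<phi> (Neg \<psi>))"

text \<open>\<open>Suc (i + j)\<close> serves as a fresh variable for the first rotated
  point.\<close>

primrec Pow_fm :: "nat \<Rightarrow> nat \<Rightarrow> nat \<Rightarrow> (unit, sym) fm" where
  "Pow_fm 0 i j = Eq i j"
| "Pow_fm (Suc p) i j = Ex () (Suc (i + j)) (Conj (Rel g_sym [i, Suc (i + j)]) (Pow_fm p (Suc (i + j)) j))"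

lemma fv_logic [simp]: "fv (All_fm i \<phi>) = fv \<phi> - {i}" "fv (Imp_fm \<phi> \<psi>) = fv \<phi> \<union> fv \<psi>"
  by (auto simp: All_fm_def Imp_fm_def)

lemma Univ_fo: "Univ (fo M) s = univ M"
  by (simp add: fo_def)

lemma sat_logic [simp]:
  "sat (fo M) (All_fm i \<phi>) \<sigma> \<longleftrightarrow> (\<forall>x\<in>univ M. sat (fo M) \<phi> (\<sigma>(i := x)))"
  "sat N (Imp_fm \<phi> \<psi>) \<sigma> \<longleftrightarrow> (sat N \<phi> \<sigma> \<longrightarrow> sat N \<psi> \<sigma>)"
  by (auto simp: All_fm_def Imp_fm_def Univ_fo)

lemma sat_Ex_fo: "sat (fo M) (Ex s i \<phi>) \<sigma> \<longleftrightarrow> (\<exists>x\<in>univ M. sat (fo M) \<phi> (\<sigma>(i := x)))"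
  by (simp add: Univ_fo)

lemma sat_S_fo: "sat (fo M) (Rel S_sym [i, j, k]) \<sigma> \<longleftrightarrow>
    \<sigma> i \<in> univ M \<and> \<sigma> j \<in> univ M \<and> \<sigma> k \<in> univ M \<and> cyc M (\<sigma> i) (\<sigma> j) (\<sigma> k)"
  by (auto simp: fo_def)

lemma sat_g_fo: "sat (fo M) (Rel g_sym [i, j]) \<sigma> \<longleftrightarrow> \<sigma> i \<in> univ M \<and> \<sigma> j \<in> univ M \<and> \<sigma> j = rot M (\<sigma> i)"
  by (auto simp: fo_def)

lemma fv_Pow_fm: "fv (Pow_fm p i j) \<subseteq> {i, j}"
proof (induction p arbitrary: i)
  case (Suc p)
  then show ?case using Suc[of "Suc (i + j)"] by auto
qed simp

lemma sat_Pow_fm: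
  assumes "\<forall>x\<in>univ M. rot M x \<in> univ M" "\<sigma> i \<in> univ M"
  shows "sat (fo M) (Pow_fm p i j) \<sigma> \<longleftrightarrow> \<sigma> j = (rot M ^^ p) (\<sigma> i)"
  using assms(2)
proof (induction p arbitrary: i \<sigma>)
  case 0
  then show ?case by auto
next
  case (Suc p)
  let ?k = "Suc (i + j)"
  have "sat (fo M) (Pow_fm (Suc p) i j) \<sigma> \<longleftrightarrow>
      (\<exists>x\<in>univ M. x = rot M (\<sigma> i) \<and> sat (fo M) (Pow_fm p ?k j) (\<sigma>(?k := x)))"
    using Suc.prems by (simp only: Pow_fm.simps sat_Ex_fo sat.simps(4) sat_g_fo) auto
  also have "\<dots> \<longleftrightarrow> sat (fo M) (Pow_fm p ?k j) (\<sigma>(?k := rot M (\<sigma> i)))"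
    using assms(1) Suc.prems by auto
  also have "\<dots> \<longleftrightarrow> \<sigma> j = (rot M ^^ p) (rot M (\<sigma> i))"
  proof -
    have "(\<sigma>(?k := rot M (\<sigma> i))) ?k \<in> univ M" using assms(1) Suc.prems by simp
    from Suc.IH[where i = ?k and \<sigma> = "\<sigma>(?k := rot M (\<sigma> i))", OF this] show ?thesis by (simp add: fun_upd_def)
  qed
  finally show ?case by (simp add: funpow_swap1)
qed

lemma elem_equivD:
  assumes "elem_equiv M M'" "fv \<phi> = {}" "sat (fo M') \<phi> (\<lambda>i. [] ! i)" shows "sat (fo M) \<phi> (\<lambda>i. [] ! i)"
  using assms unfolding elem_equiv_def holds_def by blast

lemma sat_cyc_axioms:
  "sat (fo M) (All_fm 0 (All_fm 1 (All_fm 2 (Imp_fm (Rel S_sym [0, 1, 2]) (Rel S_sym [1, 2, 0]))))) \<sigma> \<longleftrightarrow>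
      (\<forall>x\<in>univ M. \<forall>y\<in>univ M. \<forall>z\<in>univ M. cyc M x y z \<longrightarrow> cyc M y z x)"
  "sat (fo M) (All_fm 0 (All_fm 1 (All_fm 2 (Imp_fm (Rel S_sym [0, 1, 2]) (Neg (Rel S_sym [0, 2, 1])))))) \<sigma> \<longleftrightarrow>
      (\<forall>x\<in>univ M. \<forall>y\<in>univ M. \<forall>z\<in>univ M. cyc M x y z \<longrightarrow> \<not> cyc M x z y)"
  "sat (fo M) (All_fm 0 (All_fm 1 (All_fm 2 (Imp_fm (Neg (Eq 0 1)) (Imp_fm (Neg (Eq 1 2)) (Imp_fm (Neg (Eq 0 2))
         (Imp_fm (Neg (Rel S_sym [0, 1, 2])) (Rel S_sym [0, 2, 1])))))))) \<sigma> \<longleftrightarrow>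
      (\<forall>x\<in>univ M. \<forall>y\<in>univ M. \<forall>z\<in>univ M. x \<noteq> y \<longrightarrow> y \<noteq> z \<longrightarrow> x \<noteq> z \<longrightarrow> \<not> cyc M x y z \<longrightarrow> cyc M x z y)"
  "sat (fo M) (All_fm 0 (All_fm 1 (All_fm 2 (All_fm 3 (Imp_fm (Rel S_sym [0, 1, 2]) (Imp_fm (Rel S_sym [0, 2, 3]) (Rel S_sym [0, 1, 3]))))))) \<sigma> \<longleftrightarrow>
      (\<forall>x\<in>univ M. \<forall>y\<in>univ M. \<forall>z\<in>univ M. \<forall>w\<in>univ M. cyc M x y z \<longrightarrow> cyc M x z w \<longrightarrow> cyc M x y w)"
  "sat (fo M) (All_fm 0 (All_fm 1 (Imp_fm (Neg (Eq 0 1)) (Ex () 2 (Rel S_sym [0, 2, 1]))))) \<sigma> \<longleftrightarrow>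
      (\<forall>x\<in>univ M. \<forall>y\<in>univ M. x \<noteq> y \<longrightarrow> (\<exists>z\<in>univ M. cyc M x z y))"
  by (simp_all add: sat_S_fo sat_Ex_fo del: sat.simps(2,5))

lemma sat_rot_axiom:
  assumes "\<forall>x\<in>univ M. rot M x \<in> univ M"
  shows "sat (fo M) (All_fm 0 (All_fm 1 (All_fm 2 (All_fm 3 (All_fm 4 (All_fm 5 (Imp_fm (Rel g_sym [0, 3]) (Imp_fm (Rel g_sym [1, 4])
      (Imp_fm (Rel g_sym [2, 5]) (Imp_fm (Rel S_sym [0, 1, 2]) (Rel S_sym [3, 4, 5])))))))))) ) \<sigma> \<longleftrightarrow>
    (\<forall>x\<in>univ M. \<forall>y\<in>univ M. \<forall>z\<in>univ M. cyc M x y z \<longrightarrow> cyc M (rot M x) (rot M y) (rot M z))"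
  using assms by (simp add: sat_S_fo sat_g_fo del: sat.simps(2))

lemma rotation_axioms_transfer:
  assumes eq: "elem_equiv M M'" and ax: "rotation_axioms n M'"
  shows "rotation_axioms n M"
proof -
  note tr = elem_equivD[OF eq]
  note a = rotation_axiomsD[OF ax]
  have cl': "\<forall>x\<in>univ M'. rot M' x \<in> univ M'" by (rule a(2))
  \<comment> \<open>Closure under rotation has to come first: the structure records the graph of
    \<open>rot\<close> only inside the universe, and the reading of \<open>Pow_fm\<close> depends on
    closure.\<close>
  have cl: "\<forall>x\<in>univ M. rot M x \<in> univ M"
    using tr[of "All_fm 0 (Ex () (Suc 0) (Rel g_sym [0, Suc 0]))"] cl'
    by (simp add: sat_Ex_fo sat_g_fo del: sat.simps) blast
  have pw: "(rot M ^^ i) x \<in> univ M" if "x \<in> univ M" for i x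
    by (induction i) (use cl that in auto)
  have 0: "univ M \<noteq> {}"
    using tr[of "Ex () 0 (Eq 0 0)"] a(1) by (auto simp: sat_Ex_fo simp del: sat.simps(5))
  have 1: "\<forall>x\<in>univ M. (rot M ^^ n) x = x"
  proof -
    have "sat (fo M) (All_fm 0 (Pow_fm n 0 0)) (\<lambda>i. [] ! i)"
      by (rule tr) (use fv_Pow_fm[of n 0 0] cl' a(3) in \<open>auto simp: sat_Pow_fm\<close>)
    then show ?thesis using cl by (auto simp: sat_Pow_fm)
  qed
  have 2: "\<forall>x\<in>univ M. \<forall>y\<in>univ M. \<forall>z\<in>univ M. cyc M x y z \<longrightarrow> cyc M y z x"
    by (rule tr[OF _ iffD2[OF sat_cyc_axioms(1) a(4)], unfolded sat_cyc_axioms]) (simp add: insert_Diff_if)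
  have 3: "\<forall>x\<in>univ M. \<forall>y\<in>univ M. \<forall>z\<in>univ M. cyc M x y z \<longrightarrow> \<not> cyc M x z y"
    by (rule tr[OF _ iffD2[OF sat_cyc_axioms(2) a(5)], unfolded sat_cyc_axioms]) (simp add: insert_Diff_if)
  have 4: "\<forall>x\<in>univ M. \<forall>y\<in>univ M. \<forall>z\<in>univ M. x \<noteq> y \<longrightarrow> y \<noteq> z \<longrightarrow> x \<noteq> z \<longrightarrow> \<not> cyc M x y z \<longrightarrow> cyc M x z y"
    by (rule tr[OF _ iffD2[OF sat_cyc_axioms(3) a(6)], unfolded sat_cyc_axioms]) (simp add: insert_Diff_if)
  have 5: "\<forall>x\<in>univ M. \<forall>y\<in>univ M. \<forall>z\<in>univ M. \<forall>w\<in>univ M. cyc M x y z \<longrightarrow> cyc M x z w \<longrightarrow> cyc M x y w"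
    by (rule tr[OF _ iffD2[OF sat_cyc_axioms(4) a(7)], unfolded sat_cyc_axioms]) (simp add: insert_Diff_if)
  have 6: "\<forall>x\<in>univ M. \<forall>y\<in>univ M. x \<noteq> y \<longrightarrow> (\<exists>z\<in>univ M. cyc M x z y)"
    by (rule tr[OF _ iffD2[OF sat_cyc_axioms(5) a(8)], unfolded sat_cyc_axioms]) (simp add: insert_Diff_if)
  have 7: "\<forall>x\<in>univ M. \<forall>y\<in>univ M. \<forall>z\<in>univ M. cyc M x y z \<longrightarrow> cyc M (rot M x) (rot M y) (rot M z)"
    by (rule tr[OF _ iffD2[OF sat_rot_axiom[OF cl'] a(9)], unfolded sat_rot_axiom[OF cl]]) (simp add: insert_Diff_if)
  have 8: "\<forall>x\<in>univ M. cyc M x ((rot M ^^ i) x) ((rot M ^^ j) x)" if ij: "0 < i" "i < j" "j < n" for i j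
  proof -
    let ?\<phi> = "All_fm 0 (All_fm (Suc 0) (All_fm 2 (Imp_fm (Pow_fm i 0 (Suc 0)) (Imp_fm (Pow_fm j 0 2) (Rel S_sym [0, Suc 0, 2])))))"
    have "sat (fo M) ?\<phi> (\<lambda>i. [] ! i)"
    proof (rule tr)
      show "fv ?\<phi> = {}" using fv_Pow_fm[of i 0 "Suc 0"] fv_Pow_fm[of j 0 2] by auto
      have "\<forall>x\<in>univ M'. cyc M' x ((rot M' ^^ i) x) ((rot M' ^^ j) x)" using a(10) ij by blast
      then show "sat (fo M') ?\<phi> (\<lambda>i. [] ! i)" using cl' by (simp add: sat_S_fo sat_Pow_fm del: sat.simps(2,5))
    qed
    then show ?thesis using cl pw by (simp add: sat_S_fo sat_Pow_fm del: sat.simps(2,5))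
  qed
  have 9: "\<forall>x\<in>univ M. (rot M ^^ i) x \<noteq> x" if i: "0 < i" "i < n" for i
  proof -
    have "\<forall>x\<in>univ M'. (rot M' ^^ i) x \<noteq> x" using a(11) i by blast
    then have "sat (fo M) (All_fm 0 (Neg (Pow_fm i 0 0))) (\<lambda>i. [] ! i)"
      by (intro tr) (use fv_Pow_fm[of i 0 0] cl' in \<open>auto simp: sat_Pow_fm\<close>)
    then show ?thesis using cl by (auto simp: sat_Pow_fm)
  qed
  show ?thesis unfolding rotation_axioms_def
    by (intro conjI allI impI 0 1 2 3 4 5 6 7 8 9 cl)
qed


section \<open>The circle\<close>

lemma cis_inj_window:
  assumes "cis (- \<beta>) = cis (- \<gamma>)" "0 \<le> \<beta>" "\<beta> < 2 * pi" "0 \<le> \<gamma>" "\<gamma> < 2 * pi" shows "\<beta> = \<gamma>"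
proof -
  have "sin (- \<beta>) = sin (- \<gamma>) \<and> cos (- \<beta>) = cos (- \<gamma>)" using assms(1) by (simp add: complex_eq_iff)
  then obtain k :: int where k: "- \<beta> = - \<gamma> + 2 * pi * k" using sin_cos_eq_iff by blast
  have "\<bar>2 * pi * k\<bar> < 2 * pi" using k assms(2-) by linarith
  then have "\<bar>real_of_int k\<bar> < 1" by (simp add: abs_mult)
  then have "k = 0" by linarith
  then show ?thesis using k by simp
qed

lemma cis_minus_turn: "cis (- (2 * pi - t)) = cis t"
proof -
  have "cis (t - 2 * pi) = cis (t - 2 * pi) * cis (2 * pi)" by simp
  also have "\<dots> = cis t" unfolding cis_mult by simp
  finally show ?thesis by simp
qed

text \<open>\<open>Arg\<close> counts anticlockwise and takes both signs; a positive value is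
  replaced by the clockwise angle \<open>2 * pi - Arg (b / a)\<close>.\<close>

lemma circle_arc:
  assumes "cmod a = 1" "cmod b = 1" shows "\<exists>\<beta>. 0 \<le> \<beta> \<and> \<beta> < 2 * pi \<and> b = a * cis (- \<beta>)"
proof -
  have a0: "a \<noteq> 0" "b / a \<noteq> 0" using assms by auto
  have "cis (Arg (b / a)) = b / a" using cis_Arg[OF a0(2)] assms by (simp add: sgn_div_norm norm_divide)
  then have b: "b = a * cis (Arg (b / a))" using a0 by (simp add: field_simps)
  show ?thesis
  proof (cases "Arg (b / a) \<le> 0")
    case True
    then show ?thesis using b Arg_bounded[of "b / a"] by (intro exI[of _ "- Arg (b / a)"]) auto
  next
    case False
    have "cis (- (2 * pi - Arg (b / a))) = cis (Arg (b / a))" by (rule cis_minus_turn)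
    then show ?thesis using b False Arg_bounded[of "b / a"] by (intro exI[of _ "2 * pi - Arg (b / a)"]) auto
  qed
qed

lemma circle_simps [simp]:
  "univ (circle n) = {z. cmod z = 1}"
  "cyc (circle n) a b c \<longleftrightarrow> (\<exists>\<beta> \<gamma>. 0 < \<beta> \<and> \<beta> < \<gamma> \<and> \<gamma> < 2 * pi \<and> b = a * cis (- \<beta>) \<and> c = a * cis (- \<gamma>))"
  "rot (circle n) a = a * cis (- (2 * pi / real n))"
  by (simp_all add: circle_def)

lemma circle_rot_pow: "(rot (circle n) ^^ i) a = a * cis (- (real i * (2 * pi / real n)))"
proof (induction i)
  case (Suc i)
  have "(rot (circle n) ^^ Suc i) a = a * (cis (- (real i * (2 * pi / real n))) * cis (- (2 * pi / real n)))"
    unfolding funpow.simps comp_apply circle_simps(3) Suc.IH mult.assoc ..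
  also have "\<dots> = a * cis (- (real (Suc i) * (2 * pi / real n)))"
    unfolding cis_mult by (simp add: algebra_simps add_divide_distrib)
  finally show ?case .
qed simp

text \<open>Writing points as clockwise arcs from x turns the cyclic order starting at x into the
  order of angles below \<open>2 * pi\<close>.\<close>

lemma circle_axioms: assumes n: "1 < n" shows "rotation_axioms n (circle n)"
proof -
  let ?C = "circle n"
  have cyc_eq: "cyc ?C a (a * cis (- \<beta>)) (a * cis (- \<gamma>)) \<longleftrightarrow> 0 < \<beta> \<and> \<beta> < \<gamma>"
    if "cmod a = 1" "0 \<le> \<beta>" "\<beta> < 2 * pi" "0 \<le> \<gamma>" "\<gamma> < 2 * pi" for a \<beta> \<gamma>
  proof
    assume "cyc ?C a (a * cis (- \<beta>)) (a * cis (- \<gamma>))"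
    then obtain \<beta>' \<gamma>' where *: "0 < \<beta>'" "\<beta>' < \<gamma>'" "\<gamma>' < 2 * pi" "a * cis (- \<beta>) = a * cis (- \<beta>')" "a * cis (- \<gamma>) = a * cis (- \<gamma>')"
      by auto
    have "a \<noteq> 0" using that by auto
    then have "\<beta> = \<beta>'" "\<gamma> = \<gamma>'" using * that cis_inj_window[of \<beta> \<beta>'] cis_inj_window[of \<gamma> \<gamma>'] by auto
    then show "0 < \<beta> \<and> \<beta> < \<gamma>" using * by simp
  qed (use that in auto)
  have 2: "cyc ?C y z x" if c: "cyc ?C x y z" for x y z
  proof -
    obtain \<beta> \<gamma> where *: "0 < \<beta>" "\<beta> < \<gamma>" "\<gamma> < 2 * pi" "y = x * cis (- \<beta>)" "z = x * cis (- \<gamma>)" using c by auto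
    have "z = y * cis (- (\<gamma> - \<beta>))" unfolding * by (simp add: cis_mult)
    moreover have "x = y * cis (- (2 * pi - \<beta>))" unfolding *(4) cis_minus_turn mult.assoc cis_mult by simp
    moreover have "0 < \<gamma> - \<beta> \<and> \<gamma> - \<beta> < 2 * pi - \<beta> \<and> 2 * pi - \<beta> < 2 * pi" using * by simp
    ultimately show ?thesis unfolding circle_simps by blast
  qed
  have 8: "cyc ?C x ((rot ?C ^^ i) x) ((rot ?C ^^ j) x)" if "0 < i" "i < j" "j < n" for i j x
  proof -
    have "real j < real n" using that by simp
    then have "real j * (2 * pi / real n) < 2 * pi" using n by (simp add: field_simps)
    moreover have "0 < real i * (2 * pi / real n)" "real i * (2 * pi / real n) < real j * (2 * pi / real n)"
      using n that by (simp_all add: divide_strict_right_mono)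
    ultimately show ?thesis unfolding circle_rot_pow circle_simps by blast
  qed
  show ?thesis
    unfolding rotation_axioms_def
  proof (intro conjI allI impI ballI)
    have "1 \<in> univ ?C" by simp
    then show "univ ?C \<noteq> {}" by blast
    fix x assume x: "x \<in> univ ?C"
    then have x1: "cmod x = 1" by simp
    show "rot ?C x \<in> univ ?C" using x by (simp add: norm_mult)
    show "(rot ?C ^^ n) x = x" unfolding circle_rot_pow using n cis_minus_turn[of 0] by simp
    show "(rot ?C ^^ i) x \<noteq> x" if "0 < i" "i < n" for i
    proof
      assume "(rot ?C ^^ i) x = x"
      then have "x * cis (- (real i * (2 * pi / real n))) = x * cis (- 0)" unfolding circle_rot_pow by simp
      then have e: "cis (- (real i * (2 * pi / real n))) = cis (- 0)" using x1 by (metis mult_cancel_left norm_zero zero_neq_one)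
      have "real i < real n" using that by simp
      then have "real i * (2 * pi / real n) < 2 * pi" using n by (simp add: field_simps)
      then have "real i * (2 * pi / real n) = 0" using e n by (intro cis_inj_window) auto
      then show False using that n by simp
    qed
    show "cyc ?C x ((rot ?C ^^ i) x) ((rot ?C ^^ j) x)" if "0 < i" "i < j" "j < n" for i j
      by (rule 8[OF that])
    fix y assume y: "y \<in> univ ?C"
    then obtain \<beta> where \<beta>: "0 \<le> \<beta>" "\<beta> < 2 * pi" "y = x * cis (- \<beta>)" using circle_arc[OF x1, of y] by auto
    show "\<exists>z\<in>univ ?C. cyc ?C x z y" if "x \<noteq> y"
    proof
      have "\<beta> \<noteq> 0" using that \<beta>(3) by auto
      then have "0 < \<beta> / 2 \<and> \<beta> / 2 < \<beta> \<and> \<beta> < 2 * pi" using \<beta> by simp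
      then show "cyc ?C x (x * cis (- (\<beta> / 2))) y" unfolding circle_simps using \<beta>(3) by blast
      show "x * cis (- (\<beta> / 2)) \<in> univ ?C" using x1 by (simp add: norm_mult)
    qed
    fix z assume z: "z \<in> univ ?C"
    then obtain \<gamma> where \<gamma>: "0 \<le> \<gamma>" "\<gamma> < 2 * pi" "z = x * cis (- \<gamma>)" using circle_arc[OF x1, of z] by auto
    note ce = cyc_eq[OF x1]
    show "cyc ?C x y z \<Longrightarrow> cyc ?C y z x" by (rule 2)
    show "cyc ?C x y z \<Longrightarrow> \<not> cyc ?C x z y"
      unfolding \<beta>(3) \<gamma>(3) ce[OF \<beta>(1,2) \<gamma>(1,2)] ce[OF \<gamma>(1,2) \<beta>(1,2)] by simp
    show "cyc ?C x z y" if "x \<noteq> y" "y \<noteq> z" "x \<noteq> z" "\<not> cyc ?C x y z"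
    proof -
      have "\<beta> \<noteq> 0" "\<gamma> \<noteq> 0" "\<beta> \<noteq> \<gamma>" using that \<beta>(3) \<gamma>(3) by auto
      then show ?thesis using that(4)
        unfolding \<beta>(3) \<gamma>(3) ce[OF \<beta>(1,2) \<gamma>(1,2)] ce[OF \<gamma>(1,2) \<beta>(1,2)] using \<beta>(1) \<gamma>(1) by simp
    qed
    show "cyc ?C (rot ?C x) (rot ?C y) (rot ?C z)" if c: "cyc ?C x y z"
    proof -
      obtain \<beta> \<gamma> where "0 < \<beta>" "\<beta> < \<gamma>" "\<gamma> < 2 * pi" "y = x * cis (- \<beta>)" "z = x * cis (- \<gamma>)" using c by auto
      then show ?thesis unfolding circle_simps by (intro exI[of _ \<beta>] exI[of _ \<gamma>]) simp
    qed
    fix w assume w: "w \<in> univ ?C"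
    then obtain \<delta> where \<delta>: "0 \<le> \<delta>" "\<delta> < 2 * pi" "w = x * cis (- \<delta>)" using circle_arc[OF x1, of w] by auto
    show "cyc ?C x y z \<Longrightarrow> cyc ?C x z w \<Longrightarrow> cyc ?C x y w"
      unfolding \<beta>(3) \<gamma>(3) \<delta>(3) ce[OF \<beta>(1,2) \<gamma>(1,2)] ce[OF \<gamma>(1,2) \<delta>(1,2)] ce[OF \<beta>(1,2) \<delta>(1,2)] by simp
  qed
qed


section \<open>The cover\<close>

locale circular_rotation =
  fixes M :: "'a rotstruct" and n :: nat
  assumes n1: "1 < n" and ax: "rotation_axioms n M"
begin

abbreviation "U \<equiv> univ M"
abbreviation "R i \<equiv> rot M ^^ i"

lemmas axs = rotation_axiomsD[OF ax, rule_format]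

lemma R_U: "x \<in> U \<Longrightarrow> R i x \<in> U"
  by (induction i) (auto simp: axs(2))

lemma R_cyc: "x \<in> U \<Longrightarrow> y \<in> U \<Longrightarrow> z \<in> U \<Longrightarrow> cyc M x y z \<Longrightarrow> cyc M (R i x) (R i y) (R i z)"
  by (induction i) (auto intro: axs(9) R_U)

lemma R_add: "R i (R j x) = R (i + j) x" by (simp add: funpow_add)

lemma R_back: assumes "x \<in> U" "i \<le> n" shows "R (n - i) (R i x) = x" "R i (R (n - i) x) = x"
  using axs(3)[OF assms(1)] assms(2) unfolding R_add by auto

section \<open>Cutting the circle open at a base point\<close>

definition base :: 'a where "base = (SOME x. x \<in> U)"

lemma base_U: "base \<in> U" unfolding base_def using axs(1) some_in_eq by blast

text \<open>The circle is opened just before \<open>base\<close>, which becomes the least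
  element.\<close>

definition lo :: "'a \<Rightarrow> 'a \<Rightarrow> bool" where
  "lo x y \<longleftrightarrow> x \<in> U \<and> y \<in> U \<and> (if x = base then y \<noteq> base else cyc M base x y)"

lemma cyc_distinct: assumes "x \<in> U" "y \<in> U" "z \<in> U" "cyc M x y z" shows "x \<noteq> y" "y \<noteq> z" "x \<noteq> z"
proof -
  have 1: "cyc M y z x" "cyc M z x y" using axs(4) assms by blast+
  show "y \<noteq> z" using axs(5)[OF assms] assms(4) by auto
  show "x \<noteq> z" using axs(5)[OF assms(2,3,1) 1(1)] 1(1) by auto
  show "x \<noteq> y" using axs(5)[OF assms(3,1,2) 1(2)] 1(2) by auto
qed

lemma lo_U: "lo x y \<Longrightarrow> x \<in> U \<and> y \<in> U" unfolding lo_def by simp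

lemma lo_ne: "lo x y \<Longrightarrow> x \<noteq> y"
  unfolding lo_def using cyc_distinct[OF base_U] by (auto split: if_splits)

lemma lo_base: "lo x y \<Longrightarrow> y \<noteq> base"
  unfolding lo_def using cyc_distinct(3)[OF base_U, of x y] by (cases "x = base") auto

lemma lo_irrefl: "\<not> lo x x" using lo_ne by blast

lemma lo_trans: assumes "lo x y" "lo y z" shows "lo x z"
proof -
  have U: "x \<in> U" "y \<in> U" "z \<in> U" using assms lo_U by auto
  have y: "y \<noteq> base" and z: "z \<noteq> base" using lo_base assms by auto
  have c: "cyc M base y z" using assms(2) y unfolding lo_def by simp
  show ?thesis
  proof (cases "x = base")
    case True then show ?thesis unfolding lo_def using U z by simp
  next
    case False
    then have "cyc M base x y" using assms(1) unfolding lo_def by simp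
    then show ?thesis unfolding lo_def using False U axs(7)[OF base_U U _ c] by simp
  qed
qed

lemma lo_total: assumes "x \<in> U" "y \<in> U" "x \<noteq> y" shows "lo x y \<or> lo y x"
proof (cases "x = base \<or> y = base")
  case True then show ?thesis using assms unfolding lo_def by auto
next
  case False
  then show ?thesis using axs(6)[OF base_U assms(1,2)] assms unfolding lo_def by auto
qed

lemma lo_asym: "lo x y \<Longrightarrow> \<not> lo y x" using lo_trans lo_irrefl by blast

lemma cyc_of_lo: assumes "lo x y" "lo y z" shows "cyc M x y z"
proof -
  have U: "x \<in> U" "y \<in> U" "z \<in> U" using assms lo_U by auto
  have y: "y \<noteq> base" using lo_base assms by auto
  have c: "cyc M base y z" using assms(2) y unfolding lo_def by simp
  show ?thesis
  proof (cases "x = base")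
    case True then show ?thesis using c by simp
  next
    case False
    then have "cyc M base x y" using assms(1) unfolding lo_def by simp
    then have c1: "cyc M y base x" using axs(4) base_U U by blast
    have c2: "cyc M y z base" using axs(4)[OF base_U U(2,3) c] .
    have "cyc M y z x" by (rule axs(7)[OF U(2,3) base_U U(1) c2 c1])
    then show ?thesis using axs(4) U by blast
  qed
qed

text \<open>The three alternatives are the cyclic rotations of one linear arrangement; by
  \<open>cyc_of_lo\<close> the other three arrangements would give the opposite cyclic
  order.\<close>

lemma cyc_lo_iff:
  assumes "x \<in> U" "y \<in> U" "z \<in> U"
  shows "cyc M x y z \<longleftrightarrow> (lo x y \<and> lo y z) \<or> (lo y z \<and> lo z x) \<or> (lo z x \<and> lo x y)"
proof
  assume c: "cyc M x y z"
  note d = cyc_distinct[OF assms c]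
  have n1: "\<not> cyc M x z y" using axs(5)[OF assms c] .
  have n2: "\<not> (lo x z \<and> lo z y)" using cyc_of_lo n1 by blast
  have n3: "\<not> (lo z y \<and> lo y x)"
  proof
    assume "lo z y \<and> lo y x"
    then have "cyc M z y x" using cyc_of_lo by blast
    then show False using n1 axs(4) assms by blast
  qed
  have n4: "\<not> (lo y x \<and> lo x z)"
  proof
    assume "lo y x \<and> lo x z"
    then have "cyc M y x z" using cyc_of_lo by blast
    then show False using n1 axs(4) assms by blast
  qed
  show "(lo x y \<and> lo y z) \<or> (lo y z \<and> lo z x) \<or> (lo z x \<and> lo x y)"
    using n2 n3 n4 lo_total[OF assms(1,2) d(1)] lo_total[OF assms(2,3) d(2)] lo_total[OF assms(1,3) d(3)] by blast
next
  assume "(lo x y \<and> lo y z) \<or> (lo y z \<and> lo z x) \<or> (lo z x \<and> lo x y)"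
  then show "cyc M x y z"
  proof (elim disjE conjE)
    assume "lo x y" "lo y z" then show ?thesis by (rule cyc_of_lo)
  next
    assume "lo y z" "lo z x" then have "cyc M y z x" by (rule cyc_of_lo)
    then show ?thesis using axs(4) assms by blast
  next
    assume "lo z x" "lo x y" then have "cyc M z x y" by (rule cyc_of_lo)
    then show ?thesis using axs(4) assms by blast
  qed
qed

lemma cyc_lo_between: assumes "cyc M x y z" "lo x z" "y \<in> U" shows "lo x y \<and> lo y z"
proof -
  have "x \<in> U" "z \<in> U" using lo_U assms(2) by auto
  then show ?thesis using cyc_lo_iff[of x y z] assms lo_asym by blast
qed

lemma lo_dense: assumes "lo y z" shows "\<exists>w. lo y w \<and> lo w z"
proof -
  have U: "y \<in> U" "z \<in> U" using assms lo_U by auto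
  obtain w where w: "w \<in> U" "cyc M y w z" using axs(8)[OF U lo_ne[OF assms]] by blast
  then show ?thesis using cyc_lo_between[OF w(2) assms w(1)] by blast
qed

section \<open>The arc from the base point to its rotation, and the rotates of this arc\<close>

definition L :: "'a set" where "L = {y. lo y (rot M base)}"

lemma L_U: "y \<in> L \<Longrightarrow> y \<in> U" unfolding L_def using lo_U by blast

lemma rot_base: "rot M base \<noteq> base" using axs(11)[of 1 base] n1 base_U by simp

lemma lo_base_iff: "lo base y \<longleftrightarrow> y \<in> U \<and> y \<noteq> base" unfolding lo_def using base_U by simp

lemma base_L: "base \<in> L" unfolding L_def using lo_base_iff rot_base axs(2) base_U by simp

lemma lo_R_base: assumes "i < j" "j < n" shows "lo (R i base) (R j base)"
proof (cases "i = 0")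
  case True
  then show ?thesis using lo_base_iff axs(11)[of j base] base_U R_U assms by simp
next
  case False
  then have "cyc M base (R i base) (R j base)" using axs(10)[of i j base] assms base_U by simp
  moreover have "R i base \<noteq> base" using axs(11)[of i base] base_U False assms by simp
  ultimately show ?thesis unfolding lo_def using R_U base_U by simp
qed

text \<open>The cyclic relation of \<open>base\<close>, y and the end of the arc is rotated i times
  and then read off in the linear order.\<close>

lemma R_L_ge: assumes "y \<in> L" "i < n" shows "y = base \<or> lo (R i base) (R i y)"
  and "Suc i < n \<Longrightarrow> lo (R i y) (R (Suc i) base)"
proof -
  have yU: "y \<in> U" using L_U assms by blast
  have c: "cyc M (R i base) (R i y) (R (Suc i) base)" if "y \<noteq> base"
  proof -
    have "lo base y" "lo y (rot M base)" using that yU lo_base_iff assms(1) L_def by auto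
    then have "cyc M base y (rot M base)" by (rule cyc_of_lo)
    then have "cyc M (R i base) (R i y) (R i (rot M base))" using R_cyc base_U yU axs(2) by blast
    then show ?thesis by (simp add: funpow_swap1)
  qed
  show "lo (R i y) (R (Suc i) base)" if "Suc i < n"
  proof (cases "y = base")
    case True then show ?thesis using lo_R_base[of i "Suc i"] that by simp
  next
    case False
    then show ?thesis using cyc_lo_between[OF c lo_R_base[of i "Suc i"]] that R_U yU by simp
  qed
  show "y = base \<or> lo (R i base) (R i y)"
  proof (cases "y = base")
    case False
    show ?thesis
    proof (cases "Suc i < n")
      case True
      then show ?thesis using cyc_lo_between[OF c[OF False] lo_R_base[of i "Suc i"]] R_U yU by simp
    next
      \<comment> \<open>The last rotate ends at \<open>base\<close> again, which is the least
        element, so the linear order is recovered from a cyclic permutation of the relation.\<close>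
      case F: False
      then have "Suc i = n" using assms by simp
      then have e: "R (Suc i) base = base" using axs(3) base_U by simp
      have "cyc M base (R i base) (R i y)" 
        using axs(4)[OF R_U[OF yU] base_U R_U[OF base_U] axs(4)[OF R_U[OF base_U] R_U[OF yU] base_U c[OF False, unfolded e]]] .
      moreover have "R i base \<noteq> base" using axs(11)[of i base] base_U n1 \<open>Suc i = n\<close> assms(2) by (cases i) auto
      ultimately show ?thesis unfolding lo_def using R_U base_U yU by simp
    qed
  qed simp
qed

lemma lo_R_same: assumes "lo y z" "y \<in> L" "z \<in> L" "i < n" shows "lo (R i y) (R i z)"
proof (cases "y = base")
  case True
  then show ?thesis using R_L_ge(1)[OF assms(3,4)] lo_ne[OF assms(1)] by auto
next
  case False
  have U: "y \<in> U" "z \<in> U" using assms L_U by auto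
  have "cyc M base y z" using assms(1) False unfolding lo_def by simp
  then have "cyc M (R i base) (R i y) (R i z)" using R_cyc base_U U by blast
  moreover have "lo (R i base) (R i z)" using R_L_ge(1)[OF assms(3,4)] lo_base[OF assms(1)] by blast
  ultimately show ?thesis using cyc_lo_between R_U U by blast
qed

lemma lo_R_less: assumes "i < j" "j < n" "y \<in> L" "z \<in> L" shows "lo (R i y) (R j z)"
proof -
  have 1: "lo (R i y) (R (Suc i) base)" using R_L_ge(2)[OF assms(3), of i] assms by simp
  have 2: "R (Suc i) base = R j base \<or> lo (R (Suc i) base) (R j base)"
    using lo_R_base[of "Suc i" j] assms by (cases "Suc i = j") auto
  have 3: "z = base \<or> lo (R j base) (R j z)" using R_L_ge(1)[OF assms(4,2)] .
  have 4: "lo (R i y) (R j base)" using 2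
  proof
    assume "R (Suc i) base = R j base" from 1[unfolded this] show ?thesis .
  qed (rule lo_trans[OF 1])
  from 3 show ?thesis
  proof
    assume "z = base" show ?thesis unfolding \<open>z = base\<close> by (rule 4)
  qed (rule lo_trans[OF 4])
qed

text \<open>i is the greatest index below n for which \<open>R i base\<close> is not above u.
  Rotating u back, that is forward by \<open>n - i\<close>, lands in the arc.\<close>

lemma R_L_exists: assumes "u \<in> U" shows "\<exists>i<n. \<exists>y\<in>L. u = R i y"
proof -
  let ?P = "\<lambda>i. i < n \<and> \<not> lo u (R i base)"
  have "?P 0" using n1 lo_base by auto
  then obtain i where i: "?P i" "\<And>j. ?P j \<Longrightarrow> j \<le> i"
    using GreatestI_nat[of ?P 0 n] Greatest_le_nat[of ?P _ n] by (metis (no_types, lifting) less_imp_le)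
  have nx: "Suc i < n \<Longrightarrow> lo u (R (Suc i) base)" using i(2)[of "Suc i"] by auto
  have ge: "u = R i base \<or> lo (R i base) u" using i(1) lo_total[OF R_U[OF base_U, of i] assms] by blast
  define y where "y = R (n - i) u"
  have u: "u = R i y" unfolding y_def using R_back(2)[OF assms, of i] i(1) by simp
  have "y \<in> L"
  proof (cases "u = R i base")
    case True
    then have "y = base" unfolding y_def using R_back(1)[OF base_U, of i] i(1) by simp
    then show ?thesis using base_L by simp
  next
    case False
    then have l: "lo (R i base) u" using ge by blast
    have c: "cyc M (R i base) u (R (Suc i) base)"
    proof (cases "Suc i < n")
      case True
      then show ?thesis using cyc_of_lo[OF l nx] by blast
    next
      case F: False
      then have "Suc i = n" using i(1) by simp
      then have e: "R (Suc i) base = base" using axs(3) base_U by simp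
      have "R i base \<noteq> base" using axs(11)[of i base] base_U n1 \<open>Suc i = n\<close> i(1) by (cases i) auto
      then have "cyc M base (R i base) u" using l unfolding lo_def by simp
      then show ?thesis unfolding e
        by (rule axs(4)[OF base_U R_U[OF base_U] assms])
    qed
    have "cyc M (R (n - i) (R i base)) (R (n - i) u) (R (n - i) (R (Suc i) base))"
      using R_cyc[OF R_U[OF base_U] assms R_U[OF base_U] c] .
    moreover have "R (n - i) (R i base) = base" using R_back(1)[OF base_U, of i] i(1) by simp
    moreover have "R (n - i) (R (Suc i) base) = rot M base"
    proof -
      have "R (n - i) (R (Suc i) base) = R (n - i) (R i (rot M base))" by (simp add: funpow_swap1)
      then show ?thesis using R_back(1)[of "rot M base" i] i(1) axs(2) base_U by simp
    qed
    ultimately have c2: "cyc M base y (rot M base)" unfolding y_def by simp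
    have yU: "y \<in> U" unfolding y_def using R_U assms by blast
    have "lo base (rot M base)" using lo_base_iff rot_base axs(2) base_U by simp
    then show ?thesis unfolding L_def using cyc_lo_between[OF c2 _ yU] by blast
  qed
  then show ?thesis using u i(1) by blast
qed

section \<open>The cover: integers times the arc, ordered lexicographically\<close>

definition K :: "(int \<times> 'a) set" where "K = UNIV \<times> L"
definition lt :: "int \<times> 'a \<Rightarrow> int \<times> 'a \<Rightarrow> bool" where
  "lt a b \<longleftrightarrow> a \<in> K \<and> b \<in> K \<and> (fst a < fst b \<or> (fst a = fst b \<and> lo (snd a) (snd b)))"
definition sh :: "int \<Rightarrow> int \<times> 'a \<Rightarrow> int \<times> 'a" where "sh k a = (fst a + k, snd a)"
text \<open>The integer modulo n counts the rotations to be applied, so \<open>sh 1\<close> covers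
  one rotation and n steps close up.\<close>

definition pr :: "int \<times> 'a \<Rightarrow> 'a" where "pr a = R (nat (fst a mod int n)) (snd a)"

lemma lt_fst: "lt a b \<Longrightarrow> fst a \<le> fst b" unfolding lt_def by auto

lemma fst_sh [simp]: "fst (sh k a) = fst a + k" unfolding sh_def by simp

lemma lt_total_K: "a \<in> K \<Longrightarrow> b \<in> K \<Longrightarrow> a \<noteq> b \<Longrightarrow> lt a b \<or> lt b a"
  unfolding lt_def K_def using lo_total L_U by (cases a; cases b) force

lemma lt_pr_window:
  assumes "lt a b" "0 \<le> fst a" "fst b < int n" shows "lo (pr a) (pr b)"
proof -
  have ab: "snd a \<in> L" "snd b \<in> L" "fst a < fst b \<or> (fst a = fst b \<and> lo (snd a) (snd b))"
    using assms(1) unfolding lt_def K_def by auto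
  have r: "fst a mod int n = fst a" "fst b mod int n = fst b" using assms ab(3) by auto
  show ?thesis
  proof (cases "fst a < fst b")
    case True
    then show ?thesis unfolding pr_def r using lo_R_less[of "nat (fst a)" "nat (fst b)"] ab assms by simp
  next
    case False
    then show ?thesis unfolding pr_def r using lo_R_same[of "snd a" "snd b" "nat (fst a)"] ab assms by auto
  qed
qed

text \<open>One full turn, with integer parts from 0 to n - 1, embeds by \<open>pr\<close> into the
  opened circle as an ordered set.\<close>

lemma lt_pr_window_iff:
  assumes "a \<in> K" "b \<in> K" "0 \<le> fst a" "fst a < int n" "0 \<le> fst b" "fst b < int n"
  shows "lo (pr a) (pr b) \<longleftrightarrow> lt a b"
  using lt_pr_window[of a b] lt_pr_window[of b a] lt_total_K[OF assms(1,2)] assms lo_asym lo_irrefl by metis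

lemma pr_U: "a \<in> K \<Longrightarrow> pr a \<in> U" unfolding pr_def K_def using R_U L_U by auto

definition red :: "int \<times> 'a \<Rightarrow> int \<times> 'a" where "red a = (fst a mod int n, snd a)"

lemma red: "a \<in> K \<Longrightarrow> red a \<in> K" "0 \<le> fst (red a)" "fst (red a) < int n" "pr (red a) = pr a"
   "a = sh (int n * (fst a div int n)) (red a)"
  unfolding red_def K_def pr_def sh_def using n1 by (auto simp: mem_Times_iff)

lemma K_sh [simp]: "sh k a \<in> K \<longleftrightarrow> a \<in> K" unfolding sh_def K_def by (auto simp: mem_Times_iff)

lemma lt_sh [simp]: "lt (sh k a) (sh k b) \<longleftrightarrow> lt a b"
  unfolding lt_def by (simp add: sh_def K_def mem_Times_iff)

lemma sh_sh_add: "sh j (sh k a) = sh (j + k) a" by (simp add: sh_def)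

lemma pr_sh_n: "pr (sh (int n * k) a) = pr a" unfolding pr_def sh_def by simp

text \<open>For reduced points the numbers of turns (i, j) can only be (0, 0), (0, 1) or (1, 1), and
  these are the three arrangements in \<open>cyc_lo_iff\<close>.\<close>

lemma cyc_cover_window:
  assumes K: "a \<in> K" "b \<in> K" "c \<in> K"
    and w: "0 \<le> fst a" "fst a < int n" "0 \<le> fst b" "fst b < int n" "0 \<le> fst c" "fst c < int n"
  shows "cyc M (pr a) (pr b) (pr c) \<longleftrightarrow>
      (\<exists>i j. lt a (sh (int n * i) b) \<and> lt (sh (int n * i) b) (sh (int n * j) c) \<and> lt (sh (int n * j) c) (sh (int n) a))"
    (is "_ \<longleftrightarrow> ?rhs")
proof -
  have n0: "0 < int n" using n1 by simp
  have "cyc M (pr a) (pr b) (pr c) \<longleftrightarrow> (lt a b \<and> lt b c) \<or> (lt b c \<and> lt c a) \<or> (lt c a \<and> lt a b)"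
    unfolding cyc_lo_iff[OF pr_U[OF K(1)] pr_U[OF K(2)] pr_U[OF K(3)]]
    using lt_pr_window_iff K w by simp
  also have "\<dots> \<longleftrightarrow> ?rhs"
  proof
    have far: "lt x (sh (int n) y)" if "x \<in> K" "y \<in> K" "fst x < int n" "0 \<le> fst y" for x y
      using that unfolding lt_def K_def sh_def by auto
    have s0: "sh (int n * 0) x = x" "sh (int n * 1) x = sh (int n) x" for x by (auto simp: sh_def)
    assume "(lt a b \<and> lt b c) \<or> (lt b c \<and> lt c a) \<or> (lt c a \<and> lt a b)"
    then show ?rhs
    proof (elim disjE conjE)
      assume "lt a b" "lt b c"
      then show ?thesis using far[OF K(3,1)] w by (intro exI[of _ 0]) (simp only: s0)
    next
      assume "lt b c" "lt c a"
      then show ?thesis using far[OF K(1,2)] w by (intro exI[of _ 1]) (simp only: s0 lt_sh)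
    next
      assume "lt c a" "lt a b"
      then show ?thesis using far[OF K(2,3)] w by (intro exI[of _ 0] exI[of _ 1]) (simp only: s0 lt_sh)
    qed
  next
    assume ?rhs
    then obtain i j where ij: "lt a (sh (int n * i) b)" "lt (sh (int n * i) b) (sh (int n * j) c)" "lt (sh (int n * j) c) (sh (int n) a)"
      by blast
    have f: "fst a \<le> fst b + int n * i" "fst b + int n * i \<le> fst c + int n * j" "fst c + int n * j \<le> fst a + int n"
      using ij[THEN lt_fst] by simp_all
    have "int n * (- 1) < int n * i" "int n * i < int n * 2" "int n * (- 1) < int n * j" "int n * j < int n * 2"
      using f w by linarith+
    then have "- 1 < i" "i < 2" "- 1 < j" "j < 2" using n0 by (simp_all only: mult_less_cancel_left_pos)
    then consider "i = 0" "j = 0" | "i = 0" "j = 1" | "i = 1" "j = 1" | "i = 1" "j = 0" by linarith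
    then show "(lt a b \<and> lt b c) \<or> (lt b c \<and> lt c a) \<or> (lt c a \<and> lt a b)"
    proof cases
      case 1 then show ?thesis using ij by (simp add: sh_def)
    next
      case 2
      then have "lt a b" "lt (sh (int n) c) (sh (int n) a)" using ij by (simp_all add: sh_def)
      then show ?thesis by simp
    next
      case 3
      then have "lt (sh (int n) b) (sh (int n) c)" "lt (sh (int n) c) (sh (int n) a)" using ij by (simp_all add: sh_def)
      then show ?thesis by simp
    next
      case 4
      then show ?thesis using f w by simp
    qed
  qed
  finally show ?thesis .
qed

lemma cover: "rotation_cover M n K lt sh pr"
proof
  show "1 < n" by (rule n1)
  show "K \<noteq> {}" unfolding K_def using base_L by auto
  show "lt a b \<Longrightarrow> a \<in> K \<and> b \<in> K" for a b unfolding lt_def by simp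
  show "\<not> lt a a" for a unfolding lt_def using lo_irrefl by simp
  show "lt a b \<Longrightarrow> lt b c \<Longrightarrow> lt a c" for a b c unfolding lt_def using lo_trans by auto
  show "a \<in> K \<Longrightarrow> b \<in> K \<Longrightarrow> a \<noteq> b \<Longrightarrow> lt a b \<or> lt b a" for a b by (rule lt_total_K)
  show "\<exists>c. lt a c \<and> lt c b" if ab: "lt a b" for a b
  proof -
    obtain i y j z where e: "a = (i, y)" "b = (j, z)" by (cases a; cases b) auto
    have L: "y \<in> L" "z \<in> L" using ab unfolding e lt_def K_def by auto
    \<comment> \<open>On a common level the new point must stay below z; otherwise the end of the
      arc leaves room above y on its own level.\<close>
    define t where "t = (if i < j then rot M base else z)"
    have "lo y t" using ab L unfolding e lt_def t_def L_def by auto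
    then obtain w where w: "lo y w" "lo w t" using lo_dense by blast
    have "w \<in> L" using w(2) L(2) lo_trans unfolding t_def L_def by (auto split: if_splits)
    then show ?thesis using w ab L unfolding e lt_def K_def t_def
      by (intro exI[of _ "(i, w)"]) (auto split: if_splits)
  qed
  show "a \<in> K \<Longrightarrow> sh k a \<in> K" for a k by simp
  show "sh 0 a = a" for a by (simp add: sh_def)
  show "sh (j + k) a = sh j (sh k a)" for j k a by (simp add: sh_def)
  show "lt a b \<Longrightarrow> lt (sh k a) (sh k b)" for a b k by simp
  show "a \<in> K \<Longrightarrow> lt a (sh 1 a)" for a unfolding lt_def sh_def K_def by auto
  show "\<exists>k. lt b (sh k a)" if "a \<in> K" "b \<in> K" for a b
    using that unfolding lt_def by (intro exI[of _ "fst b - fst a + 1"]) (auto simp: sh_def K_def)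
  show "a \<in> K \<Longrightarrow> pr a \<in> U" for a by (rule pr_U)
  show "\<exists>a\<in>K. pr a = x" if x: "x \<in> U" for x
  proof -
    obtain i y where "i < n" "y \<in> L" "x = R i y" using R_L_exists[OF x] by blast
    then show ?thesis unfolding K_def pr_def by (intro bexI[of _ "(int i, y)"]) auto
  qed
  show "rot M (pr a) = pr (sh 1 a)" if a: "a \<in> K" for a
  proof -
    have yU: "snd a \<in> U" using a L_U unfolding K_def by auto
    let ?m = "fst a mod int n"
    have m: "0 \<le> ?m" "?m < int n" using n1 by auto
    have s: "(fst a + 1) mod int n = (?m + 1) mod int n" by (simp add: mod_add_left_eq)
    show ?thesis
    proof (cases "?m + 1 = int n")
      case True
      then have "R (Suc (nat ?m)) (snd a) = snd a" using axs(3)[OF yU] m by (metis Suc_nat_eq_nat_zadd1 add.commute nat_int)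
      then show ?thesis unfolding pr_def sh_def fst_conv snd_conv s using True by simp
    next
      case False
      then have "(?m + 1) mod int n = ?m + 1" using m by simp
      then have "nat ((fst a + 1) mod int n) = Suc (nat ?m)" using s m by simp
      then show ?thesis unfolding pr_def sh_def fst_conv snd_conv by simp
    qed
  qed
  show "pr a = pr b \<longleftrightarrow> (\<exists>k. b = sh (int n * k) a)" if ab: "a \<in> K" "b \<in> K" for a b
  proof
    assume "pr a = pr b"
    then have "pr (red a) = pr (red b)" using red(4) ab by simp
    then have "\<not> lt (red a) (red b)" "\<not> lt (red b) (red a)"
      using lt_pr_window_iff[of "red a" "red b"] lt_pr_window_iff[of "red b" "red a"] red ab lo_irrefl by simp_all
    then have e: "red a = red b" using lt_total_K red(1) ab by blast
    then have "snd a = snd b" "fst a mod int n = fst b mod int n" unfolding red_def by auto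
    moreover from this(2) have "int n dvd fst b - fst a" by (metis mod_eq_dvd_iff)
    then obtain k where "fst b - fst a = int n * k" by (elim dvdE)
    ultimately have "b = sh (int n * k) a" unfolding sh_def by (simp add: prod_eq_iff)
    then show "\<exists>k. b = sh (int n * k) a" by blast
  next
    assume "\<exists>k. b = sh (int n * k) a"
    then show "pr a = pr b" by (elim exE) (simp only: pr_sh_n)
  qed
  show "cyc M (pr a) (pr b) (pr c) \<longleftrightarrow>
      (\<exists>i j. lt a (sh (int n * i) b) \<and> lt (sh (int n * i) b) (sh (int n * j) c) \<and> lt (sh (int n * j) c) (sh (int n) a))"
    if K: "a \<in> K" "b \<in> K" "c \<in> K" for a b c
  proof -
    define q where "q x = fst x div int n" for x :: "int \<times> 'a"
    have e: "x = sh (int n * q x) (red x)" for x unfolding q_def red_def sh_def by simp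
    let ?P = "\<lambda>a b c i j. lt a (sh (int n * i) b) \<and> lt (sh (int n * i) b) (sh (int n * j) c) \<and> lt (sh (int n * j) c) (sh (int n) a)"
    \<comment> \<open>Every point is a reduced point shifted by full turns. The turns of a are
      divided out and those of b and c are absorbed into i and j.\<close>
    have sx: "sh (int n * i) x = sh (int n * q a) (sh (int n * (i + q x - q a)) (red x))" for i x
      by (subst e[of x]) (simp add: sh_sh_add algebra_simps)
    have sa: "sh (int n) a = sh (int n * q a) (sh (int n) (red a))"
      by (subst e[of a]) (simp add: sh_sh_add add.commute)
    have P: "?P a b c i j \<longleftrightarrow> ?P (red a) (red b) (red c) (i + q b - q a) (j + q c - q a)" for i j
      unfolding sx[of i b] sx[of j c] sa by (subst (1) e[of a]) (simp only: lt_sh)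
    have "cyc M (pr a) (pr b) (pr c) \<longleftrightarrow> cyc M (pr (red a)) (pr (red b)) (pr (red c))" using red(4) K by simp
    also have "\<dots> \<longleftrightarrow> (\<exists>i j. ?P (red a) (red b) (red c) i j)"
      by (rule cyc_cover_window) (use red K in auto)
    also have "\<dots> \<longleftrightarrow> (\<exists>i j. ?P a b c i j)"
    proof
      assume "\<exists>i j. ?P (red a) (red b) (red c) i j"
      then obtain i j where "?P (red a) (red b) (red c) i j" by (elim exE)
      moreover have "i - q b + q a + q b - q a = i" "j - q c + q a + q c - q a = j" by simp_all
      ultimately have "?P (red a) (red b) (red c) (i - q b + q a + q b - q a) (j - q c + q a + q c - q a)" by (simp only:)
      then have "?P a b c (i - q b + q a) (j - q c + q a)" by (rule iffD2[OF P])
      then show "\<exists>i j. ?P a b c i j" by (intro exI)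
    next
      assume "\<exists>i j. ?P a b c i j"
      then obtain i j where "?P a b c i j" by (elim exE)
      then have "?P (red a) (red b) (red c) (i + q b - q a) (j + q c - q a)" by (rule iffD1[OF P])
      then show "\<exists>i j. ?P (red a) (red b) (red c) i j" by (intro exI)
    qed
    finally show ?thesis .
  qed
qed

end

theorem theorem4p8:
  fixes M :: "nat \<Rightarrow> 'a rotstruct" and \<kappa> :: "nat \<Rightarrow> 'a rel"
  assumes "\<And>n. 1 < n \<Longrightarrow> big_model n (\<kappa> n) (M n)"
  shows
    "(\<forall>n > 1.
        (\<forall>s s12 s02 s01 v. marked_shell (\<kappa> n) (M n) s s12 s02 s01 v \<longrightarrow>
           (\<exists>a b c c' k1 k2 k3. shell_data n (M n) s12 s02 s01 v a b c c' k1 k2 k3) \<and>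
           (\<forall>a b c c' k1 k2 k3. shell_data n (M n) s12 s02 s01 v a b c c' k1 k2 k3 \<longrightarrow>
              B_shell (\<kappa> n) (M n) s = ereal (real_of_int (n_shell n k1 k2 k3)))) \<and>
        (\<exists>s s12 s02 s01 v a b c c'. marked_shell (\<kappa> n) (M n) s s12 s02 s01 v \<and>
           shell_data n (M n) s12 s02 s01 v a b c c' 0 0 \<lfloor>real n / 2\<rfloor>) \<and>
        n_shell n 0 0 \<lfloor>real n / 2\<rfloor> \<ge> int n - 1 \<and>
        B_max (\<kappa> n) (M n) \<ge> ereal (real n - 1)) \<and>
     (\<lambda>n. B_max (\<kappa> n) (M n)) \<longlonglongrightarrow> \<infinity>"
proof
  have rotation: "circular_rotation (M n) n" if n: "1 < n" for n
  proof
    have "elem_equiv (M n) (circle n)" using assms[OF n] unfolding big_model_def by (elim conjE)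
    then show "rotation_axioms n (M n)" using circle_axioms[OF n] by (rule rotation_axioms_transfer)
  qed (rule n)
  have uncountable: "natLeq <o \<kappa> n" if n: "1 < n" for n
    using assms[OF n] unfolding big_model_def by (elim conjE)
  note summary = rotation_cover.shell_summary[OF circular_rotation.cover[OF rotation] uncountable]
  show "\<forall>n > 1.
        (\<forall>s s12 s02 s01 v. marked_shell (\<kappa> n) (M n) s s12 s02 s01 v \<longrightarrow>
           (\<exists>a b c c' k1 k2 k3. shell_data n (M n) s12 s02 s01 v a b c c' k1 k2 k3) \<and>
           (\<forall>a b c c' k1 k2 k3. shell_data n (M n) s12 s02 s01 v a b c c' k1 k2 k3 \<longrightarrow>
              B_shell (\<kappa> n) (M n) s = ereal (real_of_int (n_shell n k1 k2 k3)))) \<and>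
        (\<exists>s s12 s02 s01 v a b c c'. marked_shell (\<kappa> n) (M n) s s12 s02 s01 v \<and>
           shell_data n (M n) s12 s02 s01 v a b c c' 0 0 \<lfloor>real n / 2\<rfloor>) \<and>
        n_shell n 0 0 \<lfloor>real n / 2\<rfloor> \<ge> int n - 1 \<and>
        B_max (\<kappa> n) (M n) \<ge> ereal (real n - 1)"
    by (intro allI impI) (rule summary)
  have ge: "ereal (real n - 1) \<le> B_max (\<kappa> n) (M n)" if "1 < n" for n
    using summary[OF that that] by (elim conjE)
  show "(\<lambda>n. B_max (\<kappa> n) (M n)) \<longlonglongrightarrow> \<infinity>"
    unfolding tendsto_PInfty
  proof (intro allI)
    fix r :: real
    \<comment> \<open>The bound n - 1 exceeds r once n is at least k; the maximum with 2 below keeps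
      n > 1.\<close>
    obtain k :: nat where k: "r + 1 < real k" using reals_Archimedean2 by blast
    have "ereal r < B_max (\<kappa> n) (M n)" if n: "max 2 k \<le> n" for n
    proof -
      have "real k \<le> real n" using n by simp
      then have "ereal r < ereal (real n - 1)" using k by simp
      also have "\<dots> \<le> B_max (\<kappa> n) (M n)" using ge n by simp
      finally show ?thesis .
    qed
    then show "\<forall>\<^sub>F n in sequentially. ereal r < B_max (\<kappa> n) (M n)"
      by (rule eventually_sequentiallyI)
  qed
qed

end
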